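(* Let $M$ be a non-orientable manifold (possibly with boundary) of finite type. Then for each integer $i\geq 0$ the map $$k\mapsto \dim_{\mathbb{Q}} H_{i}(C_{k}(M);\mathbb{Q})$$ is monotonically increasing (i.e. non-decreasing) in $k$; that is, $\dim_{\mathbb{Q}} H_{i}(C_{k}(M);\mathbb{Q})\leq \dim_{\mathbb{Q}} H_{i}(C_{k+1}(M);\mathbb{Q})$ for all integers $k\geq 1$.
   Context: For a manifold $M$ and a positive integer $k$, $F_{k}(M)=\{(x_{1},\ldots,x_{k})\in M^{k} : x_{i}\neq x_{j}\text{ for } i\neq j\}$, with the subspace topology from $M^k$, is the ordered configuration space of $k$ distinct points in $M$. The symmetric group $S_{k}$ acts on $F_{k}(M)$ by permuting coordinates, and $C_{k}(M)=F_{k}(M)/S_{k}$, with the quotient topology, is the unordered configuration space. Manifolds may have boundary. A manifold is of finite type if its Betti numbers are finite. *)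

theory Defs
  imports
    "HOL-Homology.Homology"
    "HOL-Library.Extended_Nat"
    "Jordan_Normal_Form.VS_Connect"
begin

section \<open>Quotient spaces and configuration spaces\<close>

text \<open>The finest topology on the image of \<open>q\<close> that makes \<open>q\<close> continuous.\<close>

definition quotient_topology :: "('a \<Rightarrow> 'b) \<Rightarrow> 'a topology \<Rightarrow> 'b topology" where
  "quotient_topology q X =
     topology (\<lambda>U. U \<subseteq> q ` topspace X \<and> openin X {x \<in> topspace X. q x \<in> U})"

lemma openin_quotient_topology:
  "openin (quotient_topology q X) U \<longleftrightarrow>
     U \<subseteq> q ` topspace X \<and> openin X {x \<in> topspace X. q x \<in> U}"
proof -
  let ?P = "\<lambda>U. U \<subseteq> q ` topspace X \<and> openin X {x \<in> topspace X. q x \<in> U}"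
  have "?P (S \<inter> T)" if "?P S" "?P T" for S T
  proof -
    have "{x \<in> topspace X. q x \<in> S \<inter> T} =
        {x \<in> topspace X. q x \<in> S} \<inter> {x \<in> topspace X. q x \<in> T}" by auto
    then show ?thesis using that by auto
  qed
  moreover have "?P (\<Union>\<K>)" if "\<forall>K\<in>\<K>. ?P K" for \<K>
  proof -
    have "{x \<in> topspace X. q x \<in> \<Union>\<K>} = (\<Union>K\<in>\<K>. {x \<in> topspace X. q x \<in> K})" by auto
    moreover have "openin X (\<Union>K\<in>\<K>. {x \<in> topspace X. q x \<in> K})"
      using that by blast
    ultimately show ?thesis using that by auto
  qed
  ultimately have "istopology ?P"
    unfolding istopology_def by blast
  then show ?thesis
    by (simp add: quotient_topology_def topology_inverse')
qed

lemma topspace_quotient_topology [simp]: "topspace (quotient_topology q X) = q ` topspace X"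
proof
  show "topspace (quotient_topology q X) \<subseteq> q ` topspace X"
    using openin_quotient_topology openin_topspace by metis
  have "{x \<in> topspace X. q x \<in> q ` topspace X} = topspace X" by auto
  then have "openin (quotient_topology q X) (q ` topspace X)"
    by (simp add: openin_quotient_topology)
  then show "q ` topspace X \<subseteq> topspace (quotient_topology q X)"
    by (rule openin_subset)
qed

lemma quotient_map_quotient_topology: "quotient_map X (quotient_topology q X) q"
  by (auto simp: quotient_map_def openin_quotient_topology)

text \<open>A point of $X^k$ is a function on the index set \<open>{..<k}\<close>, extended by \<open>undefined\<close>.
  A permutation of \<open>{..<k}\<close> fixes every other index, so that precomposition with it
  preserves this convention.\<close>

definition ordered_configuration_space :: "nat \<Rightarrow> 'a topology \<Rightarrow> (nat \<Rightarrow> 'a) topology" where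
  "ordered_configuration_space k X =
     subtopology (product_topology (\<lambda>i. X) {..<k}) {x. inj_on x {..<k}}"

definition configuration_orbit :: "nat \<Rightarrow> (nat \<Rightarrow> 'a) \<Rightarrow> (nat \<Rightarrow> 'a) set" where
  "configuration_orbit k x = {x \<circ> \<sigma> |\<sigma>. \<sigma> permutes {..<k}}"

definition unordered_configuration_space :: "nat \<Rightarrow> 'a topology \<Rightarrow> (nat \<Rightarrow> 'a) set topology" where
  "unordered_configuration_space k X =
     quotient_topology (configuration_orbit k) (ordered_configuration_space k X)"


section \<open>Manifolds and orientability\<close>

definition second_countable_space :: "'a topology \<Rightarrow> bool" where
  "second_countable_space X \<longleftrightarrow>
     (\<exists>\<B>. countable \<B> \<and> (\<forall>V\<in>\<B>. openin X V) \<and>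
        (\<forall>U x. openin X U \<and> x \<in> U \<longrightarrow> (\<exists>V\<in>\<B>. x \<in> V \<and> V \<subseteq> U)))"

text \<open>For \<open>n = 0\<close> this is all of \<open>Euclidean_space 0\<close>, a single point.\<close>

definition half_space :: "nat \<Rightarrow> (nat \<Rightarrow> real) topology" where
  "half_space n = subtopology (Euclidean_space n) {x. 0 \<le> x 0}"

text \<open>The point \<open>x\<close> of \<open>X\<close> has an open neighbourhood homeomorphic to an open subset of \<open>H\<close>.\<close>

definition has_chart_at :: "'b topology \<Rightarrow> 'a topology \<Rightarrow> 'a \<Rightarrow> bool" where
  "has_chart_at H X x \<longleftrightarrow>
     (\<exists>U V. openin X U \<and> x \<in> U \<and> openin H V \<and>
        subtopology X U homeomorphic_space subtopology H V)"

text \<open>Topological \<open>n\<close>-manifolds with possibly empty boundary. Neither connectedness nor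
  compactness is required.\<close>

definition manifold_with_boundary :: "nat \<Rightarrow> 'a topology \<Rightarrow> bool" where
  "manifold_with_boundary n X \<longleftrightarrow>
     Hausdorff_space X \<and> second_countable_space X \<and>
     (\<forall>x\<in>topspace X. has_chart_at (half_space n) X x)"

definition manifold_interior :: "nat \<Rightarrow> 'a topology \<Rightarrow> 'a set" where
  "manifold_interior n X = {x \<in> topspace X. has_chart_at (Euclidean_space n) X x}"

text \<open>The local homology group $H_n(X, X \setminus A; \mathbb{Z})$.\<close>

abbreviation local_homology_group :: "nat \<Rightarrow> 'a topology \<Rightarrow> 'a set \<Rightarrow> 'a chain set monoid" where
  "local_homology_group n X A \<equiv> relative_homology_group (int n) X (topspace X - A)"

text \<open>An orientation of a manifold without boundary: a choice of a generator \<open>\<mu> x\<close> of each local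
  homology group at a point, such that near every point all \<open>\<mu> y\<close> are restrictions of one class.\<close>

definition is_orientation :: "nat \<Rightarrow> 'a topology \<Rightarrow> ('a \<Rightarrow> 'a chain set) \<Rightarrow> bool" where
  "is_orientation n X \<mu> \<longleftrightarrow>
     (\<forall>x\<in>topspace X.
        \<mu> x \<in> carrier (local_homology_group n X {x}) \<and>
        generate (local_homology_group n X {x}) {\<mu> x} = carrier (local_homology_group n X {x})) \<and>
     (\<forall>x\<in>topspace X. \<exists>U. openin X U \<and> x \<in> U \<and>
        (\<exists>\<alpha>\<in>carrier (local_homology_group n X U). \<forall>y\<in>U.
           hom_induced (int n) X (topspace X - U) X (topspace X - {y}) id \<alpha> = \<mu> y))"

text \<open>A manifold with boundary is orientable if its interior is.\<close>

definition orientable_manifold :: "nat \<Rightarrow> 'a topology \<Rightarrow> bool" where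
  "orientable_manifold n X \<longleftrightarrow>
     (\<exists>\<mu>. is_orientation n (subtopology X (manifold_interior n X)) \<mu>)"


section \<open>Singular homology with rational coefficients\<close>

text \<open>The session \<open>HOL-Homology\<close> treats integral coefficients only. The definitions below follow it
  with \<open>rat\<close> in place of \<open>int\<close>. The fields \<open>mult\<close> and \<open>one\<close> of the record type
  \<open>module\<close> play no role for modules.\<close>

type_synonym 'a rational_chain = "((nat \<Rightarrow> real) \<Rightarrow> 'a) \<Rightarrow>\<^sub>0 rat"

definition rational_chains :: "nat \<Rightarrow> 'a topology \<Rightarrow> (rat, 'a rational_chain) module" where
  "rational_chains p X =
     \<lparr>carrier = {c. Poly_Mapping.keys c \<subseteq> singular_simplex_set p X},
      mult = undefined, one = undefined, zero = 0, add = (+),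
      smult = (\<lambda>r. Poly_Mapping.map ((*) r))\<rparr>"

definition rational_boundary :: "nat \<Rightarrow> 'a rational_chain \<Rightarrow> 'a rational_chain" where
  "rational_boundary p c =
     (if p = 0 then 0 else
        \<Sum>f\<in>Poly_Mapping.keys c. \<Sum>k\<le>p.
          Poly_Mapping.single (singular_face p k f) ((-1) ^ k * Poly_Mapping.lookup c f))"

definition rational_cycles :: "nat \<Rightarrow> 'a topology \<Rightarrow> (rat, 'a rational_chain) module" where
  "rational_cycles p X =
     (rational_chains p X)\<lparr>carrier := {c \<in> carrier (rational_chains p X). rational_boundary p c = 0}\<rparr>"

definition rational_boundaries :: "nat \<Rightarrow> 'a topology \<Rightarrow> 'a rational_chain set" where
  "rational_boundaries p X = rational_boundary (Suc p) ` carrier (rational_chains (Suc p) X)"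

text \<open>Multiplying a coset elementwise by \<open>r = 0\<close> would give \<open>{0}\<close>, which is not a coset. Hence
  scalar multiplication takes the cosets of the multiples.\<close>

definition quotient_module :: "('r, 'v, 'm) module_scheme \<Rightarrow> 'v set \<Rightarrow> ('r, 'v set) module" where
  "quotient_module V W =
     \<lparr>carrier = a_rcosets\<^bsub>V\<^esub> W, mult = undefined, one = undefined, zero = W, add = set_add V,
      smult = (\<lambda>r A. \<Union>a\<in>A. W +>\<^bsub>V\<^esub> (r \<odot>\<^bsub>V\<^esub> a))\<rparr>"

definition rational_homology :: "nat \<Rightarrow> 'a topology \<Rightarrow> (rat, 'a rational_chain set) module" where
  "rational_homology p X = quotient_module (rational_cycles p X) (rational_boundaries p X)"

text \<open>The number \<open>vectorspace.dim\<close> is meaningful for finite-dimensional spaces only.\<close>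

definition vector_space_dim :: "('k, 'b) ring_scheme \<Rightarrow> ('k, 'v, 'm) module_scheme \<Rightarrow> enat" where
  "vector_space_dim K V =
     (if vectorspace.fin_dim K V then enat (vectorspace.dim K V) else \<infinity>)"

definition rational_betti :: "nat \<Rightarrow> 'a topology \<Rightarrow> enat" where
  "rational_betti p X = vector_space_dim class_ring (rational_homology p X)"

definition finite_type :: "'a topology \<Rightarrow> bool" where
  "finite_type X \<longleftrightarrow> (\<forall>p. rational_betti p X < \<infinity>)"

subsection \<open>Rational homology is a vector space\<close>

lemma lookup_map_mult [simp]:
  "Poly_Mapping.lookup (Poly_Mapping.map ((*) (r::rat)) c) x = r * Poly_Mapping.lookup c x"
  by (auto simp: Poly_Mapping.map.rep_eq when_def)

lemma keys_map_mult: "Poly_Mapping.keys (Poly_Mapping.map ((*) (r::rat)) c) \<subseteq> Poly_Mapping.keys c"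
  by (auto simp: in_keys_iff)

lemma vectorspace_rational_chains: "vectorspace class_ring (rational_chains p X)"
proof -
  have ag: "abelian_group (rational_chains p X)"
  proof (rule abelian_groupI)
    fix x assume "x \<in> carrier (rational_chains p X)"
    then show "\<exists>y\<in>carrier (rational_chains p X).
        y \<oplus>\<^bsub>rational_chains p X\<^esub> x = \<zero>\<^bsub>rational_chains p X\<^esub>"
      by (intro bexI[of _ "- x"]) (auto simp: rational_chains_def)
  qed (auto simp: rational_chains_def add.assoc add.commute dest: subsetD[OF Poly_Mapping.keys_add])
  have "Module.module class_ring (rational_chains p X)"
  proof (rule moduleI)
    show "cring (class_ring :: rat ring)" by (rule class_cring.cring_axioms)
  qed (use ag in \<open>auto simp: rational_chains_def lookup_add algebra_simps
         intro!: poly_mapping_eqI dest: subsetD[OF keys_map_mult]\<close>)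
  then show ?thesis
    by (simp add: vectorspace_def class_field.field_axioms)
qed

lemma rational_boundary_superset:
  assumes "finite S" "Poly_Mapping.keys c \<subseteq> S" "p \<noteq> 0"
  shows "rational_boundary p c =
    (\<Sum>f\<in>S. \<Sum>k\<le>p. Poly_Mapping.single (singular_face p k f) ((-1) ^ k * Poly_Mapping.lookup c f))"
  using assms unfolding rational_boundary_def
  by (auto intro!: sum.mono_neutral_left simp: in_keys_iff)

lemma rational_boundary_0 [simp]: "rational_boundary p 0 = 0"
  by (simp add: rational_boundary_def)

lemma rational_boundary_add:
  "rational_boundary p (c + d) = rational_boundary p c + rational_boundary p d"
proof (cases "p = 0")
  case False
  let ?S = "Poly_Mapping.keys c \<union> Poly_Mapping.keys d"
  have S: "finite ?S" "Poly_Mapping.keys c \<subseteq> ?S" "Poly_Mapping.keys d \<subseteq> ?S"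
    "Poly_Mapping.keys (c + d) \<subseteq> ?S"
    by (auto simp: Poly_Mapping.keys_add)
  show ?thesis
    unfolding S(2,3,4)[THEN rational_boundary_superset[OF S(1) _ False]]
    by (simp add: lookup_add distrib_left single_add sum.distrib)
qed (simp add: rational_boundary_def)

lemma map_mult_add: "Poly_Mapping.map ((*) (r::rat)) (c + d) =
    Poly_Mapping.map ((*) r) c + Poly_Mapping.map ((*) r) d"
  by (auto intro!: poly_mapping_eqI simp: lookup_add algebra_simps)

lemma map_mult_sum: "Poly_Mapping.map ((*) (r::rat)) (\<Sum>i\<in>I. c i) =
    (\<Sum>i\<in>I. Poly_Mapping.map ((*) r) (c i))"
  by (induction I rule: infinite_finite_induct) (auto simp: map_mult_add intro!: poly_mapping_eqI)

lemma rational_boundary_smult: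
  "rational_boundary p (Poly_Mapping.map ((*) r) c) = Poly_Mapping.map ((*) r) (rational_boundary p c)"
proof (cases "p = 0")
  case False
  show ?thesis
    unfolding rational_boundary_superset[OF finite_keys keys_map_mult[of r c] False]
      rational_boundary_superset[OF finite_keys order_refl[of "Poly_Mapping.keys c"] False]
    by (simp add: map_mult_sum mult.left_commute)
qed (simp add: rational_boundary_def poly_mapping_eqI)

lemma rational_boundary_sum:
  "rational_boundary p (\<Sum>i\<in>I. c i) = (\<Sum>i\<in>I. rational_boundary p (c i))"
  by (induction I rule: infinite_finite_induct) (auto simp: rational_boundary_add)

lemma lookup_map_of_int [simp]:
  "Poly_Mapping.lookup (Poly_Mapping.map rat_of_int c) x = rat_of_int (Poly_Mapping.lookup c x)"
  by (auto simp: Poly_Mapping.map.rep_eq when_def)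

lemma map_of_int_add: "Poly_Mapping.map rat_of_int (c + d) =
    Poly_Mapping.map rat_of_int c + Poly_Mapping.map rat_of_int d"
  by (auto intro!: poly_mapping_eqI simp: lookup_add)

lemma map_of_int_sum: "Poly_Mapping.map rat_of_int (\<Sum>i\<in>I. c i) =
    (\<Sum>i\<in>I. Poly_Mapping.map rat_of_int (c i))"
  by (induction I rule: infinite_finite_induct) (auto simp: map_of_int_add intro!: poly_mapping_eqI)

lemma rational_boundary_of_int:
  "rational_boundary p (Poly_Mapping.map rat_of_int c) = Poly_Mapping.map rat_of_int (chain_boundary p c)"
proof (cases "p = 0")
  case False
  have keys: "Poly_Mapping.keys (Poly_Mapping.map rat_of_int c) = Poly_Mapping.keys c"
    by (auto simp: in_keys_iff)
  have *: "Poly_Mapping.map rat_of_int (frag_cmul a (frag_cmul ((-1) ^ k) (frag_of g))) =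
      Poly_Mapping.single g ((-1) ^ k * rat_of_int a)" for a k and g :: "(nat \<Rightarrow> real) \<Rightarrow> 'a"
    by (auto intro!: poly_mapping_eqI simp: lookup_single when_def)
  show ?thesis
    using False
    by (simp add: rational_boundary_def chain_boundary_def keys frag_extend_def frag_cmul_sum
        map_of_int_sum * del: frag_cmul_cmul)
qed (simp add: rational_boundary_def chain_boundary_def poly_mapping_eqI)

lemma rational_boundary_boundary:
  assumes "c \<in> carrier (rational_chains (Suc p) X)"
  shows "rational_boundary p (rational_boundary (Suc p) c) = 0"
proof -
  have single: "rational_boundary p (rational_boundary (Suc p) (Poly_Mapping.single f r)) = 0"
    if "singular_simplex (Suc p) X f" for f r
  proof -
    have eq: "Poly_Mapping.single f r = Poly_Mapping.map ((*) r) (Poly_Mapping.map rat_of_int (frag_of f))"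
      by (auto intro!: poly_mapping_eqI simp: lookup_single when_def)
    have "singular_chain (Suc p) X (frag_of f)"
      using that by (simp add: singular_chain_of)
    then show ?thesis
      unfolding eq rational_boundary_smult rational_boundary_of_int
      by (simp add: chain_boundary_boundary_alt poly_mapping_eqI)
  qed
  have "c = (\<Sum>f\<in>Poly_Mapping.keys c. Poly_Mapping.single f (Poly_Mapping.lookup c f))"
    by (auto intro!: poly_mapping_eqI simp: lookup_sum lookup_single when_def in_keys_iff)
  then have "rational_boundary p (rational_boundary (Suc p) c) =
      (\<Sum>f\<in>Poly_Mapping.keys c. rational_boundary p
         (rational_boundary (Suc p) (Poly_Mapping.single f (Poly_Mapping.lookup c f))))"
    by (metis rational_boundary_sum)
  also have "\<dots> = 0"
    using assms by (intro sum.neutral) (auto simp: rational_chains_def intro!: single)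
  finally show ?thesis .
qed

lemma rational_boundary_in_chains:
  assumes "c \<in> carrier (rational_chains (Suc p) X)"
  shows "rational_boundary (Suc p) c \<in> carrier (rational_chains p X)"
proof -
  let ?b = "\<lambda>f k. Poly_Mapping.single (singular_face (Suc p) k f)
    ((-1) ^ k * Poly_Mapping.lookup c f)"
  have "Poly_Mapping.keys (\<Sum>k\<le>Suc p. ?b f k) \<subseteq> singular_simplex_set p X"
    if "f \<in> Poly_Mapping.keys c" for f
  proof -
    have f: "singular_simplex (Suc p) X f"
      using that assms by (auto simp: rational_chains_def)
    have "Poly_Mapping.keys (?b f k) \<subseteq> singular_simplex_set p X" if "k \<le> Suc p" for k
      using singular_simplex_singular_face[OF f _ that] by simp
    then show ?thesis
      by (intro order_trans[OF Poly_Mapping.keys_sum]) blast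
  qed
  then have "Poly_Mapping.keys (\<Sum>f\<in>Poly_Mapping.keys c. \<Sum>k\<le>Suc p. ?b f k)
      \<subseteq> singular_simplex_set p X"
    by (intro order_trans[OF Poly_Mapping.keys_sum]) blast
  then show ?thesis
    unfolding rational_boundary_def rational_chains_def by simp
qed

lemma vectorspace_rational_cycles: "vectorspace class_ring (rational_cycles p X)"
proof -
  interpret V: vectorspace class_ring "rational_chains p X" by (rule vectorspace_rational_chains)
  have "LinearCombinations.submodule class_ring (carrier (rational_cycles p X)) (rational_chains p X)"
    using V.module.module_axioms V.zero_closed V.a_closed V.smult_closed
    unfolding LinearCombinations.submodule_def rational_cycles_def
    by (auto simp: rational_boundary_add rational_boundary_smult rational_chains_def
        intro!: poly_mapping_eqI)
  then have "Module.module class_ring (rational_cycles p X)"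
    using V.module.submodule_is_module by (fastforce simp: rational_cycles_def)
  then show ?thesis by (simp add: vectorspace_def class_field.field_axioms)
qed

lemma vectorspace_quotient_module:
  assumes V: "vectorspace K V" and W: "LinearCombinations.submodule K W V"
  shows "vectorspace K (quotient_module V W)"
proof -
  interpret V: vectorspace K V by (rule V)
  have W_sub: "W \<subseteq> carrier V" and W_add: "\<And>v w. v \<in> W \<Longrightarrow> w \<in> W \<Longrightarrow> v \<oplus>\<^bsub>V\<^esub> w \<in> W"
    and W_zero: "\<zero>\<^bsub>V\<^esub> \<in> W"
    and W_smult: "\<And>c v. c \<in> carrier K \<Longrightarrow> v \<in> W \<Longrightarrow> c \<odot>\<^bsub>V\<^esub> v \<in> W"
    using W by (auto simp: LinearCombinations.submodule_def)
  have minus: "\<ominus>\<^bsub>V\<^esub> w = (\<ominus>\<^bsub>K\<^esub> \<one>\<^bsub>K\<^esub>) \<odot>\<^bsub>V\<^esub> w" if "w \<in> carrier V" for w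
    using that by (simp add: V.module.smult_l_minus)
  have W_minus: "\<ominus>\<^bsub>V\<^esub> w \<in> W" if "w \<in> W" for w
    using that W_sub W_smult[of "\<ominus>\<^bsub>K\<^esub> \<one>\<^bsub>K\<^esub>" w] minus[of w] by auto
  have "subgroup W (add_monoid V)"
    using W_sub W_add W_zero W_minus
    by (intro group.subgroupI[OF V.module.M.a_group]) (auto simp: a_inv_def)
  then interpret W: abelian_subgroup W V
    by (intro abelian_subgroupI3) (auto intro: additive_subgroup.intro V.module.M.abelian_group_axioms)
  have smult: "(\<Union>a\<in>W +>\<^bsub>V\<^esub> v. W +>\<^bsub>V\<^esub> (r \<odot>\<^bsub>V\<^esub> a)) = W +>\<^bsub>V\<^esub> (r \<odot>\<^bsub>V\<^esub> v)"
    if v: "v \<in> carrier V" and r: "r \<in> carrier K" for v r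
  proof -
    have "W +>\<^bsub>V\<^esub> (r \<odot>\<^bsub>V\<^esub> a) = W +>\<^bsub>V\<^esub> (r \<odot>\<^bsub>V\<^esub> v)" if a: "a \<in> W +>\<^bsub>V\<^esub> v" for a
    proof -
      obtain w where w: "w \<in> W" "a = w \<oplus>\<^bsub>V\<^esub> v"
        using a by (auto simp: a_r_coset_def r_coset_def)
      have "r \<odot>\<^bsub>V\<^esub> a = r \<odot>\<^bsub>V\<^esub> w \<oplus>\<^bsub>V\<^esub> r \<odot>\<^bsub>V\<^esub> v"
        using w W_sub v r by (auto simp: V.module.smult_r_distr)
      then have "r \<odot>\<^bsub>V\<^esub> a \<in> W +>\<^bsub>V\<^esub> (r \<odot>\<^bsub>V\<^esub> v)"
        using W_smult[OF r w(1)] by (auto simp: a_r_coset_def r_coset_def)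
      then show ?thesis
        using W.a_repr_independence' v r by (metis V.module.smult_closed)
    qed
    then show ?thesis using W.a_rcos_self[OF v] by blast
  qed
  let ?Q = "quotient_module V W"
  have Q: "carrier ?Q = (\<lambda>v. W +>\<^bsub>V\<^esub> v) ` carrier V"
    by (auto simp: quotient_module_def A_RCOSETS_def RCOSETS_def a_r_coset_def)
  have Q_add: "(W +>\<^bsub>V\<^esub> u) \<oplus>\<^bsub>?Q\<^esub> (W +>\<^bsub>V\<^esub> v) = W +>\<^bsub>V\<^esub> (u \<oplus>\<^bsub>V\<^esub> v)"
    if "u \<in> carrier V" "v \<in> carrier V" for u v
    using that by (simp add: quotient_module_def W.a_rcos_sum)
  have Q_smult: "r \<odot>\<^bsub>?Q\<^esub> (W +>\<^bsub>V\<^esub> v) = W +>\<^bsub>V\<^esub> (r \<odot>\<^bsub>V\<^esub> v)"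
    if "v \<in> carrier V" "r \<in> carrier K" for r v
    using smult[OF that] by (simp add: quotient_module_def)
  have Q_zero: "\<zero>\<^bsub>?Q\<^esub> = W +>\<^bsub>V\<^esub> \<zero>\<^bsub>V\<^esub>"
    using W.a_rcos_const[OF W_zero] by (simp add: quotient_module_def)
  have ag: "abelian_group ?Q"
  proof (rule abelian_groupI)
    fix A assume "A \<in> carrier ?Q"
    then obtain v where "v \<in> carrier V" "A = W +>\<^bsub>V\<^esub> v" by (auto simp: Q)
    then show "\<exists>B\<in>carrier ?Q. B \<oplus>\<^bsub>?Q\<^esub> A = \<zero>\<^bsub>?Q\<^esub>"
      by (intro bexI[of _ "W +>\<^bsub>V\<^esub> (\<ominus>\<^bsub>V\<^esub> v)"]) (auto simp: Q Q_add Q_zero V.module.M.l_neg)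
  qed (auto simp: Q Q_add Q_zero V.module.M.a_ac)
  have "Module.module K ?Q"
    by (rule moduleI[OF _ ag])
      (auto simp: Q Q_add Q_smult V.module.smult_l_distr V.module.smult_r_distr
        V.module.smult_assoc1 intro: V.R.cring_axioms)
  then show ?thesis by (simp add: vectorspace_def V.field_axioms)
qed

theorem vectorspace_rational_homology: "vectorspace class_ring (rational_homology p X)"
  unfolding rational_homology_def
proof (rule vectorspace_quotient_module[OF vectorspace_rational_cycles])
  interpret C: vectorspace class_ring "rational_chains (Suc p) X"
    by (rule vectorspace_rational_chains)
  interpret Z: vectorspace class_ring "rational_cycles p X" by (rule vectorspace_rational_cycles)
  show "LinearCombinations.submodule class_ring (rational_boundaries p X) (rational_cycles p X)"
  proof (unfold LinearCombinations.submodule_def, intro conjI allI impI)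
    show "Module.module class_ring (rational_cycles p X)" by (rule Z.module.module_axioms)
    show "rational_boundaries p X \<subseteq> carrier (rational_cycles p X)"
      by (auto simp: rational_boundaries_def rational_cycles_def rational_boundary_boundary
          rational_boundary_in_chains)
    show "v \<oplus>\<^bsub>rational_cycles p X\<^esub> w \<in> rational_boundaries p X"
      if "v \<in> rational_boundaries p X" "w \<in> rational_boundaries p X" for v w
    proof -
      obtain c d where cd: "c \<in> carrier (rational_chains (Suc p) X)" "v = rational_boundary (Suc p) c"
        "d \<in> carrier (rational_chains (Suc p) X)" "w = rational_boundary (Suc p) d"
        using \<open>v \<in> _\<close> \<open>w \<in> _\<close> by (auto simp: rational_boundaries_def)
      have "c + d \<in> carrier (rational_chains (Suc p) X)"
        using C.module.M.a_closed[OF cd(1,3)] by (simp add: rational_chains_def)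
      then show ?thesis
        unfolding cd by (simp add: rational_boundaries_def rational_cycles_def rational_chains_def
            flip: rational_boundary_add)
    qed
    show "\<zero>\<^bsub>rational_cycles p X\<^esub> \<in> rational_boundaries p X"
      by (auto simp: rational_boundaries_def rational_cycles_def rational_chains_def
          intro!: image_eqI[of _ _ 0])
    show "r \<odot>\<^bsub>rational_cycles p X\<^esub> v \<in> rational_boundaries p X"
      if "v \<in> rational_boundaries p X" for r :: rat and v
    proof -
      obtain c where c: "c \<in> carrier (rational_chains (Suc p) X)" "v = rational_boundary (Suc p) c"
        using \<open>v \<in> _\<close> by (auto simp: rational_boundaries_def)
      have "Poly_Mapping.map ((*) r) c \<in> carrier (rational_chains (Suc p) X)"
        using C.module.smult_closed[OF _ c(1), of r] by (simp add: rational_chains_def)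
      then show ?thesis
        unfolding c by (simp add: rational_boundaries_def rational_cycles_def rational_chains_def
            flip: rational_boundary_smult)
    qed
  qed
qed

end

theory Submission
  imports Defs "HOL-Analysis.Abstract_Topological_Spaces"
begin

text \<open>On chains of ordered configurations, symmetrised and modulo torsion, the transfer \<open>\<tau>\<close> is the
sum of the maps that forget one point. Inserting a point near a fixed interior point \<open>q\<close> gives an
operator \<open>s\<close>, inserting the points of a sphere around \<open>q\<close> gives \<open>d\<close>. Up to homology
\<open>\<tau> s = s \<tau> + 1\<close> and \<open>\<tau> d = d \<tau>\<close>, and \<open>d\<^sup>2\<close> commutes with \<open>s\<close>; hence \<open>s \<tau> + l\<close> is rationally
onto for \<open>l \<ge> 1\<close>. By excision and the Thom isomorphism, a cycle \<open>x\<close> is determined, up to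
configurations avoiding \<open>q\<close>, by a cycle \<open>y\<close> with one point fewer and \<open>d y \<sim> 0\<close>. A non-orientable
manifold has an isotopy fixing \<open>q\<close> and reversing the orientation there, and comparing \<open>x\<close> with
its image gives \<open>2 * y \<sim> d z\<close> with \<open>d\<^sup>2 z \<sim> 0\<close>. Lifting \<open>z\<close> along \<open>\<tau>\<close> within the kernel of
\<open>d\<^sup>2\<close> to \<open>w\<close>, the cycle \<open>d w\<close> closes up to a lift of a multiple of \<open>x\<close>. So \<open>\<tau>\<close> is onto in rational
homology, and dimensions can only grow.\<close>

type_synonym rvec = "nat => real"
type_synonym 'a rpair = "('a \<times> rvec) \<times> rvec"

abbreviation "cmap == continuous_map"
abbreviation "relcycle == singular_relcycle"
abbreviation "schain == singular_chain"
abbreviation "Euc == Euclidean_space"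
abbreviation "ptop == prod_topology"
abbreviation "bdry == chain_boundary"
abbreviation "subtop == subtopology"
abbreviation "scal == frag_cmul"
abbreviation "relbdry == singular_relboundary"
abbreviation "homrel == homologous_rel"
abbreviation "Rtop == euclideanreal"
abbreviation "chm == chain_map"
abbreviation "tops == topspace"
abbreviation "bpt z == fst (fst z)"
abbreviation "mpt z == snd (fst z)"
abbreviation "sd == singular_subdivision"
abbreviation "rbdries == rational_boundaries"
abbreviation "stdsimp == standard_simplex"
abbreviation "homset == homologous_rel_set"
abbreviation "rhom == rational_homology"
abbreviation "rcycles == rational_cycles"
abbreviation "rchains == rational_chains"
abbreviation "ssimp == singular_simplex"
abbreviation "smap == simplex_map"
abbreviation "rhgroup == relative_homology_group"
abbreviation "keys == Poly_Mapping.keys"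
abbreviation "lookup == Poly_Mapping.lookup"
abbreviation "I01 == top_of_set {0..1::real}"

lemmas
  relcycle = singular_relcycle and
  relbdry = singular_relboundary and
  cmap = continuous_map and
  homrel_def = homologous_rel_def and
  relbdry_chm = singular_relboundary_chain_map and
  chm_cmul = chain_map_cmul and
  schain_def = singular_chain_def and
  bdry_cmul = chain_boundary_cmul and
  bdry_diff = chain_boundary_diff and
  schain_cmul = singular_chain_cmul and
  schain_diff = singular_chain_diff and
  relcycle_restrict = singular_relcycle_restrict and
  relbdry_restrict = singular_relboundary_restrict and
  cont_in_subtop = continuous_map_in_subtopology and
  chm_eq = chain_map_eq and
  cont_comp = continuous_map_compose and
  schain_chm = singular_chain_chain_map and
  chm_id_gen = chain_map_id_gen and
  chm_ident = chain_map_ident and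
  relcycle_cmul = singular_relcycle_cmul and
  relcycle_chm = singular_relcycle_chain_map and
  cont_fst = continuous_map_fst and
  cont_snd = continuous_map_snd and
  ssimplex_def = singular_simplex_def and
  chm_diff = chain_map_diff and
  cont_id = continuous_map_id and
  bdry_chm = chain_boundary_chain_map and
  bdry_def = chain_boundary_def and
  chm_add = chain_map_add and
  sbdry = singular_chain_boundary and
  cont_fun = continuous_map_funspace and
  cont_pairedI = continuous_map_pairedI and
  top_Euc = topspace_Euclidean_space and
  subtop_subtop = subtopology_subtopology and
  cont_from_sub = continuous_map_from_subtopology and
  openin_preim = openin_continuous_map_preimage and
  cont_const = continuous_map_const and
  cont_Euc_add = continuous_map_Euclidean_space_add and
  cont_diff = continuous_map_diff and
  cont_real_divide = continuous_map_real_divide and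
  cont_full = continuous_map_into_fulltopology and
  cont_cconst = continuous_map_canonical_const and
  scycle = singular_cycle

section \<open>Rational vanishing of relative homology classes\<close>

definition rnull :: "nat => 'a topology => 'a set => 'a chain => bool" where
  "rnull p X S c \<longleftrightarrow> (\<exists>m. m ~= 0 & relbdry p X S (scal m c))"

abbreviation hq :: "nat => 'a topology => 'a set => 'a chain => 'a chain => bool" where
  "hq p X S a b == rnull p X S (a - b)"

lemma rnull_relboundary: "relbdry p X S c ==> rnull p X S c" unfolding rnull_def by (intro exI[of _ 1]) simp

lemma hq_homol: "homrel p X S a b ==> hq p X S a b" by (simp add: homrel_def rnull_relboundary)

lemma scal_diff: "scal k (a - b) = scal k a - scal k b" by (intro poly_mapping_eqI) (simp add: lookup_minus algebra_simps)

lemma chm_comp: "chm p h (chm p g c) = chm p (%x. h (g x)) c" using chain_map_compose[of p h g] by (simp add: fun_eq_iff o_def)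

lemma rnull_0 [simp]: "rnull p X S 0" by (simp add: rnull_relboundary)

lemma rnull_cmul: "rnull p X S c ==> rnull p X S (scal k c)" unfolding rnull_def
  using singular_relboundary_cmul[of p X S _ k] by (metis frag_cmul_cmul mult.commute)

lemma rnull_cancel: "rnull p X S (scal k c) ==> k ~= 0 ==> rnull p X S c" unfolding rnull_def by (auto intro: exI[of _ "_ * k"])

lemma rnull_cmul_iff: "k ~= 0 ==> rnull p X S (scal k c) \<longleftrightarrow> rnull p X S c" using rnull_cancel rnull_cmul by blast

lemma rnull_minus [simp]: "rnull p X S (- c) \<longleftrightarrow> rnull p X S c" using rnull_cmul_iff[of "-1" p X S c] by simp

lemma rnull_add:
  assumes "rnull p X S a" "rnull p X S b"
  shows "rnull p X S (a + b)"
proof -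
  obtain k l where "k ~= 0" "l ~= 0" "relbdry p X S (scal k a)"
     "relbdry p X S (scal l b)" using assms by (auto simp: rnull_def)
  then have "relbdry p X S (scal l (scal k a) + scal k (scal l b))"
    by (intro singular_relboundary_add) (simp_all only: singular_relboundary_cmul)
  then have "relbdry p X S (scal (k * l) (a + b))" by (simp add: frag_cmul_distrib2 mult.commute)
  then show ?thesis unfolding rnull_def using \<open>k ~= 0\<close> \<open>l ~= 0\<close> by (intro exI[of _ "k * l"]) simp
qed

lemma rnull_diff: "rnull p X S a ==> rnull p X S b ==> rnull p X S (a - b)" using rnull_add[of p X S a "- b"] by simp

lemma rnull_sum: "(!!i. i \<in> I ==> rnull p X S (f i)) ==> rnull p X S (sum f I)"
  by (induction I rule: infinite_finite_induct) (auto simp: rnull_add)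

lemma hq_sym: "hq p X S a b ==> hq p X S b a" using rnull_minus[of p X S "a - b"] by simp

lemma hq_trans [trans]: "hq p X S a b ==> hq p X S b c ==> hq p X S a c" using rnull_add[of p X S "a - b" "b - c"] by simp

lemma hq_refl [simp]: "hq p X S a a" by simp

lemma hq_add: "hq p X S a b ==> hq p X S c d ==> hq p X S (a + c) (b + d)"
  using rnull_add[of p X S "a - b" "c - d"] by (simp add: algebra_simps)

lemma hq_cmul: "hq p X S a b ==> hq p X S (scal k a) (scal k b)" using rnull_cmul[of p X S "a - b" k] by (simp only: scal_diff)

lemma hq_sum: "(!!i. i \<in> I ==> hq p X S (f i) (g i)) ==> hq p X S (sum f I) (sum g I)"
  using rnull_sum[of I p X S "%i. f i - g i"] by (simp add: sum_subtractf)

lemma hq_rnull: "hq p X S a b ==> rnull p X S b ==> rnull p X S a" using rnull_add[of p X S "a - b" b] by simp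

lemma rnull_chain: "schain p (subtop X S) c ==> rnull p X S c" by (simp add: rnull_relboundary singular_chain_imp_relboundary)

lemma rnull_boundary: "schain (Suc p) X c ==> rnull p X S (bdry (Suc p) c)"
  by (intro rnull_relboundary) (auto simp: singular_relboundary_def)

lemma rnull_chm:
  assumes "rnull p X S c" "cmap X X' g" "g \<in> tops X Int S \<rightarrow> T"
  shows "rnull p X' T (chm p g c)"
proof -
  obtain m where "m ~= 0" "relbdry p X (tops X Int S) (scal m c)" using assms(1) by (auto simp: rnull_def)
  then show ?thesis using relbdry_chm[OF _ assms(2,3)] unfolding rnull_def by (intro exI[of _ m]) (simp flip: chm_cmul)
qed

lemma rnull_mono:
  assumes "rnull p X S c" "tops X Int S \<subseteq> T"
  shows "rnull p X T c"
proof -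
  obtain m where "m ~= 0" "relbdry p X S (scal m c)" using assms(1) by (auto simp: rnull_def)
  moreover have "relbdry p X T c" if c: "relbdry p X S c" for c
  proof -
    obtain d e where *: "schain (Suc p) X d" "schain p (subtop X (tops X Int S)) e"
      "bdry (Suc p) d + e = c" using c unfolding relbdry subtopology_restrict[of X S, symmetric] by auto
    then show ?thesis unfolding relbdry using singular_chain_mono[OF *(2) assms(2)] by blast
  qed
  ultimately show ?thesis unfolding rnull_def by blast
qed

lemma rnull_imp_chain:
  assumes "rnull p X S c" shows "schain p X c"
proof -
  obtain m where "m ~= 0" "relbdry p X S (scal m c)" using assms(1) by (auto simp: rnull_def)
  then show ?thesis using singular_relboundary_imp_chain[of p X S "scal m c"] by (auto simp: schain_def)
qed

lemma rnull_iff: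
  "rnull p X S c \<longleftrightarrow> (\<exists>m d e. m ~= 0 & schain (Suc p) X d &
     schain p (subtop X S) e & scal m c = bdry (Suc p) d + e)" unfolding rnull_def relbdry by (simp add: eq_commute)

lemma rnull_empty_iff:
  "rnull p X {} c \<longleftrightarrow> (\<exists>m d. m ~= 0 & schain (Suc p) X d & scal m c = bdry (Suc p) d)"
  unfolding rnull_def singular_boundary by (simp add: eq_commute)

lemma rnull_bdry:
  assumes "rnull (Suc p) X S c"
  shows "rnull p (subtop X S) {} (bdry (Suc p) c)"
proof -
  obtain m d e where *: "m ~= 0" "schain (Suc (Suc p)) X d"
     "schain (Suc p) (subtop X S) e" "scal m c = bdry (Suc (Suc p)) d + e" using assms by (auto simp: rnull_iff)
  then have "scal m (bdry (Suc p) c) = bdry (Suc p) e" by (simp add: chain_boundary_add chain_boundary_boundary_alt flip: bdry_cmul)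
  then show ?thesis using * unfolding rnull_empty_iff by blast
qed

lemma bdry_cycle: "relcycle p X {} c ==> bdry p c = 0" by (simp add: scycle)

lemma relcycle_lift:
  assumes c: "schain (Suc p) X c"
    and "rnull p (subtop X S) {} (bdry (Suc p) c)"
  obtains m e where "m ~= 0" "schain (Suc p) (subtop X S) e"
    "relcycle (Suc p) X {} (scal m c - e)"
proof -
  obtain m d where *: "m ~= 0" "schain (Suc p) (subtop X S) d"
     "scal m (bdry (Suc p) c) = bdry (Suc p) d" using assms by (auto simp: rnull_empty_iff)
  moreover have "schain (Suc p) X d" using * by (simp add: singular_chain_subtopology)
  ultimately show thesis using c by (intro that[of m d])
      (auto simp: scycle bdry_diff bdry_cmul
         intro: schain_cmul schain_diff)
qed

lemma rnull_imp_hq_sub: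
  assumes c: "relcycle p X {} c" and "rnull p X S c"
  obtains m e where "m ~= 0" "relcycle p (subtop X S) {} e" "hq p X {} (scal m c) e"
proof -
  obtain m d e where *: "m ~= 0" "schain (Suc p) X d"
     "schain p (subtop X S) e" "scal m c = bdry (Suc p) d + e" using assms by (auto simp: rnull_iff)
  have "bdry p (scal m c) = 0" using c by (simp add: scycle bdry_cmul)
  then have "bdry p e = 0" using * by (simp add: chain_boundary_add chain_boundary_boundary_alt)
  then show thesis using * by (intro that[of m e]) (auto simp: scycle rnull_boundary)
qed

lemma relcycle_of_cycle: "relcycle p X {} c ==> relcycle p X S c" by (simp only: scycle) (simp add: relcycle)

lemma relcycle_cong: "tops X Int S = tops X Int T ==> relcycle p X S c \<longleftrightarrow> relcycle p X T c"
  using relcycle_restrict[of p X S] relcycle_restrict[of p X T] by simp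

lemma relboundary_cong: "tops X Int S = tops X Int T ==> relbdry p X S c \<longleftrightarrow> relbdry p X T c"
  using relbdry_restrict[of p X S] relbdry_restrict[of p X T] by simp

lemma cont_subI:
  "cmap X Y f ==> (!!x. x \<in> tops X ==> f x \<in> S) ==> cmap X (subtop Y S) f" by (auto simp: cont_in_subtop)

lemma homol_homotopy:
  assumes c: "relcycle p X S c"
    and H: "cmap (ptop (I01) X) U H"
    and HV: "!!t x. [|0 \<le> t; t \<le> 1; x \<in> tops X; x \<in> S|] ==> H (t, x) \<in> V"
  shows "homrel p U V (chm p (%x. H (0, x)) c) (chm p (%x. H (1, x)) c)"
proof (rule homotopic_imp_homologous_rel_chain_maps)
  show "relcycle p X (tops X Int S) c" using c by simp
  show "homotopic_with (%h. h \<in> tops X Int S \<rightarrow> V) X U (%x. H (0, x)) (%x. H (1, x))"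
    unfolding homotopic_with_def using H HV by (intro exI[of _ H]) auto
qed

lemma hq_homotopy:
  assumes "relcycle p X S c"
    and "cmap (ptop (I01) X) U H"
    and "!!t x. [|0 \<le> t; t \<le> 1; x \<in> tops X; x \<in> S|] ==> H (t, x) \<in> V"
    and "!!x. x \<in> tops X ==> H (0, x) = f x"
    and "!!x. x \<in> tops X ==> H (1, x) = g x"
  shows "hq p U V (chm p f c) (chm p g c)"
proof -
  have "schain p X c" using assms(1) by (simp add: relcycle)
  then have "chm p f c = chm p (%x. H (0, x)) c" "chm p g c = chm p (%x. H (1, x)) c" using assms(4,5) by (auto intro: chm_eq)
  then show ?thesis using homol_homotopy[OF assms(1-3)] by (simp add: hq_homol)
qed

lemma relboundary_deform:
  assumes c: "relcycle p X S c"
    and H: "cmap (ptop (I01) X) X H"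
    and HS: "!!t x. [|0 \<le> t; t \<le> 1; x \<in> tops X; x \<in> S|] ==> H (t, x) \<in> S"
    and H0: "!!x. x \<in> tops X ==> H (0, x) = x"
    and H1: "!!x. x \<in> tops X ==> H (1, x) \<in> S"
  shows "relbdry p X S c"
proof -
  have sc: "schain p X c" using c by (simp add: relcycle)
  have "cmap X X (%x. H (1, x))" by (rule cont_comp[OF _ H, unfolded o_def]) (auto intro: continuous_intros)
  then have "cmap X (subtop X S) (%x. H (1, x))" using H1 by (auto simp: cont_in_subtop)
  then have "schain p (subtop X S) (chm p (%x. H (1, x)) c)" using sc schain_chm by blast
  moreover have "chm p (%x. H (0, x)) c = c" using sc H0 by (simp add: chm_id_gen)
  moreover have "relbdry p X S (c - chm p (%x. H (1, x)) c)" using homol_homotopy[OF c H HS] calculation by (simp add: homrel_def)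
  ultimately show ?thesis using singular_relboundary_add[of p X S "c - chm p (%x. H (1, x)) c" "chm p (%x. H (1, x)) c"]
    by (simp add: singular_chain_imp_relboundary)
qed

lemma excision_surj:
  assumes A: "openin X A" and B: "openin X B" and AB: "tops X \<subseteq> A Un B"
    and c: "relcycle p X B c"
  obtains c' where "relcycle p (subtop X A) B c'" "homrel p X B c c'"
proof -
  let ?U = "tops X - A"
  have cl: "X closure_of ?U \<subseteq> X interior_of B"
  proof -
    have "closedin X ?U" using A by blast
    then show ?thesis using AB by (auto simp: closure_of_closedin interior_of_openin[OF B])
  qed
  have sub: "B \<subseteq> tops X" using B openin_subset by blast
  have "relcycle p (subtop X (tops X)) B c" using c by simp
  then obtain c' where c': "relcycle p (subtop X (tops X - ?U)) (B - ?U) c'"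
    "homrel p (subtop X (tops X)) B c c'" using excised_relcycle_exists[OF cl sub] by blast
  have "tops X - ?U = A" "tops (subtop X A) Int (B - ?U) = tops (subtop X A) Int B" using A openin_subset by fastforce+
  then have "relcycle p (subtop X A) B c'" using c'(1) relcycle_restrict[of p "subtop X A" "B - ?U"]
      relcycle_restrict[of p "subtop X A" "B"] by simp
  then show thesis using c' that by simp
qed

lemma excision_inj:
  assumes A: "openin X A" and B: "openin X B" and AB: "tops X \<subseteq> A Un B"
    and c: "relcycle p (subtop X A) B c" and n: "relbdry p X B c"
  shows "relbdry p (subtop X A) B c"
proof -
  let ?U = "tops X - A"
  let ?A = "subtop X A"
  have cl: "X closure_of ?U \<subseteq> X interior_of B"
  proof -
    have "closedin X ?U" using A by blast
    then show ?thesis using AB by (auto simp: closure_of_closedin interior_of_openin[OF B])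
  qed
  have sub: "B \<subseteq> tops X" using B openin_subset by blast
  have eqA: "tops X - ?U = A" "tops ?A Int (B - ?U) = tops ?A Int B" using A openin_subset by fastforce+
  have cyc: "relcycle p ?A (B - ?U) c" using c relcycle_restrict[of p ?A "B - ?U"] relcycle_restrict[of p ?A B] by (simp only: eqA(2))
  let ?h = "hom_induced (int p) ?A (B - ?U) X B id"
  have iso: "?h \<in> iso (rhgroup p ?A (B - ?U)) (rhgroup p X B)" using homology_excision_axiom[OF cl sub, of "int p"] by (simp add: eqA)
  have h: "?h (homset p ?A (B - ?U) c) = homset p X B (chm p id c)" by (rule hom_induced_chain_map) (use cyc in auto)
  have "schain p X c" using n singular_relboundary_imp_chain by blast
  then have "?h (homset p ?A (B - ?U) c) = singular_relboundary_set p X B"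
    using h n by (simp add: chm_ident homologous_rel_set_eq_relboundary)
  moreover have "?h (homset p ?A (B - ?U) 0) = singular_relboundary_set p X B"
    by (subst hom_induced_chain_map) (auto simp: homologous_rel_set_eq_relboundary)
  moreover have "homset p ?A (B - ?U) c \<in> carrier (rhgroup p ?A (B - ?U))"
    "homset p ?A (B - ?U) 0 \<in> carrier (rhgroup p ?A (B - ?U))"
    using cyc singular_relcycle_0[of p ?A "B - ?U"] by (auto simp only: carrier_relative_homology_group image_iff mem_Collect_eq)
  moreover have "inj_on ?h (carrier (rhgroup p ?A (B - ?U)))" using iso by (simp add: iso_def bij_betw_def)
  ultimately have "homset p ?A (B - ?U) c = homset p ?A (B - ?U) 0" by (metis inj_onD)
  then have "relbdry p ?A (B - ?U) c" by (metis diff_zero homrel_def homologous_rel_set_eq)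
  then show ?thesis using relbdry_restrict[of p ?A "B - ?U"] relbdry_restrict[of p ?A B] by (simp only: eqA(2))
qed

lemma excision_surj_Int:
  assumes A: "openin X (tops X Int A)" and B: "openin X (tops X Int B)" and AB: "tops X \<subseteq> A Un B"
    and c: "relcycle p X B c"
  obtains c' where "relcycle p (subtop X A) B c'" "homrel p X B c c'"
proof -
  have "tops X \<subseteq> (tops X Int A) Un (tops X Int B)" using AB by blast
  moreover have "relcycle p X (tops X Int B) c" using c by (simp only: relcycle_restrict)
  ultimately obtain c' where c': "relcycle p (subtop X (tops X Int A)) (tops X Int B) c'"
      "homrel p X (tops X Int B) c c'" using excision_surj[OF A B] by blast
  have eq: "tops (subtop X A) Int (tops X Int B) = tops (subtop X A) Int B" by auto
  show thesis using c' unfolding subtopology_restrict homologous_rel_restrict relcycle_cong[OF eq] by (rule that)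
qed

lemma rnull_excision:
  assumes A: "openin X (tops X Int A)" and B: "openin X (tops X Int B)" and AB: "tops X \<subseteq> A Un B"
    and c: "relcycle p (subtop X A) B c" and n: "rnull p X B c"
  shows "rnull p (subtop X A) B c"
proof -
  obtain m where m: "m ~= 0" "relbdry p X B (scal m c)" using n by (auto simp: rnull_def)
  have eq: "tops (subtop X A) Int (tops X Int B) = tops (subtop X A) Int B" by auto
  have "tops X \<subseteq> (tops X Int A) Un (tops X Int B)" using AB by blast
  moreover have "relcycle p (subtop X (tops X Int A)) (tops X Int B) (scal m c)"
    unfolding subtopology_restrict relcycle_cong[OF eq] using c by (rule relcycle_cmul)
  moreover have "relbdry p X (tops X Int B) (scal m c)" unfolding relbdry_restrict by (rule m(2))
  ultimately have "relbdry p (subtop X (tops X Int A)) (tops X Int B) (scal m c)" by (rule excision_inj[OF A B])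
  then show ?thesis unfolding subtopology_restrict relboundary_cong[OF eq] rnull_def using m(1) by blast
qed

section \<open>The cross product of singular chains\<close>

lemma boundary_of_contraction:
  assumes c: "relcycle p X {} c" and p: "p ~= 0"
    and H: "cmap (ptop (I01) X) X H"
    and H0: "!!x. x \<in> tops X ==> H (0, x) = x"
    and H1: "!!x. x \<in> tops X ==> H (1, x) = a" and a: "a \<in> tops X"
  shows "relbdry p X {} c"
proof -
  have sc: "schain p X c" using c by (simp add: relcycle)
  have 1: "homrel p X {} (chm p (%x. H (0, x)) c) (chm p (%x. H (1, x)) c)" by (rule homol_homotopy[OF c H]) auto
  have 0: "chm p (%x. H (0, x)) c = c" "chm p (%x. H (1, x)) c = chm p (%x. a) c" using sc H0 H1 by (auto simp: chm_id_gen intro: chm_eq)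
  have "cmap X (subtop X {a}) (%x. a)" using a by (auto simp: cont_in_subtop)
  then have "relcycle p (subtop X {a}) {} (chm p (%x. a) c)" using c by (intro relcycle_chm) auto
  moreover have "tops (subtop X {a}) = {a}" using a by auto
  ultimately have "relbdry p (subtop X {a}) {} (chm p (%x. a) c)"
    using singular_boundary_eq_cycle_singleton[of "subtop X {a}" a p] p by auto
  then have "relbdry p X {} (chm p (%x. a) c)" using singular_boundary_mono[of "{a}" "tops X" p X] a by simp
  then show ?thesis using 1 singular_relboundary_add[of p X "{}" "c - chm p (%x. a) c" "chm p (%x. a) c"] by (simp add: 0 homrel_def)
qed

abbreviation sspace :: "nat => rvec topology" where
  "sspace p == subtop (powertop_real UNIV) (stdsimp p)"

abbreviation sid :: "nat => rvec chain" where
  "sid p == frag_of (restrict id (stdsimp p))"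

abbreviation vertex0 :: "nat => real" where
  "vertex0 == (%j. if j = 0 then 1 else 0)"

definition crossw :: "('c \<times> 'd) chain => nat => nat => (('c => 'a) \<Rightarrow>\<^sub>0 int) => (('d => 'b) \<Rightarrow>\<^sub>0 int) => ('a \<times> 'b) chain" where
  "crossw E p q a b =
     frag_extend (%f. frag_extend (%g. chm (p + q) (map_prod f g) E) b) a"

text \<open>The fundamental chain of a product of two simplices: a filling of the boundary prescribed by
  the Leibniz rule, which exists by induction since the product is contractible.\<close>

fun ez :: "nat => nat => (rvec \<times> rvec) chain" where
  "ez 0 q = frag_of (restrict (%x. (vertex0, x)) (stdsimp q))"
| "ez (Suc p) 0 = frag_of (restrict (%x. (x, vertex0)) (stdsimp (Suc p)))"
| "ez (Suc p) (Suc q) = (SOME c.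
     schain (Suc p + Suc q) (ptop (sspace (Suc p)) (sspace (Suc q))) c &
     bdry (Suc p + Suc q) c =
       crossw (ez p (Suc q)) p (Suc q) (bdry (Suc p) (sid (Suc p))) (sid (Suc q)) +
       scal ((-1) ^ Suc p)
         (crossw (ez (Suc p) q) (Suc p) q (sid (Suc p)) (bdry (Suc q) (sid (Suc q)))))"

definition cross :: "nat => nat => 'a chain => 'b chain => ('a \<times> 'b) chain" where
  "cross p q = crossw (ez p q) p q"

lemma crossw_zero [simp]: "crossw E p q 0 b = 0" "crossw E p q a 0 = 0" by (auto simp: crossw_def intro: frag_extend_eq_0)

lemma cross_zero [simp]: "cross p q 0 b = 0" "cross p q a 0 = 0" by (simp_all add: cross_def)

lemma crossw_add_left: "crossw E p q (a + a') b = crossw E p q a b + crossw E p q a' b" by (simp add: crossw_def frag_extend_add)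

lemma crossw_diff_left: "crossw E p q (a - a') b = crossw E p q a b - crossw E p q a' b" by (simp add: crossw_def frag_extend_diff)

lemma crossw_cmul_left: "crossw E p q (scal k a) b = scal k (crossw E p q a b)" by (simp add: crossw_def frag_extend_cmul)

lemma frag_extend_add_fun: "frag_extend (%x. f x + g x) c = frag_extend f c + frag_extend g c"
  by (simp add: frag_extend_def frag_cmul_distrib2 sum.distrib)

lemma frag_extend_diff_fun: "frag_extend (%x. f x - g x) c = frag_extend f c - frag_extend g c"
  by (simp add: frag_extend_def scal_diff sum_subtractf)

lemma frag_extend_cmul_fun: "frag_extend (%x. scal k (f x)) c = scal k (frag_extend f c)"
  by (simp add: frag_extend_def frag_cmul_sum o_def mult.commute)

lemma crossw_add_right: "crossw E p q a (b + b') = crossw E p q a b + crossw E p q a b'"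
  by (simp add: crossw_def frag_extend_add frag_extend_add_fun)

lemma crossw_diff_right: "crossw E p q a (b - b') = crossw E p q a b - crossw E p q a b'"
  by (simp add: crossw_def frag_extend_diff frag_extend_diff_fun)

lemma crossw_cmul_right: "crossw E p q a (scal k b) = scal k (crossw E p q a b)"
  by (simp add: crossw_def frag_extend_cmul frag_extend_cmul_fun)

lemma cm_fst: "cmap Z (ptop X Y) f ==> cmap Z X (%z. fst (f z))" using continuous_map_fst_of by (auto simp: o_def)

lemma cm_snd: "cmap Z (ptop X Y) f ==> cmap Z Y (%z. snd (f z))" using continuous_map_snd_of by (auto simp: o_def)

lemma cont_map_prod:
  assumes "cmap X X' f" "cmap Y Y' g"
  shows "cmap (ptop X Y) (ptop X' Y') (map_prod f g)"
  using assms by (auto simp: map_prod_def case_prod_unfold intro!: continuous_intros cont_comp[OF cont_fst, unfolded o_def] cont_comp[OF cont_snd, unfolded o_def])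

lemma schain_crossw:
  assumes "schain (p + q) (ptop (sspace p) (sspace q)) E"
    and "schain p X a" "schain q Y b"
  shows "schain (p + q) (ptop X Y) (crossw E p q a b)" unfolding crossw_def using assms(2,3)
  by (intro singular_chain_extend schain_chm[OF assms(1)] cont_map_prod)
    (auto simp: schain_def ssimplex_def)

lemma crossw_natural:
  assumes E: "schain (p + q) (ptop (sspace p) (sspace q)) E"
  shows "crossw E p q (chm p \<phi> a) (chm q \<psi> b) =
    chm (p + q) (map_prod \<phi> \<psi>) (crossw E p q a b)"
proof -
  have one: "crossw E p q (chm p \<phi> (frag_of f)) (chm q \<psi> (frag_of g)) =
    chm (p + q) (map_prod \<phi> \<psi>) (crossw E p q (frag_of f) (frag_of g))" for f g
  proof -
    have "chm (p + q) (map_prod (smap p \<phi> f) (smap q \<psi> g)) E =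
        chm (p + q) (map_prod \<phi> \<psi> \<circ> map_prod f g) E" by (rule chm_eq[OF E]) (auto simp: simplex_map_def)
    then show ?thesis by (simp add: crossw_def chain_map_compose)
  qed
  have two: "crossw E p q (chm p \<phi> (frag_of f)) (chm q \<psi> b) =
    chm (p + q) (map_prod \<phi> \<psi>) (crossw E p q (frag_of f) b)" for f using subset_UNIV
    by (induction b rule: frag_induction) (use one in \<open>auto simp: chm_diff crossw_diff_right simp del: chain_map_of\<close>)
  show ?thesis using subset_UNIV
    by (induction a rule: frag_induction) (use two in \<open>auto simp: chm_diff crossw_diff_left simp del: chain_map_of\<close>)
qed

lemma cross_0_left:
  assumes "schain q Y b"
  shows "cross 0 q (frag_of f) b = chm q (%y. (f vertex0, y)) b" using assms unfolding schain_def
proof (induction b rule: frag_induction)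
  case (one g)
  then have "smap q (map_prod f g) (restrict (Pair vertex0) (stdsimp q)) =
      smap q (%y. (f vertex0, y)) g" by (auto simp: simplex_map_def restrict_def fun_eq_iff)
  then show ?case by (simp add: cross_def crossw_def)
qed (auto simp: cross_def crossw_diff_right chm_diff)

lemma ez_0_right: "ez p 0 = frag_of (restrict (%x. (x, vertex0)) (stdsimp p))"
proof (cases p)
  case 0
  have "restrict (%x. (vertex0, x)) (stdsimp 0) = restrict (%x. (x, vertex0)) (stdsimp 0)"
    unfolding standard_simplex_0 by (rule restrict_ext) simp
  then show ?thesis by (simp only: 0 ez.simps)
qed simp

lemma cross_0_right:
  assumes "schain p X a"
  shows "cross p 0 a (frag_of g) = chm p (%x. (x, g vertex0)) a" using assms unfolding schain_def
proof (induction a rule: frag_induction)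
  case (one f)
  have "ez p 0 = frag_of (restrict (%x. (x, vertex0)) (stdsimp p))" by (rule ez_0_right)
  moreover have "smap p (map_prod f g) (restrict (%x. (x, vertex0)) (stdsimp p)) =
      smap p (%x. (x, g vertex0)) f" by (auto simp: simplex_map_def restrict_def fun_eq_iff)
  ultimately show ?case by (simp add: cross_def crossw_def)
qed (auto simp: cross_def crossw_diff_left chm_diff)

lemma ssid: "ssimp p (sspace p) (restrict id (stdsimp p))" by (auto simp: ssimplex_def intro: continuous_map_eq[OF cont_id])

lemma schain_sid: "schain p (sspace p) (sid p)" by (simp add: singular_chain_of ssid)

definition ez_ok :: "nat => nat => bool" where
  "ez_ok p q \<longleftrightarrow> schain (p + q) (ptop (sspace p) (sspace q)) (ez p q) &
     bdry (p + q) (ez p q) =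
       cross (p - 1) q (bdry p (sid p)) (sid q) +
       scal ((-1) ^ p) (cross p (q - 1) (sid p) (bdry q (sid q)))"

lemma cross_Leibniz_ez:
  assumes ok: "ez_ok p q" and ok1: "p ~= 0 ==> ez_ok (p - 1) q" and ok2: "q ~= 0 ==> ez_ok p (q - 1)"
    and a: "schain p X a" and b: "schain q Y b"
  shows "bdry (p + q) (cross p q a b) =
     cross (p - 1) q (bdry p a) b + scal ((-1) ^ p) (cross p (q - 1) a (bdry q b))"
proof -
  have one: "bdry (p + q) (cross p q (frag_of f) (frag_of g)) =
     cross (p - 1) q (bdry p (frag_of f)) (frag_of g) +
     scal ((-1) ^ p) (cross p (q - 1) (frag_of f) (bdry q (frag_of g)))"
    if f: "ssimp p X f" and g: "ssimp q Y g" for f g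
  proof -
    have E: "schain (p + q) (ptop (sspace p) (sspace q)) (ez p q)"
      and D: "bdry (p + q) (ez p q) =
       cross (p - 1) q (bdry p (sid p)) (sid q) +
       scal ((-1) ^ p) (cross p (q - 1) (sid p) (bdry q (sid q)))" using ok by (auto simp: ez_ok_def)
    have ids: "chm p f (sid p) = frag_of f" "chm q g (sid q) = frag_of g" using f g singular_simplex_chain_map_id by blast+
    have fb: "chm (p - 1) f (bdry p (sid p)) = bdry p (frag_of f)" using bdry_chm[OF schain_sid, of p f] ids by simp
    have gb: "chm (q - 1) g (bdry q (sid q)) = bdry q (frag_of g)" using bdry_chm[OF schain_sid, of q g] ids by simp
    have t1: "chm (p + q - 1) (map_prod f g) (cross (p - 1) q (bdry p (sid p)) (sid q))
       = cross (p - 1) q (bdry p (frag_of f)) (frag_of g)"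
    proof (cases "p = 0")
      case False
      then have "p + q - 1 = p - 1 + q" by simp
      then show ?thesis using crossw_natural[of "p - 1" q "ez (p - 1) q" f "bdry p (sid p)" g "sid q"]
          ok1[OF False] unfolding cross_def ez_ok_def fb ids(2) by metis
    qed (simp add: bdry_def cross_def)
    have t2: "chm (p + q - 1) (map_prod f g) (cross p (q - 1) (sid p) (bdry q (sid q)))
       = cross p (q - 1) (frag_of f) (bdry q (frag_of g))"
    proof (cases "q = 0")
      case False
      then have "p + q - 1 = p + (q - 1)" by simp
      then show ?thesis using crossw_natural[of p "q - 1" "ez p (q - 1)" f "sid p" g "bdry q (sid q)"]
          ok2[OF False] unfolding cross_def ez_ok_def gb ids(1) by metis
    qed (simp add: bdry_def cross_def)
    have "bdry (p + q) (cross p q (frag_of f) (frag_of g)) =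
        chm (p + q - 1) (map_prod f g) (bdry (p + q) (ez p q))" using bdry_chm[OF E, of "map_prod f g"] by (simp add: cross_def crossw_def)
    also have "\<dots> = chm (p + q - 1) (map_prod f g) (cross (p - 1) q (bdry p (sid p)) (sid q))
       + scal ((-1) ^ p) (chm (p + q - 1) (map_prod f g)
           (cross p (q - 1) (sid p) (bdry q (sid q))))" by (simp only: D chm_add chm_cmul)
    finally show ?thesis by (simp only: t1 t2)
  qed
  have two: "bdry (p + q) (cross p q (frag_of f) b) =
     cross (p - 1) q (bdry p (frag_of f)) b +
     scal ((-1) ^ p) (cross p (q - 1) (frag_of f) (bdry q b))"
    if f: "ssimp p X f" for f using b unfolding schain_def by (induction b rule: frag_induction)
      (use one f in \<open>auto simp: bdry_diff cross_def crossw_diff_right scal_diff\<close>)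
  show ?thesis using a unfolding schain_def by (induction a rule: frag_induction)
      (use two in \<open>auto simp: bdry_diff cross_def crossw_diff_left scal_diff\<close>)
qed

lemma vertex0_in [simp]: "vertex0 \<in> stdsimp p" using basis_in_standard_simplex[of 0 p] by simp

lemma simplex_map_restrict_id:
  "smap p f (restrict id (stdsimp p)) = restrict f (stdsimp p)" unfolding simplex_map_def by (rule restrict_ext) simp

lemma ez_ok_0_left: "ez_ok 0 q"
proof -
  have E: "ez 0 q = chm q (%y. (vertex0, y)) (sid q)" by (simp add: simplex_map_restrict_id)
  have "cmap (sspace q) (ptop (sspace 0) (sspace q)) (%y. (vertex0, y))" by (auto intro!: continuous_intros)
  then have "schain q (ptop (sspace 0) (sspace q)) (ez 0 q)" unfolding E by (rule schain_chm[OF schain_sid])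
  moreover have "bdry (0 + q) (ez 0 q) = chm (q - 1) (%y. (vertex0, y)) (bdry q (sid q))"
    using bdry_chm[OF schain_sid, of q "%y. (vertex0, y)"] by (simp add: E del: ez.simps)
  moreover have "cross 0 (q - 1) (sid 0) (bdry q (sid q)) = chm (q - 1) (%y. (restrict id (stdsimp 0) vertex0, y)) (bdry q (sid q))"
    using sbdry[OF schain_sid, of q] by (intro cross_0_left) simp
  moreover have "restrict id (stdsimp 0) vertex0 = vertex0" by simp
  moreover have "bdry 0 (sid 0) = 0" by (simp add: bdry_def)
  ultimately show ?thesis unfolding ez_ok_def by simp
qed

lemma ez_ok_0_right: "ez_ok p 0"
proof -
  have E: "ez p 0 = chm p (%y. (y, vertex0)) (sid p)" unfolding ez_0_right by (simp add: simplex_map_restrict_id)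
  have "cmap (sspace p) (ptop (sspace p) (sspace 0)) (%y. (y, vertex0))" by (auto intro!: continuous_intros)
  then have "schain p (ptop (sspace p) (sspace 0)) (ez p 0)" unfolding E by (rule schain_chm[OF schain_sid])
  moreover have "bdry (p + 0) (ez p 0) = chm (p - 1) (%y. (y, vertex0)) (bdry p (sid p))"
    using bdry_chm[OF schain_sid, of p "%y. (y, vertex0)"] by (simp add: E del: ez.simps)
  moreover have "cross (p - 1) 0 (bdry p (sid p)) (sid 0) = chm (p - 1) (%y. (y, restrict id (stdsimp 0) vertex0)) (bdry p (sid p))"
    using sbdry[OF schain_sid, of p] by (intro cross_0_right) simp
  moreover have "restrict id (stdsimp 0) vertex0 = vertex0" by simp
  moreover have "bdry 0 (sid 0) = 0" by (simp add: bdry_def)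
  ultimately show ?thesis unfolding ez_ok_def by simp
qed

lemma simplex_product_contraction:
  obtains H where "cmap (ptop (I01) (ptop (sspace p) (sspace q)))
       (ptop (sspace p) (sspace q)) H"
    "!!x. H (0, x) = x" "!!x. H (1, x) = (vertex0, vertex0)"
proof -
  define h :: "real => rvec => rvec" where "h = (%t x i. (1 - t) * x i + t * vertex0 i)"
  define H where "H = (%(t, x, y). (h t x, h t y))"
  have hm: "h t x \<in> stdsimp r" if "t \<in> {0..1}" "x \<in> stdsimp r" for t x r
    using convex_standard_simplex[of x r vertex0 t] that by (simp add: h_def)
  have c: "cmap Z (sspace r) (%z. h (f z) (g z))"
    if f: "cmap Z (I01) f" and g: "cmap Z (sspace r) g" for Z f g r
  proof -
    have "cmap Z Rtop f" using f by (simp add: cont_in_subtop)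
    moreover have "cmap Z (powertop_real UNIV) g" using g by (simp add: cont_in_subtop)
    then have "cmap Z Rtop (%z. g z i)" for i by (simp add: continuous_map_componentwise_UNIV)
    ultimately have "cmap Z (powertop_real UNIV) (%z. h (f z) (g z))"
      unfolding continuous_map_componentwise_UNIV h_def by (intro continuous_intros allI)
    moreover have "h (f z) (g z) \<in> stdsimp r" if "z \<in> tops Z" for z
      using hm[of "f z" "g z" r] cont_fun[OF f] cont_fun[OF g] that by (auto simp: Pi_iff)
    ultimately show ?thesis by (auto simp: cont_in_subtop)
  qed
  show thesis
  proof
    show "cmap (ptop (I01) (ptop (sspace p) (sspace q)))
       (ptop (sspace p) (sspace q)) H" unfolding H_def case_prod_unfold
      by (intro cont_pairedI c cont_fst cm_fst[OF cont_snd] cm_snd[OF cont_snd])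
  qed (auto simp: H_def h_def)
qed

lemma ez_ok_all: "ez_ok p q"
proof (induction "p + q" arbitrary: p q rule: less_induct)
  case (less p' q')
  show ?case
  proof (cases "p' = 0 | q' = 0")
    case True
    then show ?thesis using ez_ok_0_left[of q'] ez_ok_0_right[of p'] by (elim disjE) simp_all
  next
    case False
    then obtain p q where pq: "p' = Suc p" "q' = Suc q" by (cases p'; cases q') auto
    let ?P = "ptop (sspace (Suc p)) (sspace (Suc q))"
    let ?i = "sid (Suc p)" and ?j = "sid (Suc q)"
    let ?di = "bdry (Suc p) ?i" and ?dj = "bdry (Suc q) ?j"
    let ?z = "cross p (Suc q) ?di ?j + scal ((-1) ^ Suc p) (cross (Suc p) q ?i ?dj)"
    have ok: "ez_ok r s" if "r + s \<le> Suc (p + q)" for r s using less[of r s] that pq by simp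
    have i: "schain (Suc p) (sspace (Suc p)) ?i" "schain (Suc q) (sspace (Suc q)) ?j" by (rule schain_sid)+
    then have di: "schain p (sspace (Suc p)) ?di" "schain q (sspace (Suc q)) ?dj" by (auto intro: singular_chain_boundary_alt)
    have E: "schain (r + s) (ptop (sspace r) (sspace s)) (ez r s)"
      if "r + s \<le> Suc (p + q)" for r s using ok[OF that] by (simp add: ez_ok_def)
    have c1: "schain (p + Suc q) ?P (cross p (Suc q) ?di ?j)" unfolding cross_def by (rule schain_crossw[OF E di(1) i(2)]) simp
    have c2: "schain (Suc p + q) ?P (cross (Suc p) q ?i ?dj)" unfolding cross_def by (rule schain_crossw[OF E i(1) di(2)]) simp
    have z: "schain (Suc (p + q)) ?P ?z" using c1 c2 by (intro singular_chain_add schain_cmul) auto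
    have dd: "bdry p ?di = 0" "bdry q ?dj = 0" using i chain_boundary_boundary_alt by blast+
    have "bdry (p + Suc q) (cross p (Suc q) ?di ?j) =
        scal ((-1) ^ p) (cross p q ?di ?dj)"
      by (subst cross_Leibniz_ez[OF ok ok ok di(1) i(2)]) (auto simp: dd cross_def simp del: ez.simps)
    moreover have "bdry (Suc p + q) (cross (Suc p) q ?i ?dj) = cross p q ?di ?dj"
      by (subst cross_Leibniz_ez[OF ok ok ok i(1) di(2)]) (auto simp: dd cross_def simp del: ez.simps)
    moreover have "scal ((-1) ^ p) x + scal ((-1) ^ Suc p) x = 0" for x :: "(rvec \<times> rvec) chain"
      using frag_cmul_distrib[of "(-1) ^ p" "- ((-1) ^ p)" x] by simp
    ultimately have "bdry (Suc (p + q)) ?z = 0" by (simp only: chain_boundary_add bdry_cmul add_Suc add_Suc_right)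
    then have "relcycle (Suc (p + q)) ?P {} ?z" using z by (simp add: scycle)
    moreover obtain H where H: "cmap (ptop (I01) ?P) ?P H"
      "!!x. H (0, x) = x" "!!x. H (1, x) = (vertex0, vertex0)" using simplex_product_contraction by blast
    moreover have "(vertex0, vertex0) \<in> tops ?P" by simp
    ultimately have "relbdry (Suc (p + q)) ?P {} ?z" by (intro boundary_of_contraction[of _ _ _ H "(vertex0, vertex0)"]) auto
    then have "\<exists>c. schain (Suc p + Suc q) ?P c & bdry (Suc p + Suc q) c = ?z" unfolding singular_boundary by simp
    from someI_ex[OF this] show ?thesis unfolding ez_ok_def pq cross_def by simp
  qed
qed

lemma schain_ez: "schain (p + q) (ptop (sspace p) (sspace q)) (ez p q)" using ez_ok_all[of p q] by (simp add: ez_ok_def)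

lemma cross_Leibniz:
  assumes "schain p X a" "schain q Y b"
  shows "bdry (p + q) (cross p q a b) =
     cross (p - 1) q (bdry p a) b + scal ((-1) ^ p) (cross p (q - 1) a (bdry q b))" using assms by (intro cross_Leibniz_ez ez_ok_all)

lemma schain_cross:
  "schain p X a ==> schain q Y b ==>
    schain (p + q) (ptop X Y) (cross p q a b)" unfolding cross_def by (rule schain_crossw[OF schain_ez])

lemma cross_natural:
  "cross p q (chm p \<phi> a) (chm q \<psi> b) = chm (p + q) (map_prod \<phi> \<psi>) (cross p q a b)"
  unfolding cross_def by (rule crossw_natural[OF schain_ez])

lemma cross_minus [simp]: "cross p q (- a) b = - cross p q a b" "cross p q a (- b) = - cross p q a b"
  using crossw_diff_left[of "ez p q" p q 0 a b] crossw_diff_right[of "ez p q" p q a 0 b] by (simp_all add: cross_def)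

lemmas cross_add_left = crossw_add_left[of "ez p q" p q for p q, folded cross_def]
lemmas cross_add_right = crossw_add_right[of "ez p q" p q for p q, folded cross_def]
lemmas cross_diff_left = crossw_diff_left[of "ez p q" p q for p q, folded cross_def]
lemmas cross_diff_right = crossw_diff_right[of "ez p q" p q for p q, folded cross_def]
lemmas cross_cmul_left = crossw_cmul_left[of "ez p q" p q for p q, folded cross_def]
lemmas cross_cmul_right = crossw_cmul_right[of "ez p q" p q for p q, folded cross_def]

lemma schain_csub:
  assumes a: "schain p (subtop X A) a" and b: "schain q (subtop Y B) b"
    and AB: "A \<times> B \<subseteq> C"
  shows "schain (p + q) (subtop (ptop X Y) C) (cross p q a b)" using schain_cross[OF a b] singular_chain_mono[OF _ AB]
  by (auto simp: subtopology_Times)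

definition csub :: "'a set => 'b set => ('a \<times> 'b) set" where
  "csub S T = {(x, y). x \<in> S | y \<in> T}"

lemma chain_csub_left:
  assumes "schain p (subtop X S) a" "schain q Y b"
  shows "schain (p + q) (subtop (ptop X Y) (csub S T)) (cross p q a b)" using assms schain_csub[of p X S a q Y UNIV b "csub S T"]
  by (auto simp: csub_def)

lemma chain_csub_right:
  assumes "schain p X a" "schain q (subtop Y T) b"
  shows "schain (p + q) (subtop (ptop X Y) (csub S T)) (cross p q a b)" using assms schain_csub[of p X UNIV a q Y T b "csub S T"]
  by (auto simp: csub_def)

lemma chain_cross_bd_left:
  assumes "relcycle p X S a" "schain q Y b"
  shows "schain (p + q - 1) (subtop (ptop X Y) (csub S T))
    (cross (p - 1) q (bdry p a) b)"
proof (cases "p = 0")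
  case False
  then have eq: "p + q - 1 = p - 1 + q" by simp
  show ?thesis unfolding eq using assms chain_csub_left by (auto simp: relcycle)
qed (simp add: bdry_def)

lemma chain_cross_bd_right:
  assumes "schain p X a" "relcycle q Y T b"
  shows "schain (p + q - 1) (subtop (ptop X Y) (csub S T))
    (cross p (q - 1) a (bdry q b))"
proof (cases "q = 0")
  case False
  then have eq: "p + q - 1 = p + (q - 1)" by simp
  show ?thesis unfolding eq using assms chain_csub_right by (auto simp: relcycle)
qed (simp add: bdry_def)

lemma relcycle_cross:
  assumes a: "relcycle p X S a" and b: "relcycle q Y T b"
  shows "relcycle (p + q) (ptop X Y) (csub S T) (cross p q a b)"
proof -
  have sa: "schain p X a" and sb: "schain q Y b" using a b by (auto simp: relcycle)
  show ?thesis unfolding relcycle cross_Leibniz[OF sa sb] using chain_cross_bd_left[OF a sb] chain_cross_bd_right[OF sa b]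
    by (auto intro: schain_cross[OF sa sb] singular_chain_add schain_cmul)
qed

lemma rnull_cross_left:
  assumes a: "rnull p X S a" and b: "relcycle q Y T b"
  shows "rnull (p + q) (ptop X Y) (csub S T) (cross p q a b)"
proof -
  obtain m d e where *: "m ~= 0" "schain (Suc p) X d"
     "schain p (subtop X S) e" "scal m a = bdry (Suc p) d + e" using a by (auto simp: rnull_iff)
  have sb: "schain q Y b" using b by (auto simp: relcycle)
  let ?P = "ptop X Y" and ?C = "csub S T"
  have "bdry (Suc p + q) (cross (Suc p) q d b) =
     cross p q (bdry (Suc p) d) b + scal ((-1) ^ Suc p) (cross (Suc p) (q - 1) d (bdry q b))" using cross_Leibniz[OF *(2) sb] by simp
  moreover have "rnull (p + q) ?P ?C (bdry (Suc p + q) (cross (Suc p) q d b))"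
    using rnull_boundary[of "p + q" ?P "cross (Suc p) q d b" ?C] schain_cross[OF *(2) sb] by simp
  moreover have "rnull (p + q) ?P ?C (cross (Suc p) (q - 1) d (bdry q b))" using chain_cross_bd_right[OF *(2) b] by (intro rnull_chain) simp
  ultimately have "rnull (p + q) ?P ?C (cross p q (bdry (Suc p) d) b)"
    using rnull_diff[OF _ rnull_cmul[of "p + q" ?P ?C _ "(-1) ^ Suc p"]] by fastforce
  moreover have "rnull (p + q) ?P ?C (cross p q e b)" by (rule rnull_chain[OF chain_csub_left[OF *(3) sb]])
  ultimately have "rnull (p + q) ?P ?C (cross p q (scal m a) b)" unfolding *(4) cross_add_left by (rule rnull_add)
  then show ?thesis unfolding cross_cmul_left using *(1) by (rule rnull_cancel)
qed

lemma rnull_cross_right: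
  assumes a: "relcycle p X S a" and b: "rnull q Y T b"
  shows "rnull (p + q) (ptop X Y) (csub S T) (cross p q a b)"
proof -
  obtain m d e where *: "m ~= 0" "schain (Suc q) Y d"
     "schain q (subtop Y T) e" "scal m b = bdry (Suc q) d + e" using b by (auto simp: rnull_iff)
  have sa: "schain p X a" using a by (auto simp: relcycle)
  let ?P = "ptop X Y" and ?C = "csub S T"
  have "bdry (p + Suc q) (cross p (Suc q) a d) =
     cross (p - 1) (Suc q) (bdry p a) d + scal ((-1) ^ p) (cross p q a (bdry (Suc q) d))" using cross_Leibniz[OF sa *(2)] by simp
  moreover have "rnull (p + q) ?P ?C (bdry (p + Suc q) (cross p (Suc q) a d))"
    using rnull_boundary[of "p + q" ?P "cross p (Suc q) a d" ?C] schain_cross[OF sa *(2)] by simp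
  moreover have "rnull (p + q) ?P ?C (cross (p - 1) (Suc q) (bdry p a) d)" using chain_cross_bd_left[OF a *(2)] by (intro rnull_chain) simp
  ultimately have "rnull (p + q) ?P ?C (scal ((-1) ^ p) (cross p q a (bdry (Suc q) d)))" using rnull_diff by fastforce
  then have "rnull (p + q) ?P ?C (cross p q a (bdry (Suc q) d))" by (rule rnull_cancel) simp
  moreover have "rnull (p + q) ?P ?C (cross p q a e)" by (rule rnull_chain[OF chain_csub_right[OF sa *(3)]])
  ultimately have "rnull (p + q) ?P ?C (cross p q a (scal m b))" unfolding *(4) cross_add_right by (rule rnull_add)
  then show ?thesis unfolding cross_cmul_right using *(1) by (rule rnull_cancel)
qed

section \<open>A Thom isomorphism for trivial bundles\<close>

abbreviation zv :: "nat => real" where "zv == (%i. 0)"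

abbreviation nz :: "rvec set" where "nz == {u. u ~= zv}"

lemma mem_csub_empty [simp]: "z \<in> csub {} T \<longleftrightarrow> snd z \<in> T" by (auto simp: csub_def)

lemma cont_EuclideanI:
  assumes "!!i. i < n ==> cmap Z Rtop (%z. f z i)"
    and "!!z i. z \<in> tops Z ==> n \<le> i ==> f z i = 0"
  shows "cmap Z (Euc n) f"
proof -
  have "cmap Z Rtop (%z. f z i)" for i
  proof (cases "i < n")
    case False
    then have "cmap Z Rtop (%z. 0)" "!!z. z \<in> tops Z ==> 0 = f z i" using assms(2) by auto
    then show ?thesis by (rule continuous_map_eq)
  qed (rule assms)
  then show ?thesis using assms(2) by (auto simp: Euclidean_space_def cont_in_subtop continuous_map_componentwise_UNIV)
qed

lemma cont_EuclideanD:
  "cmap Z (Euc n) f ==> cmap Z Rtop (%z. f z i)" by (auto simp: Euclidean_space_def cont_in_subtop continuous_map_componentwise_UNIV)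

lemma cont_01D:
  "cmap Z (I01) f ==> cmap Z Rtop f" by (simp add: cont_in_subtop)

lemma nz_index:
  assumes "x \<in> tops (Euc n)" "x ~= zv"
  shows "\<exists>i<n. x i ~= 0"
proof -
  obtain i where "x i ~= 0" using assms(2) by auto
  moreover have "i < n" using assms(1) calculation by (auto simp: top_Euc intro: leI)
  ultimately show ?thesis by blast
qed

definition noray :: "nat => rvec set" where
  "noray n = {x. (\<exists>i<n. x i ~= 0) | x n < 0}"

lemma noray_nz: "noray n \<subseteq> nz" by (auto simp: noray_def)

lemma noray_relboundary:
  assumes c: "relcycle p (ptop Y (Euc (Suc n))) (csub {} (noray n)) c"
  shows "relbdry p (ptop Y (Euc (Suc n))) (csub {} (noray n)) c"
proof (rule relboundary_deform[OF c])
  let ?E = "Euc (Suc n)"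
  let ?H = "%z. (fst (snd z), (snd (snd z))(n := snd (snd z) n - 2 * fst z * (1 + \<bar>snd (snd z) n\<bar>)))"
  let ?Z = "ptop (I01) (ptop Y ?E)"
  have 1: "cmap ?Z ?E (%z. snd (snd z))" "cmap ?Z Y (%z. fst (snd z))"
    "cmap ?Z Rtop fst" by (auto intro!: cm_fst[OF cont_snd] cm_snd[OF cont_snd] cont_01D cont_fst)
  have 2: "cmap ?Z Rtop (%z. snd (snd z) i)" for i using cont_EuclideanD[OF 1(1)] .
  have "cmap ?Z ?E (%z. (snd (snd z))(n := snd (snd z) n - 2 * fst z * (1 + \<bar>snd (snd z) n\<bar>)))" by (rule cont_EuclideanI)
      (auto simp: fun_upd_def top_Euc intro!: continuous_intros 1 2)
  then show "cmap ?Z (ptop Y ?E) ?H" by (intro cont_pairedI 1)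
  show "?H (t, x) \<in> csub {} (noray n)" if "0 \<le> t" "t \<le> 1" "x \<in> csub {} (noray n)" for t x
    using that by (auto simp: csub_def noray_def intro: less_le_trans[of _ 0] order.strict_trans1[of _ "snd x n"])
  show "?H (1, x) \<in> csub {} (noray n)" for x by (auto simp: csub_def noray_def)
qed auto

lemma noray_relboundary_single:
  assumes c: "relcycle p (Euc (Suc n)) (noray n) c"
  shows "relbdry p (Euc (Suc n)) (noray n) c"
proof -
  let ?P = "ptop (Euc 0) (Euc (Suc n))"
  have "cmap (Euc (Suc n)) ?P (%x. (zv, x))" by (auto intro!: continuous_intros simp: top_Euc)
  then have "relcycle p ?P (csub {} (noray n)) (chm p (%x. (zv, x)) c)" by (rule relcycle_chm[OF c]) (auto simp: csub_def)
  then have "relbdry p (Euc (Suc n)) (noray n) (chm p snd (chm p (%x. (zv, x)) c))"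
    by (rule relbdry_chm[OF noray_relboundary cont_snd]) (auto simp: csub_def)
  moreover have "chm p snd (chm p (%x. (zv, x)) c) = c" unfolding chm_comp
    using c by (intro chm_id_gen[of p "Euc (Suc n)"]) (auto simp: relcycle)
  ultimately show ?thesis by simp
qed

fun thom :: "nat => rvec chain" where
  "thom 0 = frag_of (restrict (%x. zv) (stdsimp 0))"
| "thom (Suc n) = (SOME b. schain (Suc n) (Euc (Suc n)) b &
      schain n (subtop (Euc (Suc n)) (noray n))
        (bdry (Suc n) b - chm n (%x. x(n := 1)) (thom n)))"

lemma cont_upd: "cmap (Euc n) (Euc (Suc n)) (%x. x(n := r))" by (rule cont_EuclideanI)
    (auto simp: fun_upd_def top_Euc intro!: continuous_intros cont_EuclideanD[OF cont_id, unfolded id_def])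

lemma thom_Suc_aux:
  assumes "relcycle n (Euc n) nz (thom n)"
  shows "schain (Suc n) (Euc (Suc n)) (thom (Suc n)) &
      schain n (subtop (Euc (Suc n)) (noray n))
        (bdry (Suc n) (thom (Suc n)) - chm n (%x. x(n := 1)) (thom n))"
proof -
  let ?E = "Euc (Suc n)"
  have "relcycle n (Euc n) (tops (Euc n) Int nz) (thom n)" using assms by (simp only: relcycle_restrict)
  then have "relcycle n ?E (noray n) (chm n (%x. x(n := 1)) (thom n))"
  proof (rule relcycle_chm[OF _ cont_upd])
    show "(%x. x(n := 1)) \<in> tops (Euc n) Int nz \<rightarrow> noray n"
    proof
      fix x assume x: "x \<in> tops (Euc n) Int nz"
      then obtain i where "i < n" "x i ~= 0" using nz_index[of x n] by auto
      then show "x(n := 1) \<in> noray n" by (auto simp: noray_def)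
    qed
  qed
  from noray_relboundary_single[OF this]
  obtain d e where "schain (Suc n) ?E d" "schain n (subtop ?E (noray n)) e"
    "bdry (Suc n) d = chm n (%x. x(n := 1)) (thom n) + e" by (auto simp: singular_relboundary_alt)
  then have "\<exists>b. schain (Suc n) ?E b & schain n (subtop ?E (noray n))
        (bdry (Suc n) b - chm n (%x. x(n := 1)) (thom n))" by (intro exI[of _ d]) simp
  from someI_ex[OF this] show ?thesis by simp
qed

lemma relcycle_thom: "relcycle n (Euc n) nz (thom n)"
proof (induction n)
  case 0
  then show ?case by (auto simp: relcycle singular_chain_of ssimplex_def bdry_def top_Euc)
next
  case (Suc n)
  let ?E = "Euc (Suc n)"
  let ?j = "chm n (%x. x(n := 1)) (thom n)"
  have j: "schain n (subtop ?E nz) ?j"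
  proof (rule schain_chm)
    show "schain n (Euc n) (thom n)" using Suc by (simp add: relcycle)
    have "x(n := 1) ~= zv" for x :: "nat => real" by (metis fun_upd_same zero_neq_one)
    then show "cmap (Euc n) (subtop ?E nz) (%x. x(n := 1))" using cont_upd[of n 1] by (auto simp: cont_in_subtop)
  qed
  moreover have "schain n (subtop ?E nz) (bdry (Suc n) (thom (Suc n)) - ?j)"
    using thom_Suc_aux[OF Suc] singular_chain_mono[OF _ noray_nz] by blast
  ultimately have "schain n (subtop ?E nz) (bdry (Suc n) (thom (Suc n)))" using singular_chain_add by fastforce
  then show ?case using thom_Suc_aux[OF Suc] by (simp add: relcycle del: thom.simps)
qed

lemmas thom_Suc = thom_Suc_aux[OF relcycle_thom]

lemma schain_thom: "schain n (Euc n) (thom n)" using relcycle_thom[of n] by (simp add: relcycle)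

declare thom.simps(2) [simp del]

lemma relboundary_triple:
  assumes TS: "T \<subseteq> S"
    and XT: "!!c. relcycle (Suc r) X T c ==> relbdry (Suc r) X T c"
    and e: "schain (Suc r) X e"
    and bd: "relbdry r (subtop X S) T (bdry (Suc r) e)"
  shows "relbdry (Suc r) X S e"
proof -
  have ST: "subtop (subtop X S) T = subtop X T" using TS by (simp add: subtop_subtop inf.absorb2)
  obtain f g where f: "schain (Suc r) (subtop X S) f" and g: "schain r (subtop X T) g"
    and fg: "bdry (Suc r) f + g = bdry (Suc r) e" using bd by (auto simp: relbdry ST)
  have fX: "schain (Suc r) X f" using f by (simp add: singular_chain_subtopology)
  have "bdry (Suc r) (e - f) = g" using fg by (simp add: bdry_diff algebra_simps)
  then have "relcycle (Suc r) X T (e - f)" using e fX g by (simp add: relcycle schain_diff)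
  then obtain h k where h: "schain (Suc (Suc r)) X h" and k: "schain (Suc r) (subtop X T) k"
    and hk: "bdry (Suc (Suc r)) h + k = e - f" using XT[of "e - f"] unfolding relbdry by blast
  have "schain (Suc r) (subtop X S) (k + f)" using f singular_chain_mono[OF k TS] by (rule singular_chain_add[rotated])
  moreover have "bdry (Suc (Suc r)) h + (k + f) = e" using hk by (simp add: algebra_simps)
  ultimately show ?thesis using h unfolding relbdry by blast
qed

context
  fixes Y :: "'a topology" and n :: nat
begin

private abbreviation (input) "P == ptop Y (Euc (Suc n))"
private abbreviation (input) "P' == ptop Y (Euc n)"
private abbreviation (input) "X == subtop P (csub {} nz)"
private abbreviation (input) "A == {z. snd z n > 0}"
private abbreviation (input) "B == csub {} (noray n)"
private abbreviation (input) "pr == map_prod id (%x. x(n := 0))"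
private abbreviation (input) "j == map_prod id (%x. x(n := 1))"

lemma upper_half_aux:
  "openin X (tops X Int A)" "openin X (tops X Int B)" "tops X \<subseteq> (tops X Int A) Un (tops X Int B)"
  "cmap (subtop X (tops X Int A)) P' pr" "pr \<in> tops X Int A Int B \<rightarrow> csub {} nz"
  "cmap P' (subtop X (tops X Int A)) j" "j \<in> tops P' Int csub {} nz \<rightarrow> B"
proof -
  have snd: "cmap X (Euc (Suc n)) snd" by (intro cont_from_sub cont_snd)
  have si: "cmap X Rtop (%z. snd z i)" for i using cont_EuclideanD[OF snd] .
  have o: "openin X {z \<in> tops X. f z \<in> U}" if "cmap X Rtop f" "open U" for f and U :: "real set"
    using that openin_preim by fastforce
  have "tops X Int A = {z \<in> tops X. snd z n \<in> {0<..}}" by auto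
  then show "openin X (tops X Int A)" using o[OF si[of n], of "{0<..}"] by simp
  have eqB: "tops X Int B = {z \<in> tops X. snd z n \<in> {..<0}} Un (\<Union>i\<in>{..<n}. {z \<in> tops X. snd z i \<in> - {0}})"
    by (auto simp: csub_def noray_def)
  have "openin X {z \<in> tops X. snd z i \<in> - {0}}" for i by (rule o[OF si]) auto
  then have "openin X (\<Union>i\<in>{..<n}. {z \<in> tops X. snd z i \<in> - {0}})" by blast
  moreover have "openin X {z \<in> tops X. snd z n \<in> {..<0}}" by (rule o[OF si]) auto
  ultimately show "openin X (tops X Int B)" unfolding eqB by (intro openin_Un)
  show "tops X \<subseteq> (tops X Int A) Un (tops X Int B)"
  proof
    fix z assume z: "z \<in> tops X"
    then obtain i where "i \<le> n" "snd z i ~= 0" using nz_index[of "snd z" "Suc n"] by (auto simp: less_Suc_eq_le)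
    then show "z \<in> (tops X Int A) Un (tops X Int B)" using z by (cases "i = n") (auto simp: csub_def noray_def)
  qed
  have si: "cmap (Euc (Suc n)) Rtop (%x. x i)" for i using cont_EuclideanD[OF cont_id] by (simp add: id_def)
  have "cmap (Euc (Suc n)) (Euc n) (%x. x(n := 0))"
  proof (rule cont_EuclideanI)
    show "cmap (Euc (Suc n)) Rtop (%z. (z(n := 0)) i)" for i unfolding fun_upd_def by (intro continuous_intros si)
  qed (auto simp: top_Euc)
  then have "cmap P P' pr" by (intro cont_map_prod cont_id)
  then show "cmap (subtop X (tops X Int A)) P' pr" by (intro cont_from_sub)
  show "pr \<in> tops X Int A Int B \<rightarrow> csub {} nz"
  proof
    fix z assume "z \<in> tops X Int A Int B"
    then obtain i where "i < n" "snd z i ~= 0" by (auto simp: csub_def noray_def)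
    then have "snd (pr z) i ~= 0" by simp
    then show "pr z \<in> csub {} nz" by (auto simp del: snd_map_prod)
  qed
  have "cmap P' P j" by (intro cont_map_prod cont_id cont_upd)
  moreover have "j z \<in> A Int csub {} nz" for z :: "'a \<times> rvec"
  proof -
    have "((snd z)(n := 1)) n ~= zv n" by simp
    then have "(snd z)(n := 1) ~= zv" by metis
    then show ?thesis by simp
  qed
  ultimately have jX: "cmap P' X j" by (intro cont_subI) auto
  moreover have "j z \<in> tops X" if "z \<in> tops P'" for z using continuous_map_image_subset_topspace[OF jX] that by blast
  ultimately show "cmap P' (subtop X (tops X Int A)) j" by (intro cont_subI[OF jX]) auto
  show "j \<in> tops P' Int csub {} nz \<rightarrow> B"
  proof
    fix z assume z: "z \<in> tops P' Int csub {} nz"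
    then obtain i where "i < n" "snd z i ~= 0" using nz_index[of "snd z" n] by auto
    then show "j z \<in> B" by (auto simp: noray_def)
  qed
qed

lemma upper_half_homotopy:
  assumes c: "relcycle r (subtop X (tops X Int A)) B c"
  shows "homrel r X B c (chm r j (chm r pr c))"
proof -
  let ?U = "subtop X (tops X Int A)"
  let ?Z = "ptop (I01) ?U"
  let ?H = "%z. (fst (snd z), (snd (snd z))(n := (1 - fst z) * snd (snd z) n + fst z))"
  have U: "cmap ?U P id" by (simp add: cont_from_sub)
  have "cmap ?Z P (%z. snd z)" using cont_comp[OF cont_snd U] by (simp add: o_def)
  then have 1: "cmap ?Z (Euc (Suc n)) (%z. snd (snd z))" "cmap ?Z Y (%z. fst (snd z))" by (auto intro: cm_fst cm_snd)
  have 0: "cmap ?Z Rtop fst" by (auto intro!: cont_01D cont_fst)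
  have 2: "cmap ?Z Rtop (%z. snd (snd z) i)" for i using cont_EuclideanD[OF 1(1)] .
  have "cmap ?Z (Euc (Suc n)) (%z. (snd (snd z))(n := (1 - fst z) * snd (snd z) n + fst z))"
  proof (rule cont_EuclideanI)
    show "cmap ?Z Rtop (%z. ((snd (snd z))(n := (1 - fst z) * snd (snd z) n + fst z)) i)" for i
      unfolding fun_upd_def by (intro continuous_intros 0 2)
  qed (auto simp: top_Euc)
  then have "cmap ?Z P ?H" by (intro cont_pairedI 1)
  moreover have "?H z \<in> csub {} nz" if "z \<in> tops ?Z" for z :: "real \<times> 'a \<times> rvec"
  proof -
    have z: "0 \<le> fst z" "fst z \<le> 1" "snd (snd z) n > 0" using that by (auto simp: csub_def)
    have "(1 - fst z) * snd (snd z) n + fst z > 0" using z by (cases "fst z = 0") (auto intro: add_nonneg_pos)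
    then show ?thesis by (auto simp: csub_def fun_eq_iff)
  qed
  ultimately have H: "cmap ?Z X ?H" by (auto simp: cont_in_subtop)
  have HV: "?H (t, x) \<in> B" if "0 \<le> t" "t \<le> 1" "x \<in> tops ?U" "x \<in> B" for t x
    using that by (auto simp: csub_def noray_def)
  have "chm r j (chm r pr c) = chm r (%x. ?H (1, x)) c" by (simp add: chm_comp map_prod_def case_prod_unfold)
  moreover have "chm r (%x. ?H (0, x)) c = c" using c by (intro chm_id_gen[of r ?U]) (auto simp: relcycle)
  ultimately show ?thesis using homol_homotopy[OF c H HV] by (simp del: fun_upd_apply)
qed

end

lemma thom_surj:
  assumes "relcycle q (ptop Y (Euc n)) (csub {} nz) c"
  obtains y where "relcycle (q - n) Y {} y" "q < n ==> y = 0"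
    "homrel q (ptop Y (Euc n)) (csub {} nz) c (cross (q - n) n y (thom n))" using assms
proof (induction n arbitrary: q c thesis)
  case 0
  let ?P = "ptop Y (Euc 0)"
  let ?y = "chm q fst c"
  have top: "tops (Euc 0) = {zv}" by (auto simp: top_Euc)
  then have "tops ?P Int csub {} nz = {}" by auto
  then have c: "relcycle q ?P {} c" using 0(2) relcycle_restrict[of q ?P "csub {} nz"] by simp
  then have sc: "schain q ?P c" by (simp add: relcycle)
  have y: "relcycle q Y {} ?y" by (rule relcycle_chm[OF c cont_fst]) simp
  have "cross q 0 ?y (thom 0) = chm q (%x. (x, zv)) ?y"
    using cross_0_right[of q Y ?y "restrict (%x. zv) (stdsimp 0)"] y by (simp add: relcycle)
  also have "\<dots> = c" unfolding chm_comp by (rule chm_id_gen[OF sc]) (auto simp: top)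
  finally show ?case using 0(1)[of ?y] y by simp
next
  case (Suc n)
  let ?E = "Euc (Suc n)"
  let ?P = "ptop Y ?E"
  let ?P' = "ptop Y (Euc n)"
  let ?X = "subtop ?P (csub {} nz)"
  let ?B = "csub {} (noray n) :: ('a \<times> rvec) set"
  let ?A = "tops ?X Int {z. snd z n > 0}"
  let ?pr = "map_prod id (%x. x(n := 0)) :: 'a \<times> rvec => _"
  let ?j = "map_prod id (%x. x(n := 1)) :: 'a \<times> rvec => _"
  have BS: "?B \<subseteq> csub {} nz" using noray_nz by fastforce
  have sc: "schain q ?P c" using Suc(3) by (simp add: relcycle)
  show ?case
  proof (cases q)
    case 0
    have "relcycle 0 ?P ?B c" using sc 0 by (simp add: relcycle bdry_def)
    then have "relbdry 0 ?P ?B c" by (rule noray_relboundary)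
    then have "relbdry 0 ?P (csub {} nz) c" using singular_chain_mono[OF _ BS] unfolding relbdry by blast
    then show ?thesis using Suc(2)[of 0] 0 by (simp add: homrel_def)
  next
    case (Suc r)
    let ?b = "bdry (Suc r) c"
    have b: "relcycle r ?X {} ?b" using Suc.prems(2) Suc chain_boundary_boundary_alt[of r ?P c] by (simp add: relcycle)
    then have bB: "relcycle r ?X (tops ?X Int ?B) ?b" by (rule relcycle_of_cycle)
    note u = upper_half_aux[where Y = Y and n = n]
    obtain c1 where c1: "relcycle r (subtop ?X ?A) (tops ?X Int ?B) c1"
       "homrel r ?X (tops ?X Int ?B) ?b c1" using excision_surj[OF u(1-3) bB] .
    have c1B: "relcycle r (subtop ?X ?A) ?B c1"
    proof -
      have eq: "tops (subtop ?X ?A) Int (tops ?X Int ?B) = tops (subtop ?X ?A) Int ?B" by auto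
      show ?thesis using c1(1) unfolding relcycle_cong[OF eq] .
    qed
    have "relcycle r ?P' (csub {} nz) (chm r ?pr c1)"
    proof (rule relcycle_chm[OF _ u(4)])
      show "relcycle r (subtop ?X ?A) (?A Int ?B) c1" using c1B relcycle_restrict[of r "subtop ?X ?A" ?B] by simp
    qed (use u(5) in auto)
    then obtain y where y: "relcycle (r - n) Y {} y" "r < n ==> y = 0"
      "homrel r ?P' (csub {} nz) (chm r ?pr c1) (cross (r - n) n y (thom n))" using Suc.IH by blast
    let ?d = "cross (r - n) n y (bdry (Suc n) (thom (Suc n)))"
    have yc: "schain (r - n) Y y" using y(1) by (simp add: relcycle)
    have jX: "cmap ?P' ?X ?j" using u(6) by (simp add: cont_in_subtop)
    have "homrel r ?X ?B (chm r ?j (chm r ?pr c1)) (chm r ?j (cross (r - n) n y (thom n)))" using relbdry_chm[OF y(3)[unfolded homrel_def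
          relbdry_restrict[of r ?P' "csub {} nz", symmetric]] jX u(7)] by (simp add: homrel_def chm_diff)
    moreover have "homrel r ?X ?B c1 (chm r ?j (chm r ?pr c1))" by (rule upper_half_homotopy[OF c1B])
    moreover have "homrel r ?X ?B ?b c1" using c1(2) unfolding homologous_rel_restrict .
    ultimately have 1: "homrel r ?X ?B ?b (chm r ?j (cross (r - n) n y (thom n)))" using homologous_rel_trans by blast
    have 2: "homrel r ?X ?B (chm r ?j (cross (r - n) n y (thom n))) ?d"
    proof (cases "r < n")
      case False
      then have r: "r - n + n = r" by simp
      have "schain n (subtop ?E (noray n)) (chm n (%x. x(n := 1)) (thom n) - bdry (Suc n) (thom (Suc n)))"
        using thom_Suc[of n] singular_chain_minus by fastforce
      then have "schain (r - n + n) (subtop ?P ?B) (cross (r - n) n y (chm n (%x. x(n := 1)) (thom n) - bdry (Suc n) (thom (Suc n))))"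
        by (rule chain_csub_right[OF yc])
      moreover have "cross (r - n) n y (chm n (%x. x(n := 1)) (thom n)) = chm r ?j (cross (r - n) n y (thom n))"
        using cross_natural[of "r - n" n id y "%x. x(n := 1)" "thom n"] chm_ident[OF yc] r by simp
      ultimately have "schain r (subtop ?P ?B) (chm r ?j (cross (r - n) n y (thom n)) - ?d)" using r by (simp add: cross_diff_right)
      then have "schain r (subtop ?X ?B) (chm r ?j (cross (r - n) n y (thom n)) - ?d)" using BS by (simp add: subtop_subtop inf.absorb2)
      then show ?thesis unfolding homrel_def by (rule singular_chain_imp_relboundary)
    qed (simp add: y(2))
    let ?y = "scal ((-1) ^ (r - n)) y"
    let ?e = "c - cross (r - n) (Suc n) ?y (thom (Suc n))"
    have sq: "scal ((-1) ^ k) (scal ((-1) ^ k) z) = z" for k and z :: "('a \<times> rvec) chain" by (simp flip: power_add mult_2)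
    have th: "schain (Suc n) ?E (thom (Suc n))" by (rule schain_thom)
    have e: "schain (Suc r) ?P ?e & bdry (Suc r) ?e = ?b - ?d"
    proof (cases "r < n")
      case False
      then have r: "r - n + Suc n = Suc r" by simp
      have "bdry (r - n + Suc n) (cross (r - n) (Suc n) y (thom (Suc n))) = scal ((-1) ^ (r - n)) ?d"
        using cross_Leibniz[OF yc th] bdry_cycle[OF y(1)] by simp
      then have "bdry (Suc r) (cross (r - n) (Suc n) ?y (thom (Suc n))) = ?d" by (simp only: r cross_cmul_left bdry_cmul sq)
      moreover have "schain (Suc r) ?P (cross (r - n) (Suc n) ?y (thom (Suc n)))" using schain_cross[OF schain_cmul[OF yc] th] r by metis
      ultimately show ?thesis using sc Suc by (simp add: schain_diff bdry_diff)
    qed (use sc Suc in \<open>simp add: y(2)\<close>)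
    have "homrel r ?X ?B ?b ?d" using 1 2 homologous_rel_trans by blast
    then have "relbdry r ?X ?B (bdry (Suc r) ?e)" using e by (simp add: homrel_def)
    then have "relbdry (Suc r) ?P (csub {} nz) ?e" using e by (intro relboundary_triple[OF BS noray_relboundary]) auto
    then show ?thesis using Suc.prems(1)[of ?y] Suc y(1,2) by (simp add: homrel_def relcycle_cmul)
  qed
qed

lemma thom_inj_aux:
  assumes "relcycle p Y {} y"
    and "relbdry (p + n) (ptop Y (Euc n)) (csub {} nz) (cross p n y (thom n))"
  shows "relbdry p Y {} y" using assms(2)
proof (induction n)
  case 0
  let ?P = "ptop Y (Euc 0)"
  have y: "schain p Y y" using assms(1) by (simp add: relcycle)
  have top: "tops (Euc 0) = {zv}" by (auto simp: top_Euc)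
  then have "tops ?P Int csub {} nz = {}" by auto
  then have "relbdry p ?P {} (cross p 0 y (thom 0))" using 0 relbdry_restrict[of p ?P "csub {} nz"] by simp
  then have "relbdry p Y {} (chm p fst (cross p 0 y (thom 0)))" by (rule relbdry_chm[OF _ cont_fst]) simp
  moreover have "chm p fst (cross p 0 y (thom 0)) = y" using cross_0_right[OF y, of "restrict (%x. zv) (stdsimp 0)"] chm_ident[OF y]
    by (simp add: chm_comp id_def)
  ultimately show ?case by simp
next
  case (Suc n)
  let ?E = "Euc (Suc n)"
  let ?P = "ptop Y ?E"
  let ?P' = "ptop Y (Euc n)"
  let ?X = "subtop ?P (csub {} nz)"
  let ?B = "csub {} (noray n) :: ('a \<times> rvec) set"
  let ?A = "tops ?X Int {z. snd z n > 0}"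
  let ?pr = "map_prod id (%x. x(n := 0)) :: 'a \<times> rvec => _"
  let ?j = "map_prod id (%x. x(n := 1)) :: 'a \<times> rvec => _"
  let ?r = "p + n"
  let ?jy = "chm ?r ?j (cross p n y (thom n))"
  have y: "schain p Y y" using assms(1) by (simp add: relcycle)
  have BS: "?B \<subseteq> csub {} nz" using noray_nz by fastforce
  note u = upper_half_aux[where Y = Y and n = n]
  have th: "schain (Suc n) ?E (thom (Suc n))" by (rule schain_thom)
  let ?d = "cross p n y (bdry (Suc n) (thom (Suc n)))"
  obtain f g where f: "schain (Suc (Suc ?r)) ?P f" and g: "schain (Suc ?r) ?X g"
    and fg: "bdry (Suc (Suc ?r)) f + g = cross p (Suc n) y (thom (Suc n))" using Suc.prems by (auto simp: relbdry)
  have "bdry (Suc ?r) g = bdry (Suc ?r) (cross p (Suc n) y (thom (Suc n)))"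
    using chain_boundary_boundary_alt[OF f] by (simp add: chain_boundary_add flip: fg)
  also have "\<dots> = scal ((-1) ^ p) ?d" using cross_Leibniz[OF y th] bdry_cycle[OF assms(1)] by simp
  finally have "relbdry ?r ?X {} (scal ((-1) ^ p) ?d)" using g singular_boundary by metis
  from singular_relboundary_cmul[OF this, of "(-1) ^ p"]
  have d0: "relbdry ?r ?X {} ?d" by (simp flip: power_add mult_2)
  have d: "relbdry ?r ?X ?B ?d"
  proof -
    obtain f where "schain (Suc ?r) ?X f" "bdry (Suc ?r) f = ?d" using d0 by (auto simp: singular_boundary)
    then show ?thesis unfolding relbdry by (intro exI[of _ f] exI[of _ 0]) simp
  qed
  have "schain n (subtop ?E (noray n)) (chm n (%x. x(n := 1)) (thom n) - bdry (Suc n) (thom (Suc n)))"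
    using thom_Suc[of n] singular_chain_minus by fastforce
  then have "schain ?r (subtop ?P ?B) (cross p n y (chm n (%x. x(n := 1)) (thom n) - bdry (Suc n) (thom (Suc n))))"
    by (rule chain_csub_right[OF y])
  moreover have "cross p n y (chm n (%x. x(n := 1)) (thom n)) = ?jy"
    using cross_natural[of p n id y "%x. x(n := 1)" "thom n"] chm_ident[OF y] by simp
  ultimately have "schain ?r (subtop ?X ?B) (?jy - ?d)" using BS by (simp add: subtop_subtop inf.absorb2 cross_diff_right)
  then have "relbdry ?r ?X ?B (?jy - ?d)" by (rule singular_chain_imp_relboundary)
  from singular_relboundary_add[OF this d]
  have jy: "relbdry ?r ?X ?B ?jy" by simp
  have "relcycle ?r ?P' (csub {} nz) (cross p n y (thom n))" by (rule relcycle_cross[OF assms(1) relcycle_thom])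
  then have "relcycle ?r (subtop ?X ?A) ?B ?jy"
    using relcycle_chm[OF _ u(6) u(7), of ?r "cross p n y (thom n)"] relcycle_restrict[of ?r ?P' "csub {} nz"] by simp
  moreover have eq: "tops (subtop ?X ?A) Int (tops ?X Int ?B) = tops (subtop ?X ?A) Int ?B" by auto
  ultimately have "relcycle ?r (subtop ?X ?A) (tops ?X Int ?B) ?jy" unfolding relcycle_cong[OF eq] by blast
  moreover have "relbdry ?r ?X (tops ?X Int ?B) ?jy" using jy unfolding relbdry_restrict .
  ultimately have "relbdry ?r (subtop ?X ?A) (tops ?X Int ?B) ?jy" by (rule excision_inj[OF u(1-3)])
  moreover have "tops (subtop ?X ?A) Int (tops ?X Int ?B) = tops (subtop ?X ?A) Int (?A Int ?B)" by auto
  ultimately have "relbdry ?r (subtop ?X ?A) (?A Int ?B) ?jy" using relboundary_cong by blast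
  then have "relbdry ?r ?P' (csub {} nz) (chm ?r ?pr ?jy)" by (rule relbdry_chm[OF _ u(4,5)])
  moreover have "chm ?r ?pr ?jy = cross p n y (thom n)" unfolding chm_comp
  proof (rule chm_id_gen[OF schain_cross[OF y schain_thom]])
    show "?pr (?j x) = x" if "x \<in> tops ?P'" for x using that by (auto simp: top_Euc fun_eq_iff)
  qed
  ultimately show ?case using Suc.IH by simp
qed

lemma thom_inj:
  assumes "relcycle p Y {} y"
    and "rnull (p + n) (ptop Y (Euc n)) (csub {} nz) (cross p n y (thom n))"
  shows "rnull p Y {} y"
proof -
  obtain m where m: "m ~= 0"
    "relbdry (p + n) (ptop Y (Euc n)) (csub {} nz) (scal m (cross p n y (thom n)))" using assms(2) by (auto simp: rnull_def)
  then have "relbdry p Y {} (scal m y)" by (intro thom_inj_aux[OF relcycle_cmul[OF assms(1)], where n = n]) (simp only: cross_cmul_left)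
  then show ?thesis using m(1) by (auto simp: rnull_def)
qed

section \<open>Sphere classes\<close>

definition enorm :: "nat => rvec => real" where
  "enorm n u = (\<Sum>i<n. \<bar>u i\<bar>)"

lemma enorm_nonneg [simp]: "0 \<le> enorm n u" by (simp add: enorm_def sum_nonneg)

lemma enorm_zv [simp]: "enorm n zv = 0" by (simp add: enorm_def)

lemma enorm_pos_iff: "u \<in> tops (Euc n) ==> 0 < enorm n u \<longleftrightarrow> u ~= zv"
proof
  assume u: "u \<in> tops (Euc n)" and "u ~= zv"
  then obtain i where "i < n" "u i ~= 0" using nz_index by blast
  then have "0 < \<bar>u i\<bar>" "\<bar>u i\<bar> \<le> enorm n u" unfolding enorm_def by (auto intro!: member_le_sum)
  then show "0 < enorm n u" by linarith
qed (auto simp: enorm_def)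

lemma enorm_scale: "enorm n (%i. c * u i) = \<bar>c\<bar> * enorm n u" by (simp add: enorm_def abs_mult sum_distrib_left)

lemma enorm_minus: "enorm n (%i. - u i) = enorm n u" by (simp add: enorm_def)

lemma enorm_triangle: "enorm n (%i. u i + v i) \<le> enorm n u + enorm n v"
  unfolding enorm_def sum.distrib[symmetric] by (intro sum_mono abs_triangle_ineq)

lemma enorm_diff_ge: "enorm n u - enorm n v \<le> enorm n (%i. u i - v i)"
  unfolding enorm_def sum_subtractf[symmetric] by (intro sum_mono) linarith

lemma enorm_add_ge: "enorm n u - enorm n v \<le> enorm n (%i. u i + v i)"
  unfolding enorm_def sum_subtractf[symmetric] by (intro sum_mono) linarith

lemma cont_enorm [continuous_intros]:
  "cmap Z (Euc n) f ==> cmap Z Rtop (%z. enorm m (f z))" unfolding enorm_def by (intro continuous_intros cont_EuclideanD) auto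

lemma cont_scale [continuous_intros]:
  assumes "cmap Z Rtop c" "cmap Z (Euc n) f"
  shows "cmap Z (Euc n) (%z i. c z * f z i)"
proof (rule cont_EuclideanI)
  show "cmap Z Rtop (%z. c z * f z i)" for i by (intro continuous_intros assms(1) cont_EuclideanD[OF assms(2)])
  show "c z * f z i = 0" if "z \<in> tops Z" "n \<le> i" for z i
    using continuous_map_image_subset_topspace[OF assms(2)] that by (auto simp: top_Euc)
qed

lemma cont_uminus_Euclidean [continuous_intros]:
  "cmap Z (Euc n) f ==> cmap Z (Euc n) (%z i. - f z i)" using cont_scale[of Z "%z. -1" n f] by (simp add: cont_const)

definition sig :: "nat => rvec => rvec" where
  "sig n u = (%i. 1 / (1 + enorm n u) * u i)"

lemma enorm_add1_pos: "0 < 1 + enorm n u" "1 + enorm n u ~= 0" using enorm_nonneg[of n u] by linarith+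

lemma cont_sig [continuous_intros]:
  "cmap Z (Euc n) f ==> cmap Z (Euc n) (%z. sig n (f z))" unfolding sig_def by (intro continuous_intros) (auto simp: enorm_add1_pos)

lemma sig_zv [simp]: "sig n zv = zv" by (simp add: sig_def)

lemma enorm_sig: "enorm n (sig n u) = enorm n u / (1 + enorm n u)" unfolding sig_def enorm_scale using enorm_add1_pos(1)[of n u] by simp

lemma enorm_sig_less: "enorm n (sig n u) < 1" unfolding enorm_sig using enorm_add1_pos(1)[of n u] by (simp add: field_simps)

lemma sig_eq_zv_iff [simp]: "sig n u = zv \<longleftrightarrow> u = zv" using enorm_add1_pos(2)[of n u] by (auto simp: sig_def fun_eq_iff)

definition sph :: "nat => rvec chain" where
  "sph n = bdry n (thom n)"

abbreviation E0 :: "nat => rvec topology" where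
  "E0 n == subtop (Euc n) nz"

lemma cycle_sph: "relcycle k (E0 (Suc k)) {} (sph (Suc k))"
  using relcycle_thom[of "Suc k"] chain_boundary_boundary_alt[OF schain_thom[of "Suc k"]] by (simp add: scycle sph_def) (simp add: relcycle)

lemma schain_sph: "schain k (E0 (Suc k)) (sph (Suc k))" using cycle_sph by (simp add: scycle)

lemma cross_cycle:
  assumes "relcycle p X {} a" "relcycle q Y {} b"
  shows "relcycle (p + q) (ptop X Y) {} (cross p q a b)" using relcycle_cross[OF assms] by (simp add: csub_def)

lemma rnull_cross_left0:
  assumes "rnull p X {} a" "relcycle q Y {} b"
  shows "rnull (p + q) (ptop X Y) {} (cross p q a b)" using rnull_cross_left[OF assms] by (simp add: csub_def)

lemma rnull_cross_right0:
  assumes "relcycle p X {} a" "rnull q Y {} b"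
  shows "rnull (p + q) (ptop X Y) {} (cross p q a b)" using rnull_cross_right[OF assms] by (simp add: csub_def)

lemma boundary_cross_thom:
  assumes "relcycle p Y {} y"
  shows "bdry (Suc (p + k)) (cross p (Suc k) y (thom (Suc k))) = scal ((-1) ^ p) (cross p k y (sph (Suc k)))"
  using cross_Leibniz[OF _ schain_thom, of p Y y "Suc k"] bdry_cycle[OF assms(1)] assms(1) by (simp add: sph_def relcycle)

lemma prod_E0: "ptop (Y :: 'a topology) (E0 n) = subtop (ptop Y (Euc n)) (csub {} nz)"
proof -
  have "csub {} nz = (UNIV :: 'a set) \<times> nz" by (auto simp: csub_def)
  then show ?thesis using subtopology_Times[of Y "Euc n" UNIV nz] by simp
qed

lemma rnull_sph_extend:
  assumes y: "relcycle p Y {} y"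
    and F: "cmap (ptop Y (Euc (Suc k))) Z F"
  shows "rnull (p + k) Z {} (chm (p + k) F (cross p k y (sph (Suc k))))"
proof -
  let ?P = "ptop Y (Euc (Suc k))"
  have "schain (Suc (p + k)) ?P (cross p (Suc k) y (thom (Suc k)))"
    using schain_cross[OF _ schain_thom, of p Y y "Suc k"] y by (simp add: relcycle)
  from rnull_boundary[OF this, of "{}"]
  have "rnull (p + k) ?P {} (scal ((-1) ^ p) (cross p k y (sph (Suc k))))" using boundary_cross_thom[OF y] by simp
  then have "rnull (p + k) ?P {} (cross p k y (sph (Suc k)))" by (rule rnull_cancel) simp
  then show ?thesis by (rule rnull_chm[OF _ F]) simp
qed

lemma hq_straight_rel:
  assumes c: "relcycle p X S c"
    and f: "cmap X (ptop Z (Euc n)) f"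
    and g: "cmap X (ptop Z (Euc n)) g"
    and fg: "!!x. x \<in> tops X ==> fst (f x) = fst (g x)"
    and D: "!!s x. [|0 \<le> s; s \<le> 1; x \<in> tops X|] ==>
      (fst (f x), %i. (1 - s) * snd (f x) i + s * snd (g x) i) \<in> D"
    and V: "!!s x. [|0 \<le> s; s \<le> 1; x \<in> tops X; x \<in> S|] ==>
      (fst (f x), %i. (1 - s) * snd (f x) i + s * snd (g x) i) \<in> V"
  shows "hq p (subtop (ptop Z (Euc n)) D) V (chm p f c) (chm p g c)"
proof (rule hq_homotopy[OF c])
  let ?H = "%z. (fst (f (snd z)), %i. (1 - fst z) * snd (f (snd z)) i + fst z * snd (g (snd z)) i)"
  let ?I = "ptop (I01) X"
  have "cmap ?I (ptop Z (Euc n)) (%z. f (snd z))"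
    "cmap ?I (ptop Z (Euc n)) (%z. g (snd z))" using cont_comp[OF cont_snd f] cont_comp[OF cont_snd g] by (auto simp: o_def)
  then have "cmap ?I (ptop Z (Euc n)) ?H" by (intro cont_pairedI cont_Euc_add cont_scale cont_diff
       cont_01D[OF cont_fst] cm_fst cm_snd) (auto intro: cont_01D[OF cont_fst])
  then show "cmap ?I (subtop (ptop Z (Euc n)) D) ?H" using D by (intro cont_subI) auto
  show "!!t x. [|0 \<le> t; t \<le> 1; x \<in> tops X; x \<in> S|] ==> ?H (t, x) \<in> V" using V by simp
qed (use fg in \<open>auto simp: prod_eq_iff\<close>)

lemmas hq_straight = hq_straight_rel[where S = "{}" and V = "{}", simplified]

lemma hq_trans': "hq p X S a b ==> hq p X S b' b ==> hq p X S a b'" by (meson hq_sym hq_trans)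

lemma sphere_inj:
  assumes w: "relcycle p Z {} w"
    and null: "rnull (p + k) (ptop Z (E0 (Suc k))) {} (cross p k w (sph (Suc k)))"
  shows "rnull p Z {} w"
proof -
  let ?n = "Suc k"
  let ?P = "ptop Z (Euc ?n)"
  let ?S = "csub {} nz :: ('a \<times> rvec) set"
  let ?r = "p + k"
  have c: "schain (Suc ?r) ?P (cross p ?n w (thom ?n))" using schain_cross[OF _ schain_thom, of p Z w ?n] w by (simp add: relcycle)
  have "rnull ?r (subtop ?P ?S) {} (bdry (Suc ?r) (cross p ?n w (thom ?n)))"
    using boundary_cross_thom[OF w] null by (simp add: prod_E0 rnull_cmul)
  from relcycle_lift[OF c this] obtain m e where m: "m ~= 0" "schain (Suc ?r) (subtop ?P ?S) e"
    "relcycle (Suc ?r) ?P {} (scal m (cross p ?n w (thom ?n)) - e)" by blast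
  let ?z = "scal m (cross p ?n w (thom ?n)) - e"
  let ?e0 = "%i. if i = 0 then 1 else (0::real)"
  have cont: "cmap ?P ?P (%z. (fst z, ?e0))" by (intro cont_pairedI cont_fst) (auto simp: top_Euc)
  have "hq (Suc ?r) (subtop ?P UNIV) {} (chm (Suc ?r) (%z. z) ?z) (chm (Suc ?r) (%z. (fst z, ?e0)) ?z)"
    using cont by (intro hq_straight[OF m(3)]) auto
  then have 1: "hq (Suc ?r) ?P ?S ?z (chm (Suc ?r) (%z. (fst z, ?e0)) ?z)" using m(3) by (auto simp: chm_id_gen relcycle intro: rnull_mono)
  have "schain (Suc ?r) (subtop ?P ?S) (chm (Suc ?r) (%z. (fst z, ?e0)) ?z)" using m(3) cont by (intro schain_chm[of _ ?P] cont_subI)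
      (auto simp: relcycle fun_eq_iff)
  then have "rnull (Suc ?r) ?P ?S (chm (Suc ?r) (%z. (fst z, ?e0)) ?z)" by (rule rnull_chain)
  then have "rnull (Suc ?r) ?P ?S ?z" using 1 hq_rnull by blast
  then have "rnull (Suc ?r) ?P ?S (scal m (cross p ?n w (thom ?n)))" using rnull_add[OF _ rnull_chain[OF m(2)]] by fastforce
  then have "rnull (p + ?n) ?P ?S (cross p ?n w (thom ?n))" using rnull_cancel[OF _ m(1)] by simp
  then show ?thesis by (rule thom_inj[OF w])
qed

lemma thom_generates:
  assumes c: "relcycle n (Euc n) nz c"
  obtains b where "homrel n (Euc n) nz c (scal b (thom n))"
proof -
  let ?Y = "Euc 0" and ?E = "Euc n"
  let ?P = "ptop ?Y ?E"
  have top: "tops ?Y = {zv}" by (auto simp: top_Euc)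
  have "cmap ?E ?P (%x. (zv, x))" by (auto intro!: cont_pairedI simp: top)
  then have "relcycle n ?P (csub {} nz) (chm n (%x. (zv, x)) c)" by (rule relcycle_chm[OF c]) auto
  from thom_surj[OF this] obtain y where y: "relcycle 0 ?Y {} y"
    "homrel n ?P (csub {} nz) (chm n (%x. (zv, x)) c) (cross 0 n y (thom n))" by auto
  have "schain 0 ?Y y" using y(1) by (simp add: scycle)
  then obtain b where "y = scal b (frag_of (restrict (%x. zv) (stdsimp 0)))" using singular_chain_singleton[OF top] by blast
  then have "cross 0 n y (thom n) = scal b (chm n (%x. (zv, x)) (thom n))" by (simp add: cross_cmul_left cross_0_left[OF schain_thom])
  then have "relbdry n ?P (csub {} nz) (chm n (%x. (zv, x)) (c - scal b (thom n)))" using y(2) by (simp add: homrel_def chm_diff)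
  then have "relbdry n ?E nz (chm n snd (chm n (%x. (zv, x)) (c - scal b (thom n))))" by (rule relbdry_chm[OF _ cont_snd]) auto
  moreover have "schain n ?E (c - scal b (thom n))" using c by (intro schain_diff schain_cmul schain_thom) (simp add: relcycle)
  ultimately show thesis by (intro that[of b]) (simp add: chm_comp homrel_def chm_id_gen)
qed

lemma thom_nontorsion:
  assumes "rnull n (Euc n) nz (scal b (thom n))"
  shows "b = 0"
proof (rule ccontr)
  assume b: "b ~= 0"
  let ?Y = "Euc 0" and ?E = "Euc n"
  let ?P = "ptop ?Y ?E"
  let ?y = "frag_of (restrict (%x. zv) (stdsimp 0)) :: rvec chain"
  have top: "tops ?Y = {zv}" by (auto simp: top_Euc)
  have "cmap ?E ?P (%x. (zv, x))" by (auto intro!: cont_pairedI simp: top)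
  moreover have "rnull n ?E nz (thom n)" using rnull_cancel[OF assms b] .
  ultimately have "rnull n ?P (csub {} nz) (chm n (%x. (zv, x)) (thom n))" by (intro rnull_chm) auto
  then have "rnull (0 + n) ?P (csub {} nz) (cross 0 n ?y (thom n))" by (simp add: cross_0_left[OF schain_thom])
  moreover have "relcycle 0 ?Y {} ?y" by (auto simp: scycle singular_chain_of ssimplex_def bdry_def top)
  ultimately have "rnull 0 ?Y {} ?y" using thom_inj by blast
  then show False using singular_boundary_singleton[OF top, of 0] by (auto simp: rnull_def)
qed

definition anti :: "rvec => rvec" where
  "anti u = (%i. - u i)"

lemma cont_anti: "cmap (Euc n) (Euc n) anti" unfolding anti_def using cont_uminus_Euclidean[OF cont_id, of n] by (simp add: id_def)

lemma anti_nz: "anti u = zv \<longleftrightarrow> u = zv" by (auto simp: anti_def fun_eq_iff)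

lemma antipode_sign:
  obtains a :: int where "a = 1 | a = - 1"
    "hq n (Euc n) nz (chm n anti (thom n)) (scal a (thom n))"
proof -
  let ?E = "Euc n"
  have "relcycle n ?E nz (chm n anti (thom n))" by (rule relcycle_chm[OF relcycle_thom cont_anti]) (auto simp: anti_nz)
  from thom_generates[OF this] obtain a where
    "homrel n ?E nz (chm n anti (thom n)) (scal a (thom n))" .
  then have a: "hq n ?E nz (chm n anti (thom n)) (scal a (thom n))" by (rule hq_homol)
  then have "rnull n ?E nz (chm n anti (chm n anti (thom n) - scal a (thom n)))" by (rule rnull_chm[OF _ cont_anti]) (auto simp: anti_nz)
  then have "hq n ?E nz (thom n) (scal a (chm n anti (thom n)))"
    using schain_thom[of n] by (simp add: chm_diff chm_comp chm_id_gen[of n ?E] anti_def)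
  then have "hq n ?E nz (thom n) (scal (a * a) (thom n))" using hq_trans[OF _ hq_cmul[OF a, of a]] by simp
  then have "rnull n ?E nz (scal (1 - a * a) (thom n))" by (simp add: frag_cmul_diff_distrib)
  then have "a * a = 1" using thom_nontorsion by fastforce
  then have "a = 1 | a = - 1" by (auto simp: zmult_eq_1_iff)
  then show thesis using a that by blast
qed

lemma antipode_sph:
  assumes "hq (Suc k) (Euc (Suc k)) nz (chm (Suc k) anti (thom (Suc k))) (scal a (thom (Suc k)))"
  shows "hq k (E0 (Suc k)) {} (chm k anti (sph (Suc k))) (scal a (sph (Suc k)))"
  using rnull_bdry[OF assms] bdry_chm[OF schain_thom, of "Suc k" anti] by (simp add: bdry_diff bdry_cmul sph_def)

lemma openin_preimage_nz:
  assumes f: "cmap X (Euc n) f"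
  shows "openin X (tops X Int {x. f x \<in> nz})"
proof -
  have "closedin (Euc n) {zv}" using closedin_Hausdorff_singleton[OF Hausdorff_Euclidean_space] by (simp add: top_Euc)
  then have "openin X (tops X - {x \<in> tops X. f x \<in> {zv}})" using closedin_continuous_map_preimage[OF f] by blast
  moreover have "tops X - {x \<in> tops X. f x \<in> {zv}} = tops X Int {x. f x \<in> nz}" by auto
  ultimately show ?thesis by simp
qed

definition sphswap :: "'a rpair => 'a rpair" where
  "sphswap z = ((bpt z, snd z), mpt z)"

abbreviation torus :: "nat => nat => 'a chain => ('a rpair) chain" where
  "torus k p y == cross (p + k) k (cross p k y (sph (Suc k))) (sph (Suc k))"

abbreviation torus_space :: "nat => 'a topology => ('a rpair) topology" where
  "torus_space n Y == ptop (ptop Y (E0 n)) (E0 n)"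

lemma cycle_torus:
  "relcycle p Y {} y ==> relcycle (p + k + k) (torus_space (Suc k) Y) {} (torus k p y)" by (intro cross_cycle cycle_sph)

lemma cont_sphswap:
  "cmap (ptop (ptop Y A) B) (ptop (ptop Y B) A) sphswap" unfolding sphswap_def
  by (intro cont_pairedI cont_fst cont_snd cm_fst[OF cont_fst] cm_snd[OF cont_fst])

lemma torus_space_eq:
  "torus_space n (Y :: 'a topology) =
    subtop (ptop (ptop Y (Euc n)) (Euc n)) {z. mpt z \<in> nz & snd z \<in> nz}"
proof -
  have 1: "UNIV \<times> nz = (csub {} nz :: ('a \<times> rvec) set)" by (auto simp: csub_def)
  have 2: "(csub {} nz :: ('a \<times> rvec) set) \<times> nz = {z. mpt z \<in> nz & snd z \<in> nz}" by (auto simp: csub_def)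
  show ?thesis unfolding prod_E0[of Y] using subtopology_Times[of "ptop Y (Euc n)" "Euc n" "csub {} nz" nz] by (simp only: 2)
qed

lemma rotation_aux:
  fixes s :: real
  assumes "0 \<le> s" "s \<le> 1" "!!i. (1 - s) * u i + s * w i = 0" "!!i. (1 - s) * - w i + s * u i = 0"
  shows "u i = 0 & w i = (0::real)"
proof -
  have pos: "(1 - s) * (1 - s) + s * s ~= 0"
    using assms(1,2) by (metis add_nonneg_eq_0_iff diff_self mult_eq_0_iff mult_nonneg_nonneg diff_ge_0_iff_ge diff_zero zero_neq_one)
  have "((1 - s) * (1 - s) + s * s) * u i = (1 - s) * ((1 - s) * u i + s * w i) + s * ((1 - s) * - w i + s * u i)"
    "((1 - s) * (1 - s) + s * s) * w i = s * ((1 - s) * u i + s * w i) - (1 - s) * ((1 - s) * - w i + s * u i)"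
    by (simp_all add: algebra_simps)
  then have "((1 - s) * (1 - s) + s * s) * u i = 0" "((1 - s) * (1 - s) + s * s) * w i = 0" unfolding assms(3,4) by simp_all
  then show ?thesis using pos by auto
qed

lemma swap_torus:
  fixes y :: "'a chain"
  assumes y: "relcycle p Y {} y"
    and a: "hq (Suc k) (Euc (Suc k)) nz (chm (Suc k) anti (thom (Suc k))) (scal a (thom (Suc k)))"
  shows "hq (p + k + k) (torus_space (Suc k) Y) {}
    (chm (p + k + k) sphswap (torus k p y)) (scal (- a) (torus k p y))"
proof -
  let ?n = "Suc k"
  let ?E = "Euc ?n"
  let ?Q = "ptop Y ?E"
  let ?P = "ptop ?Q ?E"
  let ?S = "sph ?n"
  let ?yt = "cross p ?n y (thom ?n)"
  let ?w = "cross (Suc (p + k)) ?n ?yt (thom ?n)"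
  let ?D = "csub (csub {} nz) nz :: ('a rpair) set"
  let ?X = "subtop ?P ?D"
  let ?A1 = "{z. mpt z \<in> nz} :: ('a rpair) set"
  let ?A2 = "{z. snd z \<in> nz} :: ('a rpair) set"
  let ?r = "Suc (p + k + k)"
  have memD: "z \<in> ?D \<longleftrightarrow> mpt z ~= zv | snd z ~= zv" for z by (cases z) (auto simp: csub_def)
  have yc: "schain p Y y" using y by (simp add: scycle)
  have yt: "relcycle (Suc (p + k)) ?Q (csub {} nz) ?yt" using relcycle_cross[OF y relcycle_thom, of ?n] by simp
  have w: "relcycle (Suc ?r) ?P ?D ?w" using relcycle_cross[OF yt relcycle_thom, of ?n] by simp
  have sw: "cmap ?P ?P sphswap" by (rule cont_sphswap)
  have ia: "cmap ?P ?P (map_prod id anti)" by (intro cont_map_prod cont_id cont_anti)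
  have 1: "hq (Suc ?r) ?P ?D (chm (Suc ?r) (map_prod id anti) ?w) (chm (Suc ?r) sphswap ?w)"
  proof (rule hq_homotopy[OF w])
    let ?I = "ptop (I01) ?P"
    let ?H = "%z. ((fst (fst (snd z)), %i. (1 - fst z) * snd (fst (snd z)) i + fst z * snd (snd z) i),
       %i. (1 - fst z) * anti (snd (snd z)) i + fst z * snd (fst (snd z)) i)"
    have c: "cmap ?I ?Q (%z. fst (snd z))" "cmap ?I ?E (%z. snd (snd z))" by (auto intro: cm_fst[OF cont_snd] cm_snd[OF cont_snd])
    have c3: "cmap ?I Y (%z. fst (fst (snd z)))" "cmap ?I ?E (%z. snd (fst (snd z)))" using cm_fst[OF c(1)] cm_snd[OF c(1)] .
    have c4: "cmap ?I ?E (%z. anti (snd (snd z)))" using cont_comp[OF c(2) cont_anti] by (simp add: o_def)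
    have f: "cmap ?I Rtop fst" by (rule cont_01D[OF cont_fst])
    show "cmap ?I ?P ?H" by (intro cont_pairedI cont_Euc_add cont_scale cont_diff c c3 c4 f) simp_all
    show "?H (t, x) \<in> ?D" if t: "0 \<le> t" "t \<le> 1" and xD: "x \<in> ?D" for t x
    proof (rule ccontr)
      assume "?H (t, x) \<notin> ?D"
      then have h: "!!i. (1 - t) * mpt x i + t * snd x i = 0" "!!i. (1 - t) * - snd x i + t * mpt x i = 0"
        unfolding memD by (auto simp: anti_def fun_eq_iff)
      have "mpt x i = 0 & snd x i = 0" for i by (rule rotation_aux[OF t h])
      then show False using xD memD by auto
    qed
  qed (auto simp: sphswap_def map_prod_def case_prod_unfold)
  have ytc: "schain (Suc (p + k)) ?Q ?yt" using yt by (simp add: relcycle)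
  have "chm (Suc ?r) (map_prod id anti) ?w = cross (Suc (p + k)) ?n ?yt (chm ?n anti (thom ?n))"
    using cross_natural[of "Suc (p + k)" ?n id ?yt anti "thom ?n"] unfolding chm_ident[OF ytc] by simp
  moreover have "rnull (Suc ?r) ?P ?D (cross (Suc (p + k)) ?n ?yt (chm ?n anti (thom ?n) - scal a (thom ?n)))"
    using rnull_cross_right[OF yt a] by simp
  ultimately have "hq (Suc ?r) ?P ?D (chm (Suc ?r) (map_prod id anti) ?w) (scal a ?w)" by (simp add: cross_diff_right cross_cmul_right)
  then have "hq (Suc ?r) ?P ?D (chm (Suc ?r) sphswap ?w) (scal a ?w)" using 1 hq_sym hq_trans by blast
  then have null: "rnull ?r ?X {} (bdry (Suc ?r) (chm (Suc ?r) sphswap ?w - scal a ?w))" by (rule rnull_bdry)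
  define z1c where "z1c = scal ((-1) ^ p) (cross (p + k) ?n (cross p k y ?S) (thom ?n))"
  define z2c where "z2c = scal ((-1) ^ Suc (p + k)) (cross (Suc (p + k)) k ?yt ?S)"
  let ?t = "torus k p y"
  let ?e = "(-1) ^ k :: int"
  have wc: "schain (Suc ?r) ?P ?w" using w by (simp add: relcycle)
  have bw: "bdry (Suc ?r) ?w = z1c + z2c" using cross_Leibniz[OF ytc schain_thom, of ?n] boundary_cross_thom[OF y, of k]
    by (simp add: sph_def cross_cmul_left z1c_def z2c_def)
  have S: "relcycle k (E0 ?n) {} ?S" by (rule cycle_sph)
  have yS: "relcycle (p + k) (ptop Y (E0 ?n)) {} (cross p k y ?S)" by (rule cross_cycle[OF y S])
  have z1: "schain ?r (ptop (ptop Y (E0 ?n)) ?E) z1c"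
    unfolding z1c_def using yS schain_cross[OF _ schain_thom, of "p + k" _ "cross p k y ?S" ?n] by (auto simp: scycle intro!: schain_cmul)
  have z2: "schain ?r (ptop ?Q (E0 ?n)) z2c" unfolding z2c_def using schain_cross[OF ytc schain_sph, of k] by (intro schain_cmul) simp
  have bz1: "bdry ?r z1c = scal ?e ?t"
  proof -
    have "bdry ?r (cross (p + k) ?n (cross p k y ?S) (thom ?n)) = scal ((-1) ^ (p + k)) ?t" by (rule boundary_cross_thom[OF yS])
    moreover have "(-1) ^ p * (-1) ^ (p + k) = ?e" by (simp add: power_add flip: mult.assoc power_mult_distrib)
    ultimately show ?thesis by (simp add: z1c_def bdry_cmul)
  qed
  have bz2: "bdry ?r z2c = scal (- ?e) ?t"
  proof -
    have "bdry ?r z1c + bdry ?r z2c = 0" using chain_boundary_boundary_alt[OF wc] unfolding bw chain_boundary_add .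
    then have "bdry ?r z2c = - bdry ?r z1c" by (simp only: add_eq_0_iff)
    then show ?thesis unfolding bz1 minus_frag_cmul .
  qed
  have s1: "schain ?r (ptop ?Q (E0 ?n)) (chm ?r sphswap z1c)" by (rule schain_chm[OF z1 cont_sphswap])
  have s2: "schain ?r (ptop (ptop Y (E0 ?n)) ?E) (chm ?r sphswap z2c)" by (rule schain_chm[OF z2 cont_sphswap])
  have XA1: "ptop (ptop Y (E0 ?n)) ?E = subtop ?X ?A1"
  proof -
    have "(csub {} nz :: ('a \<times> rvec) set) \<times> UNIV = ?D Int ?A1" by (auto simp: csub_def)
    then show ?thesis unfolding prod_E0[of Y] using subtopology_Times[of ?Q ?E "csub {} nz" UNIV] by (simp add: subtop_subtop)
  qed
  have XA2: "ptop ?Q (E0 ?n) = subtop ?X ?A2"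
  proof -
    have "csub {} nz = ?D Int ?A2" by (auto simp: csub_def)
    then show ?thesis unfolding prod_E0 by (simp add: subtop_subtop)
  qed
  have XA12: "subtop (subtop ?X ?A1) ?A2 = torus_space ?n Y"
  proof -
    have "?D Int ?A1 Int ?A2 = {z. mpt z \<in> nz & snd z \<in> nz}" by (auto simp: csub_def)
    then show ?thesis unfolding torus_space_eq by (simp only: subtop_subtop)
  qed
  let ?c = "chm ?r sphswap z2c - scal a z1c"
  let ?d = "chm ?r sphswap z1c - scal a z2c"
  have cd: "bdry (Suc ?r) (chm (Suc ?r) sphswap ?w - scal a ?w) = ?c + ?d" using bdry_chm[OF wc, of sphswap]
    by (simp add: bdry_diff bdry_cmul bw chm_add frag_cmul_distrib2)
  have cc: "schain ?r (subtop ?X ?A1) ?c" using s2 z1 unfolding XA1 by (intro schain_diff schain_cmul)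
  have dc: "schain ?r (subtop ?X ?A2) ?d" using s1 z2 unfolding XA2 by (intro schain_diff schain_cmul)
  have bc: "bdry ?r ?c = scal (- ?e) (chm (p + k + k) sphswap ?t + scal a ?t)" using bdry_chm[OF z2, of sphswap] bz1 bz2
    by (simp add: bdry_diff bdry_cmul frag_cmul_distrib2 mult.commute)
  have t: "schain (p + k + k) (torus_space ?n Y) ?t" using cycle_torus[OF y] by (simp add: scycle)
  have "schain (p + k + k) (torus_space ?n Y) (bdry ?r ?c)"
    unfolding bc using t by (intro schain_cmul singular_chain_add schain_chm[OF t cont_sphswap])
  then have rc: "relcycle ?r (subtop ?X ?A1) ?A2 ?c" using cc unfolding XA12[symmetric] relcycle by simp
  have op: "openin ?X (tops ?X Int ?A1)" "openin ?X (tops ?X Int ?A2)"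
  proof -
    have f: "cmap ?X ?E (%z. mpt z)" "cmap ?X ?E snd" by (auto intro!: cont_from_sub cm_snd[OF cont_fst] cont_snd)
    show "openin ?X (tops ?X Int ?A1)" "openin ?X (tops ?X Int ?A2)" using openin_preimage_nz[OF f(1)] openin_preimage_nz[OF f(2)] by auto
  qed
  have cov: "tops ?X \<subseteq> ?A1 Un ?A2" using memD by auto
  have "rnull ?r ?X ?A2 ?c"
  proof -
    have "rnull ?r ?X ?A2 (?c + ?d)" using null unfolding cd by (rule rnull_mono) auto
    then show ?thesis using rnull_diff[OF _ rnull_chain[OF dc]] by fastforce
  qed
  then have "rnull ?r (subtop ?X ?A1) ?A2 ?c" by (rule rnull_excision[OF op cov rc])
  then have "rnull (p + k + k) (subtop (subtop ?X ?A1) ?A2) {} (bdry ?r ?c)" by (rule rnull_bdry)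
  then have "rnull (p + k + k) (torus_space ?n Y) {} (chm (p + k + k) sphswap ?t + scal a ?t)" unfolding bc XA12 by (rule rnull_cancel) simp
  then show ?thesis by (simp flip: minus_frag_cmul)
qed

definition crb :: "nat => ('a => nat => real) => 'a \<times> rvec => 'a \<times> rvec" where
  "crb n \<zeta> z = (fst z, %i. 2 * enorm n (\<zeta> (fst z)) / enorm n (snd z) * snd z i)"

definition crs :: "nat => ('a => nat => real) => 'a \<times> rvec => 'a \<times> rvec" where
  "crs n \<zeta> z = (fst z, %i. enorm n (\<zeta> (fst z)) / 2 * sig n (snd z) i)"

definition crl :: "nat => ('a => nat => real) => 'a \<times> rvec => 'a \<times> rvec" where
  "crl n \<zeta> z = (fst z, %i. \<zeta> (fst z) i + enorm n (\<zeta> (fst z)) / 2 * sig n (snd z) i)"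

lemma enorm_half_sig_less:
  assumes "0 < r" shows "enorm n (%i. r / 2 * sig n u i) < r / 2" unfolding enorm_scale using assms enorm_sig_less[of n u] by simp

lemma posmult: "0 < c ==> u ~= zv ==> (%i. c * u i) ~= zv" for c :: real by (auto simp: fun_eq_iff)

lemma convex_pos:
  assumes "0 < a" "0 < b" "0 \<le> s" "s \<le> (1::real)"
  shows "0 < (1 - s) * a + s * b"
proof (cases "s = 0")
  case False
  then show ?thesis using assms by (intro add_nonneg_pos) auto
qed (use assms in auto)

lemma hq_radial:
  assumes c: "relcycle p X {} c"
    and f: "cmap X (ptop Z (Euc n)) f"
    and g: "cmap X (ptop Z (Euc n)) g"
    and fg: "!!x. x \<in> tops X ==> fst (f x) = fst (g x) &
      (\<exists>a b w. 0 < a & 0 < b & w ~= zv & snd (f x) = (%i. a * w i) & snd (g x) = (%i. b * w i))"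
  shows "hq p (subtop (ptop Z (Euc n)) (csub {} nz)) {} (chm p f c) (chm p g c)"
proof (rule hq_straight[OF c f g])
  fix s x assume s: "0 \<le> (s::real)" "s \<le> 1" and x: "x \<in> tops X"
  obtain a b w where *: "0 < a" "0 < b" "w ~= zv" "snd (f x) = (%i. a * w i)" "snd (g x) = (%i. b * w i)" using fg[OF x] by blast
  have "(%i. (1 - s) * snd (f x) i + s * snd (g x) i) = (%i. ((1 - s) * a + s * b) * w i)" unfolding * by (auto simp: algebra_simps)
  then have "(%i. (1 - s) * snd (f x) i + s * snd (g x) i) ~= zv" using posmult[OF convex_pos[OF *(1,2) s] *(3)] by (simp only:) simp
  then show "(fst (f x), %i. (1 - s) * snd (f x) i + s * snd (g x) i) \<in> csub {} nz" by simp
qed (use fg in auto)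

text \<open>A large sphere around the origin is the sum of a small sphere around the origin and a small
  sphere around the removed point \<open>\<zeta>\<close>: the difference of the first two bounds in the complement of
  the origin, so by excision and the Thom isomorphism it is a multiple of the third, and translating
  \<open>\<zeta>\<close> to the origin determines the multiple.\<close>

lemma crossing:
  assumes y: "relcycle p Z {} y"
    and \<zeta>: "cmap Z (Euc (Suc k)) \<zeta>"
    and nz\<zeta>: "!!z. z \<in> tops Z ==> \<zeta> z ~= zv"
  shows "hq (p + k) (subtop (ptop Z (Euc (Suc k))) {z. snd z ~= zv & snd z ~= \<zeta> (fst z)}) {}
    (chm (p + k) (crb (Suc k) \<zeta>) (cross p k y (sph (Suc k))))
    (chm (p + k) (crs (Suc k) \<zeta>) (cross p k y (sph (Suc k))) +
     chm (p + k) (crl (Suc k) \<zeta>) (cross p k y (sph (Suc k))))"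
proof -
  let ?n = "Suc k"
  let ?E = "Euc ?n"
  let ?P = "ptop Z ?E"
  let ?X = "subtop ?P (csub {} nz)"
  let ?W = "{z. snd z ~= \<zeta> (fst z)}"
  let ?r = "p + k"
  let ?Y = "cross p k y (sph ?n)"
  let ?B = "crb ?n \<zeta>" and ?L = "crs ?n \<zeta>" and ?K = "crl ?n \<zeta>"
  let ?nn = "%z. enorm ?n (\<zeta> (fst z))"
  have X: "?X = ptop Z (E0 ?n)" by (rule prod_E0[symmetric])
  have G: "subtop ?X ?W = subtop ?P {z. snd z ~= zv & snd z ~= \<zeta> (fst z)}"
    unfolding subtop_subtop by (rule arg_cong[where f = "subtop ?P"]) auto
  have \<zeta>E: "\<zeta> z \<in> tops ?E" if "z \<in> tops Z" for z using continuous_map_image_subset_topspace[OF \<zeta>] that by auto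
  have npos: "0 < enorm ?n (\<zeta> z)" if "z \<in> tops Z" for z using enorm_pos_iff[OF \<zeta>E[OF that]] nz\<zeta>[OF that] by simp
  have upos: "0 < enorm ?n u" if "u \<in> tops ?E" "u ~= zv" for u using enorm_pos_iff[OF that(1)] that(2) by simp
  have pz: "enorm ?n u > 0 ==> u ~= zv" for u by auto
  have Y: "relcycle ?r ?X {} ?Y" unfolding X by (rule cross_cycle[OF y cycle_sph])
  have Yc: "schain ?r ?X ?Y" using Y by (simp add: scycle)
  have cs: "cmap T ?E (%z. snd (f z))" "cmap T ?E (%z. \<zeta> (fst (f z)))" "cmap T Z (%z. fst (f z))"
    if "cmap T ?P f" for T :: "'b topology" and f
    using that cm_snd[OF that] cm_fst[OF that] cont_comp[OF cm_fst[OF that] \<zeta>] by (auto simp: o_def)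
  have idX: "cmap (subtop ?X S) ?P (%z. z)" "cmap ?X ?P (%z. z)" "cmap ?P ?P (%z. z)" for S by (auto simp: cont_from_sub)
  note csX = cs[OF idX(2)] and csP = cs[OF idX(3)] and csS = cs[OF idX(1)]
  note enX = cont_enorm[OF csX(1)] cont_enorm[OF csX(2)]
    cont_enorm[OF continuous_map_Euclidean_space_diff[OF csX(1,2)]]
  note enP = cont_enorm[OF csP(2)]
  have memX: "z \<in> tops ?X \<longleftrightarrow> fst z \<in> tops Z & snd z \<in> tops ?E & snd z ~= zv" for z by (cases z) auto
  have Bc: "cmap ?X ?P ?B"
  proof -
    have "enorm ?n (snd z) ~= 0" if "z \<in> tops ?X" for z using upos[of "snd z"] that unfolding memX by simp
    then have "cmap ?X Rtop (%z. 2 * ?nn z / enorm ?n (snd z))" by (intro cont_real_divide continuous_map_real_mult enX) simp_all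
    then show ?thesis unfolding crb_def by (intro cont_pairedI csX cont_scale)
  qed
  have Lc: "cmap ?P ?P ?L" and Kc: "cmap ?P ?P ?K" unfolding crs_def crl_def by (intro cont_pairedI csP cont_Euc_add cont_scale
        cont_sig cont_real_divide enP; simp)+
  have Lc': "cmap ?X ?P ?L" using Lc by (rule cont_from_sub)
  have Kn: "enorm ?n (snd (?K z)) > 0" if "fst z \<in> tops Z" for z
  proof -
    have "?nn z - enorm ?n (%i. ?nn z / 2 * sig ?n (snd z) i) \<le> enorm ?n (snd (?K z))" unfolding crl_def snd_conv by (rule enorm_add_ge)
    then show ?thesis using enorm_half_sig_less[OF npos[OF that], of ?n "snd z"] npos[OF that] by linarith
  qed
  have KX: "cmap ?P ?X ?K" using Kc Kn pz by (intro cont_subI) auto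
  have KW: "?K z \<in> ?W" if "z \<in> tops ?X" for z
  proof -
    have "(%i. ?nn z / 2 * sig ?n (snd z) i) ~= zv" using npos[of "fst z"] that sig_eq_zv_iff[of ?n "snd z"] by (auto simp: fun_eq_iff)
    then show ?thesis by (auto simp: crl_def fun_eq_iff)
  qed
  have BW: "?B z \<in> ?W" if z: "z \<in> tops ?X" for z
  proof -
    have "0 < enorm ?n (snd z)" using upos z unfolding memX by blast
    then have "enorm ?n (snd (?B z)) = 2 * ?nn z" unfolding crb_def snd_conv enorm_scale by simp
    then have "enorm ?n (snd (?B z)) ~= ?nn z" using npos[of "fst z"] z by auto
    then show ?thesis by (auto simp: crb_def)
  qed
  have LW: "?L z \<in> ?W" if z: "z \<in> tops ?X" for z
  proof -
    have "0 < ?nn z" using npos z unfolding memX by blast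
    then have "enorm ?n (snd (?L z)) < ?nn z" using enorm_half_sig_less[of "?nn z" ?n "snd z"] unfolding crs_def snd_conv by linarith
    then show ?thesis by (auto simp: crs_def)
  qed
  have "snd (?B z) ~= zv" "snd (?L z) ~= zv" if z: "z \<in> tops ?X" for z
  proof -
    have n: "0 < ?nn z" "0 < enorm ?n (snd z)" "snd z ~= zv" using npos upos z unfolding memX by blast+
    show "snd (?B z) ~= zv" unfolding crb_def snd_conv using n by (intro posmult) simp_all
    show "snd (?L z) ~= zv" unfolding crs_def snd_conv using n by (intro posmult) simp_all
  qed
  then have BX: "cmap ?X ?X ?B" and LX: "cmap ?X ?X ?L" using Bc Lc' by (auto intro!: cont_subI)
  have BG: "cmap ?X (subtop ?X ?W) ?B" by (rule cont_subI[OF BX BW])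
  have LG: "cmap ?X (subtop ?X ?W) ?L" by (rule cont_subI[OF LX LW])
  have KG: "cmap ?X (subtop ?X ?W) ?K" by (rule cont_subI[OF cont_from_sub[OF KX] KW])
  have 1: "hq ?r ?X {} (chm ?r ?B ?Y) (chm ?r ?L ?Y)"
  proof (rule hq_radial[OF Y Bc Lc'])
    fix x assume x: "x \<in> tops ?X"
    have n: "0 < ?nn x" "0 < enorm ?n (snd x)" "snd x ~= zv" using npos upos x unfolding memX by blast+
    show "fst (?B x) = fst (?L x) & (\<exists>a b w. 0 < a & 0 < b & w ~= zv &
        snd (?B x) = (%i. a * w i) & snd (?L x) = (%i. b * w i))" using n enorm_add1_pos(1)[of ?n "snd x"]
      by (intro conjI exI[of _ "2 * ?nn x / enorm ?n (snd x)"] exI[of _ "?nn x / 2 * (1 / (1 + enorm ?n (snd x)))"] exI[of _ "snd x"])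
        (simp_all add: crb_def crs_def sig_def)
  qed
  let ?c = "chm ?r ?B ?Y - chm ?r ?L ?Y"
  obtain m h where m: "m ~= 0" and h: "schain (Suc ?r) ?X h" "scal m ?c = bdry (Suc ?r) h" using 1 by (auto simp: rnull_empty_iff)
  have cG: "relcycle ?r (subtop ?X ?W) {} ?c" using Y BG LG by (intro singular_relcycle_diff relcycle_chm[OF Y]) auto
  have hrel: "relcycle (Suc ?r) ?X ?W h" using h(1) cG schain_cmul[of ?r "subtop ?X ?W" ?c m] unfolding scycle by (simp add: relcycle h(2))
  let ?A = "{z. enorm ?n (%i. snd z i - \<zeta> (fst z) i) < ?nn z / 2}"
  have opA: "openin ?X (tops ?X Int ?A)"
  proof -
    have "cmap ?X Rtop (%z. ?nn z / 2 - enorm ?n (%i. snd z i - \<zeta> (fst z) i))" by (intro cont_diff cont_real_divide enX) simp_all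
    then have "openin ?X {z \<in> tops ?X. ?nn z / 2 - enorm ?n (%i. snd z i - \<zeta> (fst z) i) \<in> {0<..}}" by (rule openin_preim) simp
    moreover have "{z \<in> tops ?X. ?nn z / 2 - enorm ?n (%i. snd z i - \<zeta> (fst z) i) \<in> {0<..}} = tops ?X Int ?A" by auto
    ultimately show ?thesis by (simp only:)
  qed
  have opW: "openin ?X (tops ?X Int ?W)"
  proof -
    have "openin ?X (tops ?X Int {z. (%i. snd z i - \<zeta> (fst z) i) \<in> nz})"
      by (rule openin_preimage_nz[OF continuous_map_Euclidean_space_diff[OF csX(1,2)]])
    moreover have "{z. (%i. snd z i - \<zeta> (fst z) i) \<in> nz} = ?W" by (auto simp: fun_eq_iff)
    ultimately show ?thesis by (simp only:)
  qed
  have cov: "tops ?X \<subseteq> ?A Un ?W"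
  proof
    fix z assume z: "z \<in> tops ?X"
    show "z \<in> ?A Un ?W"
    proof (cases "snd z = \<zeta> (fst z)")
      case True
      then have "enorm ?n (%i. snd z i - \<zeta> (fst z) i) = 0" by simp
      then show ?thesis using npos[of "fst z"] z by auto
    qed simp
  qed
  obtain h1 where h1: "relcycle (Suc ?r) (subtop ?X ?A) ?W h1" "homrel (Suc ?r) ?X ?W h h1" using excision_surj_Int[OF opA opW cov hrel] .
  let ?k = "%z. (fst z, %i. snd z i - \<zeta> (fst z) i)"
  have kP: "cmap (subtop ?X S) ?P ?k" for S by (intro cont_pairedI continuous_intros csS)
  have "relcycle (Suc ?r) ?P (csub {} nz) (chm (Suc ?r) ?k h1)" by (rule relcycle_chm[OF h1(1) kP]) (auto simp: fun_eq_iff)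
  from thom_surj[OF this] obtain y' where y': "relcycle p Z {} y'"
    "homrel (Suc ?r) ?P (csub {} nz) (chm (Suc ?r) ?k h1) (cross p ?n y' (thom ?n))" by auto
  have KnzW: "?K \<in> tops ?P Int csub {} nz \<rightarrow> ?W" using KW memX by auto
  have 2: "hq (Suc ?r) ?X ?W (chm (Suc ?r) ?K (chm (Suc ?r) ?k h1)) (chm (Suc ?r) ?K (cross p ?n y' (thom ?n)))"
    using rnull_chm[OF hq_homol[OF y'(2)] KX KnzW] by (simp add: chm_diff)
  have 3: "hq (Suc ?r) ?X ?W (chm (Suc ?r) (%z. z) h1) (chm (Suc ?r) (%z. ?K (?k z)) h1)"
  proof (rule hq_straight_rel[OF h1(1)])
    show "cmap (subtop ?X ?A) ?P (%z. z)" by (rule idX)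
    show "cmap (subtop ?X ?A) ?P (%z. ?K (?k z))" using cont_comp[OF kP Kc] by (simp add: o_def)
    fix s x assume s: "0 \<le> (s::real)" "s \<le> 1" and x: "x \<in> tops (subtop ?X ?A)"
    let ?d = "%i. snd x i - \<zeta> (fst x) i"
    define q where "q = ?nn x / 2 * (1 / (1 + enorm ?n ?d))"
    let ?co = "(1 - s) + s * q"
    have xx: "fst x \<in> tops Z" "enorm ?n ?d < ?nn x / 2" using x by auto
    have Kk: "snd (?K (?k x)) i = \<zeta> (fst x) i + q * ?d i" for i by (simp add: crl_def sig_def q_def)
    have eq: "(1 - s) * snd x i + s * snd (?K (?k x)) i = \<zeta> (fst x) i + ?co * ?d i" for i unfolding Kk by (simp add: algebra_simps)
    have n0: "0 < ?nn x" using npos xx by blast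
    then have q0: "0 < q" using enorm_add1_pos(1)[of ?n ?d] by (simp add: q_def)
    then have co: "0 < ?co" using s by (cases "s = 0") (auto intro!: add_nonneg_pos)
    have "q * enorm ?n ?d < ?nn x / 2" using enorm_half_sig_less[OF n0, of ?n ?d] n0 unfolding enorm_scale enorm_sig q_def by simp
    then have "q * enorm ?n ?d \<le> ?nn x / 2" "enorm ?n ?d \<le> ?nn x / 2" using xx(2) by simp_all
    from mult_left_mono[OF this(1) s(1)] mult_left_mono[OF this(2), of "1 - s"] s(2)
    have "?co * enorm ?n ?d \<le> ?nn x / 2" by (simp add: distrib_right left_diff_distrib mult.assoc)
    then have "enorm ?n (%i. ?co * ?d i) < ?nn x" unfolding enorm_scale using co n0 by simp
    then have "0 < enorm ?n (%i. \<zeta> (fst x) i + ?co * ?d i)" using enorm_add_ge[of ?n "\<zeta> (fst x)" "%i. ?co * ?d i"] by linarith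
    then show "(fst x, %i. (1 - s) * snd x i + s * snd (?K (?k x)) i) \<in> csub {} nz" using pz unfolding eq by simp
    assume "x \<in> ?W"
    then have "?d ~= zv" by (auto simp: fun_eq_iff)
    then have "(%i. ?co * ?d i) ~= zv" using posmult[OF co] by blast
    then show "(fst x, %i. (1 - s) * snd x i + s * snd (?K (?k x)) i) \<in> ?W" unfolding eq by (auto simp: fun_eq_iff)
  qed (auto simp: crl_def)
  have "schain (Suc ?r) (subtop ?X ?A) h1" using h1(1) by (simp add: relcycle)
  then have "chm (Suc ?r) (%z. z) h1 = h1" by (rule chm_id_gen) simp
  then have "hq (Suc ?r) ?X ?W h1 (chm (Suc ?r) ?K (cross p ?n y' (thom ?n)))" using hq_trans[OF 3 2[unfolded chm_comp]] by simp
  then have "hq (Suc ?r) ?X ?W h (chm (Suc ?r) ?K (cross p ?n y' (thom ?n)))" using hq_trans[OF hq_homol[OF h1(2)]] by blast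
  then have "rnull ?r (subtop ?X ?W) {} (bdry (Suc ?r) (h - chm (Suc ?r) ?K (cross p ?n y' (thom ?n))))" by (rule rnull_bdry)
  moreover have "schain (Suc ?r) ?P (cross p ?n y' (thom ?n))"
    using schain_cross[OF _ schain_thom, of p Z y' ?n] y'(1) by (simp add: relcycle)
  moreover define y2 where "y2 = scal ((-1) ^ p) y'"
  ultimately have 4: "hq ?r (subtop ?X ?W) {} (scal m ?c) (chm ?r ?K (cross p k y2 (sph ?n)))"
    using boundary_cross_thom[OF y'(1), of k] h(2) by (simp add: bdry_diff bdry_chm cross_cmul_left)
  have y2: "relcycle p Z {} y2" using y'(1) relcycle_cmul y2_def by blast
  let ?Y2 = "cross p k y2 (sph ?n)"
  have Y2: "relcycle ?r ?X {} ?Y2" unfolding X by (rule cross_cycle[OF y2 cycle_sph])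
  have kX: "cmap (subtop ?X ?W) ?X ?k" using kP by (intro cont_subI) (auto simp: fun_eq_iff)
  have 5: "hq ?r ?X {} (scal m (chm ?r ?k ?c)) (chm ?r ?k (chm ?r ?K ?Y2))" using rnull_chm[OF 4 kX] by (simp add: chm_diff)
  have kB: "hq ?r ?X {} (chm ?r (%z. ?k (?B z)) ?Y) (chm ?r (%z. z) ?Y)"
  proof (rule hq_straight[OF Y])
    show "cmap ?X ?P (%z. ?k (?B z))" using cont_comp[OF BG kP] by (simp add: o_def)
    fix s x assume s: "0 \<le> (s::real)" "s \<le> 1" and x: "x \<in> tops ?X"
    have x': "0 < ?nn x" "0 < enorm ?n (snd x)" using x npos upos unfolding memX by blast+
    define q where "q = 2 * ?nn x / enorm ?n (snd x)"
    let ?co = "(1 - s) * q + s"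
    have Bk: "snd (?k (?B x)) i = q * snd x i - \<zeta> (fst x) i" for i by (simp add: crb_def q_def)
    have eq: "(1 - s) * snd (?k (?B x)) i + s * snd x i = ?co * snd x i - (1 - s) * \<zeta> (fst x) i" for i
      unfolding Bk by (simp add: algebra_simps)
    have q: "0 < q" "q * enorm ?n (snd x) = 2 * ?nn x" using x' by (auto simp: q_def)
    have "enorm ?n (%i. ?co * snd x i) = (1 - s) * (q * enorm ?n (snd x)) + s * enorm ?n (snd x)"
    proof -
      have "0 \<le> ?co" using s q(1) by simp
      then show ?thesis unfolding enorm_scale abs_of_nonneg[OF \<open>0 \<le> ?co\<close>] by (simp add: distrib_right mult.assoc)
    qed
    moreover have "enorm ?n (%i. (1 - s) * \<zeta> (fst x) i) = (1 - s) * ?nn x" unfolding enorm_scale using s by simp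
    moreover have "0 < (1 - s) * ?nn x + s * enorm ?n (snd x)" using convex_pos[OF x' s] .
    ultimately have "0 < enorm ?n (%i. ?co * snd x i - (1 - s) * \<zeta> (fst x) i)"
      using enorm_diff_ge[of ?n "%i. ?co * snd x i" "%i. (1 - s) * \<zeta> (fst x) i"] unfolding q(2) by linarith
    then show "(fst (?k (?B x)), %i. (1 - s) * snd (?k (?B x)) i + s * snd x i) \<in> csub {} nz" using pz unfolding eq by simp
  qed (use idX in \<open>auto simp: crb_def\<close>)
  have kL: "rnull ?r ?X {} (chm ?r (%z. ?k (?L z)) ?Y)"
  proof (rule rnull_sph_extend[OF y])
    have "cmap ?P ?P (%z. ?k (?L z))" unfolding crs_def fst_conv snd_conv
      by (intro cont_pairedI csP continuous_map_Euclidean_space_diff cont_scale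
        cont_sig cont_real_divide enP) simp_all
    moreover have "snd (?k (?L z)) ~= zv" if "z \<in> tops ?P" for z
    proof -
      have "0 < ?nn z" using npos[of "fst z"] that by auto
      then have "enorm ?n (snd (?L z)) < ?nn z" using enorm_half_sig_less[of "?nn z" ?n "snd z"] unfolding crs_def snd_conv by linarith
      then have "snd (?L z) ~= \<zeta> (fst z)" by auto
      then show ?thesis by (auto simp: crs_def fun_eq_iff)
    qed
    ultimately show "cmap ?P ?X (%z. ?k (?L z))" by (intro cont_subI) auto
  qed
  have kK: "hq ?r ?X {} (chm ?r (%z. ?k (?K z)) ?Y2) (chm ?r (%z. z) ?Y2)"
  proof (rule hq_radial[OF Y2])
    show "cmap ?X ?P (%z. ?k (?K z))" using cont_comp[OF KG kP] by (simp add: o_def)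
    fix x assume x: "x \<in> tops ?X"
    have n: "0 < ?nn x" "snd x ~= zv" using npos x unfolding memX by blast+
    show "fst (?k (?K x)) = fst x & (\<exists>a b w. 0 < a & 0 < b & w ~= zv &
        snd (?k (?K x)) = (%i. a * w i) & snd x = (%i. b * w i))" using n enorm_add1_pos(1)[of ?n "snd x"]
      by (intro conjI exI[of _ "?nn x / 2 * (1 / (1 + enorm ?n (snd x)))"] exI[of _ 1] exI[of _ "snd x"])
        (simp_all add: crl_def sig_def)
  qed (rule idX)
  have Y2c: "schain ?r ?X ?Y2" using Y2 by (simp add: scycle)
  have Yid: "chm ?r (%z. z) ?Y = ?Y" "chm ?r (%z. z) ?Y2 = ?Y2" using chm_id_gen[OF Yc, of "%z. z"] chm_id_gen[OF Y2c, of "%z. z"] by auto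
  have kc: "chm ?r ?k ?c = chm ?r (%z. ?k (?B z)) ?Y - chm ?r (%z. ?k (?L z)) ?Y" by (simp only: chm_diff chm_comp)
  have kB': "hq ?r ?X {} (chm ?r (%z. ?k (?B z)) ?Y) ?Y" using kB by (simp only: Yid)
  have "chm ?r ?k ?c - ?Y = (chm ?r (%z. ?k (?B z)) ?Y - ?Y) - chm ?r (%z. ?k (?L z)) ?Y"
    unfolding kc by (simp only: diff_diff_eq add.commute)
  then have "hq ?r ?X {} (chm ?r ?k ?c) ?Y" using rnull_diff[OF kB' kL] by (simp only:)
  then have "hq ?r ?X {} (scal m ?Y) (scal m (chm ?r ?k ?c))" by (rule hq_cmul[OF hq_sym])
  moreover have "hq ?r ?X {} (chm ?r ?k (chm ?r ?K ?Y2)) ?Y2" using kK unfolding chm_comp Yid .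
  ultimately have "hq ?r ?X {} (scal m ?Y) ?Y2" using 5 hq_trans by blast
  then have "rnull ?r (ptop Z (E0 ?n)) {} (cross p k (scal m y - y2) (sph ?n))" unfolding X by (simp add: cross_diff_left cross_cmul_left)
  then have "rnull p Z {} (scal m y - y2)" by (rule sphere_inj[OF singular_relcycle_diff[OF relcycle_cmul[OF y] y2]])
  from rnull_cross_left0[OF this cycle_sph]
  have "rnull ?r ?X {} (cross p k (scal m y - y2) (sph ?n))" unfolding X .
  from rnull_chm[OF this KG]
  have "hq ?r (subtop ?X ?W) {} (scal m (chm ?r ?K ?Y)) (chm ?r ?K ?Y2)" by (simp add: cross_diff_left cross_cmul_left chm_diff)
  from hq_trans'[OF 4 this]
  have "rnull ?r (subtop ?X ?W) {} (scal m (?c - chm ?r ?K ?Y))" by (simp add: scal_diff)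
  then have "rnull ?r (subtop ?X ?W) {} (?c - chm ?r ?K ?Y)" by (rule rnull_cancel[OF _ m])
  then show ?thesis unfolding G by (simp add: algebra_simps)
qed

section \<open>The commutation relation in configurations of three points\<close>

type_synonym 'a triple = "'a \<times> rvec \<times> rvec \<times> rvec"

abbreviation tspace :: "nat => 'a topology => 'a triple topology" where
  "tspace n Y == ptop Y (ptop (Euc n) (ptop (Euc n) (Euc n)))"

definition dtrip :: "'a triple set" where
  "dtrip = {(y, a, b, c). a ~= zv & b ~= zv & c ~= zv & a ~= b & b ~= c & a ~= c}"

abbreviation lerp :: "real => rvec => rvec => rvec" where
  "lerp s u v == (%i. (1 - s) * u i + s * v i)"

abbreviation tlerp :: "real => 'a triple => 'a triple => 'a triple" where
  "tlerp s x x' == (fst x, lerp s (fst (snd x)) (fst (snd x')), lerp s (fst (snd (snd x))) (fst (snd (snd x'))),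
    lerp s (snd (snd (snd x))) (snd (snd (snd x'))))"

lemma cont_triple:
  assumes "cmap X Y f" "cmap X (Euc n) A"
    "cmap X (Euc n) B" "cmap X (Euc n) C"
  shows "cmap X (tspace n Y) (%x. (f x, A x, B x, C x))" by (intro cont_pairedI assms)

lemma cont_tripleD:
  assumes "cmap X (tspace n Y) f"
  shows "cmap X Y (%x. fst (f x))" "cmap X (Euc n) (%x. fst (snd (f x)))"
    "cmap X (Euc n) (%x. fst (snd (snd (f x))))"
    "cmap X (Euc n) (%x. snd (snd (snd (f x))))"
  using cm_fst[OF assms] cm_fst[OF cm_snd[OF assms]] cm_fst[OF cm_snd[OF cm_snd[OF assms]]] cm_snd[OF cm_snd[OF cm_snd[OF assms]]] by auto

lemma cont_lerp:
  assumes "cmap X Rtop s" "cmap X (Euc n) A" "cmap X (Euc n) B"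
  shows "cmap X (Euc n) (%x. lerp (s x) (A x) (B x))" by (intro cont_Euc_add cont_scale cont_diff assms) simp

lemma hq_straight_triple:
  assumes c: "relcycle p X {} c"
    and f: "cmap X (tspace n Y) f" and g: "cmap X (tspace n Y) g"
    and fg: "!!x. x \<in> tops X ==> fst (f x) = fst (g x)"
    and D: "!!s x. [|0 \<le> s; s \<le> 1; x \<in> tops X|] ==>
      (tlerp s (f x) (g x)) \<in> D"
  shows "hq p (subtop (tspace n Y) D) {} (chm p f c) (chm p g c)"
proof (rule hq_homotopy[OF c])
  let ?H = "%z. (tlerp (fst z) (f (snd z)) (g (snd z)))"
  let ?I = "ptop (I01) X"
  have 0: "cmap ?I (tspace n Y) (%z. f (snd z))" "cmap ?I (tspace n Y) (%z. g (snd z))"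
    using cont_comp[OF cont_snd f] cont_comp[OF cont_snd g] by (auto simp: o_def)
  have t: "cmap ?I Rtop fst" by (rule cont_01D[OF cont_fst])
  have "cmap ?I (tspace n Y) ?H" by (intro cont_triple cont_lerp t cont_tripleD[OF 0(1)] cont_tripleD[OF 0(2)])
  then show "cmap ?I (subtop (tspace n Y) D) ?H" using D by (intro cont_subI) auto
qed (use fg in \<open>auto simp: prod_eq_iff\<close>)

definition uvec :: "nat => real" where
  "uvec = (%i. if i = 0 then 1 else 0)"

lemma enorm_uvec [simp]: "enorm (Suc k) uvec = 1"
  by (simp add: enorm_def uvec_def lessThan_Suc_eq_insert_0 sum.insert_if image_iff sum.neutral)

lemma uvec_in: "uvec \<in> tops (Euc (Suc k))" by (auto simp: uvec_def top_Euc)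

definition perm12 :: "'a triple => 'a triple" where
  "perm12 = (%(y, a, b, c). (y, b, a, c))"

definition perm23 :: "'a triple => 'a triple" where
  "perm23 = (%(y, a, b, c). (y, a, c, b))"

lemma cont_perms:
  "cmap (subtop (tspace n Y) dtrip) (subtop (tspace n Y) dtrip) perm12"
  "cmap (subtop (tspace n Y) dtrip) (subtop (tspace n Y) dtrip) perm23"
proof -
  have id: "cmap (subtop (tspace n Y) dtrip) (tspace n Y) (%x. x)" by (simp add: cont_from_sub)
  show "cmap (subtop (tspace n Y) dtrip) (subtop (tspace n Y) dtrip) perm12" unfolding perm12_def case_prod_unfold
    by (intro cont_subI cont_triple cont_tripleD[OF id]) (auto simp: dtrip_def)
  show "cmap (subtop (tspace n Y) dtrip) (subtop (tspace n Y) dtrip) perm23" unfolding perm23_def case_prod_unfold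
    by (intro cont_subI cont_triple cont_tripleD[OF id]) (auto simp: dtrip_def)
qed

locale commutator =
  fixes k p :: nat and Y :: "'a topology" and y :: "'a chain" and T :: "'b topology"
    and \<Psi> :: "'a triple => 'b" and Nul :: "'b chain => bool" and a :: int
  assumes y: "relcycle p Y {} y"
    and Psi: "cmap (subtop (tspace (Suc k) Y) dtrip) T \<Psi>"
    and Nul_rnull: "rnull (p + k + k) T {} c ==> Nul c"
    and Nul_add: "Nul c ==> Nul d ==> Nul (c + d)"
    and Nul_cmul: "Nul c ==> Nul (scal m c)"
    and Nul_cancel: "Nul (scal m c) ==> m ~= 0 ==> Nul c"
    and Nul_perm12: "relcycle (p + k + k) (subtop (tspace (Suc k) Y) dtrip) {} x ==>
      Nul (chm (p + k + k) \<Psi> (chm (p + k + k) perm12 x) - chm (p + k + k) \<Psi> x)"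
    and Nul_perm23: "relcycle (p + k + k) (subtop (tspace (Suc k) Y) dtrip) {} x ==>
      Nul (chm (p + k + k) \<Psi> (chm (p + k + k) perm23 x) - chm (p + k + k) \<Psi> x)"
    and a_sign: "a = 1 | a = - 1"
    and a_anti: "hq (Suc k) (Euc (Suc k)) nz (chm (Suc k) anti (thom (Suc k))) (scal a (thom (Suc k)))"
begin

abbreviation "n == Suc k"
abbreviation "r == p + k + k"
abbreviation "E == Euc n"
abbreviation "TS == torus_space n Y"
abbreviation "C3 == subtop (tspace n Y) dtrip"
abbreviation "t == torus k p y"

definition V :: "('a rpair => 'a triple) => 'b chain" where
  "V F = chm r (%z. \<Psi> (F z)) t"

definition eqv :: "'b chain => 'b chain => bool" where
  "eqv c d \<longleftrightarrow> Nul (c - d)"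

lemma Nul_minus: "Nul c ==> Nul (- c)" using Nul_cmul[of c "-1"] by simp

lemma Nul_0: "Nul 0" by (rule Nul_rnull) simp

lemma eqv_refl: "eqv c c" by (simp add: eqv_def Nul_0)

lemma eqv_sym: "eqv c d ==> eqv d c" using Nul_minus[of "c - d"] by (simp add: eqv_def)

lemma eqv_trans [trans]: "eqv c d ==> eqv d e ==> eqv c e" using Nul_add[of "c - d" "d - e"] by (simp add: eqv_def)

lemma eqv_add: "eqv c d ==> eqv c' d' ==> eqv (c + c') (d + d')" using Nul_add[of "c - d" "c' - d'"] by (simp add: eqv_def algebra_simps)

lemma eqv_cmul: "eqv c d ==> eqv (scal m c) (scal m d)" using Nul_cmul[of "c - d" m] by (simp add: eqv_def scal_diff)

lemma eqv_0: "eqv c 0 \<longleftrightarrow> Nul c" by (simp add: eqv_def)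

lemma tcyc: "relcycle r TS {} t" by (rule cycle_torus[OF y])

lemma tch: "schain r TS t" using tcyc by (simp add: scycle)

lemma V_straight:
  assumes "cmap TS (tspace n Y) F" "cmap TS (tspace n Y) G"
    and "!!x. x \<in> tops TS ==> fst (F x) = fst (G x)"
    and "!!s x. [|0 \<le> s; s \<le> 1; x \<in> tops TS|] ==>
      (tlerp s (F x) (G x)) \<in> dtrip"
  shows "eqv (V F) (V G)"
proof -
  have "hq r C3 {} (chm r F t) (chm r G t)" by (rule hq_straight_triple[OF tcyc assms])
  from rnull_chm[OF this Psi]
  show ?thesis unfolding eqv_def V_def by (intro Nul_rnull) (simp add: chm_diff chm_comp)
qed

lemma V_perm:
  assumes F: "cmap TS C3 F"
  shows "eqv (V (%z. perm12 (F z))) (V F)" "eqv (V (%z. perm23 (F z))) (V F)"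
proof -
  have "relcycle r C3 {} (chm r F t)" by (rule relcycle_chm[OF tcyc F]) simp
  from Nul_perm12[OF this] Nul_perm23[OF this]
  show "eqv (V (%z. perm12 (F z))) (V F)" "eqv (V (%z. perm23 (F z))) (V F)" by (simp_all add: eqv_def V_def chm_comp)
qed

lemma V_transform:
  assumes F: "cmap TS C3 F" and h: "hq r TS {} (chm r h t) (scal m t)"
  shows "eqv (V (%z. F (h z))) (scal m (V F))"
proof -
  have "cmap TS T (%z. \<Psi> (F z))" using cont_comp[OF F Psi] by (simp add: o_def)
  from rnull_chm[OF h this] show ?thesis unfolding eqv_def V_def by (intro Nul_rnull) (simp add: chm_diff chm_comp)
qed

lemma V_swap:
  assumes F: "cmap TS C3 F"
  shows "eqv (V (%z. F (sphswap z))) (scal (- a) (V F))" by (rule V_transform[OF F swap_torus[OF y a_anti]])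

lemma hq_anti: "hq k (E0 n) {} (chm k anti (sph n)) (scal a (sph n))" by (rule antipode_sph[OF a_anti])

lemma yS_cycle: "relcycle (p + k) (ptop Y (E0 n)) {} (cross p k y (sph n))" by (rule cross_cycle[OF y cycle_sph])

lemma V_anti2:
  assumes F: "cmap TS C3 F"
  shows "eqv (V (%z. F (fst z, anti (snd z)))) (scal a (V F))"
proof (rule V_transform[OF F])
  have c: "schain (p + k) (ptop Y (E0 n)) (cross p k y (sph n))" using yS_cycle by (simp add: scycle)
  have "chm r (map_prod id anti) t = cross (p + k) k (cross p k y (sph n)) (chm k anti (sph n))"
    using cross_natural[of "p + k" k id "cross p k y (sph n)" anti "sph n"] unfolding chm_ident[OF c] by simp
  moreover have "(%z. (fst z, anti (snd z))) = (map_prod id anti :: 'a rpair => _)" by (auto simp: map_prod_def)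
  moreover have "rnull r TS {} (cross (p + k) k (cross p k y (sph n)) (chm k anti (sph n) - scal a (sph n)))"
    by (rule rnull_cross_right0[OF yS_cycle hq_anti])
  ultimately show "hq r TS {} (chm r (%z. (fst z, anti (snd z))) t) (scal a t)" by (simp only: cross_diff_right cross_cmul_right)
qed

lemma V_anti1:
  assumes F: "cmap TS C3 F"
  shows "eqv (V (%z. F ((bpt z, anti (mpt z)), snd z))) (scal a (V F))"
proof (rule V_transform[OF F])
  have yc: "schain p Y y" using y by (simp add: scycle)
  have "chm (p + k) (map_prod id anti) (cross p k y (sph n)) = cross p k y (chm k anti (sph n))"
    using cross_natural[of p k id y anti "sph n"] unfolding chm_ident[OF yc] by simp
  moreover have "chm r (map_prod (map_prod id anti) id) t =
      cross (p + k) k (chm (p + k) (map_prod id anti) (cross p k y (sph n))) (sph n)"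
    using cross_natural[of "p + k" k "map_prod id anti" "cross p k y (sph n)" id "sph n"] unfolding chm_ident[OF schain_sph] by simp
  moreover have "(%z. ((bpt z, anti (mpt z)), snd z)) =
      (map_prod (map_prod id anti) id :: 'a rpair => _)" by (auto simp: map_prod_def)
  moreover have "rnull r TS {} (cross (p + k) k (cross p k y (chm k anti (sph n) - scal a (sph n))) (sph n))"
    by (rule rnull_cross_left0[OF rnull_cross_right0[OF y hq_anti] cycle_sph])
  ultimately show "hq r TS {} (chm r (%z. ((bpt z, anti (mpt z)), snd z)) t) (scal a t)"
    by (simp only: cross_diff_right cross_cmul_right cross_diff_left cross_cmul_left)
qed

abbreviation "cspace Z \<zeta> == subtop (ptop Z E) {z. snd z ~= zv & snd z ~= \<zeta> (fst z)}"

lemma V_cross2: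
  assumes \<zeta>: "cmap (ptop Y (E0 n)) E \<zeta>" "!!z. z \<in> tops (ptop Y (E0 n)) ==> \<zeta> z ~= zv"
    and \<Phi>: "cmap (cspace (ptop Y (E0 n)) \<zeta>) C3 \<Phi>"
  shows "eqv (V (%z. \<Phi> (crb n \<zeta> z))) (V (%z. \<Phi> (crs n \<zeta> z)) + V (%z. \<Phi> (crl n \<zeta> z)))"
proof -
  have "cmap (cspace (ptop Y (E0 n)) \<zeta>) T (%z. \<Psi> (\<Phi> z))" using cont_comp[OF \<Phi> Psi] by (simp add: o_def)
  from rnull_chm[OF crossing[OF yS_cycle \<zeta>] this] show ?thesis
    unfolding eqv_def V_def by (intro Nul_rnull) (simp add: chm_diff chm_add chm_comp)
qed

lemma V_cross1:
  assumes \<zeta>: "cmap Y E \<zeta>" "!!z. z \<in> tops Y ==> \<zeta> z ~= zv"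
    and \<Phi>: "cmap (ptop (cspace Y \<zeta>) (E0 n)) C3 \<Phi>"
  shows "eqv (V (%z. \<Phi> (crb n \<zeta> (fst z), snd z)))
    (V (%z. \<Phi> (crs n \<zeta> (fst z), snd z)) + V (%z. \<Phi> (crl n \<zeta> (fst z), snd z)))"
proof -
  let ?Y = "cross p k y (sph n)"
  have "rnull r (ptop (cspace Y \<zeta>) (E0 n)) {} (cross (p + k) k
     (chm (p + k) (crb n \<zeta>) ?Y - (chm (p + k) (crs n \<zeta>) ?Y + chm (p + k) (crl n \<zeta>) ?Y)) (sph n))"
    by (rule rnull_cross_left0[OF crossing[OF y \<zeta>] cycle_sph])
  moreover have "cross (p + k) k (chm (p + k) f ?Y) (sph n) = chm r (%z. (f (fst z), snd z)) t" for f :: "'a \<times> rvec => 'a \<times> rvec"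
    using cross_natural[of "p + k" k f ?Y id "sph n"] unfolding chm_ident[OF schain_sph] by (simp add: map_prod_def case_prod_unfold)
  ultimately have 1: "rnull r (ptop (cspace Y \<zeta>) (E0 n)) {} (chm r (%z. (crb n \<zeta> (fst z), snd z)) t -
     (chm r (%z. (crs n \<zeta> (fst z), snd z)) t + chm r (%z. (crl n \<zeta> (fst z), snd z)) t))"
    by (simp only: cross_diff_left cross_add_left)
  have "cmap (ptop (cspace Y \<zeta>) (E0 n)) T (%z. \<Psi> (\<Phi> z))" using cont_comp[OF \<Phi> Psi] by (simp add: o_def)
  from rnull_chm[OF 1 this] show ?thesis unfolding eqv_def V_def by (intro Nul_rnull) (simp add: chm_diff chm_add chm_comp)
qed

end

lemma enorm_neq: "enorm n u ~= enorm n v ==> u ~= v" by auto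

lemma distinct_radial:
  assumes "\<alpha> * enorm n u ~= \<beta> * enorm n w" "\<beta> * enorm n w ~= \<gamma> * enorm n e" "\<alpha> * enorm n u ~= \<gamma> * enorm n e"
    "0 < \<alpha> * enorm n u" "0 < \<beta> * enorm n w" "0 < \<gamma> * enorm n e" "0 \<le> \<alpha>" "0 \<le> \<beta>" "0 \<le> \<gamma>"
  shows "(y, %i. \<alpha> * u i, %i. \<beta> * w i, %i. \<gamma> * e i) \<in> dtrip" unfolding dtrip_def using assms
  by (auto simp: enorm_scale intro!: enorm_neq[of n] dest: arg_cong[where f = "enorm n"])

lemma distinct_cluster:
  assumes e: "enorm n e = 1" and b: "0 < b * enorm n w" "0 \<le> b" and a: "0 \<le> a" "0 < a * enorm n u"
    and "(b * enorm n w < c & c + b * enorm n w < a * enorm n u) | a * enorm n u < c - b * enorm n w"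
  shows "(y, %i. a * u i, %i. c * e i + b * w i, %i. c * e i) \<in> dtrip"
proof -
  have c: "0 < c" using assms by auto
  have 1: "enorm n (%i. c * e i) = c" "enorm n (%i. b * w i) = b * enorm n w" "enorm n (%i. a * u i) = a * enorm n u"
    using c e a b by (auto simp: enorm_scale)
  have 2: "enorm n (%i. c * e i + b * w i) \<le> c + b * enorm n w" "c - b * enorm n w \<le> enorm n (%i. c * e i + b * w i)"
    using enorm_triangle[of n "%i. c * e i" "%i. b * w i"] enorm_add_ge[of n "%i. c * e i" "%i. b * w i"] 1 by auto
  have 3: "enorm n (%i. a * u i) ~= enorm n (%i. c * e i + b * w i)" "enorm n (%i. a * u i) ~= enorm n (%i. c * e i)"
     "0 < enorm n (%i. c * e i + b * w i)" "0 < enorm n (%i. c * e i)" "0 < enorm n (%i. a * u i)" using assms 1 2 by auto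
  have "(%i. b * w i) ~= zv" using 1(2) b by auto
  then have "(%i. c * e i + b * w i) ~= (%i. c * e i)" by (auto simp: fun_eq_iff)
  moreover have "(%i. a * u i) ~= zv" "(%i. c * e i + b * w i) ~= zv" "(%i. c * e i) ~= zv" using 3 by (metis enorm_zv less_irrefl)+
  ultimately show ?thesis unfolding dtrip_def using 3(1,2) by auto
qed

lemma distinct_nested:
  assumes e: "enorm n e = 1" and b: "0 < b * enorm n w" "b * enorm n w < a * enorm n u" "a * enorm n u < c" "0 \<le> a" "0 \<le> b"
  shows "(y, %i. c * e i + a * u i, %i. c * e i + b * w i, %i. c * e i) \<in> dtrip"
proof -
  have c: "0 < c" using b by linarith
  have 1: "enorm n (%i. c * e i) = c" "enorm n (%i. b * w i) = b * enorm n w" "enorm n (%i. a * u i) = a * enorm n u"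
    using c e b by (auto simp: enorm_scale)
  have 2: "c - b * enorm n w \<le> enorm n (%i. c * e i + b * w i)" "c - a * enorm n u \<le> enorm n (%i. c * e i + a * u i)"
    using enorm_add_ge[of n "%i. c * e i" "%i. b * w i"] enorm_add_ge[of n "%i. c * e i" "%i. a * u i"] 1 by auto
  have 3: "0 < enorm n (%i. c * e i + b * w i)" "0 < enorm n (%i. c * e i)" "0 < enorm n (%i. c * e i + a * u i)" using assms 1 2 by auto
  have "(%i. b * w i) ~= zv" "(%i. a * u i) ~= zv" "(%i. a * u i) ~= (%i. b * w i)" using 1 b by (metis enorm_zv less_irrefl less_trans)+
  then have "(%i. c * e i + b * w i) ~= (%i. c * e i)" "(%i. c * e i + a * u i) ~= (%i. c * e i)"
     "(%i. c * e i + a * u i) ~= (%i. c * e i + b * w i)" by (auto simp: fun_eq_iff)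
  moreover have "(%i. c * e i + a * u i) ~= zv" "(%i. c * e i + b * w i) ~= zv" "(%i. c * e i) ~= zv"
    using 3 by (metis enorm_zv less_irrefl)+
  ultimately show ?thesis unfolding dtrip_def by auto
qed

lemma lerp_less: "[|0 \<le> s; s \<le> 1; x < (x'::real); y < y'|] ==> (1 - s) * x + s * y < (1 - s) * x' + s * y'"
proof -
  assume "0 \<le> s" "s \<le> 1" "x < x'" "y < y'"
  then have "0 \<le> (1 - s) * (x' - x)" "0 \<le> s * (y' - y)" "(1 - s) * (x' - x) ~= 0 | s * (y' - y) ~= 0" by auto
  then have "0 < (1 - s) * (x' - x) + s * (y' - y)" by linarith
  then show ?thesis by (simp add: algebra_simps)
qed

definition shape :: "nat => real => real => (real => real => real => bool) => 'a rpair => 'a triple => bool" where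
  "shape n \<kappa> \<iota> P z x \<longleftrightarrow> (\<exists>\<alpha> \<beta> \<gamma>. 0 < \<alpha> & 0 < \<beta> & 0 < \<gamma> &
     x = (bpt z, (%i. \<kappa> * \<gamma> * uvec i + \<alpha> * mpt z i), (%i. \<iota> * \<gamma> * uvec i + \<beta> * snd z i), (%i. \<gamma> * uvec i)) &
     P (\<alpha> * enorm n (mpt z)) (\<beta> * enorm n (snd z)) \<gamma>)"

definition convex3 :: "(real => real => real => bool) => bool" where
  "convex3 P \<longleftrightarrow> (\<forall>a b c a' b' c' s. 0 \<le> s & s \<le> 1 & P a b c & P a' b' c' -->
     P ((1 - s) * a + s * a') ((1 - s) * b + s * b') ((1 - s) * c + s * c'))"

lemma shape_lerp:
  assumes P: "convex3 P" and s: "0 \<le> s" "s \<le> 1" and x: "shape n \<kappa> \<iota> P z x" "shape n \<kappa> \<iota> P z x'"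
  shows "shape n \<kappa> \<iota> P z (tlerp s x x')"
proof -
  obtain \<alpha> \<beta> \<gamma> where pos: "0 < \<alpha>" "0 < \<beta>" "0 < \<gamma>"
    and x1: "x = (bpt z, (%i. \<kappa> * \<gamma> * uvec i + \<alpha> * mpt z i), (%i. \<iota> * \<gamma> * uvec i + \<beta> * snd z i), (%i. \<gamma> * uvec i))"
    and P1: "P (\<alpha> * enorm n (mpt z)) (\<beta> * enorm n (snd z)) \<gamma>" using x(1) unfolding shape_def by blast
  obtain \<alpha>' \<beta>' \<gamma>' where pos': "0 < \<alpha>'" "0 < \<beta>'" "0 < \<gamma>'"
    and x2: "x' = (bpt z, (%i. \<kappa> * \<gamma>' * uvec i + \<alpha>' * mpt z i), (%i. \<iota> * \<gamma>' * uvec i + \<beta>' * snd z i), (%i. \<gamma>' * uvec i))"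
    and P2: "P (\<alpha>' * enorm n (mpt z)) (\<beta>' * enorm n (snd z)) \<gamma>'" using x(2) unfolding shape_def by blast
  have "P ((1 - s) * (\<alpha> * enorm n (mpt z)) + s * (\<alpha>' * enorm n (mpt z)))
     ((1 - s) * (\<beta> * enorm n (snd z)) + s * (\<beta>' * enorm n (snd z))) ((1 - s) * \<gamma> + s * \<gamma>')"
    using P s P1 P2 unfolding convex3_def by blast
  moreover have "0 < (1 - s) * \<alpha> + s * \<alpha>'" "0 < (1 - s) * \<beta> + s * \<beta>'" "0 < (1 - s) * \<gamma> + s * \<gamma>'"
    using lerp_less[OF s pos(1) pos'(1)] lerp_less[OF s pos(2) pos'(2)] lerp_less[OF s pos(3) pos'(3)] by auto
  ultimately show ?thesis unfolding shape_def x1 x2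
    by (intro exI[of _ "(1 - s) * \<alpha> + s * \<alpha>'"] exI[of _ "(1 - s) * \<beta> + s * \<beta>'"] exI[of _ "(1 - s) * \<gamma> + s * \<gamma>'"])
      (simp add: algebra_simps)
qed

definition good_shape :: "real => real => (real => real => real => bool) => bool" where
  "good_shape \<kappa> \<iota> P \<longleftrightarrow> convex3 P &
    (\<kappa> = 0 & \<iota> = 0 & (\<forall>a b c. P a b c --> a ~= b & b ~= c & a ~= c) |
     \<kappa> = 0 & \<iota> = 1 & (\<forall>a b c. P a b c --> b < c & c + b < a | a + b < c) |
     \<kappa> = 1 & \<iota> = 1 & (\<forall>a b c. P a b c --> b < a & a < c))"

lemma good_shapes:
  "good_shape 0 0 (%a b c. c < b & b < a)" "good_shape 0 0 (%a b c. b < c & c < a)" "good_shape 0 0 (%a b c. b < a & a < c)"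
  "good_shape 0 1 (%a b c. b < c & c + b < a)" "good_shape 0 1 (%a b c. a + b < c)" "good_shape 1 1 (%a b c. b < a & a < c)"
proof -
  have sum: "(1 - s) * x + s * x' + ((1 - s) * y + s * y') < (1 - s) * z + s * z'"
    if "0 \<le> s" "s \<le> 1" "x + y < z" "x' + y' < z'" for s x x' y y' z z' :: real using lerp_less[OF that] by (simp add: algebra_simps)
  have c: "convex3 (%a b c. c < b & b < a)" "convex3 (%a b c. b < c & c < a)" "convex3 (%a b c. b < a & a < c)"
    "convex3 (%a b c. b < c & c + b < a)" "convex3 (%a b c. a + b < c)" unfolding convex3_def using lerp_less sum by auto
  show "good_shape 0 0 (%a b c. c < b & b < a)" "good_shape 0 0 (%a b c. b < c & c < a)" "good_shape 0 0 (%a b c. b < a & a < c)"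
    "good_shape 0 1 (%a b c. b < c & c + b < a)" "good_shape 0 1 (%a b c. a + b < c)" "good_shape 1 1 (%a b c. b < a & a < c)"
    using c unfolding good_shape_def by auto
qed

lemma shape_distinct:
  assumes g: "good_shape \<kappa> \<iota> P" and x: "shape (Suc k) \<kappa> \<iota> P z x"
    and pos: "0 < enorm (Suc k) (mpt z)" "0 < enorm (Suc k) (snd z)"
  shows "x \<in> dtrip"
proof -
  let ?n = "Suc k"
  obtain \<alpha> \<beta> \<gamma> where abc: "0 < \<alpha>" "0 < \<beta>" "0 < \<gamma>"
    and x: "x = (bpt z, (%i. \<kappa> * \<gamma> * uvec i + \<alpha> * mpt z i), (%i. \<iota> * \<gamma> * uvec i + \<beta> * snd z i), (%i. \<gamma> * uvec i))"
    and P: "P (\<alpha> * enorm ?n (mpt z)) (\<beta> * enorm ?n (snd z)) \<gamma>" using x unfolding shape_def by blast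
  have p: "0 < \<alpha> * enorm ?n (mpt z)" "0 < \<beta> * enorm ?n (snd z)" using abc pos by auto
  consider "\<kappa> = 0" "\<iota> = 0" "\<forall>a b c. P a b c --> a ~= b & b ~= c & a ~= c"
    | "\<kappa> = 0" "\<iota> = 1" "\<forall>a b c. P a b c --> b < c & c + b < a | a + b < c"
    | "\<kappa> = 1" "\<iota> = 1" "\<forall>a b c. P a b c --> b < a & a < c" using g unfolding good_shape_def by blast
  then show ?thesis
  proof cases
    case 1
    then have "\<alpha> * enorm ?n (mpt z) ~= \<beta> * enorm ?n (snd z)" "\<beta> * enorm ?n (snd z) ~= \<gamma> * enorm ?n uvec"
      "\<alpha> * enorm ?n (mpt z) ~= \<gamma> * enorm ?n uvec" using P by auto
    from distinct_radial[OF this] show ?thesis unfolding x 1(1,2) using p abc by simp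
  next
    case 2
    then have "(\<beta> * enorm ?n (snd z) < \<gamma> & \<gamma> + \<beta> * enorm ?n (snd z) < \<alpha> * enorm ?n (mpt z)) | \<alpha> * enorm ?n (mpt z) < \<gamma> - \<beta> * enorm ?n (snd z)"
      using P by force
    from distinct_cluster[OF enorm_uvec _ _ _ _ this] show ?thesis unfolding x 2(1,2) using p abc by simp
  next
    case 3
    then have "\<beta> * enorm ?n (snd z) < \<alpha> * enorm ?n (mpt z)" "\<alpha> * enorm ?n (mpt z) < \<gamma>" using P by auto
    from distinct_nested[OF enorm_uvec _ this] show ?thesis unfolding x 3(1,2) using p abc by simp
  qed
qed

lemma quarter_weights:
  fixes a b :: real
  assumes "0 \<le> a" "0 \<le> b"
  shows "0 < 1/4/(1 + a + b)" "1/4/(1 + a + b) * a < 1/4" "1/4/(1 + a + b) * b < 1/4"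
    "1/4/(1 + a + b) * a + 1/4/(1 + a + b) * b < 1/4" using assms by (simp_all add: divide_simps)

context commutator
begin

abbreviation "T3 == tspace n Y"
abbreviation "U z == enorm n (mpt z)"
abbreviation "W z == enorm n (snd z)"

lemma TS_pos:
  assumes "z \<in> tops TS"
  shows "0 < U z" "0 < W z" using assms enorm_pos_iff[of "mpt z" n] enorm_pos_iff[of "snd z" n] by auto

lemma TS_cont:
  "cmap TS Y (%z. bpt z)" "cmap TS E (%z. mpt z)" "cmap TS E (%z. snd z)"
proof -
  have 1: "cmap TS (ptop Y (E0 n)) fst" "cmap TS (E0 n) (%z. snd z)" by (simp_all add: cont_fst cont_snd)
  show "cmap TS Y (%z. bpt z)" by (rule cm_fst[OF 1(1)])
  show "cmap TS E (%z. mpt z)" "cmap TS E (%z. snd z)" using cm_snd[OF 1(1)] 1(2) by (simp_all add: cont_in_subtop)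
qed

lemma E_const: "cmap X E (%z i. c * uvec i)" using uvec_in[of k] by (intro cont_scale) (auto simp: cont_const)

lemma V_shape:
  assumes g: "good_shape \<kappa> \<iota> P" and c: "cmap TS (T3) F" "cmap TS (T3) G"
    and F: "!!z. z \<in> tops TS ==> shape n \<kappa> \<iota> P z (F z)" and G: "!!z. z \<in> tops TS ==> shape n \<kappa> \<iota> P z (G z)"
  shows "eqv (V F) (V G)"
proof (rule V_straight[OF c])
  show "fst (F z) = fst (G z)" if "z \<in> tops TS" for z using F[OF that] G[OF that] unfolding shape_def by auto
  fix s z assume s: "0 \<le> s" "(s::real) \<le> 1" "z \<in> tops TS"
  have "convex3 P" using g by (simp add: good_shape_def)
  have sh: "shape n \<kappa> \<iota> P z (tlerp s (F z) (G z))"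
    by (rule shape_lerp[OF \<open>convex3 P\<close> s(1,2) F[OF s(3)] G[OF s(3)]])
  show "(tlerp s (F z) (G z)) \<in> dtrip" by (rule shape_distinct[OF g sh TS_pos[OF s(3)]])
qed

lemma shape_C3:
  assumes g: "good_shape \<kappa> \<iota> P" and c: "cmap TS (T3) F"
    and F: "!!z. z \<in> tops TS ==> shape n \<kappa> \<iota> P z (F z)"
  shows "cmap TS C3 F"
proof (intro cont_subI c)
  fix z assume z: "z \<in> tops TS"
  show "F z \<in> dtrip" by (rule shape_distinct[OF g F[OF z] TS_pos[OF z]])
qed

abbreviation "ev == (%i. 1 / 4 * uvec i)"
abbreviation "hv == (%i. 1 / 2 * uvec i)"

abbreviation "F0 == (%z :: 'a rpair. (bpt z, (%i. 1 / U z * mpt z i), (%i. 1 / 2 / W z * snd z i), ev))"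
abbreviation "F1 == (%z :: 'a rpair. (bpt z, (%i. 1 * uvec i), (%i. 1 / 2 / U z * mpt z i), (%i. 1 / 4 / W z * snd z i)))"
abbreviation "F1p == (%z :: 'a rpair. (bpt z, (%i. 1 / 2 / U z * mpt z i), (%i. 1 / 4 / W z * snd z i), (%i. 1 * uvec i)))"

definition "\<Phi>1 = (%z :: 'a rpair. (bpt z, (%i. (1 + W z) / U z * mpt z i), snd z, ev))"
definition "\<Phi>2 = (%z :: 'a rpair. (bpt z, mpt z, (%i. min (U z) (1/2) / 2 * sig n (snd z) i), hv))"
definition "\<Phi>3 = (%z :: 'a rpair. (bpt z, mpt z,
  (%i. ev i + min (enorm n (%i. mpt z i - ev i)) (1/4) / 2 * sig n (snd z) i), ev))"
abbreviation "cc == (%z :: 'a rpair. 1 / 4 / (1 + U z + W z))"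
definition "\<Phi>4 = (%z :: 'a rpair. (bpt z,
  (%i. 1 * uvec i + cc z * mpt z i), (%i. 1 * uvec i + cc z * snd z i), (%i. 1 * uvec i)))"

abbreviation "\<Phi>1s == (%z. \<Phi>1 (crs n (%_. ev) z))"
abbreviation "\<Phi>1l == (%z. \<Phi>1 (crl n (%_. ev) z))"
abbreviation "\<Phi>1b == (%z. \<Phi>1 (crb n (%_. ev) z))"
abbreviation "\<Phi>2s == (%z. \<Phi>2 (crs n (%_. hv) (fst z), snd z))"
abbreviation "\<Phi>2l == (%z. \<Phi>2 (crl n (%_. hv) (fst z), snd z))"
abbreviation "\<Phi>2b == (%z. \<Phi>2 (crb n (%_. hv) (fst z), snd z))"
abbreviation "\<Phi>3s == (%z. \<Phi>3 (crs n (%_. ev) (fst z), snd z))"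
abbreviation "\<Phi>3l == (%z. \<Phi>3 (crl n (%_. ev) (fst z), snd z))"
abbreviation "\<Phi>3b == (%z. \<Phi>3 (crb n (%_. ev) (fst z), snd z))"
abbreviation "\<Phi>4s == (%z. \<Phi>4 (crs n snd z))"
abbreviation "\<Phi>4l == (%z. \<Phi>4 (crl n snd z))"
abbreviation "\<Phi>4b == (%z. \<Phi>4 (crb n snd z))"

lemmas cc_pos = quarter_weights[OF enorm_nonneg enorm_nonneg, of n "mpt z" n "snd z" for z]

lemma cm_Phi:
  assumes y: "cmap X Y yy" and u: "cmap X E uu" and w: "cmap X E ww"
  shows "(!!x. x \<in> tops X ==> uu x ~= zv) ==> cmap X (T3) (%x. \<Phi>1 ((yy x, uu x), ww x))"
    "cmap X (T3) (%x. \<Phi>2 ((yy x, uu x), ww x))"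
    "cmap X (T3) (%x. \<Phi>3 ((yy x, uu x), ww x))"
    "cmap X (T3) (%x. \<Phi>4 ((yy x, uu x), ww x))"
proof -
  note s = cont_triple y u w cont_scale cont_sig E_const
    cont_Euc_add
  note r = cont_real_divide continuous_map_real_min continuous_map_add cont_cconst
    cont_enorm[OF u, of n] cont_enorm[OF w, of n]
  have p: "0 < 1 + enorm n (uu x) + enorm n (ww x)" for x using enorm_nonneg[of n "uu x"] enorm_nonneg[of n "ww x"] by linarith
  have p': "1 + enorm n (uu x) + enorm n (ww x) ~= 0" for x using p[of x] by linarith
  show "cmap X (T3) (%x. \<Phi>1 ((yy x, uu x), ww x))" if nz: "!!x. x \<in> tops X ==> uu x ~= zv"
  proof -
    have "enorm n (uu x) ~= 0" if "x \<in> tops X" for x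
    proof -
      have "uu x \<in> tops E" using cont_fun[OF u] that by blast
      then show ?thesis using enorm_pos_iff[of "uu x" n] nz[OF that] by simp
    qed
    then have "cmap X Rtop (%x. (1 + enorm n (ww x)) / enorm n (uu x))" by (intro r)
    then show ?thesis unfolding \<Phi>1_def fst_conv snd_conv by (intro s)
  qed
  show "cmap X (T3) (%x. \<Phi>2 ((yy x, uu x), ww x))"
  proof -
    have "cmap X Rtop (%x. min (enorm n (uu x)) (1/2) / 2)" by (intro r) simp
    then show ?thesis unfolding \<Phi>2_def fst_conv snd_conv by (intro s)
  qed
  show "cmap X (T3) (%x. \<Phi>4 ((yy x, uu x), ww x))"
  proof -
    have "cmap X Rtop (%x. 1 / 4 / (1 + enorm n (uu x) + enorm n (ww x)))" by (intro r) (simp add: p')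
    then show ?thesis unfolding \<Phi>4_def fst_conv snd_conv by (intro s)
  qed
  have "cmap X E (%x i. uu x i - ev i)" using cont_Euc_add[OF u cont_uminus_Euclidean[OF E_const[of X "1/4"]]] by simp
  note e = cont_enorm[OF this, of n]
  show "cmap X (T3) (%x. \<Phi>3 ((yy x, uu x), ww x))"
  proof -
    have "cmap X Rtop (%x. min (enorm n (%i. uu x i - ev i)) (1/4) / 2)" by (intro e r) simp
    then show ?thesis unfolding \<Phi>3_def fst_conv snd_conv by (intro s)
  qed
qed

lemma Phi_C3:
  "cmap (cspace (ptop Y (E0 n)) (%_. ev)) C3 \<Phi>1"
  "cmap (ptop (cspace Y (%_. hv)) (E0 n)) C3 \<Phi>2"
  "cmap (ptop (cspace Y (%_. ev)) (E0 n)) C3 \<Phi>3"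
  "cmap (cspace (ptop Y (E0 n)) snd) C3 \<Phi>4"
proof -
  have a: "cmap (cspace (ptop Y (E0 n)) \<zeta>) Y (%z. bpt z)"
    "cmap (cspace (ptop Y (E0 n)) \<zeta>) E (%z. mpt z)"
    "cmap (cspace (ptop Y (E0 n)) \<zeta>) E (%z. snd z)" for \<zeta>
  proof -
    have 1: "cmap (cspace (ptop Y (E0 n)) \<zeta>) (ptop Y (E0 n)) fst" by (simp add: cont_from_sub cont_fst)
    show "cmap (cspace (ptop Y (E0 n)) \<zeta>) Y (%z. bpt z)" by (rule cm_fst[OF 1])
    show "cmap (cspace (ptop Y (E0 n)) \<zeta>) E (%z. mpt z)" using cm_snd[OF 1] by (simp add: cont_in_subtop)
    show "cmap (cspace (ptop Y (E0 n)) \<zeta>) E (%z. snd z)" by (simp add: cont_from_sub cont_snd)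
  qed
  have b: "cmap (ptop (cspace Y \<zeta>) (E0 n)) Y (%z. bpt z)"
    "cmap (ptop (cspace Y \<zeta>) (E0 n)) E (%z. mpt z)"
    "cmap (ptop (cspace Y \<zeta>) (E0 n)) E (%z. snd z)" for \<zeta>
  proof -
    have "cmap (ptop (cspace Y \<zeta>) (E0 n)) (cspace Y \<zeta>) fst" by (rule cont_fst)
    then have 1: "cmap (ptop (cspace Y \<zeta>) (E0 n)) (ptop Y E) fst"  by (simp add: cont_in_subtop)
    show "cmap (ptop (cspace Y \<zeta>) (E0 n)) Y (%z. bpt z)" by (rule cm_fst[OF 1])
    show "cmap (ptop (cspace Y \<zeta>) (E0 n)) E (%z. mpt z)" by (rule cm_snd[OF 1])
    have "cmap (ptop (cspace Y \<zeta>) (E0 n)) (E0 n) snd" by (rule cont_snd)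
    then show "cmap (ptop (cspace Y \<zeta>) (E0 n)) E (%z. snd z)" by (simp add: cont_in_subtop)
  qed
  have en: "enorm n (%i. c * uvec i) = \<bar>c\<bar>" for c unfolding enorm_scale by simp
  have e: "(%i. c * uvec i) ~= zv" if "c ~= 0" for c using that by (intro enorm_neq[of n]) (unfold en, simp)
  have e: "ev ~= zv" "hv ~= zv" "(%i. 1 * uvec i) ~= zv" by (rule e, simp)+
  have pos: "0 < enorm n u" if "u \<in> tops E" "u ~= zv" for u using that enorm_pos_iff by blast
  show "cmap (cspace (ptop Y (E0 n)) (%_. ev)) C3 \<Phi>1"
  proof (rule cont_subI)
    show "cmap (cspace (ptop Y (E0 n)) (%_. ev)) (T3) \<Phi>1" by (rule cm_Phi(1)[OF a[of "%_. ev"], unfolded prod.collapse]) auto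
    fix z assume "z \<in> tops (cspace (ptop Y (E0 n)) (%_. ev))"
    then have z: "mpt z \<in> tops E" "mpt z ~= zv" "snd z \<in> tops E" "snd z ~= zv" "snd z ~= ev" by auto
    let ?A = "%i. (1 + W z) / U z * mpt z i"
    have A: "enorm n ?A = 1 + W z" unfolding enorm_scale using pos[OF z(1,2)] enorm_nonneg[of n "snd z"] by simp
    have "?A ~= zv" "?A ~= snd z" "?A ~= ev" by (rule enorm_neq[of n]; unfold A en enorm_zv; use enorm_nonneg[of n "snd z"] in linarith)+
    then show "\<Phi>1 z \<in> dtrip" unfolding \<Phi>1_def dtrip_def mem_Collect_eq prod.case using z e by metis
  qed
  show "cmap (ptop (cspace Y (%_. hv)) (E0 n)) C3 \<Phi>2"
  proof (rule cont_subI)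
    show "cmap (ptop (cspace Y (%_. hv)) (E0 n)) (T3) \<Phi>2" using cm_Phi(2)[OF b[of "%_. hv"]] by simp
    fix z assume "z \<in> tops (ptop (cspace Y (%_. hv)) (E0 n))"
    then have z: "mpt z \<in> tops E" "mpt z ~= zv" "mpt z ~= hv" "snd z \<in> tops E" "snd z ~= zv" by auto
    let ?m = "min (U z) (1/2)"
    let ?B = "%i. ?m / 2 * sig n (snd z) i"
    have m: "0 < ?m" using pos[OF z(1,2)] by simp
    have B: "enorm n ?B < ?m / 2" "?B ~= zv" using enorm_half_sig_less[OF m] posmult[of "?m / 2"] m z by auto
    have mm: "?m \<le> U z" "?m \<le> 1/2" by simp_all
    have "?B ~= mpt z" using B(1) m mm(1) by (intro enorm_neq[of n]) linarith
    moreover have "enorm n hv = 1/2" unfolding en by simp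
    then have "?B ~= hv" using B(1) m mm(2) by (intro enorm_neq[of n]) linarith
    ultimately show "\<Phi>2 z \<in> dtrip" unfolding \<Phi>2_def dtrip_def mem_Collect_eq prod.case using z e B(2) by metis
  qed
  have add: "(%i. v i + (u i :: real)) ~= v" if "u ~= zv" for u v :: "nat => real" using that by (auto simp: fun_eq_iff)
  show "cmap (ptop (cspace Y (%_. ev)) (E0 n)) C3 \<Phi>3"
  proof (rule cont_subI)
    show "cmap (ptop (cspace Y (%_. ev)) (E0 n)) (T3) \<Phi>3" using cm_Phi(3)[OF b[of "%_. ev"]] by simp
    fix z assume "z \<in> tops (ptop (cspace Y (%_. ev)) (E0 n))"
    then have z: "mpt z \<in> tops E" "mpt z ~= zv" "mpt z ~= ev" "snd z \<in> tops E" "snd z ~= zv" by auto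
    let ?m = "min (enorm n (%i. mpt z i - ev i)) (1/4)"
    let ?B = "%i. ?m / 2 * sig n (snd z) i"
    have "(%i. mpt z i - ev i) \<in> tops E" "(%i. mpt z i - ev i) ~= zv" using z uvec_in[of k] by (auto simp: top_Euc fun_eq_iff)
    then have m: "0 < ?m" using pos by simp
    have B: "enorm n ?B < ?m / 2" "?B ~= zv" using enorm_half_sig_less[OF m] posmult[of "?m / 2"] m z by auto
    have "enorm n ev = 1/4" unfolding en by simp
    then have "1/4 - ?m / 2 < enorm n (%i. ev i + ?B i)" using enorm_add_ge[of n ev ?B] B(1) by linarith
    then have "(%i. ev i + ?B i) ~= zv" using min.cobounded2[of "enorm n (%i. mpt z i - ev i)" "1/4"]
      by (intro enorm_neq[of n]) (unfold enorm_zv, linarith)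
    moreover have "mpt z ~= (%i. ev i + ?B i)"
    proof
      assume eq: "mpt z = (%i. ev i + ?B i)"
      have "enorm n (%i. mpt z i - ev i) = enorm n ?B" by (subst (1) eq) simp
      then show False using B(1) m by linarith
    qed
    ultimately show "\<Phi>3 z \<in> dtrip" unfolding \<Phi>3_def dtrip_def mem_Collect_eq prod.case using z e add[OF B(2), of ev] by metis
  qed
  show "cmap (cspace (ptop Y (E0 n)) snd) C3 \<Phi>4"
  proof (rule cont_subI)
    show "cmap (cspace (ptop Y (E0 n)) snd) (T3) \<Phi>4" using cm_Phi(4)[OF a[of snd]] by simp
    fix z assume "z \<in> tops (cspace (ptop Y (E0 n)) snd)"
    then have z: "mpt z ~= zv" "snd z ~= zv" "snd z ~= mpt z" by auto
    define c where "c = cc z"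
    have c: "0 < c" "c * U z < 1/4" "c * W z < 1/4" using cc_pos[of z] unfolding c_def by blast+
    have nz: "(%i. 1 * uvec i + c * v i) ~= zv" if "c * enorm n v < 1/4" for v
    proof (rule enorm_neq[of n])
      have "1 - c * enorm n v \<le> enorm n (%i. 1 * uvec i + c * v i)"
        using enorm_add_ge[of n "%i. 1 * uvec i" "%i. c * v i"] c(1) unfolding en enorm_scale[of n c] by simp
      then show "enorm n (%i. 1 * uvec i + c * v i) ~= enorm n zv" using that unfolding enorm_zv by linarith
    qed
    have neq: "(%i. 1 * uvec i + c * mpt z i) ~= (%i. 1 * uvec i + c * snd z i)"
    proof
      assume eq: "(%i. 1 * uvec i + c * mpt z i) = (%i. 1 * uvec i + c * snd z i)"
      have "mpt z i = snd z i" for i using fun_cong[OF eq, of i] c(1) by simp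
      then show False using z(3) by auto
    qed
    note N = nz[OF c(2)] nz[OF c(3)] e(3) neq add[OF posmult[OF c(1) z(2)]] add[OF posmult[OF c(1) z(1)]]
    show "\<Phi>4 z \<in> dtrip" unfolding \<Phi>4_def dtrip_def c_def[symmetric] mem_Collect_eq prod.case by (intro conjI N)
  qed
qed

lemma TS_ne:
  assumes "z \<in> tops TS"
  shows "U z ~= 0" "W z ~= 0" "mpt z ~= zv" "snd z ~= zv" using TS_pos[OF assms] by auto

lemmas TS_real = cont_real_divide continuous_map_real_mult cont_cconst continuous_map_add
  cont_enorm[OF TS_cont(2), of n] cont_enorm[OF TS_cont(3), of n] TS_ne

lemma TS_cross:
  assumes \<zeta>: "cmap TS E \<zeta>" and v: "cmap TS E v" and nz: "!!z. z \<in> tops TS ==> enorm n (v z) ~= 0"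
  shows "cmap TS E (%z i. 2 * enorm n (\<zeta> z) / enorm n (v z) * v z i)"
    "cmap TS E (%z i. enorm n (\<zeta> z) / 2 * sig n (v z) i)"
    "cmap TS E (%z i. \<zeta> z i + enorm n (\<zeta> z) / 2 * sig n (v z) i)"
proof -
  note r = cont_real_divide continuous_map_real_mult cont_cconst
    cont_enorm[OF \<zeta>, of n] cont_enorm[OF v, of n]
  have 1: "cmap TS Rtop (%z. 2 * enorm n (\<zeta> z) / enorm n (v z))"
    "cmap TS Rtop (%z. enorm n (\<zeta> z) / 2)" by (intro r nz | simp)+
  show "cmap TS E (%z i. 2 * enorm n (\<zeta> z) / enorm n (v z) * v z i)" by (rule cont_scale[OF 1(1) v])
  show 2: "cmap TS E (%z i. enorm n (\<zeta> z) / 2 * sig n (v z) i)" by (rule cont_scale[OF 1(2) cont_sig[OF v]])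
  show "cmap TS E (%z i. \<zeta> z i + enorm n (\<zeta> z) / 2 * sig n (v z) i)" by (rule cont_Euc_add[OF \<zeta> 2])
qed

lemma shapeI:
  assumes "0 < \<alpha>" "0 < \<beta>" "0 < \<gamma>" "P (\<alpha> * U z) (\<beta> * W z) \<gamma>"
    "A = (%i. \<kappa> * \<gamma> * uvec i + \<alpha> * mpt z i)" "B = (%i. \<iota> * \<gamma> * uvec i + \<beta> * snd z i)" "C = (%i. \<gamma> * uvec i)"
  shows "shape n \<kappa> \<iota> P z (bpt z, A, B, C)" unfolding shape_def using assms by blast

lemma enorm_uvec: "enorm n (%i. c * uvec i) = \<bar>c\<bar>" unfolding enorm_scale by simp

lemma enorm_posscale: "0 \<le> c ==> enorm n (%i. c * u i) = c * enorm n u" unfolding enorm_scale by simp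

lemma V_expand1: "eqv (V F0) (V \<Phi>1s + V \<Phi>1l)"
proof -
  have cF0: "cmap TS (T3) F0"
  proof (intro cont_triple TS_cont E_const cont_scale)
    show "cmap TS Rtop (%x. 1 / enorm n (mpt x))" "cmap TS Rtop (%x. 1 / 2 / enorm n (snd x))" by (intro TS_real | simp)+
  qed
  have eq: "\<Phi>1b = (%z. \<Phi>1 ((bpt z, mpt z), %i. 2 * enorm n ev / W z * snd z i))" by (simp add: crb_def)
  have "eqv (V F0) (V \<Phi>1b)"
  proof (rule V_shape[OF good_shapes(1) cF0])
    show "cmap TS (T3) \<Phi>1b" unfolding eq by (intro cm_Phi(1) TS_cont TS_cross E_const TS_ne)
    fix z assume z: "z \<in> tops TS"
    note UW = TS_pos[OF z]
    have e1: "enorm n ev = 1/4" unfolding enorm_uvec by simp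
    show "shape n 0 0 (%a b c. c < b & b < a) z (F0 z)" by (rule shapeI[of "1 / U z" "1 / 2 / W z" "1/4"]) (use UW in auto)
    have e2: "enorm n (%i. 2 * (1/4) / W z * snd z i) = 1/2" using UW unfolding enorm_scale by simp
    show "shape n 0 0 (%a b c. c < b & b < a) z (\<Phi>1b z)" unfolding \<Phi>1_def crb_def fst_conv snd_conv e1 e2
      by (rule shapeI[of "(1 + 1/2) / U z" "2 * (1/4) / W z" "1/4"]) (use UW in auto)
  qed
  also have "eqv \<dots> (V \<Phi>1s + V \<Phi>1l)"
    by (rule V_cross2[OF E_const _ Phi_C3(1)]) (rule enorm_neq[of n], unfold enorm_uvec, simp)
  finally show ?thesis .
qed

lemma ev_norm: "enorm n ev = 1/4" "enorm n hv = 1/2" unfolding enorm_uvec by simp_all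

lemma sig_norm: "0 \<le> c ==> enorm n (%i. c * sig n u i) = c / (1 + enorm n u) * enorm n u" by (simp add: enorm_posscale enorm_sig)

lemma sig_weight:
  assumes "0 < c"
  shows "0 < c / (1 + enorm n u)" "c / (1 + enorm n u) * enorm n u < c" using assms enorm_add1_pos(1)[of n u] by (simp_all add: field_simps)

lemma V_expand2: "eqv (V \<Phi>1s)
  (V \<Phi>2s + V \<Phi>2l)"
proof -
  have "eqv (V \<Phi>1s) (V \<Phi>2b)"
  proof (rule V_shape[OF good_shapes(2)])
    have eq: "\<Phi>1s = (%z. \<Phi>1 ((bpt z, mpt z), %i. enorm n ev / 2 * sig n (snd z) i))" by (simp add: crs_def)
    show "cmap TS (T3) \<Phi>1s" unfolding eq by (intro cm_Phi(1) TS_cont TS_cross E_const TS_ne)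
    have eq: "\<Phi>2b = (%z. \<Phi>2 ((bpt z, %i. 2 * enorm n hv / U z * mpt z i), snd z))" by (simp add: crb_def)
    show "cmap TS (T3) \<Phi>2b" unfolding eq by (intro cm_Phi(2) TS_cont TS_cross E_const TS_ne)
    fix z assume z: "z \<in> tops TS"
    note UW = TS_pos[OF z]
    have "0 < (1/8::real)" "0 < (1/4::real)" by simp_all
    note w = sig_weight[OF this(1), of "snd z"] sig_weight[OF this(2), of "snd z"]
    have e8: "1/4/2 = (1/8::real)" "0 \<le> (1/8::real)" by simp_all
    show "shape n 0 0 (%a b c. b < c & c < a) z (\<Phi>1s z)"
      unfolding \<Phi>1_def crs_def fst_conv snd_conv ev_norm e8 sig_norm[OF e8(2)] unfolding sig_def
      by (rule shapeI[of "(1 + 1/8 / (1 + W z) * W z) / U z" "1/8 / (1 + W z)" "1/4"])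
        (use UW w in \<open>auto simp: add_pos_nonneg\<close>)
    have e2: "enorm n (%i. 2 * (1/2) / U z * mpt z i) = 1" using UW unfolding enorm_scale by simp
    have e3: "min 1 (1/2) / 2 = (1/4::real)" "0 \<le> (1/4::real)" by simp_all
    show "shape n 0 0 (%a b c. b < c & c < a) z (\<Phi>2b z)"
      unfolding \<Phi>2_def crb_def fst_conv snd_conv ev_norm e2 e3 unfolding sig_def
      by (rule shapeI[of "2 * (1/2) / U z" "1/4 / (1 + W z)" "1/2"]) (use UW w in auto)
  qed
  also have "eqv (V \<Phi>2b)
     (V \<Phi>2s + V \<Phi>2l)" by (rule V_cross1[OF E_const _ Phi_C3(2)]) (rule enorm_neq[of n], unfold enorm_uvec, simp)
  finally show ?thesis .
qed

lemma cm_Phi3: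
  "cmap TS (T3) \<Phi>3s" "cmap TS (T3) \<Phi>3l"
proof -
  have eq: "\<Phi>3s = (%z. \<Phi>3 ((bpt z, %i. enorm n ev / 2 * sig n (mpt z) i), snd z))"
    "\<Phi>3l = (%z. \<Phi>3 ((bpt z, %i. ev i + enorm n ev / 2 * sig n (mpt z) i), snd z))" by (simp_all add: crs_def crl_def)
  show "cmap TS (T3) \<Phi>3s" unfolding eq(1) by (rule cm_Phi(3)[OF TS_cont(1) TS_cross(2)[OF E_const TS_cont(2) TS_ne(1)] TS_cont(3)])
  show "cmap TS (T3) \<Phi>3l" unfolding eq(2) by (rule cm_Phi(3)[OF TS_cont(1) TS_cross(3)[OF E_const TS_cont(2) TS_ne(1)] TS_cont(3)])
qed

lemma V_expand3: "eqv (V \<Phi>1l) (V \<Phi>3s + V \<Phi>3l)"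
proof -
  have "eqv (V \<Phi>1l) (V \<Phi>3b)"
  proof (rule V_shape[OF good_shapes(4)])
    have eq: "\<Phi>1l = (%z. \<Phi>1 ((bpt z, mpt z), %i. ev i + enorm n ev / 2 * sig n (snd z) i))" by (simp add: crl_def)
    show "cmap TS (T3) \<Phi>1l" unfolding eq by (intro cm_Phi(1) TS_cont TS_cross(3)[OF E_const] TS_ne)
    have eq: "\<Phi>3b = (%z. \<Phi>3 ((bpt z, %i. 2 * enorm n ev / U z * mpt z i), snd z))" by (simp add: crb_def)
    show "cmap TS (T3) \<Phi>3b" unfolding eq by (intro cm_Phi(3) TS_cont TS_cross E_const TS_ne)
    fix z assume z: "z \<in> tops TS"
    note UW = TS_pos[OF z]
    have e8: "1/4/2 = (1/8::real)" "0 \<le> (1/8::real)" "0 < (1/8::real)" by simp_all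
    define N where "N = enorm n (%i. ev i + 1/8 * sig n (snd z) i)"
    have N: "0 < (1 + N) / U z" "0 \<le> N" using UW enorm_add1_pos(1) unfolding N_def by simp_all
    have "(1 + N) / U z * U z = 1 + N" using UW by simp
    then have P: "1/8 / (1 + W z) * W z < 1/4 & 1/4 + 1/8 / (1 + W z) * W z < (1 + N) / U z * U z"
      using sig_weight(2)[OF e8(3), of "snd z"] N(2) by linarith
    show "shape n 0 1 (%a b c. b < c & c + b < a) z (\<Phi>1l z)"
      unfolding \<Phi>1_def crl_def fst_conv snd_conv ev_norm e8(1) N_def[symmetric] unfolding sig_def
      by (rule shapeI[of "(1 + N) / U z" "1/8 / (1 + W z)" "1/4"])
        (use UW N P sig_weight(1)[OF e8(3), of "snd z"] in \<open>simp_all only:, simp_all\<close>)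
    let ?x = "%i. 2 * (1/4) / U z * mpt z i"
    define m where "m = min (enorm n (%i. ?x i - ev i)) (1/4) / 2"
    have "enorm n ?x = 1/2" using UW unfolding enorm_scale by simp
    then have "1/4 \<le> enorm n (%i. ?x i - ev i)" using enorm_diff_ge[of n ?x ev] unfolding ev_norm by simp
    then have m: "m = 1/8" unfolding m_def by simp
    have "2 * (1/4) / U z * U z = 1/2" using UW by simp
    then have P2: "1/8 / (1 + W z) * W z < 1/4 & 1/4 + 1/8 / (1 + W z) * W z < 2 * (1/4) / U z * U z"
      using sig_weight(2)[OF e8(3), of "snd z"] by linarith
    show "shape n 0 1 (%a b c. b < c & c + b < a) z (\<Phi>3b z)"
      unfolding \<Phi>3_def crb_def fst_conv snd_conv ev_norm m_def[symmetric] m unfolding sig_def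
      by (rule shapeI[of "2 * (1/4) / U z" "1/8 / (1 + W z)" "1/4"])
        (use UW P2 sig_weight(1)[OF e8(3), of "snd z"] in \<open>simp_all only:, simp_all\<close>)
  qed
  also have "eqv (V \<Phi>3b) (V \<Phi>3s + V \<Phi>3l)"
    by (rule V_cross1[OF E_const _ Phi_C3(3)]) (rule enorm_neq[of n], unfold enorm_uvec, simp)
  finally show ?thesis .
qed

lemma shape_Phi3:
  assumes z: "z \<in> tops TS"
  shows "shape n 0 1 (%a b c. a + b < c) z (\<Phi>3s z)" "shape n 1 1 (%a b c. b < a & a < c) z (\<Phi>3l z)"
proof -
  note UW = TS_pos[OF z]
  have e8: "1/4/2 = (1/8::real)" "0 \<le> (1/8::real)" "0 < (1/8::real)" by simp_all
  define x where "x = (%i. 1/8 * sig n (mpt z) i)"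
  define N where "N = enorm n x"
  have N: "N < 1/8" "0 < N" "N = 1/8 / (1 + U z) * U z"
    using sig_weight[OF e8(3), of "mpt z"] UW unfolding N_def x_def sig_norm[OF e8(2)] by simp_all
  define m where "m = min (enorm n (%i. x i - ev i)) (1/4) / 2"
  have "(%i. x i - ev i) = (%i. - (ev i - x i))" by simp
  then have "1/4 - N \<le> enorm n (%i. x i - ev i)" using enorm_diff_ge[of n ev x] unfolding N_def ev_norm by (simp only: enorm_minus)
  then have "0 < enorm n (%i. x i - ev i)" using N(1) by linarith
  then have m: "0 < m" "m \<le> 1/8" using min.cobounded2[of "enorm n (%i. x i - ev i)" "1/4"] unfolding m_def by (simp, linarith)
  have "1/8 / (1 + U z) * U z + m / (1 + W z) * W z < 1/4" using sig_weight(2)[OF m(1), of "snd z"] m N by linarith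
  then show "shape n 0 1 (%a b c. a + b < c) z (\<Phi>3s z)"
    unfolding \<Phi>3_def crs_def fst_conv snd_conv ev_norm e8 x_def[symmetric] m_def[symmetric] unfolding x_def sig_def
    by (intro shapeI[of "1/8 / (1 + U z)" "m / (1 + W z)" "1/4"] sig_weight(1) e8(3) m(1)) auto
  define l where "l = min N (1/4) / 2"
  have l: "l = N / 2" using N unfolding l_def by simp
  have eq: "(%i. ev i + x i - ev i) = x" by simp
  have lpos: "0 < l" using l N(2) by linarith
  have "l / (1 + W z) * W z < 1/8 / (1 + U z) * U z &
     1/8 / (1 + U z) * U z < 1/4" using sig_weight(2)[OF lpos, of "snd z"] l N by linarith
  moreover have eq: "\<Phi>3l z = (bpt z, (%i. ev i + x i), (%i. ev i + l * sig n (snd z) i), ev)"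
    unfolding \<Phi>3_def crl_def fst_conv snd_conv ev_norm e8 l_def N_def x_def by simp
  ultimately show "shape n 1 1 (%a b c. b < a & a < c) z (\<Phi>3l z)" unfolding eq x_def sig_def
    by (intro shapeI[of "1/8 / (1 + U z)" "l / (1 + W z)" "1/4"] sig_weight(1) e8(3) lpos) simp_all
qed

lemma sphswap_sphswap: "sphswap (sphswap z) = z" by (simp add: sphswap_def)

lemma V_link2: "eqv (V \<Phi>2l) (scal (- a) (V \<Phi>3s))"
proof -
  let ?F = "%z. \<Phi>2 (crl n (%_. hv) (fst z), snd z)"
  let ?G = "%z. perm12 (?F (sphswap z))"
  have cF: "cmap TS (T3) ?F"
  proof -
    have eq: "?F = (%z. \<Phi>2 ((bpt z, %i. hv i + enorm n hv / 2 * sig n (mpt z) i), snd z))" by (simp add: crl_def)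
    show ?thesis unfolding eq by (rule cm_Phi(2)[OF TS_cont(1) TS_cross(3)[OF E_const TS_cont(2) TS_ne(1)] TS_cont(3)])
  qed
  have swTS: "sphswap z \<in> tops TS" if "z \<in> tops TS" for z using cont_fun[OF cont_sphswap[of Y "E0 n" "E0 n"]] that by blast
  have shG: "shape n 0 1 (%a b c. a + b < c) z (?G z)" if z: "z \<in> tops TS" for z
  proof -
    note UW = TS_pos[OF z]
    have e8: "1/2/2 = (1/4::real)" "0 \<le> (1/4::real)" "0 < (1/4::real)" by simp_all
    let ?x = "%i. hv i + 1/4 * sig n (snd z) i"
    define m where "m = min (enorm n ?x) (1/2) / 2"
    have "1/4 < enorm n ?x"
      using enorm_add_ge[of n hv "%i. 1/4 * sig n (snd z) i"] sig_weight(2)[OF e8(3), of "snd z"] unfolding ev_norm sig_norm[OF e8(2)] by linarith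
    then have "0 < enorm n ?x" by linarith
    then have m: "0 < m" "m \<le> 1/4" using min.cobounded2[of "enorm n ?x" "1/2"] unfolding m_def by (simp, linarith)
    have "m / (1 + U z) * U z + 1/4 / (1 + W z) * W z < 1/2"
      using sig_weight(2)[OF m(1), of "mpt z"] sig_weight(2)[OF e8(3), of "snd z"] m by linarith
    then show ?thesis
      unfolding \<Phi>2_def crl_def perm12_def sphswap_def fst_conv snd_conv prod.case ev_norm e8 m_def[symmetric] unfolding sig_def
      by (intro shapeI[of "m / (1 + U z)" "1/4 / (1 + W z)" "1/2"] sig_weight(1) e8(3) m(1)) auto
  qed
  have FD: "cmap TS C3 ?F"
  proof (intro cont_subI cF)
    fix z assume z: "z \<in> tops TS"
    have "perm12 (?F z) \<in> dtrip"
      using shape_distinct[OF good_shapes(5) shG[OF swTS[OF z]] TS_pos[OF swTS[OF z]]] by (simp add: sphswap_sphswap)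
    then show "?F z \<in> dtrip" by (auto simp: perm12_def dtrip_def split: prod.splits)
  qed
  have GD: "cmap TS C3 ?G" using cont_comp[OF cont_sphswap cont_comp[OF FD cont_perms(1)]] by (simp add: o_def)
  have 1: "eqv (V ?F) (V (%z. perm12 (?F z)))" by (rule eqv_sym[OF V_perm(1)[OF FD]])
  have 2: "eqv (V (%z. perm12 (?F z))) (scal (- a) (V ?G))" using V_swap[OF GD] by (simp add: sphswap_sphswap)
  have 3: "eqv (V ?G) (V \<Phi>3s)" by (rule V_shape[OF good_shapes(5) cont_full[OF GD] cm_Phi3(1) shG shape_Phi3(1)])
  show ?thesis by (rule eqv_trans[OF 1 eqv_trans[OF 2 eqv_cmul[OF 3]]])
qed

text \<open>Reflecting the sphere factor of a two-point cluster is the same as exchanging its two points.\<close>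

lemma V_small3_anti: "eqv (scal a (V \<Phi>3s)) (V \<Phi>3s)"
proof -
  define F where "F = (%z :: 'a rpair. (bpt z, (%i. 1/16 * sig n (mpt z) i), (%i. ev i + 1/16 * sig n (snd z) i), ev))"
  define F' where "F' = (%z :: 'a rpair. (bpt z, (%i. 1/16 * sig n (mpt z) i), (%i. ev i + (- 1/16) * sig n (snd z) i), ev))"
  have c: "cmap TS (T3) F" "cmap TS (T3) F'" unfolding F_def F'_def
    by (intro cont_triple TS_cont cont_scale cont_sig cont_Euc_add E_const cont_cconst)+
  have e: "0 \<le> (1/16::real)" "0 < (1/16::real)" by simp_all
  have sh: "shape n 0 1 (%a b c. a + b < c) z (F z)" if z: "z \<in> tops TS" for z
  proof -
    have "1/16 / (1 + U z) * U z + 1/16 / (1 + W z) * W z < 1/4"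
      using sig_weight(2)[OF e(2), of "snd z"] sig_weight(2)[OF e(2), of "mpt z"] by linarith
    then show ?thesis unfolding F_def sig_def by (intro shapeI[of "1/16 / (1 + U z)" "1/16 / (1 + W z)" "1/4"] sig_weight(1) e(2)) simp_all
  qed
  have cC: "cmap TS C3 F" by (rule shape_C3[OF good_shapes(5) c(1) sh])
  have 1: "eqv (V F) (V \<Phi>3s)" by (rule V_shape[OF good_shapes(5) c(1) cm_Phi3(1) sh shape_Phi3(1)])
  have "F (fst z, anti (snd z)) = F' z" for z unfolding F_def F'_def anti_def sig_def by (simp add: enorm_minus)
  then have 2: "eqv (V F') (scal a (V F))" using V_anti2[OF cC] by simp
  have 3: "eqv (V F') (V (%z. perm23 (F z)))"
  proof (rule V_straight[OF c(2)])
    show "cmap TS (T3) (%z. perm23 (F z))" using cont_comp[OF cC cont_perms(2)] cont_full by (fastforce simp: o_def)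
    show "fst (F' z) = fst (perm23 (F z))" for z by (simp add: F_def F'_def perm23_def)
    fix s z assume s: "0 \<le> s" "(s::real) \<le> 1" "z \<in> tops TS"
    define v where "v = (%i. 1/16 * sig n (snd z) i)"
    define u where "u = (%i. 1/16 * sig n (mpt z) i)"
    have vu: "enorm n v < 1/16" "enorm n u < 1/16" using sig_weight(2)[OF e(2), of "snd z"] sig_weight(2)[OF e(2), of "mpt z"]
      unfolding v_def u_def sig_norm[OF e(1)] by blast+
    have vu: "enorm n v < 1/16" "enorm n u < 1/16" "v ~= zv" "u ~= zv"
      using vu posmult[OF e(2), of "sig n (snd z)"] posmult[OF e(2), of "sig n (mpt z)"] TS_ne[OF s(3)]
      unfolding v_def u_def sig_eq_zv_iff by blast+
    have near: "1/16 < enorm n (%i. ev i + c * v i)" if "\<bar>c\<bar> \<le> 1" for c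
    proof -
      have "\<bar>c\<bar> * enorm n v \<le> 1 * enorm n v" using that by (intro mult_right_mono) auto
      then show ?thesis using enorm_add_ge[of n ev "%i. c * v i"] vu(1) unfolding ev_norm enorm_scale[of n c v] by linarith
    qed
    have n1: "1/16 < enorm n (%i. ev i + (s - 1) * v i)" "1/16 < enorm n (%i. ev i + s * v i)"
      using s near[of "s - 1"] near[of s] by simp_all
    have "(%i. ev i + (s - 1) * v i) ~= (%i. ev i + s * v i)"
    proof
      assume eq: "(%i. ev i + (s - 1) * v i) = (%i. ev i + s * v i)"
      have "v i = 0" for i using fun_cong[OF eq, of i] by (simp add: algebra_simps)
      then show False using vu(3) by auto
    qed
    moreover have "(%i. ev i + (s - 1) * v i) ~= zv" "(%i. ev i + s * v i) ~= zv"
      "u ~= (%i. ev i + (s - 1) * v i)" "u ~= (%i. ev i + s * v i)" using n1 vu(2) by (auto intro!: enorm_neq[of n])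
    ultimately have "(bpt z, u, %i. ev i + (s - 1) * v i, %i. ev i + s * v i) \<in> dtrip"
      unfolding dtrip_def mem_Collect_eq prod.case using vu(4) by blast
    moreover have "(tlerp s (F' z) (perm23 (F z))) =
      (bpt z, u, %i. ev i + (s - 1) * v i, %i. ev i + s * v i)" by (simp add: F_def F'_def perm23_def u_def v_def fun_eq_iff field_simps)
    ultimately show "(tlerp s (F' z) (perm23 (F z))) \<in> dtrip" by simp
  qed
  have 4: "eqv (V (%z. perm23 (F z))) (V F)" by (rule V_perm(2)[OF cC])
  show ?thesis by (rule eqv_trans[OF eqv_cmul[OF eqv_sym[OF 1]] eqv_trans[OF eqv_sym[OF 2] eqv_trans[OF 3 eqv_trans[OF 4 1]]]])
qed

text \<open>The three ways to resolve a cluster of three points give \<open>(1 + 2 * a) * J \<sim> 0\<close>.\<close>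

lemma V_link3: "eqv (V \<Phi>3l) 0"
proof -
  let ?P = "%a b c. b < a & a < (c::real)"
  let ?e = "%i. 1 * uvec i"
  define q where "q z = 1/4 / (1 + U z)" for z :: "'a rpair"
  define G where "G z = (bpt z, (%i. 1 * uvec i + q z * mpt z i), (%i. 1 * uvec i + q z * (U z / 2) * sig n (snd z) i), ?e)" for z
  define H where "H z = (bpt z, ?e, (%i. 1 * uvec i + q z * (U z / 2) * sig n (snd z) i), (%i. 1 * uvec i + - q z * mpt z i))" for z
  have qpos: "0 < q z" "q z * U z < 1/4" for z using sig_weight[of "1/4" "mpt z"] unfolding q_def by simp_all
  have cq: "cmap TS Rtop q" unfolding q_def by (intro TS_real | simp add: enorm_add1_pos)+
  have cqU: "cmap TS Rtop (%z. q z * (U z / 2))" "cmap TS Rtop (%z. - q z)" by (intro TS_real cq continuous_map_minus | simp)+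
  have cG: "cmap TS (T3) G" "cmap TS (T3) H" unfolding G_def H_def
    by (intro cont_triple TS_cont cont_scale[OF cqU(1)] cont_scale[OF cqU(2)] cont_scale[OF cq] cont_sig cont_Euc_add E_const)+
  have shG: "shape n 1 1 ?P z (G z)" if z: "z \<in> tops TS" for z
  proof -
    have p: "0 < q z * (U z / 2)" using qpos[of z] TS_pos[OF z] by simp
    have "q z * (U z / 2) / (1 + W z) * W z < q z * U z & q z * U z < 1"
    proof -
      have "q z * (U z / 2) < q z * U z" using qpos(1)[of z] TS_pos(1)[OF z] by (intro mult_strict_left_mono) simp_all
      then show ?thesis using sig_weight(2)[OF p, of "snd z"] qpos(2)[of z] by linarith
    qed

    then show ?thesis unfolding G_def sig_def
      by (intro shapeI[of "q z" "q z * (U z / 2) / (1 + W z)" "1"] sig_weight(1)[OF p] qpos) simp_all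
  qed
  have GC: "cmap TS C3 G" by (rule shape_C3[OF good_shapes(6) cG(1) shG])
  have J: "eqv (V G) (V \<Phi>3l)" by (rule V_shape[OF good_shapes(6) cG(1) cm_Phi3(2) shG shape_Phi3(2)])
  have s: "eqv (V \<Phi>4s) (V G)"
  proof (rule V_shape[OF good_shapes(6) _ cG(1) _ shG])
    have eq: "\<Phi>4s = (%z. \<Phi>4 ((bpt z, mpt z), %i. U z / 2 * sig n (snd z) i))" by (simp add: crs_def)
    show "cmap TS (T3) \<Phi>4s" unfolding eq by (rule cm_Phi(4)[OF TS_cont(1,2) TS_cross(2)[OF TS_cont(2) TS_cont(3) TS_ne(2)]])
    fix z assume z: "z \<in> tops TS"
    let ?z = "((bpt z, mpt z), %i. U z / 2 * sig n (snd z) i)"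
    define c where "c = cc ?z"
    have c: "0 < c" "c * U z < 1/4" using cc_pos(1,2)[of ?z] unfolding c_def by simp_all
    have p: "0 < c * (U z / 2)" using c TS_pos[OF z] by simp
    have "c * (U z / 2) / (1 + W z) * W z < c * U z & c * U z < 1"
    proof -
      have "c * (U z / 2) < c * U z" using c TS_pos(1)[OF z] by (intro mult_strict_left_mono) simp_all
      then show ?thesis using sig_weight(2)[OF p, of "snd z"] c(2) by linarith
    qed

    moreover have eq: "\<Phi>4 (crs n snd z) = (bpt z, (%i. 1 * uvec i + c * mpt z i), (%i. 1 * uvec i + c * (U z / 2 * sig n (snd z) i)), ?e)"
      unfolding \<Phi>4_def crs_def c_def by simp
    ultimately show "shape n 1 1 ?P z (\<Phi>4s z)" unfolding eq sig_def
      by (intro shapeI[of c "c * (U z / 2) / (1 + W z)" "1"] sig_weight(1)[OF p] c(1)) (simp_all add: mult.assoc)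
  qed
  let ?F = "%z. \<Phi>4 (crb n snd z)"
  let ?F' = "%z. perm12 (?F (sphswap z))"
  have cF: "cmap TS (T3) ?F"
  proof -
    have eq: "?F = (%z. \<Phi>4 ((bpt z, mpt z), %i. 2 * U z / W z * snd z i))" by (simp add: crb_def)
    show ?thesis unfolding eq by (rule cm_Phi(4)[OF TS_cont(1,2) TS_cross(1)[OF TS_cont(2) TS_cont(3) TS_ne(2)]])
  qed
  have swTS: "sphswap z \<in> tops TS" if "z \<in> tops TS" for z using cont_fun[OF cont_sphswap[of Y "E0 n" "E0 n"]] that by blast
  have shF: "shape n 1 1 ?P z (?F' z)" if z: "z \<in> tops TS" for z
  proof -
    note UW = TS_pos[OF z]
    let ?z = "((bpt z, snd z), %i. 2 * W z / U z * mpt z i)"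
    define c where "c = cc ?z"
    have x: "enorm n (%i. 2 * W z / U z * mpt z i) = 2 * W z" using UW unfolding enorm_scale by simp
    have c: "0 < c" "c * (2 * W z) < 1/4" using cc_pos(1,3)[of ?z] unfolding c_def snd_conv fst_conv x by simp_all
    have "c * W z < c * (2 * W z / U z) * U z & c * (2 * W z / U z) * U z < 1" using c UW by simp
    moreover have "0 < c * (2 * W z / U z)" using c UW by simp
    moreover have eq: "?F' z = (bpt z, (%i. 1 * uvec i + c * (2 * W z / U z * mpt z i)), (%i. 1 * uvec i + c * snd z i), ?e)"
      unfolding \<Phi>4_def crb_def perm12_def sphswap_def c_def by simp
    ultimately show ?thesis unfolding eq by (intro shapeI[of "c * (2 * W z / U z)" c 1] c(1)) (simp_all add: mult.assoc)
  qed
  have FD: "cmap TS C3 ?F"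
  proof (intro cont_subI cF)
    fix z assume z: "z \<in> tops TS"
    have "perm12 (?F z) \<in> dtrip"
      using shape_distinct[OF good_shapes(6) shF[OF swTS[OF z]] TS_pos[OF swTS[OF z]]] by (simp add: sphswap_sphswap)
    then show "?F z \<in> dtrip" by (auto simp: perm12_def dtrip_def split: prod.splits)
  qed
  have GD: "cmap TS C3 ?F'" using cont_comp[OF cont_sphswap cont_comp[OF FD cont_perms(1)]] by (simp add: o_def)
  have b1: "eqv (V ?F) (V (%z. perm12 (?F z)))" by (rule eqv_sym[OF V_perm(1)[OF FD]])
  have b2: "eqv (V (%z. perm12 (?F z))) (scal (- a) (V ?F'))" using V_swap[OF GD] by (simp add: sphswap_sphswap)
  have b3: "eqv (V ?F') (V G)" by (rule V_shape[OF good_shapes(6) cont_full[OF GD] cG(1) shF shG])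
  have b: "eqv (V ?F) (scal (- a) (V G))" by (rule eqv_trans[OF b1 eqv_trans[OF b2 eqv_cmul[OF b3]]])
  have k1: "eqv (V \<Phi>4l) (V H)"
  proof (rule V_straight[OF _ cG(2)])
    have eq: "\<Phi>4l = (%z. \<Phi>4 ((bpt z, mpt z), %i. mpt z i + U z / 2 * sig n (snd z) i))" by (simp add: crl_def)
    show "cmap TS (T3) \<Phi>4l" unfolding eq by (rule cm_Phi(4)[OF TS_cont(1,2) TS_cross(3)[OF TS_cont(2) TS_cont(3) TS_ne(2)]])
    show "fst (\<Phi>4l z) = fst (H z)" for z by (simp add: \<Phi>4_def H_def crl_def)
    fix s z assume s: "0 \<le> s" "(s::real) \<le> 1" and z: "z \<in> tops TS"
    let ?u = "mpt z"
    define v where "v = (%i. U z / 2 * sig n (snd z) i)"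
    let ?z = "((bpt z, mpt z), %i. ?u i + v i)"
    define c where "c = cc ?z"
    have c: "0 < c" "c * U z < 1/4" using cc_pos(1,2)[of ?z] unfolding c_def by simp_all
    define d where "d = (1 - s) * c + s * q z"
    have "0 < d" using lerp_less[OF s c(1) qpos(1)[of z]] by (simp add: d_def)
    have U2: "0 < U z / 2" using TS_pos[OF z] by simp
    have v: "enorm n v < U z / 2" "v ~= zv" "?u ~= zv"
      using enorm_half_sig_less[OF TS_pos(1)[OF z], of n "snd z"] posmult[OF U2] TS_ne[OF z] unfolding v_def by auto
    have uv: "(%i. ?u i + v i) ~= zv" using enorm_add_ge[of n ?u v] v(1) U2 by (intro enorm_neq[of n]) (unfold enorm_zv, linarith)
    have e1: "enorm n ?e = 1" by simp
    have nz: "(%i. 1 * uvec i + (x * ?u i + y * v i)) ~= zv" if "\<bar>x\<bar> * U z \<le> 1/4" "\<bar>y\<bar> * U z \<le> 1/4" for x y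
    proof (rule enorm_neq[of n])
      have "\<bar>y\<bar> * enorm n v \<le> \<bar>y\<bar> * U z" using v(1) U2 by (intro mult_left_mono) auto
      then have "1/2 \<le> enorm n (%i. 1 * uvec i + (x * ?u i + y * v i))"
        using enorm_add_ge[of n ?e "%i. x * ?u i + y * v i"] enorm_triangle[of n "%i. x * ?u i" "%i. y * v i"] that
        unfolding enorm_scale[of n x] enorm_scale[of n y] e1 by linarith
      then show "enorm n (%i. 1 * uvec i + (x * ?u i + y * v i)) ~= enorm n zv" unfolding enorm_zv by linarith
    qed
    have b: "(1 - s) * (c * U z) \<le> 1/4" "s * (q z * U z) \<le> 1/4" "d * U z \<le> 1/4" "0 \<le> (1 - s) * c" "0 \<le> s * q z"
    proof -
      show "(1 - s) * (c * U z) \<le> 1/4" "s * (q z * U z) \<le> 1/4"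
        using mult_mono[of "1 - s" 1 "c * U z" "1/4"] mult_mono[of s 1 "q z * U z" "1/4"] s c qpos[of z] by simp_all
      have "(1 - s) * (c * U z) + s * (q z * U z) < (1 - s) * (1/4) + s * (1/4)" by (rule lerp_less[OF s c(2) qpos(2)])
      also have "\<dots> = 1/4" by (simp add: field_simps)
      finally show "d * U z \<le> 1/4" by (simp add: d_def algebra_simps)
    qed (use s c qpos[of z] in auto)
    define A where "A = (%i. 1 * uvec i + ((1 - s) * c * ?u i + 0 * v i))"
    define B where "B = (%i. 1 * uvec i + ((1 - s) * c * ?u i + d * v i))"
    define C where "C = (%i. 1 * uvec i + ((- s * q z) * ?u i + 0 * v i))"
    have "A ~= zv" "B ~= zv" "C ~= zv"
    proof -
      have *: "\<bar>(1 - s) * c\<bar> * U z \<le> 1/4" "\<bar>- s * q z\<bar> * U z \<le> 1/4" "\<bar>d\<bar> * U z \<le> 1/4" "\<bar>0\<bar> * U z \<le> 1/4"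
        using b \<open>0 < d\<close> unfolding mult_minus_left abs_minus abs_of_nonneg[OF b(4)] abs_of_nonneg[OF b(5)]
        by (simp_all add: mult.assoc)
      show "A ~= zv" unfolding A_def by (rule nz[OF *(1) *(4)])
      show "B ~= zv" unfolding B_def by (rule nz[OF *(1) *(3)])
      show "C ~= zv" unfolding C_def by (rule nz[OF *(2) *(4)])
    qed
    moreover have "A ~= B" "B ~= C" "A ~= C"
    proof -
      show "A ~= B"
      proof
        assume eq: "A = B"
        have "v i = 0" for i using fun_cong[OF eq, of i] \<open>0 < d\<close> by (simp add: A_def B_def)
        then show False using v(2) by auto
      qed
      show "B ~= C"
      proof
        assume eq: "B = C"
        have "d * (?u i + v i) = 0" for i using fun_cong[OF eq, of i] by (simp add: B_def C_def d_def algebra_simps)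
        then show False using uv \<open>0 < d\<close> by auto
      qed
      show "A ~= C"
      proof
        assume eq: "A = C"
        have "d * ?u i = 0" for i using fun_cong[OF eq, of i] by (simp add: A_def C_def d_def algebra_simps)
        then show False using v(3) \<open>0 < d\<close> by auto
      qed
    qed
    ultimately have "(bpt z, A, B, C) \<in> dtrip" unfolding dtrip_def mem_Collect_eq prod.case by blast
    moreover have "\<Phi>4 (crl n snd z) = (bpt z, (%i. 1 * uvec i + c * ?u i), (%i. 1 * uvec i + c * (?u i + v i)), ?e)"
      unfolding \<Phi>4_def crl_def c_def v_def by simp
    moreover have "H z = (bpt z, ?e, (%i. 1 * uvec i + q z * v i), (%i. 1 * uvec i + - q z * ?u i))"
      unfolding H_def v_def by (simp add: mult.assoc)
    ultimately show "(tlerp s (\<Phi>4l z) (H z)) \<in> dtrip" unfolding A_def B_def C_def d_def by (simp add: algebra_simps)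
  qed
  have Geq: "perm12 (perm23 (perm12 (H z))) = G ((bpt z, anti (mpt z)), snd z)" for z
    unfolding G_def H_def perm12_def perm23_def q_def anti_def by (simp add: enorm_minus)
  have GA: "perm12 (perm23 (perm12 (G ((bpt z, anti (mpt z)), snd z)))) = H z" for z
    unfolding G_def H_def perm12_def perm23_def q_def anti_def by (simp add: enorm_minus)
  have an: "cmap TS TS (%z. ((bpt z, anti (mpt z)), snd z))"
  proof -
    have 1: "cmap TS E (%z. anti (mpt z))" using TS_cont(2) unfolding anti_def by (rule cont_uminus_Euclidean)
    have 2: "cmap TS (E0 n) (%z. anti (mpt z))" by (rule cont_subI[OF 1]) (use TS_ne(3) in \<open>auto simp: anti_def fun_eq_iff\<close>)
    show ?thesis by (intro cont_pairedI TS_cont(1) 2 cont_snd)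
  qed
  have HD: "cmap TS C3 H" using cont_comp[OF cont_comp[OF cont_comp[OF cont_comp[OF an GC] cont_perms(1)] cont_perms(2)] cont_perms(1)]
    by (simp add: o_def GA)
  have H1: "cmap TS C3 (%z. perm12 (H z))" "cmap TS C3 (%z. perm23 (perm12 (H z)))" using cont_comp[OF HD cont_perms(1)]
      cont_comp[OF cont_comp[OF HD cont_perms(1)] cont_perms(2)] by (simp_all add: o_def)
  have k2: "eqv (V (%z. G ((bpt z, anti (mpt z)), snd z))) (V H)"
    using eqv_trans[OF V_perm(1)[OF H1(2)] eqv_trans[OF V_perm(2)[OF H1(1)] V_perm(1)[OF HD]]] by (simp add: Geq)
  have k: "eqv (V \<Phi>4l) (scal a (V G))" by (rule eqv_trans[OF k1 eqv_trans[OF eqv_sym[OF k2] V_anti1[OF GC]]])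
  have "eqv (V ?F) (V \<Phi>4s + V \<Phi>4l)"
  proof (rule V_cross2[OF _ _ Phi_C3(4)])
    have "cmap (ptop Y (E0 n)) (E0 n) snd" by (rule cont_snd)
    then show "cmap (ptop Y (E0 n)) E snd" by (rule cont_full)
  qed auto
  then have "eqv (scal (- a) (V G)) (V G + scal a (V G))" using eqv_trans[OF eqv_sym[OF b] eqv_trans[OF _ eqv_add[OF s k]]] by blast
  then have "Nul (scal (- a) (V G) - (V G + scal a (V G)))" by (simp add: eqv_def)
  also have "scal (- a) (V G) - (V G + scal a (V G)) = scal (- (1 + 2 * a)) (V G)"
    by (rule poly_mapping_eqI) (simp add: lookup_minus lookup_add algebra_simps)
  finally have "Nul (V G)" using Nul_cancel[of "- (1 + 2 * a)" "V G"] a_sign by auto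
  then show ?thesis using eqv_trans[OF eqv_sym[OF J], of 0] by (simp only: eqv_0)
qed

theorem commutator_relation: "eqv (V F0) (V F1)"
proof -
  have 1: "eqv (V F0) (V \<Phi>2s + V \<Phi>2l
     + (V \<Phi>3s + V \<Phi>3l))" by (rule eqv_trans[OF V_expand1 eqv_add[OF V_expand2 V_expand3]])
  have cF1p: "cmap TS (T3) F1p"
  proof (intro cont_triple TS_cont E_const cont_scale)
    show "cmap TS Rtop (%x. 1 / 2 / enorm n (mpt x))" "cmap TS Rtop (%x. 1 / 4 / enorm n (snd x))" by (intro TS_real | simp)+
  qed
  have sh: "shape n 0 0 (%a b c. b < a & a < c) z (F1p z)" if "z \<in> tops TS" for z
    by (rule shapeI[of "1 / 2 / U z" "1 / 4 / W z" 1]) (use TS_pos[OF that] in auto)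
  have FC: "cmap TS C3 F1p" by (rule shape_C3[OF good_shapes(3) cF1p sh])
  have 2: "eqv (V \<Phi>2s) (V F1p)"
  proof (rule V_shape[OF good_shapes(3) _ cF1p _ sh])
    have eq: "\<Phi>2s = (%z. \<Phi>2 ((bpt z, %i. enorm n hv / 2 * sig n (mpt z) i), snd z))" by (simp add: crs_def)
    show "cmap TS (T3) \<Phi>2s" unfolding eq by (rule cm_Phi(2)[OF TS_cont(1) TS_cross(2)[OF E_const TS_cont(2) TS_ne(1)] TS_cont(3)])
    fix z assume z: "z \<in> tops TS"
    have e8: "1/2/2 = (1/4::real)" "0 \<le> (1/4::real)" "0 < (1/4::real)" by simp_all
    define N where "N = enorm n (%i. 1/4 * sig n (mpt z) i)"
    have N: "N < 1/4" "0 < N" "1/4 / (1 + U z) * U z = N"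
      using sig_weight[OF e8(3), of "mpt z"] TS_pos[OF z] unfolding N_def sig_norm[OF e8(2)] by simp_all
    define m where "m = min N (1/2) / 2"
    have m: "m = N / 2" using N(1) unfolding m_def by simp
    have mpos: "0 < m" using m N(2) by linarith
    have "m / (1 + W z) * W z < 1/4 / (1 + U z) * U z &
      1/4 / (1 + U z) * U z < 1/2" using sig_weight(2)[OF mpos, of "snd z"] m N by linarith
    then show "shape n 0 0 (%a b c. b < a & a < c) z (\<Phi>2s z)"
      unfolding \<Phi>2_def crs_def fst_conv snd_conv ev_norm e8 N_def[symmetric] m_def[symmetric] unfolding sig_def
      by (intro shapeI[of "1/4 / (1 + U z)" "m / (1 + W z)" "1/2"] sig_weight(1) e8(3) mpos) simp_all
  qed
  have F1: "F1 = (%z. perm12 (perm23 (F1p z)))" by (simp add: perm12_def perm23_def)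
  have "cmap TS C3 (%z. perm23 (F1p z))" using cont_comp[OF FC cont_perms(2)] by (simp add: o_def)
  then have 3: "eqv (V F1p) (V F1)" unfolding F1 by (rule eqv_sym[OF eqv_trans[OF V_perm(1) V_perm(2)[OF FC]]])
  let ?L = "V \<Phi>3s"
  let ?R = "V F1 + scal (- a) ?L + (?L + 0)"
  have 5: "eqv (V \<Phi>2s + V \<Phi>2l) (V F1 + scal (- a) ?L)" by (rule eqv_add[OF eqv_trans[OF 2 3] V_link2])
  have 6: "eqv (?L + V \<Phi>3l) (?L + 0)" by (rule eqv_add[OF eqv_refl V_link3])
  have 4: "eqv (V F0) ?R" by (rule eqv_trans[OF 1 eqv_add[OF 5 6]])
  have gen: "X + scal (- a) L + (L + 0) - X = - (scal a L - L)" for X L :: "'b chain"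
    by (rule poly_mapping_eqI) (simp add: lookup_minus lookup_add)
  have "?R - V F1 = - (scal a ?L - ?L)" by (rule gen)
  then have "eqv ?R (V F1)" using Nul_minus[OF V_small3_anti[unfolded eqv_def]] unfolding eqv_def by (simp only:)
  with 4 show ?thesis by (rule eqv_trans)
qed

end

section \<open>Configuration spaces\<close>

abbreviation conf :: "nat => 'a topology => (nat => 'a) topology" where
  "conf == ordered_configuration_space"

lemma conf_top:
  "x \<in> tops (conf k M) \<longleftrightarrow> x \<in> extensional {..<k} & (\<forall>j<k. x j \<in> tops M) & inj_on x {..<k}"
  by (auto simp: ordered_configuration_space_def PiE_def Pi_def)

lemma cont_confI:
  assumes "!!j. j < k ==> cmap X M (%x. f x j)"
    and "!!x. x \<in> tops X ==> f x \<in> extensional {..<k}"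
    and "!!x. x \<in> tops X ==> inj_on (f x) {..<k}"
  shows "cmap X (conf k M) f" unfolding ordered_configuration_space_def using assms
  by (intro cont_subI) (auto simp: continuous_map_componentwise)

lemma cont_confD:
  assumes "cmap X (conf k M) f" "j < k"
  shows "cmap X M (%x. f x j)" using assms unfolding ordered_configuration_space_def cont_in_subtop continuous_map_componentwise by auto

definition skip :: "nat => nat => nat" where
  "skip j i = (if i < j then i else Suc i)"

lemma skip_simps: "skip j i ~= j" "skip j i = skip j i' \<longleftrightarrow> i = i'" "i < k ==> skip j i < Suc k"
  "i < j ==> skip j i = i" by (auto simp: skip_def)

lemma skip_ex: "i ~= j ==> i < Suc k ==> j < Suc k ==> \<exists>l<k. i = skip j l"
  by (rule exI[of _ "if i < j then i else i - 1"]) (auto simp: skip_def)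

lemma permutes_skip:
  assumes \<rho>: "\<rho> permutes {..<Suc k}" and j: "j < Suc k"
  shows "\<exists>\<sigma>. \<sigma> permutes {..<k} & (\<forall>i<k. \<rho> (skip j i) = skip (\<rho> j) (\<sigma> i))"
proof -
  have lt: "\<rho> i < Suc k \<longleftrightarrow> i < Suc k" for i using permutes_in_image[OF \<rho>] by simp
  have inj: "\<rho> i = \<rho> i' \<longleftrightarrow> i = i'" for i i' using permutes_inj[OF \<rho>] by (auto simp: inj_def)
  have "\<exists>l<k. \<rho> (skip j i) = skip (\<rho> j) l" if "i < k" for i using that j by (intro skip_ex) (auto simp: lt inj skip_simps)
  then obtain f where f: "!!i. i < k ==> f i < k & \<rho> (skip j i) = skip (\<rho> j) (f i)" by metis
  define \<sigma> where "\<sigma> i = (if i < k then f i else i)" for i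
  have "inj_on f {..<k}"
  proof (rule inj_onI)
    fix x y assume "x \<in> {..<k}" "y \<in> {..<k}" "f x = f y"
    then have "\<rho> (skip j x) = \<rho> (skip j y)" using f by simp
    then show "x = y" by (simp add: inj skip_simps)
  qed
  then have "inj_on \<sigma> {..<k}" by (auto simp: \<sigma>_def inj_on_def)
  moreover have "\<sigma> ` {..<k} \<subseteq> {..<k}" using f by (auto simp: \<sigma>_def)
  ultimately have "bij_betw \<sigma> {..<k} {..<k}" by (metis bij_betw_def endo_inj_surj finite_lessThan)
  then have "\<sigma> permutes {..<k}" by (rule bij_imp_permutes) (auto simp: \<sigma>_def)
  with f show ?thesis by (auto simp: \<sigma>_def)
qed

definition del :: "nat => nat => (nat => 'a) => nat => 'a" where
  "del k j x = restrict (%i. x (skip j i)) {..<k}"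

lemma del_apply: "i < k ==> del k j x i = x (skip j i)" by (simp add: del_def)

lemma del_ext: "del k j x \<in> extensional {..<k}" by (simp add: del_def)

lemma cm_del: "j < Suc k ==> cmap (conf (Suc k) M) (conf k M) (del k j)"
proof (rule cont_confI)
  show "cmap (conf (Suc k) M) M (%x. del k j x i)" if "i < k" for i
    using that cont_confD[OF cont_id[of "conf (Suc k) M"], of "skip j i"] by (simp add: del_apply skip_simps)
  show "inj_on (del k j x) {..<k}" if "x \<in> tops (conf (Suc k) M)" for x
    using that skip_simps(2,3) by (auto simp: inj_on_def conf_top del_apply) (metis lessThan_iff)
qed (simp add: del_ext)

lemma comp_perm_ext:
  assumes "\<sigma> permutes {..<k}" "x \<in> extensional {..<k}" shows "x \<circ> \<sigma> \<in> extensional {..<k}"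
  using assms permutes_not_in[OF assms(1)] by (auto simp: extensional_def)

lemma cm_perm: "\<sigma> permutes {..<k} ==> cmap (conf k M) (conf k M) (%x. x \<circ> \<sigma>)"
proof (rule cont_confI)
  assume s: "\<sigma> permutes {..<k}"
  have lt: "\<sigma> i < k" if "i < k" for i using permutes_in_image[OF s, of i] that by simp
  show "cmap (conf k M) M (%x. (x \<circ> \<sigma>) j)" if "j < k" for j using cont_confD[OF cont_id[of "conf k M"] lt[OF that]] by simp
  show "x \<circ> \<sigma> \<in> extensional {..<k}" if "x \<in> tops (conf k M)" for x using that s comp_perm_ext by (auto simp: conf_top)
  show "inj_on (x \<circ> \<sigma>) {..<k}" if "x \<in> tops (conf k M)" for x
    using that permutes_inj_on[OF s] permutes_image[OF s] by (auto simp: conf_top intro: comp_inj_on)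
qed

text \<open>Averaging over the symmetric group identifies rational homology of the orbit space with
  homology of the chains below modulo chains with torsion symmetrisation.\<close>

definition Sym :: "nat => nat => (nat => 'a) chain => (nat => 'a) chain" where
  "Sym p k c = (\<Sum>\<sigma> | \<sigma> permutes {..<k}. chm p (%x. x \<circ> \<sigma>) c)"

abbreviation perms :: "nat => (nat => nat) set" where
  "perms k == {\<sigma>. \<sigma> permutes {..<k}}"

lemma finite_perms [simp]: "finite (perms k)" by (simp add: finite_permutations)

lemma card_perms [simp]: "card (perms k) = fact k" using card_permutations[of "{..<k}" k] by simp

lemma Sym_0 [simp]: "Sym p k 0 = 0" by (simp add: Sym_def)

lemma Sym_diff: "Sym p k (c - d) = Sym p k c - Sym p k d" by (simp add: Sym_def chm_diff sum_subtractf)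

lemma Sym_add: "Sym p k (c + d) = Sym p k c + Sym p k d" by (simp add: Sym_def chm_add sum.distrib)

lemma Sym_cmul: "Sym p k (scal m c) = scal m (Sym p k c)" by (simp add: Sym_def chm_cmul frag_cmul_sum)

lemma Sym_sum: "Sym p k (\<Sum>i\<in>I. c i) = (\<Sum>i\<in>I. Sym p k (c i))"
  by (induction I rule: infinite_finite_induct) (auto simp: Sym_add)

lemma Sym_perm:
  assumes "\<sigma> permutes {..<k}" shows "Sym p k (chm p (%x. x \<circ> \<sigma>) c) = Sym p k c"
proof -
  have "Sym p k (chm p (%x. x \<circ> \<sigma>) c) = (\<Sum>\<tau>\<in>perms k. chm p (%x. x \<circ> (\<sigma> \<circ> \<tau>)) c)"
    unfolding Sym_def by (simp add: chm_comp o_assoc)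
  also have "\<dots> = (\<Sum>\<tau>\<in>perms k. chm p (%x. x \<circ> \<tau>) c)"
    using setum_permutations_compose_left[OF assms, of "%\<tau>. chm p (%x. x \<circ> \<tau>) c"] by simp
  finally show ?thesis by (simp add: Sym_def)
qed

lemma scal_card: "(\<Sum>i\<in>I. c) = scal (int (card I)) (c :: 'a chain)"
  by (induction I rule: infinite_finite_induct) (auto simp: frag_cmul_distrib)

lemma Sym_Sym: "Sym p k (Sym p k c) = scal (fact k) (Sym p k c)"
proof -
  have "Sym p k (Sym p k c) = (\<Sum>\<sigma>\<in>perms k. Sym p k c)"
    unfolding Sym_def[of p k c] Sym_sum by (intro sum.cong) (auto simp: Sym_perm Sym_def[symmetric])
  then show ?thesis by (simp add: scal_card)
qed

lemma Sym_operator: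
  fixes L :: "(nat => 'a) chain => (nat => 'a) chain"
  assumes null: "rnull p X S (Sym p k c)"
    and L: "!!c. rnull p X S c ==> rnull r X' S' (Sym r l (L c))"
    and add: "!!(I :: (nat => nat) set) c. L (\<Sum>i\<in>I. c i) = (\<Sum>i\<in>I. L (c i))"
    and inv: "!!\<sigma>. \<sigma> permutes {..<k} ==> Sym r l (L (chm p (%x. x \<circ> \<sigma>) c)) = Sym r l (L c)"
  shows "rnull r X' S' (Sym r l (L c))"
proof -
  have "Sym r l (L (Sym p k c)) = (\<Sum>\<sigma>\<in>perms k. Sym r l (L c))"
    unfolding Sym_def[of p k c] add Sym_sum by (intro sum.cong) (auto simp: inv)
  also have "\<dots> = scal (fact k) (Sym r l (L c))" by (simp add: scal_card)
  finally have "rnull r X' S' (scal (fact k) (Sym r l (L c)))" using L[OF null] by simp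
  then show ?thesis by (rule rnull_cancel) simp
qed

lemma rnull_Sym:
  assumes c: "rnull p X S c"
    and f: "!!\<sigma>. \<sigma> permutes {..<k} ==> cmap X X (%x. x \<circ> \<sigma>)"
    and S: "!!\<sigma>. \<sigma> permutes {..<k} ==> (%x. x \<circ> \<sigma>) \<in> tops X Int S \<rightarrow> S"
  shows "rnull p X S (Sym p k c)" unfolding Sym_def using rnull_chm[OF c f S] by (intro rnull_sum) auto

lemma relcycle_Sym:
  assumes c: "relcycle p X {} c"
    and f: "!!\<sigma>. \<sigma> permutes {..<k} ==> cmap X X (%x. x \<circ> \<sigma>)"
  shows "relcycle p X {} (Sym p k c)" unfolding Sym_def using relcycle_chm[OF c f, of _ "{}"] by (intro singular_relcycle_sum) auto

lemma bdry_Sym: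
  "schain p X c ==> bdry p (Sym p k c) = Sym (p - 1) k (bdry p c)" by (simp add: Sym_def chain_boundary_sum bdry_chm)

definition tau :: "nat => nat => (nat => 'a) chain => (nat => 'a) chain" where
  "tau p k c = (\<Sum>j<Suc k. chm p (del k j) c)"

locale puncture =
  fixes b :: nat and M :: "'a topology" and q :: 'a and g :: "rvec => 'a" and gi :: "'a => rvec" and nu :: "'a => real"
  assumes cont_g: "cmap (Euc (Suc b)) M g"
    and cont_gi: "cmap (subtop M (g ` tops (Euc (Suc b)))) (Euc (Suc b)) gi"
    and gi_g: "u \<in> tops (Euc (Suc b)) ==> gi (g u) = u"
    and g_zv: "g zv = q"
    and cont_nu: "cmap M Rtop nu"
    and nu_nonneg: "x \<in> tops M ==> 0 \<le> nu x"
    and nu_0: "x \<in> tops M ==> nu x = 0 \<longleftrightarrow> x = q"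
    and nu_g: "u \<in> tops (Euc (Suc b)) ==> nu (g u) = min 1 (enorm (Suc b) u)"
    and nu_less_1: "x \<in> tops M ==> nu x < 1 ==> x \<in> g ` tops (Euc (Suc b))"
begin

abbreviation "n == Suc b"
abbreviation "E == Euc n"
abbreviation "X k == conf k M"
definition "avoid k = {x. \<forall>j<k. x j ~= q}"
abbreviation "Y k == subtop (X k) (avoid k)"

primrec mu :: "nat => (nat => 'a) => real" where
  "mu 0 y = 1" |
  "mu (Suc k) y = min (mu k y) (nu (y k))"

lemma mu_le: "mu k y \<le> 1" "j < k ==> mu k y \<le> nu (y j)" by (induction k) (auto simp: min_le_iff_disj less_Suc_eq)

lemma mu_greater: "[|c < 1; !!j. j < k ==> c < nu (y j)|] ==> c < mu k y" by (induction k) auto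

lemma mu_ge: "[|c \<le> 1; !!j. j < k ==> c \<le> nu (y j)|] ==> c \<le> mu k y" by (induction k) auto

lemma mu_pos: "y \<in> tops (Y k) ==> 0 < mu k y" using nu_0 nu_nonneg by (intro mu_greater) (auto simp: conf_top avoid_def less_le)

lemma cm_mu:
  assumes "!!j. j < k ==> cmap Z M (%z. f z j)"
  shows "cmap Z Rtop (%z. mu k (f z))" using assms
proof (induction k)
  case (Suc k)
  have "cmap Z Rtop (%z. nu (f z k))" using cont_comp[OF Suc.prems[of k] cont_nu] by (simp add: o_def)
  with Suc show ?case by (auto intro!: continuous_map_real_min)
qed simp

lemma mu_perm:
  assumes s: "\<sigma> permutes {..<k}" shows "mu k (y \<circ> \<sigma>) = mu k y"
proof (rule antisym)
  show "mu k (y \<circ> \<sigma>) \<le> mu k y"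
  proof (rule mu_ge[OF mu_le(1)])
    fix j assume "j < k"
    then obtain i where "i < k" "\<sigma> i = j" using permutes_image[OF s] by (metis imageE lessThan_iff)
    then show "mu k (y \<circ> \<sigma>) \<le> nu (y j)" using mu_le(2)[of i k "y \<circ> \<sigma>"] by simp
  qed
  show "mu k y \<le> mu k (y \<circ> \<sigma>)" using permutes_in_image[OF s] by (intro mu_ge mu_le(1)) (simp add: mu_le(2))
qed

lemma mu_del: "j < Suc k ==> mu (Suc k) y \<le> mu k (del k j y)"
proof (rule mu_ge[OF mu_le(1)])
  show "mu (Suc k) y \<le> nu (del k j y i)" if "i < k" for i
    using mu_le(2)[of "skip j i" "Suc k" y] that skip_simps(3)[OF that] by (simp only: del_apply)
qed

definition ins :: "nat => (nat => 'a) \<times> rvec => nat => 'a" where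
  "ins k z = (fst z)(k := g (snd z))"

lemma g_in: "u \<in> tops E ==> g u \<in> tops M" using cont_fun[OF cont_g] by blast

lemma nu_g_less: "[|u \<in> tops E; 2 * enorm n u < c; c \<le> 1|] ==> nu (g u) = enorm n u"
  using nu_g[of u] enorm_nonneg[of n u] by linarith

lemma g_neq:
  assumes "v \<in> tops E" "2 * enorm n v < mu k y" "j < k"
  shows "y j ~= g v"
proof
  assume eq: "y j = g v"
  have "mu k y \<le> enorm n v" using mu_le(2)[OF assms(3), of y] nu_g_less[OF assms(1,2) mu_le(1)] eq by simp
  then show False using assms(2) enorm_nonneg[of n v] by linarith
qed

lemma ins_conf:
  assumes y: "y \<in> tops (X k)" and v: "v \<in> tops E" "2 * enorm n v < mu k y"
  shows "ins k (y, v) \<in> tops (X (Suc k))"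
proof -
  have "inj_on (ins k (y, v)) {..<k}" using y by (auto simp: conf_top inj_on_def ins_def)
  then have "inj_on (ins k (y, v)) {..<Suc k}" using g_neq[OF v] by (fastforce simp: ins_def lessThan_Suc)
  then show ?thesis using y g_in[OF v(1)] by (auto simp: conf_top ins_def extensional_def less_Suc_eq)
qed

lemma g_eq_q: "u \<in> tops E ==> g u = q \<longleftrightarrow> u = zv"
proof -
  have "zv \<in> tops E" by (simp add: top_Euc)
  then show "u \<in> tops E ==> ?thesis" using gi_g g_zv by metis
qed

lemma ins_avoid: "y \<in> avoid k ==> v \<in> tops E ==> ins k (y, v) \<in> avoid (Suc k) \<longleftrightarrow> v ~= zv"
  by (auto simp: avoid_def ins_def less_Suc_eq g_eq_q)

lemma cm_ins:
  assumes f: "cmap Z (X k) f" and v: "cmap Z E v"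
    and small: "!!z. z \<in> tops Z ==> 2 * enorm n (v z) < mu k (f z)"
  shows "cmap Z (X (Suc k)) (%z. ins k (f z, v z))"
proof -
  have T: "f z \<in> tops (X k)" "v z \<in> tops E" if "z \<in> tops Z" for z using cont_fun[OF f] cont_fun[OF v] that by auto
  have I: "ins k (f z, v z) \<in> tops (X (Suc k))" if "z \<in> tops Z" for z by (rule ins_conf[OF T[OF that] small[OF that]])
  show ?thesis
  proof (rule cont_confI)
    show "cmap Z M (%z. ins k (f z, v z) j)" if "j < Suc k" for j
    proof (cases "j = k")
      case True
      then show ?thesis using cont_comp[OF v cont_g] by (simp add: ins_def o_def)
    next
      case False
      then show ?thesis using cont_confD[OF f, of j] that by (simp add: ins_def)
    qed
  qed (use I conf_top in blast)+
qed

lemma cm_ins_Y: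
  assumes f: "cmap Z (Y k) f" and v: "cmap Z E v"
    and small: "!!z. z \<in> tops Z ==> 2 * enorm n (v z) < mu k (f z)"
    and nz: "!!z. z \<in> tops Z ==> v z ~= zv"
  shows "cmap Z (Y (Suc k)) (%z. ins k (f z, v z))"
proof (rule cont_subI[OF cm_ins[OF cont_full[OF f] v small]])
  fix z assume z: "z \<in> tops Z"
  have "f z \<in> avoid k" "v z \<in> tops E" using cont_fun[OF f] cont_fun[OF v] z by auto
  then show "ins k (f z, v z) \<in> avoid (Suc k)" using nz[OF z] by (simp add: ins_avoid)
qed

definition pt :: "nat => (nat => 'a) \<times> rvec => rvec" where
  "pt k z = (%i. mu k (fst z) / 2 * sig n (snd z) i)"

definition P :: "nat => (nat => 'a) \<times> rvec => nat => 'a" where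
  "P k z = ins k (fst z, pt k z)"

lemma enorm_pt: "y \<in> tops (Y k) ==> 2 * enorm n (pt k (y, u)) < mu k y"
  using enorm_half_sig_less[OF mu_pos, of y k n u] by (simp add: pt_def)

lemma pt_zv: "y \<in> tops (Y k) ==> pt k (y, u) = zv \<longleftrightarrow> u = zv"
  using posmult[of "mu k y / 2" "sig n u"] mu_pos[of y k] by (auto simp: pt_def)

lemma cm_Y_D: "cmap Z (Y k) f ==> j < k ==> cmap Z M (%z. f z j)" using cont_confD cont_full by blast

lemma cm_pt:
  assumes "cmap Z (Y k) f" "cmap Z E v"
  shows "cmap Z E (%z. pt k (f z, v z))" unfolding pt_def fst_conv snd_conv
  by (intro cont_scale cont_sig assms cont_real_divide cm_mu cm_Y_D[OF assms(1)]) auto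

lemma cm_P: "cmap (ptop (Y k) E) (X (Suc k)) (P k)"
proof -
  have P: "P k = (%z. ins k (fst z, pt k (fst z, snd z)))" by (rule ext) (simp add: P_def)
  show ?thesis unfolding P by (intro cm_ins cm_pt cont_fst cont_snd cont_full[OF cont_fst] enorm_pt) auto
qed

lemma cm_P_Y: "cmap (ptop (Y k) (E0 n)) (Y (Suc k)) (P k)"
proof -
  have P: "P k = (%z. ins k (fst z, pt k (fst z, snd z)))" by (rule ext) (simp add: P_def)
  have s: "cmap (ptop (Y k) (E0 n)) E snd" by (rule cont_full[OF cont_snd])
  show ?thesis unfolding P by (intro cm_ins_Y cm_pt cont_fst s enorm_pt) (auto simp: pt_zv)
qed

lemma P_perm: "\<sigma> permutes {..<k} ==> P k (y \<circ> \<sigma>, u) = P k (y, u) \<circ> \<sigma>"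
proof -
  assume s: "\<sigma> permutes {..<k}"
  have "pt k (y \<circ> \<sigma>, u) = pt k (y, u)" using mu_perm[OF s] by (simp add: pt_def)
  moreover have "\<sigma> j = k \<longleftrightarrow> j = k" for j
    using permutes_not_in[OF s, of k] permutes_inj[OF s] by (auto simp: inj_def)
  ultimately show ?thesis unfolding P_def ins_def fst_conv snd_conv by (intro ext) (simp del: pt_def)
qed

lemma permutes_Suc: "\<sigma> permutes {..<k} ==> \<sigma> permutes {..<Suc k}" by (rule permutes_subset) auto

lemma perm_avoid: "\<sigma> permutes {..<k} ==> (%x. x \<circ> \<sigma>) \<in> avoid k \<rightarrow> avoid k"
  using permutes_in_image[of \<sigma> "{..<k}"] by (auto simp: avoid_def)

lemma cm_perm_Y: "\<sigma> permutes {..<k} ==> cmap (Y k) (Y k) (%x. x \<circ> \<sigma>)"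
  using perm_avoid by (intro cont_subI cont_from_sub cm_perm) auto

lemma cm_del_Y: "j < Suc k ==> cmap (Y (Suc k)) (Y k) (del k j)"
  by (intro cont_subI cont_from_sub cm_del) (auto simp: avoid_def del_apply skip_simps)

definition N :: "nat => nat => (nat => 'a) chain => bool" where
  "N p k c \<longleftrightarrow> rnull p (Y k) {} (Sym p k c)"

definition st :: "nat => nat => (nat => 'a) chain => (nat => 'a) chain" where
  "st p k c = chm p (%y. P k (y, uvec)) c"

definition dt :: "nat => nat => (nat => 'a) chain => (nat => 'a) chain" where
  "dt p k c = chm (p + b) (P k) (cross p b c (sph n))"

definition Tt :: "nat => nat => (nat => 'a) chain => (nat => 'a) chain" where
  "Tt p k c = chm (p + n) (P k) (cross p n c (thom n))"

abbreviation "cyc p k c == relcycle p (Y k) {} c"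

lemma N_null: "rnull p (Y k) {} c ==> N p k c" unfolding N_def by (rule rnull_Sym) (auto intro: cm_perm_Y)

lemma N_add: "N p k c ==> N p k d ==> N p k (c + d)" by (simp add: N_def Sym_add rnull_add)

lemma N_cmul: "N p k c ==> N p k (scal m c)" by (simp add: N_def Sym_cmul rnull_cmul)

lemma N_cancel: "N p k (scal m c) ==> m ~= 0 ==> N p k c" unfolding N_def Sym_cmul by (rule rnull_cancel)

lemma N_diff: "N p k c ==> N p k d ==> N p k (c - d)" using N_add[of p k c "scal (-1) d"] N_cmul[of p k d "-1"] by simp

lemma N_perm: "\<sigma> permutes {..<k} ==> N p k (chm p (%x. x \<circ> \<sigma>) c - c)" by (simp add: N_def Sym_diff Sym_perm)

end

lemma cross_sum_left: "cross p q (\<Sum>i\<in>I. c i) d = (\<Sum>i\<in>I. cross p q (c i) d)"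
  by (induction I rule: infinite_finite_induct) (auto simp: cross_add_left)

lemma chm_sum': "chm p f (\<Sum>i\<in>I. c i) = (\<Sum>i\<in>I. chm p f (c i))"
  by (induction I rule: infinite_finite_induct) (auto simp: chm_add)

lemma del_perm:
  assumes "\<rho> permutes {..<Suc k}" "j < Suc k"
  obtains \<sigma> where "\<sigma> permutes {..<k}" "!!x. del k j (x \<circ> \<rho>) = del k (\<rho> j) x \<circ> \<sigma>"
proof -
  obtain \<sigma> where s: "\<sigma> permutes {..<k}" and eq: "!!i. i < k ==> \<rho> (skip j i) = skip (\<rho> j) (\<sigma> i)"
    using permutes_skip[OF assms] by blast
  have "del k j (x \<circ> \<rho>) i = (del k (\<rho> j) x \<circ> \<sigma>) i" for x :: "nat => 'b" and i
  proof (cases "i < k")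
    case True
    then show ?thesis using permutes_in_image[OF s, of i] eq[OF True] by (simp add: del_apply)
  next
    case False
    then show ?thesis using permutes_not_in[OF s, of i] by (simp add: del_def)
  qed
  then show thesis using that[OF s] by blast
qed

lemma tau_sum: "tau p k (\<Sum>i\<in>I. c i) = (\<Sum>i\<in>I. tau p k (c i))"
  by (simp add: tau_def chm_sum' del: sum.lessThan_Suc) (rule sum.swap)

lemma tau_add: "tau p k (c + d) = tau p k c + tau p k d" by (simp add: tau_def chm_add sum.distrib del: sum.lessThan_Suc)

lemma tau_cmul: "tau p k (scal m c) = scal m (tau p k c)" by (simp add: tau_def chm_cmul frag_cmul_sum o_def del: sum.lessThan_Suc)

lemma Sym_tau_perm:
  fixes c :: "(nat => 'a) chain"
  assumes "\<rho> permutes {..<Suc k}"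
  shows "Sym p k (tau p k (chm p (%x. x \<circ> \<rho>) c)) = Sym p k (tau p k c)"
proof -
  have "Sym p k (chm p (del k j) (chm p (%x. x \<circ> \<rho>) c)) = Sym p k (chm p (del k (\<rho> j)) c)" if j: "j < Suc k" for j
  proof -
    obtain \<sigma> where "\<sigma> permutes {..<k}" "!!x :: nat => 'a. del k j (x \<circ> \<rho>) = del k (\<rho> j) x \<circ> \<sigma>"
      using del_perm[OF assms j] by metis
    then show ?thesis using Sym_perm[of \<sigma> k p "chm p (del k (\<rho> j)) c"] by (simp add: chm_comp)
  qed
  then have "Sym p k (tau p k (chm p (%x. x \<circ> \<rho>) c)) = (\<Sum>j<Suc k. Sym p k (chm p (del k (\<rho> j)) c))"
    unfolding tau_def Sym_sum by (intro sum.cong) auto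
  also have "\<dots> = (\<Sum>j<Suc k. Sym p k (chm p (del k j) c))" by (rule sum.reindex_bij_betw[OF permutes_imp_bij[OF assms]])
  finally show ?thesis unfolding tau_def Sym_sum .
qed

lemma Sym_tau_Sym: "Sym p k (tau p k (Sym p (Suc k) c)) = scal (int (fact (Suc k))) (Sym p k (tau p k c))"
proof -
  have "Sym p k (tau p k (Sym p (Suc k) c)) = (\<Sum>\<sigma>\<in>perms (Suc k). Sym p k (tau p k c))"
    unfolding Sym_def[of p "Suc k"] tau_sum Sym_sum by (intro sum.cong) (simp_all add: Sym_tau_perm)
  then show ?thesis by (simp only: scal_card card_perms)
qed

lemma cycle_tau: "relcycle p (conf (Suc k) M) {} c ==> relcycle p (conf k M) {} (tau p k c)"
  unfolding tau_def using relcycle_chm[OF _ cm_del, of p k M "{}" c _ "{}"] by (intro singular_relcycle_sum) auto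

context puncture
begin

lemma cyc_chain: "cyc p k c ==> schain p (Y k) c" by (simp add: relcycle)

lemma cm_st: "cmap (Y k) (Y (Suc k)) (%y. P k (y, uvec))"
proof -
  have "uvec ~= zv" by (rule enorm_neq[of n]) simp
  then have "cmap (Y k) (ptop (Y k) (E0 n)) (%y. (y, uvec))" using uvec_in[of b] by (intro cont_pairedI) (auto simp: cont_const)
  from cont_comp[OF this cm_P_Y] show ?thesis by (simp add: o_def)
qed

lemma cyc_st: "cyc p k c ==> cyc p (Suc k) (st p k c)" unfolding st_def by (rule relcycle_chm[OF _ cm_st]) auto

lemma cyc_dt: "cyc p k c ==> cyc (p + b) (Suc k) (dt p k c)"
  unfolding dt_def by (rule relcycle_chm[OF cross_cycle[OF _ cycle_sph] cm_P_Y]) auto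

lemma cyc_tau: "cyc p (Suc k) c ==> cyc p k (tau p k c)" unfolding tau_def using relcycle_chm[OF _ cm_del_Y, of p k "{}" c _ "{}"]
  by (intro singular_relcycle_sum) auto

lemma P_avoid: "P k \<in> tops (ptop (Y k) E) Int csub {} nz \<rightarrow> avoid (Suc k)"
  using ins_avoid cont_fun[OF cm_pt[OF cont_fst cont_snd]] pt_zv by (fastforce simp: P_def csub_def)

lemma linear_ops:
  "st p k (\<Sum>i\<in>I. c i) = (\<Sum>i\<in>I. st p k (c i))" "dt p k (\<Sum>i\<in>I. c i) = (\<Sum>i\<in>I. dt p k (c i))"
  "tau p k (\<Sum>i\<in>I. c i) = (\<Sum>i\<in>I. tau p k (c i))" "Tt p k (\<Sum>i\<in>I. c i) = (\<Sum>i\<in>I. Tt p k (c i))"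
  by (simp_all add: st_def dt_def tau_def Tt_def chm_sum' cross_sum_left del: sum.lessThan_Suc) (rule sum.swap)

lemma ops_add: "st p k (c + d) = st p k c + st p k d" "dt p k (c + d) = dt p k c + dt p k d"
  "tau p k (c + d) = tau p k c + tau p k d" "Tt p k (c + d) = Tt p k c + Tt p k d"
  by (simp_all add: st_def dt_def tau_def Tt_def chm_add cross_add_left sum.distrib del: sum.lessThan_Suc)

lemma ops_diff: "st p k (c - d) = st p k c - st p k d" "dt p k (c - d) = dt p k c - dt p k d"
  "tau p k (c - d) = tau p k c - tau p k d" "Tt p k (c - d) = Tt p k c - Tt p k d"
  by (simp_all add: st_def dt_def tau_def Tt_def chm_diff cross_diff_left sum_subtractf del: sum.lessThan_Suc)

lemma ops_cmul: "st p k (scal m c) = scal m (st p k c)" "dt p k (scal m c) = scal m (dt p k c)"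
  "tau p k (scal m c) = scal m (tau p k c)" "Tt p k (scal m c) = scal m (Tt p k c)"
  by (simp_all add: st_def dt_def tau_def Tt_def cross_cmul_left frag_cmul_sum o_def del: sum.lessThan_Suc)

lemma st_perm: "\<sigma> permutes {..<k} ==> st p k (chm p (%x. x \<circ> \<sigma>) c) = chm p (%x. x \<circ> \<sigma>) (st p k c)"
  unfolding st_def by (simp add: chm_comp P_perm)

lemma cross_perm:
  assumes "\<sigma> permutes {..<k}" "schain r Z w"
  shows "chm (p + r) (P k) (cross p r (chm p (%x. x \<circ> \<sigma>) c) w) =
    chm (p + r) (%x. x \<circ> \<sigma>) (chm (p + r) (P k) (cross p r c w))"
proof -
  have "cross p r (chm p (%x. x \<circ> \<sigma>) c) w = chm (p + r) (map_prod (%x. x \<circ> \<sigma>) id) (cross p r c w)"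
    using cross_natural[of p r "%x. x \<circ> \<sigma>" c id w] unfolding chm_ident[OF assms(2)] .
  moreover have "(%z. P k (map_prod (%x. x \<circ> \<sigma>) id z)) = (%z. P k z \<circ> \<sigma>)"
    using P_perm[OF assms(1)] by (auto simp: fun_eq_iff)
  ultimately show ?thesis by (simp add: chm_comp)
qed

lemma dt_perm: "\<sigma> permutes {..<k} ==> dt p k (chm p (%x. x \<circ> \<sigma>) c) = chm (p + b) (%x. x \<circ> \<sigma>) (dt p k c)"
  unfolding dt_def by (rule cross_perm[OF _ schain_sph])

lemma Tt_perm: "\<sigma> permutes {..<k} ==> Tt p k (chm p (%x. x \<circ> \<sigma>) c) = chm (p + n) (%x. x \<circ> \<sigma>) (Tt p k c)"
  unfolding Tt_def by (rule cross_perm[OF _ schain_thom])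

lemma N_st: "N p k c ==> N p (Suc k) (st p k c)" unfolding N_def
proof (erule Sym_operator)
  show "rnull p (Y (Suc k)) {} (Sym p (Suc k) (st p k c))" if "rnull p (Y k) {} c" for c
    unfolding st_def using that N_null[unfolded N_def, OF rnull_chm[OF _ cm_st]] by simp
qed (simp_all add: linear_ops st_perm Sym_perm[OF permutes_Suc])

lemma N_dt: "N p k c ==> N (p + b) (Suc k) (dt p k c)" unfolding N_def
proof (erule Sym_operator)
  show "rnull (p + b) (Y (Suc k)) {} (Sym (p + b) (Suc k) (dt p k c))" if "rnull p (Y k) {} c" for c unfolding dt_def
    by (rule N_null[unfolded N_def, OF rnull_chm[OF rnull_cross_left0[OF that cycle_sph] cm_P_Y]]) simp
qed (simp_all add: linear_ops dt_perm Sym_perm[OF permutes_Suc])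

lemma N_tau: "N p (Suc k) c ==> N p k (tau p k c)" unfolding N_def
proof (erule Sym_operator)
  show "rnull p (Y k) {} (Sym p k (tau p k c))" if "rnull p (Y (Suc k)) {} c" for c unfolding tau_def using that
    by (intro N_null[unfolded N_def] rnull_sum rnull_chm[OF _ cm_del_Y]) auto
qed (simp_all add: linear_ops Sym_tau_perm)

lemma cm_perm_rel:
  assumes "\<sigma> permutes {..<k}"
  shows "cmap (X k) (X k) (%x. x \<circ> \<sigma>)" "(%x. x \<circ> \<sigma>) \<in> tops (X k) Int avoid k \<rightarrow> avoid k"
  using cm_perm[OF assms] perm_avoid[OF assms] by auto

definition NX :: "nat => nat => (nat => 'a) chain => bool" where
  "NX p k c \<longleftrightarrow> rnull p (X k) (avoid k) (Sym p k c)"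

lemma NX_null: "rnull p (X k) (avoid k) c ==> NX p k c" unfolding NX_def by (rule rnull_Sym) (auto dest: cm_perm_rel)

lemma rnull_Tt: "rnull p (Y k) {} c ==> rnull (p + n) (X (Suc k)) (avoid (Suc k)) (Tt p k c)"
  unfolding Tt_def by (rule rnull_chm[OF rnull_cross_left[OF _ relcycle_thom] cm_P P_avoid])

lemma NX_Tt: "N p k c ==> NX (p + n) (Suc k) (Tt p k c)" unfolding N_def NX_def
proof (erule Sym_operator)
  show "rnull (p + n) (X (Suc k)) (avoid (Suc k)) (Sym (p + n) (Suc k) (Tt p k c))" if "rnull p (Y k) {} c" for c
    by (rule NX_null[unfolded NX_def, OF rnull_Tt[OF that]])
qed (simp_all add: linear_ops Tt_perm Sym_perm[OF permutes_Suc])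

lemma relcycle_Tt: "cyc p k c ==> relcycle (p + n) (X (Suc k)) (avoid (Suc k)) (Tt p k c)"
proof -
  assume c: "cyc p k c"
  have "relcycle (p + n) (ptop (Y k) E) (tops (ptop (Y k) E) Int csub {} nz) (cross p n c (thom n))"
    using relcycle_cross[OF c relcycle_thom[of n]] by (simp only: relcycle_restrict)
  then show ?thesis unfolding Tt_def by (rule relcycle_chm[OF _ cm_P P_avoid])
qed

lemma boundary_Tt: "cyc p k c ==> bdry (p + n) (Tt p k c) = scal ((-1) ^ p) (dt p k c)"
proof -
  assume c: "cyc p k c"
  have "schain (p + n) (ptop (Y k) E) (cross p n c (thom n))" using schain_cross[OF cyc_chain[OF c] schain_thom] .
  then show ?thesis using bdry_chm[of "p + n" "ptop (Y k) E" _ "P k"] boundary_cross_thom[OF c, of b] by (simp add: Tt_def dt_def)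
qed

lemma
  fixes f :: "'z => nat => 'a"
  assumes f: "cmap Z (Y k) f"
    and v: "cmap Z E v" "!!z. z \<in> tops Z ==> 2 * enorm n (v z) < mu k (f z)"
    and w: "cmap Z E w" "!!z. z \<in> tops Z ==> 2 * enorm n (w z) < mu k (f z)"
  shows hq_ins: "[|relcycle r Z S c; !!s z. [|0 \<le> s; s \<le> 1; z \<in> tops Z; z \<in> S|] ==> lerp s (v z) (w z) ~= zv|]
    ==> hq r (X (Suc k)) (avoid (Suc k)) (chm r (%z. ins k (f z, v z)) c) (chm r (%z. ins k (f z, w z)) c)"
    and hq_ins_Y: "[|relcycle r Z {} c; !!s z. [|0 \<le> s; s \<le> 1; z \<in> tops Z|] ==> lerp s (v z) (w z) ~= zv|]
    ==> hq r (Y (Suc k)) {} (chm r (%z. ins k (f z, v z)) c) (chm r (%z. ins k (f z, w z)) c)"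
proof -
  let ?I = "ptop (I01) Z"
  let ?f = "%z. f (snd z)" and ?h = "%z :: real \<times> 'z. lerp (fst z) (v (snd z)) (w (snd z))"
  have t: "cmap ?I Rtop fst" by (rule cont_01D[OF cont_fst])
  have cf: "cmap ?I (Y k) ?f" using cont_comp[OF cont_snd f] by (simp add: o_def)
  have ch: "cmap ?I E ?h" using cont_comp[OF cont_snd v(1)] cont_comp[OF cont_snd w(1)] by (intro cont_lerp t) (auto simp: o_def)
  have small: "2 * enorm n (?h z) < mu k (?f z)" if z: "z \<in> tops ?I" for z
  proof -
    obtain s x where z': "z = (s, x)" "0 \<le> s" "s \<le> 1" "x \<in> tops Z" using z by auto
    have "enorm n (lerp s (v x) (w x)) \<le> (1 - s) * enorm n (v x) + s * enorm n (w x)"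
      using enorm_triangle[of n "%i. (1 - s) * v x i" "%i. s * w x i"] z' by (simp add: enorm_scale)
    also have "\<dots> < (1 - s) * (mu k (f x) / 2) + s * (mu k (f x) / 2)" using v(2)[OF z'(4)] w(2)[OF z'(4)] by (intro lerp_less z') auto
    also have "\<dots> = mu k (f x) / 2" by (simp add: field_simps)
    finally show ?thesis by (simp add: z')
  qed
  let ?H = "%z. ins k (?f z, ?h z)"
  {
    assume c: "relcycle r Z S c" and D: "!!s z. [|0 \<le> s; s \<le> 1; z \<in> tops Z; z \<in> S|] ==> lerp s (v z) (w z) ~= zv"
    have H: "cmap ?I (X (Suc k)) ?H" by (rule cm_ins[OF cont_full[OF cf] ch small])
    show "hq r (X (Suc k)) (avoid (Suc k)) (chm r (%z. ins k (f z, v z)) c) (chm r (%z. ins k (f z, w z)) c)"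
    proof (rule hq_homotopy[OF c H])
      fix s z assume s: "0 \<le> s" "s \<le> (1::real)" "z \<in> tops Z" "z \<in> S"
      have "f z \<in> avoid k" using cont_fun[OF f] s(3) by auto
      moreover have "?h (s, z) \<in> tops E" using funcset_mem[OF cont_fun[OF ch], of "(s, z)"] s by simp
      ultimately show "?H (s, z) \<in> avoid (Suc k)" using ins_avoid D[OF s] by simp
    qed auto
  next
    assume c: "relcycle r Z {} c" and D: "!!s z. [|0 \<le> s; s \<le> 1; z \<in> tops Z|] ==> lerp s (v z) (w z) ~= zv"
    have "cmap ?I (Y (Suc k)) ?H" by (rule cm_ins_Y[OF cf ch small]) (use D in auto)
    then show "hq r (Y (Suc k)) {} (chm r (%z. ins k (f z, v z)) c) (chm r (%z. ins k (f z, w z)) c)" by (rule hq_homotopy[OF c]) auto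
  }
qed

text \<open>Deleting an old point commutes with the insertion up to such a change; deleting the new
  point undoes it.\<close>

lemma del_P_old:
  assumes "j < Suc k"
  shows "del (Suc k) j (P (Suc k) z) = ins k (del k j (fst z), pt (Suc k) z)"
proof
  fix i
  show "del (Suc k) j (P (Suc k) z) i = ins k (del k j (fst z), pt (Suc k) z) i" using assms by (auto simp: del_def P_def ins_def skip_def)
qed

lemma del_P_new: "fst z \<in> extensional {..<k} ==> del k k (P k z) = fst z"
  by (auto simp: del_def P_def ins_def skip_def extensional_def fun_eq_iff)

lemma
  assumes j: "j < Suc k"
  shows hq_del_P: "relcycle r (ptop (Y (Suc k)) E) (csub {} nz) c ==>
      hq r (X (Suc k)) (avoid (Suc k)) (chm r (%z. del (Suc k) j (P (Suc k) z)) c) (chm r (%z. P k (del k j (fst z), snd z)) c)"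
    and hq_del_P_Y: "relcycle r (ptop (Y (Suc k)) (E0 n)) {} c ==>
      hq r (Y (Suc k)) {} (chm r (%z. del (Suc k) j (P (Suc k) z)) c) (chm r (%z. P k (del k j (fst z), snd z)) c)"
proof -
  have eq: "(%z. del (Suc k) j (P (Suc k) z)) = (%z. ins k (del k j (fst z), pt (Suc k) (fst z, snd z)))"
    "(%z. P k (del k j (fst z), snd z)) = (%z. ins k (del k j (fst z), pt k (del k j (fst z), snd z)))"
    unfolding del_P_old[OF j] by (simp_all add: P_def)
  have small: "2 * enorm n (pt (Suc k) (y, u)) < mu k (del k j y)" "2 * enorm n (pt k (del k j y, u)) < mu k (del k j y)"
    if "y \<in> tops (Y (Suc k))" for y u
    using enorm_pt[OF that, of u] mu_del[OF j, of y] enorm_pt[of "del k j y" k u] cont_fun[OF cm_del_Y[OF j]] that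
    by (auto simp del: mu.simps)
  have nz: "lerp s (pt (Suc k) (y, u)) (pt k (del k j y, u)) ~= zv"
    if "0 \<le> s" "s \<le> 1" "y \<in> tops (Y (Suc k))" "u ~= zv" for s y u
  proof -
    have "0 < mu (Suc k) y / 2" "0 < mu k (del k j y) / 2" using mu_pos[OF that(3)] mu_del[OF j, of y] by linarith+
    from lerp_less[OF that(1,2) this]
    have "0 < (1 - s) * (mu (Suc k) y / 2) + s * (mu k (del k j y) / 2)" by simp
    moreover have "lerp s (pt (Suc k) (y, u)) (pt k (del k j y, u)) =
      (%i. ((1 - s) * (mu (Suc k) y / 2) + s * (mu k (del k j y) / 2)) * sig n u i)" by (simp add: pt_def algebra_simps del: mu.simps)
    ultimately show ?thesis using posmult that(4) by simp
  qed
  {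
    let ?Z = "ptop (Y (Suc k)) E"
    assume c: "relcycle r ?Z (csub {} nz) c"
    have d: "cmap ?Z (Y k) (%z. del k j (fst z))" using cont_comp[OF cont_fst cm_del_Y[OF j]] by (simp add: o_def)
    show "hq r (X (Suc k)) (avoid (Suc k)) (chm r (%z. del (Suc k) j (P (Suc k) z)) c) (chm r (%z. P k (del k j (fst z), snd z)) c)"
      unfolding eq by (rule hq_ins[OF d cm_pt[OF cont_fst cont_snd] _ cm_pt[OF d cont_snd] _ c])
        (use small nz in \<open>auto simp: csub_def\<close>)
  next
    let ?Z = "ptop (Y (Suc k)) (E0 n)"
    assume c: "relcycle r ?Z {} c"
    have d: "cmap ?Z (Y k) (%z. del k j (fst z))" using cont_comp[OF cont_fst cm_del_Y[OF j]] by (simp add: o_def)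
    have s: "cmap ?Z E snd" by (rule cont_full[OF cont_snd])
    show "hq r (Y (Suc k)) {} (chm r (%z. del (Suc k) j (P (Suc k) z)) c) (chm r (%z. P k (del k j (fst z), snd z)) c)" unfolding eq
      by (rule hq_ins_Y[OF d cm_pt[OF cont_fst s] _ cm_pt[OF d s] _ c])
        (use small nz in auto)
  }
qed

end

lemma image_upd: "(f(m := x)) ` {..<Suc m} = insert x (f ` {..<m})" by (auto simp: lessThan_Suc)

lemma inj_on_upd: "inj_on f {..<m} ==> x \<notin> f ` {..<m} ==> inj_on (f(m := x)) {..<Suc m}" by (auto simp: lessThan_Suc inj_on_def)

context puncture
begin

lemma P_del_cross:
  assumes "schain r Z w"
  shows "chm (p + r) (%z. P k (del k j (fst z), snd z)) (cross p r c w) =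
    chm (p + r) (P k) (cross p r (chm p (del k j) c) w)"
proof -
  have "cross p r (chm p (del k j) c) w = chm (p + r) (map_prod (del k j) id) (cross p r c w)"
    using cross_natural[of p r "del k j" c id w] unfolding chm_ident[OF assms] .
  then show ?thesis by (simp add: chm_comp map_prod_def case_prod_unfold)
qed

lemma Y_ext: "y \<in> tops (Y k) ==> y \<in> extensional {..<k}" by (simp add: conf_top)

lemma del_new_st: "cyc p k y ==> chm p (del k k) (st p k y) = y" unfolding st_def chm_comp
  by (rule chm_id_gen[OF cyc_chain]) (use del_P_new Y_ext in fastforce)+

lemma tau_split: "tau p (Suc k) c = (\<Sum>j<Suc k. chm p (del (Suc k) j) c) + chm p (del (Suc k) (Suc k)) c"
  unfolding tau_def by (rule sum.lessThan_Suc)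

lemma tau_st_0: "cyc p 0 y ==> tau p 0 (st p 0 y) = y" using del_new_st[of p 0 y] by (simp add: tau_def)

lemma tau_st:
  assumes y: "cyc p (Suc k) y"
  shows "hq p (Y (Suc k)) {} (tau p (Suc k) (st p (Suc k) y)) (st p k (tau p k y) + y)"
proof -
  have ne: "uvec ~= zv" by (rule enorm_neq[of n]) simp
  have "cmap (Y (Suc k)) (ptop (Y (Suc k)) (E0 n)) (%y. (y, uvec))" using uvec_in[of b] ne by (intro cont_pairedI) (auto simp: cont_const)
  from relcycle_chm[OF y this, of "{}"]
  have c: "relcycle p (ptop (Y (Suc k)) (E0 n)) {} (chm p (%y. (y, uvec)) y)" by simp
  have "hq p (Y (Suc k)) {} (chm p (del (Suc k) j) (st p (Suc k) y)) (st p k (chm p (del k j) y))" if "j < Suc k" for j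
    using hq_del_P_Y[OF that c] by (simp add: st_def chm_comp)
  then have "hq p (Y (Suc k)) {} (\<Sum>j<Suc k. chm p (del (Suc k) j) (st p (Suc k) y)) (\<Sum>j<Suc k. st p k (chm p (del k j) y))"
    by (intro hq_sum) auto
  moreover have "st p k (tau p k y) = (\<Sum>j<Suc k. st p k (chm p (del k j) y))" unfolding tau_def linear_ops ..
  ultimately show ?thesis unfolding tau_split del_new_st[OF y] by (simp only: add_diff_cancel_right)
qed

lemma del_new_dt:
  "cyc p k y ==> rnull (p + b) (Y k) {} (chm (p + b) (del k k) (dt p k y))"
proof -
  assume y: "cyc p k y"
  have "chm (p + b) (del k k) (dt p k y) = chm (p + b) fst (cross p b y (sph n))" unfolding dt_def chm_comp
    by (rule chm_eq[OF schain_cross[OF cyc_chain[OF y] schain_sph]]) (use del_P_new Y_ext in fastforce)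
  then show ?thesis using rnull_sph_extend[OF y cont_fst] by simp
qed

lemma tau_dt:
  assumes y: "cyc p (Suc k) y"
  shows "hq (p + b) (Y (Suc k)) {} (tau (p + b) (Suc k) (dt p (Suc k) y)) (dt p k (tau p k y))"
proof -
  have "hq (p + b) (Y (Suc k)) {} (chm (p + b) (del (Suc k) j) (dt p (Suc k) y)) (dt p k (chm p (del k j) y))" if "j < Suc k" for j
    using hq_del_P_Y[OF that cross_cycle[OF y cycle_sph]] unfolding P_del_cross[OF schain_sph] by (simp add: dt_def chm_comp)
  then have "hq (p + b) (Y (Suc k)) {} (\<Sum>j<Suc k. chm (p + b) (del (Suc k) j) (dt p (Suc k) y)) (\<Sum>j<Suc k. dt p k (chm p (del k j) y))"
    by (intro hq_sum) auto
  moreover have "dt p k (tau p k y) = (\<Sum>j<Suc k. dt p k (chm p (del k j) y))" unfolding tau_def linear_ops ..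
  ultimately show ?thesis using rnull_add[OF _ del_new_dt[OF y]] unfolding tau_split by (simp only: diff_add_eq[symmetric])
qed

lemma tau_Tt:
  assumes y: "cyc p (Suc k) y"
  shows "hq (p + n) (X (Suc k)) (avoid (Suc k)) (tau (p + n) (Suc k) (Tt p (Suc k) y)) (Tt p k (tau p k y))"
proof -
  have c: "schain (p + n) (ptop (Y (Suc k)) E) (cross p n y (thom n))" by (rule schain_cross[OF cyc_chain[OF y] schain_thom])
  have "hq (p + n) (X (Suc k)) (avoid (Suc k)) (chm (p + n) (del (Suc k) j) (Tt p (Suc k) y)) (Tt p k (chm p (del k j) y))" if "j < Suc k" for j
    using hq_del_P[OF that relcycle_cross[OF y relcycle_thom[of n]]] unfolding P_del_cross[OF schain_thom] by (simp add: Tt_def chm_comp)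
  then have 1: "hq (p + n) (X (Suc k)) (avoid (Suc k)) (\<Sum>j<Suc k. chm (p + n) (del (Suc k) j) (Tt p (Suc k) y)) (\<Sum>j<Suc k. Tt p k (chm p (del k j) y))"
    by (intro hq_sum) auto
  have "chm (p + n) (del (Suc k) (Suc k)) (Tt p (Suc k) y) = chm (p + n) fst (cross p n y (thom n))" unfolding Tt_def chm_comp
    by (rule chm_eq[OF c]) (use del_P_new Y_ext in fastforce)
  moreover have "schain (p + n) (Y (Suc k)) (chm (p + n) fst (cross p n y (thom n)))" by (rule schain_chm[OF c cont_fst])
  ultimately have 2: "rnull (p + n) (X (Suc k)) (avoid (Suc k)) (chm (p + n) (del (Suc k) (Suc k)) (Tt p (Suc k) y))"
    by (simp only: rnull_chain)
  have "Tt p k (tau p k y) = (\<Sum>j<Suc k. Tt p k (chm p (del k j) y))" unfolding tau_def linear_ops ..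
  then show ?thesis using rnull_add[OF 1 2] unfolding tau_split by (simp only: diff_add_eq[symmetric])
qed

definition ins3 :: "nat => (nat => 'a) triple => nat => 'a" where
  "ins3 k = (%(y, u, v, w). y(k := g u, Suc k := g v, Suc (Suc k) := g w))"

definition small3 :: "nat => (nat => 'a) triple set" where
  "small3 k = {(y, u, v, w). 2 * enorm n u < mu k y & 2 * enorm n v < mu k y & 2 * enorm n w < mu k y}"

lemma cm_ins3: "cmap (subtop (tspace n (Y k)) (dtrip Int small3 k)) (Y (Suc (Suc (Suc k)))) (ins3 k)"
proof -
  let ?Z = "subtop (tspace n (Y k)) (dtrip Int small3 k)"
  have id: "cmap ?Z (tspace n (Y k)) (%x. x)" by (simp add: cont_from_sub)
  note c = cont_tripleD[OF id]
  have eq: "ins3 k = (%x. (fst x)(k := g (fst (snd x)), Suc k := g (fst (snd (snd x))), Suc (Suc k) := g (snd (snd (snd x)))))"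
    by (auto simp: ins3_def)
  have T: "ins3 k x \<in> tops (X (Suc (Suc (Suc k)))) & ins3 k x \<in> avoid (Suc (Suc (Suc k)))" if x: "x \<in> tops ?Z" for x
  proof -
    obtain y u v w where x': "x = (y, u, v, w)" by (cases x) auto
    have y: "y \<in> extensional {..<k}" "\<forall>j<k. y j \<in> tops M" "inj_on y {..<k}" "y \<in> avoid k"
      and uvw: "u \<in> tops E" "v \<in> tops E" "w \<in> tops E" "u ~= zv" "v ~= zv" "w ~= zv" "u ~= v" "v ~= w" "u ~= w"
      and s: "2 * enorm n u < mu k y" "2 * enorm n v < mu k y" "2 * enorm n w < mu k y"
      using x unfolding x' by (auto simp: conf_top dtrip_def small3_def)
    have gg: "g u ~= g v" "g v ~= g w" "g u ~= g w" using uvw gi_g by metis+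
    have yg: "g u \<notin> y ` {..<k}" "g v \<notin> y ` {..<k}" "g w \<notin> y ` {..<k}"
      using g_neq[OF uvw(1) s(1)] g_neq[OF uvw(2) s(2)] g_neq[OF uvw(3) s(3)] by auto metis+
    have "inj_on (y(k := g u, Suc k := g v, Suc (Suc k) := g w)) {..<Suc (Suc (Suc k))}"
      using yg gg y(3) by (intro inj_on_upd) (auto simp: image_upd simp del: fun_upd_apply)
    then show ?thesis unfolding x' ins3_def prod.case using y uvw g_in g_eq_q by (auto simp: conf_top avoid_def extensional_def less_Suc_eq)
  qed
  show ?thesis
  proof (rule cont_subI[OF cont_confI])
    show "cmap ?Z M (%x. ins3 k x j)" if j: "j < Suc (Suc (Suc k))" for j
    proof -
      consider "j < k" | "j = k" | "j = Suc k" | "j = Suc (Suc k)" using j by linarith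
      then show ?thesis unfolding eq using cm_Y_D[OF c(1)] cont_comp[OF c(2) cont_g] cont_comp[OF c(3) cont_g] cont_comp[OF c(4) cont_g]
        by cases (auto simp: o_def)
    qed
  qed (use T conf_top in blast)+
qed

abbreviation mu_scale :: "nat => (nat => 'a) triple => (nat => 'a) triple" where
  "mu_scale k == (%(y, u, v, w). (y, pt k (y, u), pt k (y, v), pt k (y, w)))"

lemma sig_inj:
  assumes "sig m u = sig m v" shows "u = v"
proof -
  have "enorm m (sig m u) = enorm m (sig m v)" using assms by simp
  then have "enorm m u = enorm m v" unfolding enorm_sig using enorm_add1_pos[of m u] enorm_add1_pos[of m v] by (simp add: field_simps)
  then have "u i = v i" for i using fun_cong[OF assms, of i] enorm_add1_pos(2)[of m v] by (simp add: sig_def)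
  then show ?thesis by auto
qed

lemma cm_mu_scale:
  "cmap (subtop (tspace n (Y k)) dtrip) (subtop (tspace n (Y k)) (dtrip Int small3 k)) (mu_scale k)"
proof (rule cont_subI)
  let ?Z = "subtop (tspace n (Y k)) dtrip"
  have id: "cmap ?Z (tspace n (Y k)) (%x. x)" by (simp add: cont_from_sub)
  note c = cont_tripleD[OF id]
  show "cmap ?Z (tspace n (Y k)) (mu_scale k)" unfolding case_prod_unfold by (intro cont_triple cm_pt c)
  fix x assume x: "x \<in> tops ?Z"
  obtain y u v w where x': "x = (y, u, v, w)" by (cases x) auto
  have y: "y \<in> tops (Y k)" and d: "u ~= zv" "v ~= zv" "w ~= zv" "u ~= v" "v ~= w" "u ~= w"
    using x unfolding x' by (auto simp: dtrip_def)
  have "u = v" if eq: "pt k (y, u) = pt k (y, v)" for u v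
  proof -
    have "sig n u i = sig n v i" for i using fun_cong[OF eq, of i] mu_pos[OF y] by (simp add: pt_def)
    then show ?thesis using sig_inj[of n u v] by blast
  qed
  from this[of u v] this[of v w] this[of u w]
  show "mu_scale k x \<in> dtrip Int small3 k"
    using d enorm_pt[OF y, of u] enorm_pt[OF y, of v] enorm_pt[OF y, of w] pt_zv[OF y, of u] pt_zv[OF y, of v] pt_zv[OF y, of w]
    by (auto simp: x' dtrip_def small3_def)
qed

lemma ins3_scale_perm:
  "ins3 k (mu_scale k (perm12 x)) = ins3 k (mu_scale k x) \<circ> Transposition.transpose k (Suc k)"
  "ins3 k (mu_scale k (perm23 x)) = ins3 k (mu_scale k x) \<circ> Transposition.transpose (Suc k) (Suc (Suc k))"
  by (cases x; rule ext; simp add: ins3_def perm12_def perm23_def Transposition.transpose_def)+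

lemma commutator_puncture:
  assumes y: "cyc p k y" and a: "a = 1 | a = - 1"
    "hq n E nz (chm n anti (thom n)) (scal a (thom n))"
  shows "commutator b p (Y k) y (Y (Suc (Suc (Suc k)))) (%x. ins3 k (mu_scale k x)) (N (p + b + b) (Suc (Suc (Suc k)))) a"
proof
  let ?r = "p + b + b" and ?K = "Suc (Suc (Suc k))"
  show "cmap (subtop (tspace n (Y k)) dtrip) (Y ?K) (%x. ins3 k (mu_scale k x))"
    using cont_comp[OF cm_mu_scale cm_ins3] by (simp add: o_def)
  have tr: "Transposition.transpose k (Suc k) permutes {..<?K}" "Transposition.transpose (Suc k) (Suc (Suc k)) permutes {..<?K}"
    by (auto intro!: permutes_swap_id)
  show "N ?r ?K (chm ?r (%x. ins3 k (mu_scale k x)) (chm ?r perm12 x) - chm ?r (%x. ins3 k (mu_scale k x)) x)" for x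
    using N_perm[OF tr(1), of ?r "chm ?r (%x. ins3 k (mu_scale k x)) x"] unfolding chm_comp ins3_scale_perm .
  show "N ?r ?K (chm ?r (%x. ins3 k (mu_scale k x)) (chm ?r perm23 x) - chm ?r (%x. ins3 k (mu_scale k x)) x)" for x
    using N_perm[OF tr(2), of ?r "chm ?r (%x. ins3 k (mu_scale k x)) x"] unfolding chm_comp ins3_scale_perm .
qed (fact y a N_null N_add N_cmul | erule (1) N_cancel N_add)+

lemma mu_upd: "k \<le> l ==> mu k (y(l := v)) = mu k y" by (induction k) auto

lemma pt_in: "u \<in> tops E ==> pt k (y, u) \<in> tops E" by (auto simp: pt_def sig_def top_Euc)

lemma mu_P:
  assumes "y \<in> tops (Y k)" "u \<in> tops E"
  shows "mu (Suc k) (P k (y, u)) = enorm n (pt k (y, u))"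
proof -
  have e: "2 * enorm n (pt k (y, u)) < mu k y" by (rule enorm_pt[OF assms(1)])
  have "nu (g (pt k (y, u))) = enorm n (pt k (y, u))" by (rule nu_g_less[OF pt_in[OF assms(2)] e mu_le(1)])
  moreover have "enorm n (pt k (y, u)) \<le> mu k y" using e enorm_nonneg[of n "pt k (y, u)"] by linarith
  ultimately show ?thesis by (simp add: P_def ins_def mu_upd min_absorb2)
qed

lemma pt_pair: "pt k (y, u) = (%i. mu k y / 2 * sig n u i)" by (simp add: pt_def)

lemma P_Y:
  assumes "y \<in> tops (Y k)" "u \<in> tops E" "u ~= zv"
  shows "P k (y, u) \<in> tops (Y (Suc k))" using funcset_mem[OF cont_fun[OF cm_P_Y], of "(y, u)" k] assms by simp

lemma PPP:
  assumes y: "y \<in> tops (Y k)" and u: "u \<in> tops E" "u ~= zv" and w: "w \<in> tops E" "w ~= zv" and x: "x \<in> tops E"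
  shows "P (Suc (Suc k)) (P (Suc k) (P k (y, u), w), x) =
    ins3 k (y, (%i. mu k y / 2 * sig n u i), (%i. enorm n (pt k (y, u)) / 2 * sig n w i),
      (%i. enorm n (%i. enorm n (pt k (y, u)) / 2 * sig n w i) / 2 * sig n x i))"
proof -
  note 1 = P_Y[OF y u] and m = mu_P[OF y u(1)]
  have p: "pt (Suc k) (P k (y, u), w) = (%i. enorm n (pt k (y, u)) / 2 * sig n w i)" by (rule trans[OF pt_pair]) (simp only: m)
  have "mu (Suc (Suc k)) (P (Suc k) (P k (y, u), w)) = enorm n (%i. enorm n (pt k (y, u)) / 2 * sig n w i)" unfolding mu_P[OF 1 w(1)] p ..
  then have q: "pt (Suc (Suc k)) (P (Suc k) (P k (y, u), w), x) = (%i. enorm n (%i. enorm n (pt k (y, u)) / 2 * sig n w i) / 2 * sig n x i)"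
    by (intro trans[OF pt_pair]) (simp only:)
  show ?thesis unfolding P_def[of "Suc (Suc k)"] ins_def fst_conv snd_conv q unfolding P_def[of "Suc k"] ins_def fst_conv snd_conv p
    unfolding P_def ins_def ins3_def fst_conv snd_conv prod.case pt_pair[of k] ..
qed

lemma dt_dt: "dt (p + b) (Suc k) (dt p k y) = chm (p + b + b) (%z. P (Suc k) (P k (fst z), snd z)) (torus b p y)"
proof -
  have "cross (p + b) b (chm (p + b) (P k) (cross p b y (sph n))) (sph n) =
      chm (p + b + b) (map_prod (P k) id) (torus b p y)"
    using cross_natural[of "p + b" b "P k" "cross p b y (sph n)" id "sph n"] unfolding chm_ident[OF schain_sph] .
  moreover have "P (Suc k) (map_prod (P k) id z) = P (Suc k) (P k (fst z), snd z)" for z by (cases z) simp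
  ultimately show ?thesis unfolding dt_def by (simp only: chm_comp)
qed

lemma torus_map: "torus b p (chm p f y) = chm (p + b + b) (%z. ((f (bpt z), mpt z), snd z)) (torus b p y)"
proof -
  have 1: "cross p b (chm p f y) (sph n) = chm (p + b) (map_prod f id) (cross p b y (sph n))"
    using cross_natural[of p b f y id "sph n"] unfolding chm_ident[OF schain_sph] .
  have "map_prod (map_prod f id) id = (%z :: (_ \<times> rvec) \<times> rvec. ((f (bpt z), mpt z), snd z))" by (auto simp: fun_eq_iff)
  then show ?thesis using cross_natural[of "p + b" b "map_prod f id" "cross p b y (sph n)" id "sph n"]
    unfolding 1 chm_ident[OF schain_sph] by (simp only:)
qed

definition rot :: "'b triple => 'b triple" where
  "rot x = perm12 (perm23 x)"

text \<open>Both composites insert three points close to \<open>q\<close> at positions given by radial triples.\<close>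

theorem st_dt_dt:
  assumes y: "cyc p k y"
  shows "N (p + b + b) (Suc (Suc (Suc k))) (st (p + b + b) (Suc (Suc k)) (dt (p + b) (Suc k) (dt p k y)) -
    dt (p + b) (Suc (Suc k)) (dt p (Suc k) (st p k y)))"
proof -
  let ?r = "p + b + b" and ?K = "Suc (Suc (Suc k))"
  obtain a :: int where a: "a = 1 | a = - 1" "hq n E nz (chm n anti (thom n)) (scal a (thom n))" by (rule antipode_sign[of n])
  interpret C: commutator b p "Y k" y "Y ?K" "%x. ins3 k (mu_scale k x)" "N ?r ?K" a by (rule commutator_puncture[OF y a])
  let ?TS = "torus_space n (Y k)" and ?t = "torus b p y"
  let ?D = "dtrip Int small3 k :: (nat => 'a) triple set"
  have straight: "hq ?r (subtop (tspace n (Y k)) ?D) {} (chm ?r F ?t) (chm ?r G ?t)"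
    if g: "good_shape 0 0 R" and c: "cmap ?TS (tspace n (Y k)) F" "cmap ?TS (tspace n (Y k)) G"
      and F: "!!z. z \<in> tops ?TS ==> shape n 0 0 R z (F z) & F z \<in> small3 k"
      and G: "!!z. z \<in> tops ?TS ==> shape n 0 0 R z (G z) & G z \<in> small3 k" for R F G
  proof (rule hq_straight_triple[OF C.tcyc c])
    show eq: "fst (F z) = fst (G z)" if "z \<in> tops ?TS" for z using F[OF that] G[OF that] unfolding shape_def by auto
    fix s z assume s: "0 \<le> s" "(s::real) \<le> 1" "z \<in> tops ?TS"
    let ?x = "(tlerp s (F z) (G z))"
    have "shape n 0 0 R z ?x" using F[OF s(3)] G[OF s(3)] g by (intro shape_lerp s) (auto simp: good_shape_def)
    then have 1: "?x \<in> dtrip" by (rule shape_distinct[OF g _ C.TS_pos[OF s(3)]])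
    have l: "2 * enorm n (lerp s u v) < m" if "2 * enorm n u < m" "2 * enorm n v < m" for u v m
    proof -
      have "enorm n (lerp s u v) \<le> (1 - s) * enorm n u + s * enorm n v"
        using enorm_triangle[of n "%i. (1 - s) * u i" "%i. s * v i"] s by (simp add: enorm_scale)
      also have "\<dots> < (1 - s) * (m / 2) + s * (m / 2)" using that by (intro lerp_less s) auto
      also have "\<dots> = m / 2" by (simp add: field_simps)
      finally show ?thesis by simp
    qed
    have "?x \<in> small3 k" using F[OF s(3)] G[OF s(3)] eq[OF s(3)] l by (auto simp: small3_def case_prod_unfold)
    with 1 show "?x \<in> ?D" by blast
  qed
  have y0: "uvec \<in> tops E" "uvec ~= zv" "enorm n uvec = 1" using uvec_in[of b] enorm_neq[of n uvec zv] by auto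
  have rot: "cmap (subtop (tspace n (Y k)) ?D) (subtop (tspace n (Y k)) ?D) rot"
  proof (rule cont_subI)
    have id: "cmap (subtop (tspace n (Y k)) ?D) (tspace n (Y k)) (%x. x)" by (simp add: cont_from_sub)
    show "cmap (subtop (tspace n (Y k)) ?D) (tspace n (Y k)) rot"
      unfolding rot_def perm12_def perm23_def case_prod_unfold fst_conv snd_conv by (intro cont_triple cont_tripleD[OF id])
  qed (auto simp: rot_def perm12_def perm23_def dtrip_def small3_def)
  let ?m = "%z :: ((nat => 'a) \<times> rvec) \<times> rvec. mu k (bpt z)"
  let ?U = "%z :: ((nat => 'a) \<times> rvec) \<times> rvec. enorm n (mpt z)"
  let ?W = "%z :: ((nat => 'a) \<times> rvec) \<times> rvec. enorm n (snd z)"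
  have sh: "shape n 0 0 R z x & x \<in> small3 k"
    if "0 < \<alpha>" "0 < \<beta>" "0 < \<gamma>" "R (\<alpha> * ?U z) (\<beta> * ?W z) \<gamma>" "2 * (\<alpha> * ?U z) < ?m z" "2 * (\<beta> * ?W z) < ?m z" "2 * \<gamma> < ?m z"
      "x = (bpt z, (%i. \<alpha> * mpt z i), (%i. \<beta> * snd z i), (%i. \<gamma> * uvec i))" for \<alpha> \<beta> \<gamma> R z x
  proof
    show "shape n 0 0 R z x" unfolding that(8)
      by (rule C.shapeI[where \<alpha> = \<alpha> and \<beta> = \<beta> and \<gamma> = \<gamma>]) (use that in simp_all)
    show "x \<in> small3 k" using that by (simp add: small3_def C.enorm_posscale y0(3))
  qed
  define A where "A z = (bpt z, (%i. ?m z / 2 * sig n (mpt z) i), (%i. enorm n (pt k (fst z)) / 2 * sig n (snd z) i),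
      (%i. enorm n (%i. enorm n (pt k (fst z)) / 2 * sig n (snd z) i) / 2 * sig n uvec i))" for z
  define A' where "A' z = (bpt z, (%i. enorm n (pt k (bpt z, uvec)) / 2 * sig n (mpt z) i),
      (%i. enorm n (%i. enorm n (pt k (bpt z, uvec)) / 2 * sig n (mpt z) i) / 2 * sig n (snd z) i),
      (%i. ?m z / 2 * sig n uvec i))" for z
  have cm: "cmap ?TS Rtop ?m" by (intro cm_mu cm_Y_D[OF C.TS_cont(1)])
  have c0: "cmap ?TS E (%z. uvec)" using y0(1) by (simp add: cont_const)
  have cp: "cmap ?TS E (%z. pt k (fst z))" "cmap ?TS E (%z. pt k (bpt z, uvec))"
    using cm_pt[OF C.TS_cont(1,2)] cm_pt[OF C.TS_cont(1) c0] by simp_all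
  have half: "cmap ?TS Rtop (%z. f z / 2)" if "cmap ?TS Rtop f" for f using that by (intro cont_real_divide) auto
  note cs = cont_triple C.TS_cont cont_scale half cont_sig cm c0
  have cv: "cmap ?TS E (%z i. enorm n (pt k (fst z)) / 2 * sig n (snd z) i)"
    "cmap ?TS E (%z i. enorm n (pt k (bpt z, uvec)) / 2 * sig n (mpt z) i)" by (intro cs cont_enorm[OF cp(1)] cont_enorm[OF cp(2)])+
  have cA: "cmap ?TS (tspace n (Y k)) A" "cmap ?TS (tspace n (Y k)) A'"
    unfolding A_def A'_def by (intro cs cv cont_enorm[OF cv(1)] cont_enorm[OF cv(2)])+
  let ?B = "%z. mu_scale k (C.F0 z)" and ?B' = "%z. mu_scale k (C.F1p z)"
  have cB: "cmap ?TS (tspace n (Y k)) ?B" "cmap ?TS (tspace n (Y k)) ?B'"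
  proof -
    have r: "cmap ?TS Rtop (%z. c / ?U z)" "cmap ?TS Rtop (%z. c / ?W z)" for c by (intro C.TS_real | simp)+
    show "cmap ?TS (tspace n (Y k)) ?B" "cmap ?TS (tspace n (Y k)) ?B'"
      unfolding prod.case by (intro cont_triple C.TS_cont cm_pt C.E_const cont_scale r)+
  qed
  have base: "0 < ?m z" "0 < ?U z" "0 < ?W z" "bpt z \<in> tops (Y k)" if "z \<in> tops ?TS" for z
    using that mu_pos C.TS_pos[OF that] by auto
  have sig0: "(%i. c * sig n uvec i) = (%i. c / 2 * uvec i)" for c unfolding sig_def y0(3) by simp
  have pts: "(%i. c * sig n v i) = (%i. c / (1 + enorm n v) * v i)" for c v by (simp add: sig_def)
  have pt1: "pt k (y, %i. c / enorm n v * v i) = (%i. mu k y / 2 * (c / (1 + c)) / enorm n v * v i)" if "0 < c" "0 < enorm n v" for y c v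
  proof -
    have "enorm n (%i. c / enorm n v * v i) = c" using that unfolding enorm_scale by simp
    then show ?thesis unfolding pt_pair pts by (simp add: mult.assoc)
  qed
  have pt2: "pt k (y, %i. c * uvec i) = (%i. mu k y / 2 * (c / (1 + c)) * uvec i)" if "0 < c" for y c
    using that C.enorm_uvec[of c] unfolding pt_pair pts by (simp add: mult.assoc)
  have NN: "0 < c / 2 / (1 + enorm n v) * enorm n v & c / 2 / (1 + enorm n v) * enorm n v < c / 2"
    if "0 < c" "0 < enorm n v" for c v using that C.sig_weight[of "c / 2" v] by simp
  have shA: "shape n 0 0 (%a b c. c < b & b < a) z (A z) & A z \<in> small3 k"
    and shA': "shape n 0 0 (%a b c. b < a & a < c) z (A' z) & A' z \<in> small3 k"
    and shB: "shape n 0 0 (%a b c. c < b & b < a) z (?B z) & ?B z \<in> small3 k"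
    and shB': "shape n 0 0 (%a b c. b < a & a < c) z (?B' z) & ?B' z \<in> small3 k"
    if z: "z \<in> tops ?TS" for z :: "((nat => 'a) \<times> rvec) \<times> rvec"
  proof -
    note bz = base[OF z]
    define N1 where "N1 = enorm n (pt k (fst z))"
    have N1: "N1 = ?m z / 2 / (1 + ?U z) * ?U z"
      unfolding N1_def using pt_pair[of k "bpt z" "mpt z"] C.sig_norm[of "?m z / 2" "mpt z"] bz by simp
    have n1: "0 < N1" "N1 < ?m z / 2" unfolding N1 using NN[OF bz(1,2)] by auto
    define N2 where "N2 = enorm n (%i. N1 / 2 * sig n (snd z) i)"
    have N2: "N2 = N1 / 2 / (1 + ?W z) * ?W z" unfolding N2_def using n1 by (simp only: C.sig_norm)
    have n2: "0 < N2" "N2 < N1 / 2" unfolding N2 using NN[OF n1(1) bz(3)] by auto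
    have "A z = (bpt z, (%i. ?m z / 2 / (1 + ?U z) * mpt z i), (%i. N1 / 2 / (1 + ?W z) * snd z i), (%i. N2 / 2 / 2 * uvec i))"
      unfolding A_def N1_def[symmetric] N2_def[symmetric] sig0 unfolding pts ..
    moreover have "0 < ?m z / 2 / (1 + ?U z)" "0 < N1 / 2 / (1 + ?W z)" "0 < N2 / 2 / 2" using bz n1 n2 enorm_add1_pos by simp_all
    moreover have "N2 / 2 / 2 < N1 / 2 / (1 + ?W z) * ?W z & N1 / 2 / (1 + ?W z) * ?W z < ?m z / 2 / (1 + ?U z) * ?U z"
      "2 * (?m z / 2 / (1 + ?U z) * ?U z) < ?m z" "2 * (N1 / 2 / (1 + ?W z) * ?W z) < ?m z" "2 * (N2 / 2 / 2) < ?m z"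
      unfolding N1[symmetric] N2[symmetric] using n1 n2 by linarith+
    ultimately show "shape n 0 0 (%a b c. c < b & b < a) z (A z) & A z \<in> small3 k" by (intro sh)
    define N1' where "N1' = enorm n (pt k (bpt z, uvec))"
    have N1': "N1' = ?m z / 2 / 2" unfolding N1'_def pt_pair sig0 C.enorm_uvec using bz by simp
    have n1': "0 < N1'" using N1' bz by simp
    define N2' where "N2' = enorm n (%i. N1' / 2 * sig n (mpt z) i)"
    have N2': "N2' = N1' / 2 / (1 + ?U z) * ?U z" unfolding N2'_def using n1' by (simp only: C.sig_norm)
    have n2': "0 < N2'" "N2' < N1' / 2" unfolding N2' using NN[OF n1' bz(2)] by auto
    note n3' = NN[OF n2'(1) bz(3)]
    have "A' z = (bpt z, (%i. N1' / 2 / (1 + ?U z) * mpt z i), (%i. N2' / 2 / (1 + ?W z) * snd z i), (%i. ?m z / 2 / 2 * uvec i))"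
      unfolding A'_def N1'_def[symmetric] N2'_def[symmetric] sig0 unfolding pts ..
    moreover have "0 < N1' / 2 / (1 + ?U z)" "0 < N2' / 2 / (1 + ?W z)" "0 < ?m z / 2 / 2" using bz n1' n2' enorm_add1_pos by simp_all
    moreover have "N2' / 2 / (1 + ?W z) * ?W z < N1' / 2 / (1 + ?U z) * ?U z & N1' / 2 / (1 + ?U z) * ?U z < ?m z / 2 / 2"
      "2 * (N1' / 2 / (1 + ?U z) * ?U z) < ?m z" "2 * (N2' / 2 / (1 + ?W z) * ?W z) < ?m z" "2 * (?m z / 2 / 2) < ?m z"
      unfolding N2'[symmetric] using n3' n1' n2' bz(1) N1' by linarith+
    ultimately show "shape n 0 0 (%a b c. b < a & a < c) z (A' z) & A' z \<in> small3 k" by (intro sh)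
    show "shape n 0 0 (%a b c. c < b & b < a) z (?B z) & ?B z \<in> small3 k"
      unfolding prod.case by (rule sh[of "?m z / 2 * (1 / (1 + 1)) / ?U z" "?m z / 2 * (1/2 / (1 + 1/2)) / ?W z" "?m z / 2 * (1/4 / (1 + 1/4))"])
        (use bz pt1[of 1 "mpt z" "bpt z"] pt1[of "1/2" "snd z" "bpt z"] pt2[of "1/4" "bpt z"] in simp_all)
    show "shape n 0 0 (%a b c. b < a & a < c) z (?B' z) & ?B' z \<in> small3 k"
      unfolding prod.case by (rule sh[of "?m z / 2 * (1/2 / (1 + 1/2)) / ?U z" "?m z / 2 * (1/4 / (1 + 1/4)) / ?W z" "?m z / 2 * (1 / (1 + 1))"])
        (use bz pt1[of "1/2" "mpt z" "bpt z"] pt1[of "1/4" "snd z" "bpt z"] pt2[of 1 "bpt z"] in simp_all)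
  qed
  have TS_E: "mpt z \<in> tops E" "snd z \<in> tops E" if "z \<in> tops ?TS" for z using that by auto
  have 1: "st ?r (Suc (Suc k)) (dt (p + b) (Suc k) (dt p k y)) = chm ?r (%z. ins3 k (A z)) ?t" unfolding dt_dt st_def chm_comp
  proof (rule chm_eq[OF C.tch])
    fix z assume z: "z \<in> tops ?TS"
    show "P (Suc (Suc k)) (P (Suc k) (P k (fst z), snd z), uvec) = ins3 k (A z)"
      using PPP[OF base(4)[OF z] TS_E(1)[OF z] C.TS_ne(3)[OF z] TS_E(2)[OF z] C.TS_ne(4)[OF z] y0(1)] by (simp add: A_def)
  qed
  have 2: "dt (p + b) (Suc (Suc k)) (dt p (Suc k) (st p k y)) = chm ?r (%z. ins3 k (rot (A' z))) ?t"
    unfolding dt_dt st_def torus_map chm_comp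
  proof (rule chm_eq[OF C.tch])
    fix z assume z: "z \<in> tops ?TS"
    show "P (Suc (Suc k)) (P (Suc k) (fst ((P k (bpt z, uvec), mpt z), snd z)), snd ((P k (bpt z, uvec), mpt z), snd z)) = ins3 k (rot (A' z))"
      using PPP[OF base(4)[OF z] y0(1,2) TS_E(1)[OF z] C.TS_ne(3)[OF z] TS_E(2)[OF z]] by (simp add: A'_def rot_def perm12_def perm23_def)
  qed
  have 3: "N ?r ?K (chm ?r (%z. ins3 k (A z)) ?t - C.V C.F0)" using rnull_chm[OF straight[OF good_shapes(1) cA(1) cB(1) shA shB] cm_ins3]
    unfolding C.V_def by (intro N_null) (simp add: chm_diff chm_comp)
  have 4: "N ?r ?K (chm ?r (%z. ins3 k (rot (A' z))) ?t - C.V C.F1)"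
  proof -
    have F1: "(%z. ins3 k (mu_scale k (C.F1 z))) = (%z. ins3 k (rot (?B' z)))" by (simp add: rot_def perm12_def perm23_def)
    show ?thesis using rnull_chm[OF straight[OF good_shapes(3) cA(2) cB(2) shA' shB'] cont_comp[OF rot cm_ins3], of "{}"]
      unfolding C.V_def F1 by (intro N_null) (simp add: chm_diff chm_comp)
  qed
  have "N ?r ?K (C.V C.F0 - C.V C.F1)" using C.commutator_relation unfolding C.eqv_def .
  from N_diff[OF N_add[OF 3 this] 4] show ?thesis unfolding 1 2 by simp
qed

end

context puncture
begin

text \<open>The relation \<open>\<tau> s = s \<tau> + 1\<close> makes \<open>s \<tau> + l\<close> rationally onto for \<open>l \<ge> 1\<close>, by
  induction on the number of points.\<close>

primrec Wst :: "nat => nat => (nat => 'a) chain => (nat => 'a) chain" where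
  "Wst p 0 u = 0" |
  "Wst p (Suc k) u = st p k (tau p k u)"

lemma tau_st_N: "cyc p k y ==> N p k (tau p k (st p k y) - (Wst p k y + y))" by (cases k) (auto simp: tau_st_0 intro!: N_null tau_st)

lemma weyl:
  assumes A: "!!k c. A k c ==> cyc p k c" "!!k c d. A k c ==> A k d ==> A k (c - d)"
    "!!k c m. A k c ==> A k (scal m c)"
    "!!k c. A k c ==> A (Suc k) (st p k c)" "!!k c. A (Suc k) c ==> A k (tau p k c)"
    and z: "A k z"
  shows weyl_onto: "l > 0 ==> \<exists>u c. c ~= 0 & A k u & N p k (Wst p k u + scal l u - scal c z)"
    and weyl_tau_onto: "\<exists>u c. c ~= 0 & A (Suc k) u & N p k (tau p k u - scal c z)"
proof -
  have onto: "\<exists>u c. c ~= 0 & A k u & N p k (Wst p k u + scal l u - scal c z)"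
    if "A k z" "l > 0" for k z l using that
  proof (induction k arbitrary: z l)
    case 0
    then show ?case by (intro exI[of _ z] exI[of _ l]) (simp add: N_null)
  next
    case (Suc k)
    obtain u c where u: "c ~= 0" "A k u" and Nu: "N p k (Wst p k u + scal (l + 1) u - scal c (tau p k z))"
      using Suc.IH[OF A(5)[OF Suc.prems(1)], of "l + 1"] Suc.prems(2) by auto
    let ?w = "scal c z - st p k u"
    let ?x = "Wst p k u + scal (l + 1) u - scal c (tau p k z)"
    let ?y = "tau p k (st p k u) - (Wst p k u + u)"
    have "Wst p (Suc k) ?w + scal l ?w - scal (l * c) z = scal (-1) (st p k ?x + st p k ?y)"
      by (rule poly_mapping_eqI) (simp add: ops_add ops_diff ops_cmul lookup_minus lookup_add algebra_simps)
    moreover have "N p (Suc k) (scal (-1) (st p k ?x + st p k ?y))" by (intro N_cmul N_add N_st Nu tau_st_N A(1) u(2))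
    ultimately have "N p (Suc k) (Wst p (Suc k) ?w + scal l ?w - scal (l * c) z)" by simp
    moreover have "A (Suc k) ?w" using A u Suc.prems by blast
    ultimately show ?case using u(1) Suc.prems(2) by (intro exI[of _ ?w] exI[of _ "l * c"]) simp
  qed
  then show "l > 0 ==> \<exists>u c. c ~= 0 & A k u & N p k (Wst p k u + scal l u - scal c z)" using z by blast
  obtain u c where u: "c ~= 0" "A k u" "N p k (Wst p k u + scal 1 u - scal c z)" using onto[OF z, of 1] by auto
  have eq: "tau p k (st p k u) - scal c z = (tau p k (st p k u) - (Wst p k u + u)) + (Wst p k u + scal 1 u - scal c z)"
    by (rule poly_mapping_eqI) (simp add: lookup_minus lookup_add)
  show "\<exists>u c. c ~= 0 & A (Suc k) u & N p k (tau p k u - scal c z)"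
    using N_add[OF tau_st_N[OF A(1)[OF u(2)]] u(3)] u(1) A(4)[OF u(2)] by (intro exI[of _ "st p k u"] exI[of _ c]) (simp only: eq simp_thms)
qed

text \<open>Excision around the configurations with a point at \<open>q\<close>: the set \<open>near k j\<close> consists of the
  configurations whose \<open>j\<close>-th point is much closer to \<open>q\<close> than all others.\<close>

definition near :: "nat => nat => (nat => 'a) set" where
  "near k j = {x. 2 * nu (x j) < mu k (del k j x)}"

definition near_any :: "nat => (nat => 'a) set" where
  "near_any k = {x. \<exists>j<Suc k. x \<in> near k j}"

definition Rj :: "nat => nat => (nat => 'a) => (nat => 'a) \<times> rvec" where
  "Rj k j x = (del k j x, gi (x j))"

definition Rm :: "nat => (nat => 'a) => (nat => 'a) \<times> rvec" where
  "Rm k x = Rj k (THE j. j < Suc k & x \<in> near k j) x"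

lemma near_disjoint:
  assumes x: "x \<in> tops (X (Suc k))" and "i < Suc k" "j < Suc k" "x \<in> near k i" "x \<in> near k j"
  shows "i = j"
proof (rule ccontr)
  assume "i ~= j"
  then obtain l l' where "l < k" "i = skip j l" "l' < k" "j = skip i l'" using skip_ex[of i j k] skip_ex[of j i k] assms(2,3) by metis
  then have "2 * nu (x j) < nu (x i)" "2 * nu (x i) < nu (x j)"
    using assms(4,5) mu_le(2)[of l k "del k j x"] mu_le(2)[of l' k "del k i x"] by (auto simp: near_def del_apply)
  moreover have "0 \<le> nu (x i)" using x assms(2) nu_nonneg by (simp add: conf_top)
  ultimately show False by linarith
qed

lemma Rm_near: "[|x \<in> tops (X (Suc k)); j < Suc k; x \<in> near k j|] ==> Rm k x = Rj k j x"
  unfolding Rm_def by (rule arg_cong[where f = "%j. Rj k j x"], rule the_equality) (auto dest: near_disjoint)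

lemma near_props:
  assumes x: "x \<in> tops (X (Suc k))" and j: "j < Suc k" and "x \<in> near k j"
  shows "del k j x \<in> tops (Y k)" "gi (x j) \<in> tops E" "g (gi (x j)) = x j" "2 * enorm n (gi (x j)) < mu k (del k j x)"
    "x \<in> avoid (Suc k) ==> gi (x j) ~= zv"
proof -
  have xj: "x j \<in> tops M" using x j by (simp add: conf_top)
  have lt: "2 * nu (x j) < mu k (del k j x)" using assms by (simp add: near_def)
  then have "nu (x j) < 1" using mu_le(1)[of k "del k j x"] nu_nonneg[OF xj] by linarith
  then obtain u where u: "u \<in> tops E" "x j = g u" using nu_less_1[OF xj] by blast
  then show "gi (x j) \<in> tops E" "g (gi (x j)) = x j" by (simp_all add: gi_g)
  have "nu (x j) = min 1 (enorm n (gi (x j)))" using u by (simp add: nu_g gi_g)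
  then show "2 * enorm n (gi (x j)) < mu k (del k j x)" using lt \<open>nu (x j) < 1\<close> by linarith
  show "gi (x j) ~= zv" if "x \<in> avoid (Suc k)" using that j \<open>g (gi (x j)) = x j\<close> g_zv by (auto simp: avoid_def)
  have d: "del k j x \<in> tops (X k)" using cont_fun[OF cm_del[OF j]] x by blast
  moreover have "del k j x i ~= q" if "i < k" for i
  proof
    assume "del k j x i = q"
    moreover have "del k j x i \<in> tops M" using d that by (simp add: conf_top)
    ultimately have "nu (del k j x i) = 0" using nu_0 by blast
    then show False using mu_le(2)[OF that, of "del k j x"] lt nu_nonneg[OF xj] by linarith
  qed
  ultimately show "del k j x \<in> tops (Y k)" by (simp add: avoid_def)
qed

lemma openin_near: "j < Suc k ==> openin (X (Suc k)) (tops (X (Suc k)) Int near k j)"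
proof -
  assume j: "j < Suc k"
  note p = cont_confD[OF cont_id[of "X (Suc k)"]]
  have "cmap (X (Suc k)) Rtop (%x. mu k (del k j x) - 2 * nu (x j))"
  proof (intro cont_diff continuous_map_real_mult cm_mu)
    show "cmap (X (Suc k)) M (%x. del k j x i)" if "i < k" for i by (rule cont_confD[OF cm_del[OF j] that])
    show "cmap (X (Suc k)) Rtop (%x. nu (x j))" using cont_comp[OF p[OF j] cont_nu] by (simp add: o_def)
  qed auto
  from openin_preim[OF this, of "{0<..}"]
  show ?thesis by (simp add: near_def Int_def)
qed

lemma cm_Rm: "cmap (subtop (X (Suc k)) (near_any k)) (ptop (Y k) E) (Rm k)"
proof (rule pasting_lemma[where I = "{..<Suc k}" and T = "%j. tops (X (Suc k)) Int near k j" and f = "Rj k"])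
  let ?X = "subtop (X (Suc k)) (near_any k)"
  fix j assume "j \<in> {..<Suc k}"
  then have j: "j < Suc k" by simp
  have sub: "tops (X (Suc k)) Int near k j \<subseteq> near_any k" using j by (auto simp: near_any_def)
  show "openin ?X (tops (X (Suc k)) Int near k j)"
    using openin_near[OF j] sub by (auto simp: openin_subtopology_alt intro: openin_subtopology_Int2)
  have eq: "subtop ?X (tops (X (Suc k)) Int near k j) = subtop (X (Suc k)) (tops (X (Suc k)) Int near k j)"
    unfolding subtop_subtop using sub by (simp add: Int_absorb1)
  let ?Z = "subtop (X (Suc k)) (tops (X (Suc k)) Int near k j)"
  have "cmap ?Z (X k) (del k j)" by (rule cont_from_sub[OF cm_del[OF j]])
  then have 1: "cmap ?Z (Y k) (del k j)" using near_props(1)[OF _ j] by (intro cont_subI) auto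
  have "cmap ?Z M (%x. x j)" using cont_confD[OF cont_id[of "X (Suc k)"] j] by (simp add: cont_from_sub)
  then have "cmap ?Z (subtop M (g ` tops E)) (%x. x j)"
  proof (rule cont_subI)
    fix x assume "x \<in> tops ?Z"
    then have "gi (x j) \<in> tops E" "g (gi (x j)) = x j" using near_props(2,3)[OF _ j] by auto
    then show "x j \<in> g ` tops E" by (metis imageI)
  qed
  from cont_comp[OF this cont_gi] have 2: "cmap ?Z E (%x. gi (x j))" by (simp add: o_def)
  show "cmap (subtop ?X (tops (X (Suc k)) Int near k j)) (ptop (Y k) E) (Rj k j)" unfolding eq Rj_def by (intro cont_pairedI 1 2)
next
  fix i j x assume "i \<in> {..<Suc k}" "j \<in> {..<Suc k}"
    "x \<in> tops (subtop (X (Suc k)) (near_any k)) Int (tops (X (Suc k)) Int near k i) Int (tops (X (Suc k)) Int near k j)"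
  then have "i = j" by (intro near_disjoint) auto
  then show "Rj k i x = Rj k j x" by simp
next
  fix x assume "x \<in> tops (subtop (X (Suc k)) (near_any k))"
  then show "\<exists>j. j \<in> {..<Suc k} & x \<in> tops (X (Suc k)) Int near k j & Rm k x = Rj k j x"
    using Rm_near by (auto simp: near_any_def)
qed

lemma near_cover: "tops (X (Suc k)) \<subseteq> near_any k Un avoid (Suc k)"
proof
  fix x assume x: "x \<in> tops (X (Suc k))"
  show "x \<in> near_any k Un avoid (Suc k)"
  proof (cases "x \<in> avoid (Suc k)")
    case False
    then obtain j where j: "j < Suc k" "x j = q" by (auto simp: avoid_def)
    have "x i ~= q" if "i ~= j" "i < Suc k" for i using x j that by (auto simp: conf_top inj_on_def)
    then have "del k j x \<in> tops (Y k)" using cont_fun[OF cm_del[OF j(1)]] x by (auto simp: avoid_def del_apply skip_simps)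
    moreover have "nu (x j) = 0" using nu_0[of "x j"] x j by (auto simp: conf_top)
    ultimately have "x \<in> near k j" using mu_pos by (simp add: near_def)
    then show ?thesis using j by (auto simp: near_any_def)
  qed simp
qed

lemma openin_avoid: "openin (X k) (tops (X k) Int avoid k)"
proof -
  have "openin (X k) {x \<in> tops (X k). nu (x j) \<in> {0<..}}" if "j < k" for j
    using cont_comp[OF cont_confD[OF cont_id[of "X k"] that] cont_nu] by (intro openin_preim) (auto simp: o_def)
  then have "openin (X k) (tops (X k) Int (\<Inter>j\<in>{..<k}. {x \<in> tops (X k). nu (x j) \<in> {0<..}}))"
    by (cases "k = 0") (auto intro!: openin_Int openin_INT)
  also have "tops (X k) Int (\<Inter>j\<in>{..<k}. {x \<in> tops (X k). nu (x j) \<in> {0<..}}) = tops (X k) Int avoid k"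
    using nu_0 nu_nonneg by (fastforce simp: avoid_def conf_top less_le)
  finally show ?thesis .
qed

definition to_last :: "nat => nat => nat => nat" where
  "to_last k j i = (if i < k then skip j i else if i = k then j else i)"

lemma to_last_permutes: "j < Suc k ==> to_last k j permutes {..<Suc k}"
proof (rule bij_imp_permutes)
  assume j: "j < Suc k"
  have "inj_on (to_last k j) {..<Suc k}"
    by (rule inj_onI) (auto simp: to_last_def skip_simps less_Suc_eq split: if_splits dest: skip_simps(1)[THEN notE] skip_simps(1)[symmetric, THEN notE])
  moreover have "to_last k j ` {..<Suc k} \<subseteq> {..<Suc k}" using j skip_simps(3)[of _ k j] by (auto simp: to_last_def)
  ultimately show "bij_betw (to_last k j) {..<Suc k} {..<Suc k}" by (metis bij_betw_def endo_inj_surj finite_lessThan)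
qed (auto simp: to_last_def)

lemma ins_Rj: "[|x \<in> tops (X (Suc k)); j < Suc k; x \<in> near k j|] ==> ins k (Rj k j x) = x \<circ> to_last k j"
  using near_props(3) by (auto simp: fun_eq_iff ins_def Rj_def del_def to_last_def conf_top extensional_def)

lemma Sym_pointwise:
  fixes h :: "(nat => 'b) => nat => 'b"
  assumes c: "schain r Z c"
    and h: "!!f. ssimp r Z f ==> \<exists>\<rho>. \<rho> permutes {..<K} & (\<forall>t\<in>stdsimp r. h (f t) = f t \<circ> \<rho>)"
  shows "Sym r K (chm r h c) = Sym r K c" using c unfolding schain_def
proof (induction rule: frag_induction)
  case (one f)
  then obtain \<rho> where \<rho>: "\<rho> permutes {..<K}" "\<forall>t\<in>stdsimp r. h (f t) = f t \<circ> \<rho>" using h by auto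
  then have "smap r h f = smap r (%x. x \<circ> \<rho>) f" by (auto simp: simplex_map_def restrict_def fun_eq_iff)
  then show ?case using Sym_perm[OF \<rho>(1), of r "frag_of f"] by simp
qed (auto simp: chm_diff Sym_diff)

lemma openin_near_Union:
  assumes "I \<subseteq> {..<Suc k}" shows "openin (X (Suc k)) (\<Union>i\<in>I. tops (X (Suc k)) Int near k i)"
  using openin_near assms by (intro openin_Union) blast

lemma simplex_near:
  assumes f: "ssimp r (subtop (X (Suc k)) (near_any k)) f"
  obtains j where "j < Suc k" "!!t. t \<in> stdsimp r ==> f t \<in> near k j" "!!t. t \<in> stdsimp r ==> f t \<in> tops (X (Suc k))"
proof -
  let ?X = "X (Suc k)"
  have cf: "cmap (subtop (powertop_real UNIV) (stdsimp r)) ?X f" using f by (simp add: ssimplex_def cont_in_subtop)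
  have img: "f t \<in> near_any k" if "t \<in> stdsimp r" for t using f that by (auto simp: ssimplex_def cont_in_subtop Pi_iff)
  have con: "connectedin ?X (f ` stdsimp r)"
    by (rule connectedin_continuous_map_image[OF cf]) (simp add: connectedin_subtopology connectedin_standard_simplex)
  then have top: "f t \<in> tops ?X" if "t \<in> stdsimp r" for t using connectedin_subset_topspace that by blast
  obtain t0 where t0: "t0 \<in> stdsimp r" using nonempty_standard_simplex by blast
  then obtain j where j: "j < Suc k" "f t0 \<in> near k j" using img by (auto simp: near_any_def)
  define A where "A = tops ?X Int near k j"
  define B where "B = (\<Union>i\<in>{..<Suc k} - {j}. tops ?X Int near k i)"
  have opn: "openin ?X A" "openin ?X B" unfolding A_def B_def by (rule openin_near[OF j(1)], rule openin_near_Union) blast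
  have sub: "f ` stdsimp r \<subseteq> A Un B" using img top by (fastforce simp: near_any_def A_def B_def)
  have dis: "A Int B Int f ` stdsimp r = {}" unfolding A_def B_def using near_disjoint[OF _ j(1)] by fastforce
  have ne: "A Int f ` stdsimp r ~= {}" using t0 j top by (auto simp: A_def)
  have "B Int f ` stdsimp r = {}" using con opn sub dis ne unfolding connectedin by blast
  then have "f t \<in> near k j" if "t \<in> stdsimp r" for t using sub that by (auto simp: A_def)
  then show thesis using that j(1) top by blast
qed

lemma openin_near_any: "openin (X (Suc k)) (tops (X (Suc k)) Int near_any k)"
proof -
  have "tops (X (Suc k)) Int near_any k = (\<Union>j\<in>{..<Suc k}. tops (X (Suc k)) Int near k j)" by (auto simp: near_any_def)
  then show ?thesis using openin_near_Union[of "{..<Suc k}" k] by (simp only: subset_refl)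
qed

lemma Rm_avoid: "Rm k \<in> tops (subtop (X (Suc k)) (near_any k)) Int avoid (Suc k) \<rightarrow> csub {} nz"
proof
  fix x assume x: "x \<in> tops (subtop (X (Suc k)) (near_any k)) Int avoid (Suc k)"
  then obtain j where j: "j < Suc k" "x \<in> near k j" by (auto simp: near_any_def)
  then show "Rm k x \<in> csub {} nz" using x Rm_near[OF _ j] near_props(5)[OF _ j] by (auto simp: Rj_def csub_def)
qed

lemma lerp_pt:
  assumes s: "0 \<le> s" "s \<le> 1" and "y \<in> tops (Y k)" "v ~= zv"
  shows "lerp s (pt k (y, v)) v ~= zv"
proof -
  define t where "t = mu k y / 2 * (1 / (1 + enorm n v))"
  have "0 < t" using mu_pos[OF assms(3)] enorm_add1_pos(1)[of n v] unfolding t_def by (intro mult_pos_pos) auto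
  then have "0 < (1 - s) * t + s" using lerp_less[OF s, of 0 t 0 1] by simp
  then have "(%i. ((1 - s) * t + s) * v i) ~= zv" using assms(4) by (rule posmult)
  moreover have "lerp s (pt k (y, v)) v = (%i. ((1 - s) * t + s) * v i)" unfolding pt_pair sig_def t_def by (simp add: algebra_simps)
  ultimately show ?thesis by simp
qed

lemma NX_add: "NX r k c ==> NX r k d ==> NX r k (c + d)" by (simp add: NX_def Sym_add rnull_add)

lemma NX_diff: "NX r k c ==> NX r k d ==> NX r k (c - d)" by (simp add: NX_def Sym_diff rnull_diff)

lemma near_surj:
  assumes c: "relcycle r (X (Suc k)) (avoid (Suc k)) c"
  obtains y where "cyc (r - n) k y" "r < n ==> y = 0"
    "NX r (Suc k) (c - chm r (P k) (cross (r - n) n y (thom n)))"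
proof -
  let ?X = "X (Suc k)" and ?A = "avoid (Suc k)" and ?P = "ptop (Y k) E"
  let ?W = "subtop ?X (near_any k)"
  obtain c' where c': "relcycle r ?W ?A c'" and "homrel r ?X ?A c c'"
    by (rule excision_surj_Int[OF openin_near_any openin_avoid near_cover c])
  then have h1: "hq r ?X ?A c c'" by (simp add: hq_homol)
  have "relcycle r ?W (tops ?W Int ?A) c'" using c' by (simp only: relcycle_restrict)
  from relcycle_chm[OF this cm_Rm Rm_avoid]
  obtain y where y: "cyc (r - n) k y" "r < n ==> y = 0"
    and "homrel r ?P (csub {} nz) (chm r (Rm k) c') (cross (r - n) n y (thom n))" using thom_surj by blast
  then have "hq r ?P (csub {} nz) (chm r (Rm k) c') (cross (r - n) n y (thom n))" by (simp add: hq_homol)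
  from rnull_chm[OF this cm_P P_avoid]
  have h2: "hq r ?X ?A (chm r (%x. P k (Rm k x)) c') (chm r (P k) (cross (r - n) n y (thom n)))" by (simp add: chm_diff chm_comp)
  have R: "fst (Rm k x) \<in> tops (Y k)" "2 * enorm n (snd (Rm k x)) < mu k (fst (Rm k x))" "x \<in> ?A ==> snd (Rm k x) ~= zv"
    if x: "x \<in> tops ?W" for x
  proof -
    obtain j where j: "j < Suc k" "x \<in> near k j" using x by (auto simp: near_any_def)
    then show "fst (Rm k x) \<in> tops (Y k)" "2 * enorm n (snd (Rm k x)) < mu k (fst (Rm k x))" "x \<in> ?A ==> snd (Rm k x) ~= zv"
      using x near_props[OF _ j] Rm_near[OF _ j] by (auto simp: Rj_def)
  qed
  have h3: "hq r ?X ?A (chm r (%x. ins k (fst (Rm k x), pt k (fst (Rm k x), snd (Rm k x)))) c') (chm r (%x. ins k (fst (Rm k x), snd (Rm k x))) c')"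
  proof (rule hq_ins[OF cm_fst[OF cm_Rm] cm_pt[OF cm_fst[OF cm_Rm] cm_snd[OF cm_Rm]] _ cm_snd[OF cm_Rm] _ c'])
    fix s x assume s: "0 \<le> s" "s \<le> (1::real)" and x: "x \<in> tops ?W" "x \<in> ?A"
    show "lerp s (pt k (fst (Rm k x), snd (Rm k x))) (snd (Rm k x)) ~= zv" by (rule lerp_pt[OF s R(1)[OF x(1)] R(3)[OF x]])
  qed ((rule enorm_pt[OF R(1)] R(2))?, assumption)+
  have "Sym r (Suc k) (chm r (%x. ins k (Rm k x)) c') = Sym r (Suc k) c'"
  proof (rule Sym_pointwise)
    show "schain r ?W c'" using c' by (simp add: relcycle)
    fix f assume "ssimp r ?W f"
    then obtain j where j: "j < Suc k" "!!t. t \<in> stdsimp r ==> f t \<in> near k j" "!!t. t \<in> stdsimp r ==> f t \<in> tops ?X"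
      by (rule simplex_near) blast
    then show "\<exists>\<rho>. \<rho> permutes {..<Suc k} & (\<forall>t\<in>stdsimp r. ins k (Rm k (f t)) = f t \<circ> \<rho>)"
      using to_last_permutes ins_Rj Rm_near by (intro exI[of _ "to_last k j"]) auto
  qed
  then have h4: "NX r (Suc k) (c' - chm r (%x. ins k (fst (Rm k x), snd (Rm k x))) c')" by (simp add: NX_def Sym_diff)
  have fin: "NX r (Suc k) (c - chm r (P k) (cross (r - n) n y (thom n)))"
  proof -
    let ?a = "chm r (%x. P k (Rm k x)) c'" and ?b = "chm r (%x. ins k (fst (Rm k x), snd (Rm k x))) c'"
    have "NX r (Suc k) (c - c')" "NX r (Suc k) (?a - ?b)" "NX r (Suc k) (?a - chm r (P k) (cross (r - n) n y (thom n)))"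
      using NX_null[OF h1] NX_null[OF h2] NX_null[OF h3] unfolding P_def fst_conv snd_conv prod.collapse by blast+
    from NX_add[OF NX_diff[OF NX_add[OF this(1) h4] this(2)] this(3)] show ?thesis by simp
  qed
  show thesis by (rule that[OF y fin])
qed

lemma P_near:
  assumes y: "y \<in> tops (Y k)" and u: "u \<in> tops E" and \<sigma>: "\<sigma> permutes {..<Suc k}" "\<sigma> j = k" "j < Suc k"
    and \<sigma>': "\<sigma>' permutes {..<k}" "!!x :: nat => 'a. del k j (x \<circ> \<sigma>) = del k k x \<circ> \<sigma>'"
  shows "P k (y, u) \<circ> \<sigma> \<in> near k j" "Rm k (P k (y, u) \<circ> \<sigma>) = (y \<circ> \<sigma>', pt k (y, u))"
    "P k (y, u) \<circ> \<sigma> \<in> tops (X (Suc k))"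
proof -
  have d: "del k j (P k (y, u) \<circ> \<sigma>) = y \<circ> \<sigma>'"
    using \<sigma>'(2)[of "P k (y, u)"] del_P_new[of "(y, u)" k] Y_ext[OF y] by simp
  have p: "(P k (y, u) \<circ> \<sigma>) j = g (pt k (y, u))" using \<sigma>(2) by (simp add: P_def ins_def)
  note e = enorm_pt[OF y, of u]
  show 1: "P k (y, u) \<circ> \<sigma> \<in> near k j"
    using nu_g_less[OF pt_in[OF u] e mu_le(1)] e mu_perm[OF \<sigma>'(1)] unfolding near_def mem_Collect_eq d p by simp
  have "P k (y, u) \<in> tops (X (Suc k))" using funcset_mem[OF cont_fun[OF cm_P], of "(y, u)" k] y u by simp
  then show 2: "P k (y, u) \<circ> \<sigma> \<in> tops (X (Suc k))" using cont_fun[OF cm_perm[OF \<sigma>(1)]] by blast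
  show "Rm k (P k (y, u) \<circ> \<sigma>) = (y \<circ> \<sigma>', pt k (y, u))"
    unfolding Rm_near[OF 2 \<sigma>(3) 1] Rj_def d p by (simp add: gi_g[OF pt_in[OF u]])
qed

lemma near_inj:
  assumes a: "cyc p k a" and null: "NX (p + n) (Suc k) (Tt p k a)"
  shows "N p k a"
proof -
  let ?X = "X (Suc k)" and ?A = "avoid (Suc k)" and ?P = "ptop (Y k) E"
  let ?W = "subtop ?X (near_any k)" and ?r = "p + n" and ?t = "cross p n a (thom n)"
  have "\<exists>\<sigma>'. \<sigma>' permutes {..<k} & (\<forall>x :: nat => 'a. \<exists>j<Suc k. \<sigma> j = k & del k j (x \<circ> \<sigma>) = del k k x \<circ> \<sigma>')" if s: "\<sigma> permutes {..<Suc k}" for \<sigma>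
  proof -
    obtain j where j: "j < Suc k" "\<sigma> j = k" using permutes_image[OF s] by (metis imageE lessI lessThan_iff)
    from del_perm[OF s j(1)] obtain \<sigma>' where "\<sigma>' permutes {..<k}" "!!x :: nat => 'a. del k j (x \<circ> \<sigma>) = del k (\<sigma> j) x \<circ> \<sigma>'" by metis
    then show ?thesis using j by auto
  qed
  then obtain f where f: "!!\<sigma>. \<sigma> permutes {..<Suc k} ==> f \<sigma> permutes {..<k}"
    "!!\<sigma> x. \<sigma> permutes {..<Suc k} ==> \<exists>j<Suc k. \<sigma> j = k & del k j ((x :: nat => 'a) \<circ> \<sigma>) = del k k x \<circ> f \<sigma>"
    by metis
  have near: "P k z \<circ> \<sigma> \<in> near_any k & Rm k (P k z \<circ> \<sigma>) = (fst z \<circ> f \<sigma>, pt k z) & P k z \<circ> \<sigma> \<in> tops ?X"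
    if s: "\<sigma> permutes {..<Suc k}" and z: "z \<in> tops ?P" for \<sigma> z
  proof -
    obtain j where j: "j < Suc k" "\<sigma> j = k" using permutes_image[OF s] by (metis imageE lessI lessThan_iff)
    have "del k j (x \<circ> \<sigma>) = del k k x \<circ> f \<sigma>" for x :: "nat => 'a"
      using f(2)[OF s, of x] j permutes_inj[OF s] by (auto simp: inj_def)
    from P_near[OF _ _ s j(2,1) f(1)[OF s] this, of "fst z" "snd z"] show ?thesis using z j(1) by (auto simp: near_any_def)
  qed
  have c: "relcycle ?r ?P (tops ?P Int csub {} nz) ?t" using relcycle_cross[OF a relcycle_thom[of n]] by (simp only: relcycle_restrict)
  have m: "cmap ?P ?W (%z. P k z \<circ> \<sigma>)" "(%z. P k z \<circ> \<sigma>) \<in> tops ?P Int csub {} nz \<rightarrow> ?A"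
    if s: "\<sigma> permutes {..<Suc k}" for \<sigma>
  proof -
    have "cmap ?P ?X (%z. P k z \<circ> \<sigma>)" using cont_comp[OF cm_P cm_perm[OF s]] by (simp add: o_def)
    then show "cmap ?P ?W (%z. P k z \<circ> \<sigma>)" using near[OF s] by (intro cont_subI) blast+
    show "(%z. P k z \<circ> \<sigma>) \<in> tops ?P Int csub {} nz \<rightarrow> ?A" using P_avoid perm_avoid[OF s] by (auto simp: Pi_iff)
  qed
  have Sy: "Sym ?r (Suc k) (Tt p k a) = (\<Sum>\<sigma>\<in>perms (Suc k). chm ?r (%z. P k z \<circ> \<sigma>) ?t)"
    unfolding Sym_def Tt_def chm_comp ..
  have "relcycle ?r ?W ?A (Sym ?r (Suc k) (Tt p k a))" unfolding Sy by (intro singular_relcycle_sum relcycle_chm[OF c m]) auto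
  from rnull_excision[OF openin_near_any openin_avoid near_cover this null[unfolded NX_def]]
  have "rnull ?r ?P (csub {} nz) (chm ?r (Rm k) (Sym ?r (Suc k) (Tt p k a)))" by (rule rnull_chm[OF _ cm_Rm Rm_avoid])
  then have 1: "rnull ?r ?P (csub {} nz) (\<Sum>\<sigma>\<in>perms (Suc k). chm ?r (%z. Rm k (P k z \<circ> \<sigma>)) ?t)"
    unfolding Sy chm_sum' chm_comp .
  have 2: "hq ?r ?P (csub {} nz) (chm ?r (%z. Rm k (P k z \<circ> \<sigma>)) ?t) (cross p n (chm p (%x. x \<circ> f \<sigma>) a) (thom n))"
    if s: "\<sigma> permutes {..<Suc k}" for \<sigma>
  proof -
    have c0: "cmap ?P (Y k) (%z. fst z \<circ> f \<sigma>)" using cont_comp[OF cont_fst cm_perm_Y[OF f(1)[OF s]]] by (simp add: o_def)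
    have c1: "cmap ?P ?P (%z. (fst z \<circ> f \<sigma>, pt k (fst z, snd z)))" by (intro cont_pairedI c0 cm_pt cont_fst cont_snd)
    have c2: "cmap ?P ?P (%z. (fst z \<circ> f \<sigma>, snd z))" by (intro cont_pairedI c0 cont_snd)
    have "hq ?r (subtop ?P UNIV) (csub {} nz) (chm ?r (%z. (fst z \<circ> f \<sigma>, pt k (fst z, snd z))) ?t) (chm ?r (%z. (fst z \<circ> f \<sigma>, snd z)) ?t)"
    proof (rule hq_straight_rel[OF relcycle_cross[OF a relcycle_thom[of n]] c1 c2])
      fix s :: real and z :: "(nat => 'a) \<times> rvec"
      assume s: "0 \<le> s" "s \<le> 1" and z: "z \<in> tops ?P" "z \<in> csub {} nz"
      have "lerp s (pt k (fst z, snd z)) (snd z) ~= zv" using z by (intro lerp_pt[OF s]) (auto simp: csub_def)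
      then show "(fst (fst z \<circ> f \<sigma>, pt k (fst z, snd z)), lerp s (snd (fst z \<circ> f \<sigma>, pt k (fst z, snd z))) (snd (fst z \<circ> f \<sigma>, snd z))) \<in> csub {} nz"
        by (simp add: csub_def)
    qed auto
    moreover have "chm ?r (%z. Rm k (P k z \<circ> \<sigma>)) ?t = chm ?r (%z. (fst z \<circ> f \<sigma>, pt k (fst z, snd z))) ?t"
      using near[OF s] by (intro chm_eq[OF schain_cross[OF cyc_chain[OF a] schain_thom]]) auto
    moreover have "cross p n (chm p (%x. x \<circ> f \<sigma>) a) (thom n) = chm ?r (%z. (fst z \<circ> f \<sigma>, snd z)) ?t"
      using cross_natural[of p n "%x. x \<circ> f \<sigma>" a id "thom n"] unfolding chm_ident[OF schain_thom] map_prod_def case_prod_unfold by simp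
    ultimately show ?thesis by simp
  qed
  let ?s = "\<Sum>\<sigma>\<in>perms (Suc k). chm p (%x. x \<circ> f \<sigma>) a"
  have "hq ?r ?P (csub {} nz) (\<Sum>\<sigma>\<in>perms (Suc k). chm ?r (%z. Rm k (P k z \<circ> \<sigma>)) ?t) (cross p n ?s (thom n))"
    unfolding cross_sum_left using 2 by (intro hq_sum) auto
  then have 3: "rnull ?r ?P (csub {} nz) (cross p n ?s (thom n))" using rnull_diff[OF 1] by fastforce
  have "cyc p k ?s" using relcycle_chm[OF a cm_perm_Y[OF f(1)], of _ "{}"] by (intro singular_relcycle_sum) auto
  from N_null[OF thom_inj[OF this 3]]
  have "rnull p (Y k) {} (\<Sum>\<sigma>\<in>perms (Suc k). Sym p k a)" unfolding N_def Sym_sum by (simp add: Sym_perm[OF f(1)])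
  then have "rnull p (Y k) {} (scal (int (fact (Suc k))) (Sym p k a))" by (simp only: scal_card card_perms)
  then show ?thesis unfolding N_def by (rule rnull_cancel) (simp only: of_nat_eq_0_iff fact_nonzero simp_thms)
qed

end

section \<open>The transfer is onto\<close>

definition conf_map :: "('a => 'a) => nat => (nat => 'a) => nat => 'a" where
  "conf_map \<phi> k x = restrict (%j. \<phi> (x j)) {..<k}"

lemma cm_conf_map:
  assumes "cmap M M \<phi>" "inj_on \<phi> (tops M)"
  shows "cmap (conf k M) (conf k M) (conf_map \<phi> k)"
proof (rule cont_confI)
  show "cmap (conf k M) M (%x. conf_map \<phi> k x j)" if "j < k" for j
    using cont_comp[OF cont_confD[OF cont_id that] assms(1)] that by (simp add: conf_map_def o_def)
  show "inj_on (conf_map \<phi> k x) {..<k}" if "x \<in> tops (conf k M)" for x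
    using that assms(2) by (auto simp: conf_top conf_map_def inj_on_def)
qed (simp add: conf_map_def)

lemma conf_map_perm: "\<sigma> permutes {..<k} ==> conf_map \<phi> k (x \<circ> \<sigma>) = conf_map \<phi> k x \<circ> \<sigma>"
  using permutes_in_image[of \<sigma> "{..<k}"] by (auto simp: conf_map_def fun_eq_iff restrict_def)

lemma Sym_conf_map: "Sym p k (chm p (conf_map \<phi> k) c) = chm p (conf_map \<phi> k) (Sym p k c)"
  unfolding Sym_def chm_sum' chm_comp by (intro sum.cong) (simp_all add: conf_map_perm)

context puncture
begin

lemma NX_cmul: "NX p k c ==> NX p k (scal m c)" by (simp add: NX_def Sym_cmul rnull_cmul)

lemma NX_boundary:
  assumes "NX (Suc p) k c" "schain (Suc p) (X k) c"
  shows "N p k (bdry (Suc p) c)" using rnull_bdry[OF assms(1)[unfolded NX_def]] bdry_Sym[OF assms(2)] by (simp add: N_def)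

lemma cyc_mono_Y: "cyc p k u ==> relcycle p (X k) {} u" unfolding scycle singular_chain_subtopology by blast

lemma rnull_mono_Y: "rnull p (Y k) {} c ==> rnull p (X k) {} c"
proof -
  assume c: "rnull p (Y k) {} c"
  have "rnull p (X k) {} (chm p id c)" by (rule rnull_chm[OF c]) (simp_all add: cont_from_sub)
  then show ?thesis using chm_ident[OF rnull_imp_chain[OF c]] by simp
qed

lemma cyc_tau_onto: "cyc p k z ==> \<exists>u c. c ~= 0 & cyc p (Suc k) u & N p k (tau p k u - scal c z)"
  by (rule weyl_tau_onto[where A = "%k c. cyc p k c"])
    (assumption | rule cyc_st cyc_tau singular_relcycle_diff relcycle_cmul)+

lemma tau_lift:
  assumes x: "relcycle p (X (Suc k)) {} x" and x2: "relcycle p (X (Suc (Suc k))) {} x2"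
    and "C1 ~= 0" and e: "NX p (Suc k) (scal C1 x - tau p (Suc k) x2)"
  shows "\<exists>x' C. C ~= 0 & relcycle p (X (Suc (Suc k))) {} x' &
    rnull p (X (Suc k)) {} (Sym p (Suc k) (scal C x - tau p (Suc k) x'))"
proof -
  let ?e = "scal C1 x - tau p (Suc k) x2" and ?K = "fact (Suc k) :: int"
  have "relcycle p (X (Suc k)) {} (Sym p (Suc k) ?e)"
    by (intro relcycle_Sym cm_perm singular_relcycle_diff relcycle_cmul x cycle_tau[OF x2])
  from rnull_imp_hq_sub[OF this e[unfolded NX_def]]
  obtain m e' where m: "m ~= 0" "cyc p (Suc k) e'" "hq p (X (Suc k)) {} (scal m (Sym p (Suc k) ?e)) e'" by blast
  obtain u c where u: "c ~= 0" "cyc p (Suc (Suc k)) u" "N p (Suc k) (tau p (Suc k) u - scal c e')" using cyc_tau_onto[OF m(2)] by blast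
  note uX = cyc_mono_Y[OF u(2)]
  have 1: "rnull p (X (Suc k)) {} (Sym p (Suc k) (scal m (Sym p (Suc k) ?e) - e'))" by (rule rnull_Sym[OF m(3)]) (simp_all add: cm_perm)
  have 2: "rnull p (X (Suc k)) {} (Sym p (Suc k) (tau p (Suc k) u - scal c e'))" using u(3) unfolding N_def by (rule rnull_mono_Y)
  let ?C = "c * m * ?K"
  have "Sym p (Suc k) (scal (?C * C1) x - tau p (Suc k) (scal ?C x2 + u)) =
      scal c (Sym p (Suc k) (scal m (Sym p (Suc k) ?e) - e')) - Sym p (Suc k) (tau p (Suc k) u - scal c e')"
    unfolding ops_add ops_cmul Sym_diff Sym_add Sym_cmul Sym_Sym
    by (rule poly_mapping_eqI) (simp add: lookup_minus lookup_add algebra_simps)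
  then have "rnull p (X (Suc k)) {} (Sym p (Suc k) (scal (?C * C1) x - tau p (Suc k) (scal ?C x2 + u)))"
    using rnull_diff[OF rnull_cmul[OF 1] 2] by metis
  moreover have "relcycle p (X (Suc (Suc k))) {} (scal ?C x2 + u)" by (intro singular_relcycle_add relcycle_cmul x2 uX)
  moreover have "?C * C1 ~= 0" using m(1) u(1) assms(3) by simp
  ultimately show ?thesis by blast
qed

lemma cyc_A_st_tau:
  fixes s :: nat
  defines "A == %j c. cyc s j c & N (s + b + b) (Suc (Suc j)) (dt (s + b) (Suc j) (dt s j c))"
  shows "A j c ==> A (Suc j) (st s j c)" "A (Suc j) c ==> A j (tau s j c)"
proof -
  assume "A j c"
  then have c: "cyc s j c" "N (s + b + b) (Suc (Suc j)) (dt (s + b) (Suc j) (dt s j c))" by (simp_all add: A_def)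
  from N_diff[OF N_st[OF c(2)] st_dt_dt[OF c(1)]] show "A (Suc j) (st s j c)" using cyc_st[OF c(1)] by (simp add: A_def)
next
  assume "A (Suc j) c"
  then have c: "cyc s (Suc j) c" "N (s + b + b) (Suc (Suc (Suc j))) (dt (s + b) (Suc (Suc j)) (dt s (Suc j) c))" by (simp_all add: A_def)
  have 1: "N (s + b + b) (Suc (Suc j)) (tau (s + b + b) (Suc (Suc j)) (dt (s + b) (Suc (Suc j)) (dt s (Suc j) c)) -
      dt (s + b) (Suc j) (tau (s + b) (Suc j) (dt s (Suc j) c)))" by (rule N_null[OF tau_dt[OF cyc_dt[OF c(1)]]])
  have 2: "N (s + b + b) (Suc (Suc j)) (dt (s + b) (Suc j) (tau (s + b) (Suc j) (dt s (Suc j) c)) - dt (s + b) (Suc j) (dt s j (tau s j c)))"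
    using N_dt[OF N_null[OF tau_dt[OF c(1)]]] unfolding ops_diff .
  from N_diff[OF N_tau[OF c(2)] N_add[OF 1 2]] show "A j (tau s j c)" using cyc_tau[OF c(1)] by (simp add: A_def)
qed

lemma tau_onto_aux:
  assumes phi: "cmap M M \<phi>" "inj_on \<phi> (tops M)" "\<phi> q = q" "q \<in> tops M"
    and iso: "!!p k x. relcycle p (X k) {} x ==> hq p (X k) {} (chm p (conf_map \<phi> k) x) x"
    and rev: "!!p k y. cyc p k y ==> rnull (p + n) (X (Suc k)) (avoid (Suc k))
      (chm (p + n) (conf_map \<phi> (Suc k)) (Tt p k y) + Tt p k (chm p (conf_map \<phi> k) y))"
    and x: "relcycle (r + n) (X (Suc k)) {} x"
    and y: "cyc r k y" and xy: "NX (r + n) (Suc k) (x - Tt r k y)"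
  shows "\<exists>x' C. C ~= 0 & relcycle (r + n) (X (Suc (Suc k))) {} x' &
    rnull (r + n) (X (Suc k)) {} (Sym (r + n) (Suc k) (scal C x - tau (r + n) (Suc k) x'))"
proof -
  let ?p = "r + n"
  let ?ph = "%p k. chm p (conf_map \<phi> k)"
  have zero: ?thesis if "N r k y"
  proof -
    have "NX ?p (Suc k) x" using NX_add[OF xy NX_Tt[OF that]] by simp
    then show ?thesis using tau_lift[OF x singular_relcycle_0, of 1] ops_cmul(3)[of ?p "Suc k" 0 0] by simp
  qed
  have phX: "cmap (X k) (X k) (conf_map \<phi> k)" for k by (rule cm_conf_map[OF phi(1,2)])
  have pav: "conf_map \<phi> k \<in> tops (X k) Int avoid k \<rightarrow> avoid k" for k
    using phi by (auto simp: avoid_def conf_map_def conf_top inj_on_def)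
  have phY: "cmap (Y k) (Y k) (conf_map \<phi> k)" for k using pav phX by (intro cont_subI cont_from_sub) auto
  have phNX: "NX s k (?ph s k c)" if "NX s k c" for s k c
    using rnull_chm[OF that[unfolded NX_def] phX pav] by (simp add: NX_def Sym_conf_map)
  have py: "cyc r k (?ph r k y)" using relcycle_chm[OF y phY, of "{}"] by simp
  have ch: "schain ?p (X (Suc k)) (x - Tt r k y)" using x relcycle_Tt[OF y] by (intro schain_diff) (simp_all only: relcycle)
  have dy: "N (r + b) (Suc k) (dt r k y)"
  proof -
    have "N (r + b) (Suc k) (bdry ?p (x - Tt r k y))" using NX_boundary[of "r + b" "Suc k" "x - Tt r k y"] xy ch by simp
    also have "bdry ?p (x - Tt r k y) = scal (- ((-1) ^ r)) (dt r k y)" unfolding bdry_diff bdry_cycle[OF x] boundary_Tt[OF y] by simp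
    finally show ?thesis by (rule N_cancel) simp
  qed
  have anti: "N r k (y + ?ph r k y)"
  proof (rule near_inj)
    show "cyc r k (y + ?ph r k y)" by (intro singular_relcycle_add y py)
    have 1: "NX ?p (Suc k) (?ph ?p (Suc k) x - x)" by (rule NX_null[OF rnull_mono[OF iso[OF x]]]) simp
    have "Tt r k (y + ?ph r k y) = (?ph ?p (Suc k) (Tt r k y) + Tt r k (?ph r k y)) + ?ph ?p (Suc k) (x - Tt r k y) - (?ph ?p (Suc k) x - x) - (x - Tt r k y)"
      unfolding ops_add chm_diff by simp
    then show "NX ?p (Suc k) (Tt r k (y + ?ph r k y))"
      using NX_diff[OF NX_diff[OF NX_add[OF NX_null[OF rev[OF y]] phNX[OF xy]] 1] xy] by simp
  qed
  have two: ?thesis if "N r k (?ph r k y - y)"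
  proof (rule zero)
    have "y + ?ph r k y - (?ph r k y - y) = scal 2 y" by (rule poly_mapping_eqI) (simp add: lookup_minus lookup_add)
    then show "N r k y" using N_cancel[of r k 2 y] N_diff[OF anti that] by simp
  qed
  show ?thesis
  proof (cases k)
    case 0
    have "?ph r k y = y"
    proof (rule chm_id_gen[OF cyc_chain[OF y]])
      show "conf_map \<phi> k z = z" if "z \<in> tops (Y k)" for z
        using that 0 by (auto simp: conf_map_def conf_top extensional_def fun_eq_iff)
    qed
    then show ?thesis using two N_null[of r k 0] by simp
  next
    case (Suc k0)
    have "rnull r (X k) {} (?ph r k y - y)" by (rule iso[OF cyc_mono_Y[OF y]])
    then obtain m w where m: "m ~= 0" and w: "schain (Suc r) (X k) w" "bdry (Suc r) w = scal m (?ph r k y - y)"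
      by (auto simp: rnull_empty_iff)
    have "schain r (Y k) (bdry (Suc r) w)" unfolding w(2) by (intro schain_cmul schain_diff cyc_chain[OF y] cyc_chain[OF py])
    then have wr: "relcycle (Suc r) (X (Suc k0)) (avoid (Suc k0)) w" using w(1) by (simp add: relcycle Suc)
    from near_surj[OF wr] obtain z where z: "cyc (Suc r - n) k0 z" "Suc r < n ==> z = 0"
      and wz: "NX (Suc r) (Suc k0) (w - chm (Suc r) (P k0) (cross (Suc r - n) n z (thom n)))" by blast
    show ?thesis
    proof (cases "Suc r < n")
      case True
      have "NX (Suc r) k w" using wz unfolding z(2)[OF True] Suc cross_zero chain_map_0 diff_0_right .
      from NX_boundary[OF this w(1)] show ?thesis unfolding w(2) by (rule two[OF N_cancel[OF _ m]])
    next
      case False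
      then obtain s where s: "r = s + b" by (metis Suc_less_eq le_add_diff_inverse2 not_less)
      have e: "Suc r = s + n" "Suc r - n = s" using s by simp_all
      have z: "cyc s k0 z" and wz: "NX (s + n) (Suc k0) (w - Tt s k0 z)" using z(1) wz unfolding e Tt_def by auto
      have "schain (s + n) (X (Suc k0)) (w - Tt s k0 z)"
        using wr relcycle_Tt[OF z] unfolding e(1) by (intro schain_diff) (simp_all only: relcycle)
      with wz have "N r k (bdry (Suc r) (w - Tt s k0 z))" unfolding Suc by (intro NX_boundary) (simp_all only: e(1))
      moreover have "bdry (Suc r) (Tt s k0 z) = scal ((-1) ^ s) (dt s k0 z)" using boundary_Tt[OF z] unfolding e(1) .
      ultimately have 1: "N r k (scal m (?ph r k y - y) - scal ((-1) ^ s) (dt s k0 z))" unfolding bdry_diff w(2) by simp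
      define \<zeta> where "\<zeta> = scal ((-1) ^ s) z"
      define c1 where "c1 = - 2 * m"
      have c1: "c1 ~= 0" using m by (simp add: c1_def)
      have \<zeta>: "cyc s k0 \<zeta>" unfolding \<zeta>_def by (intro relcycle_cmul z)
      have "dt s k0 \<zeta> - scal c1 y = scal m (y + ?ph r k y) - (scal m (?ph r k y - y) - scal ((-1) ^ s) (dt s k0 z))"
        unfolding \<zeta>_def ops_cmul c1_def by (rule poly_mapping_eqI) (simp add: lookup_minus lookup_add algebra_simps)
      then have d\<zeta>: "N r k (dt s k0 \<zeta> - scal c1 y)" using N_diff[OF N_cmul[OF anti] 1] by simp
      define A where "A j c \<longleftrightarrow> cyc s j c & N (s + b + b) (Suc (Suc j)) (dt (s + b) (Suc j) (dt s j c))" for j c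
      have "N (s + b + b) (Suc (Suc k0)) (dt (s + b) (Suc k0) (dt s k0 \<zeta>))"
        using N_add[OF N_dt[OF d\<zeta>] N_cmul[OF dy, of c1]] unfolding ops_diff ops_cmul s Suc by simp
      then have A\<zeta>: "A k0 \<zeta>" using \<zeta> by (simp add: A_def)
      obtain u c where u: "c ~= 0" "A (Suc k0) u" "N s k0 (tau s k0 u - scal c \<zeta>)"
      proof -
        have "\<exists>u c. c ~= 0 & A (Suc k0) u & N s k0 (tau s k0 u - scal c \<zeta>)"
        proof (rule weyl_tau_onto[where A = A, OF _ _ _ _ _ A\<zeta>])
          show "A k c ==> cyc s k c" for k c by (simp add: A_def)
          show "A k (c - d)" if "A k c" "A k d" for k c d using that by (auto simp: A_def ops_diff intro: singular_relcycle_diff N_diff)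
          show "A k (scal m c)" if "A k c" for k c m using that by (auto simp: A_def ops_cmul intro: relcycle_cmul N_cmul)
          show "A (Suc k) (st s k c)" if "A k c" for k c using cyc_A_st_tau(1) that unfolding A_def by blast
          show "A k (tau s k c)" if "A (Suc k) c" for k c using cyc_A_st_tau(2) that unfolding A_def by blast
        qed
        then show thesis using that by blast
      qed
      have uc: "cyc s k u" and Du: "N (r + b) (Suc (Suc k)) (dt r (Suc k) (dt s k u))" using u(2) by (simp_all add: A_def s Suc)
      define y' where "y' = dt s k u"
      have y': "cyc r (Suc k) y'" using cyc_dt[OF uc] by (simp add: y'_def s)
      let ?K = "Suc (Suc k)"
      let ?T = "Sym ?p ?K (Tt r (Suc k) y')"
      have chT: "schain ?p (X ?K) (Tt r (Suc k) y')" using relcycle_Tt[OF y'] by (simp only: relcycle)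
      have chT': "schain ?p (X ?K) ?T" unfolding Sym_def by (intro singular_chain_sum schain_chm[OF chT] cm_perm) auto
      have "bdry ?p ?T = scal ((-1) ^ r) (Sym (r + b) ?K (dt r (Suc k) y'))"
        using bdry_Sym[OF chT, of ?K] boundary_Tt[OF y'] by (simp add: Sym_cmul)
      then have "rnull (r + b) (Y ?K) {} (bdry ?p ?T)" using Du rnull_cmul by (simp add: N_def y'_def)
      with chT' obtain m2 e where m2: "m2 ~= 0" "schain ?p (Y ?K) e" "relcycle ?p (X ?K) {} (scal m2 ?T - e)"
        using relcycle_lift[of "r + b" "X ?K" ?T "avoid ?K" thesis] by simp
      let ?x2 = "scal m2 ?T - e"
      have e1: "NX ?p (Suc k) (tau ?p (Suc k) e)"
      proof (rule NX_null[OF rnull_chain])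
        show "schain ?p (Y (Suc k)) (tau ?p (Suc k) e)" unfolding tau_def by (intro singular_chain_sum schain_chm[OF m2(2)] cm_del_Y) auto
      qed
      have t1: "NX ?p (Suc k) (tau ?p (Suc k) (Tt r (Suc k) y') - Tt r k (tau r k y'))"
        unfolding Suc by (rule NX_null[OF tau_Tt[OF y'[unfolded Suc]]])
      have ty: "N r k (tau r k y' - scal (c * c1) y)"
      proof -
        have 1: "N r k (tau r k y' - dt s k0 (tau s k0 u))" using N_null[OF tau_dt[OF uc[unfolded Suc]]] unfolding y'_def Suc s .
        have 2: "N r k (dt s k0 (tau s k0 u) - scal c (dt s k0 \<zeta>))" using N_dt[OF u(3)] unfolding ops_diff ops_cmul s Suc .
        have "tau r k y' - scal (c * c1) y = (tau r k y' - dt s k0 (tau s k0 u)) + (dt s k0 (tau s k0 u) - scal c (dt s k0 \<zeta>)) + scal c (dt s k0 \<zeta> - scal c1 y)"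
          by (rule poly_mapping_eqI) (simp add: lookup_minus lookup_add algebra_simps)
        then show ?thesis using N_add[OF N_add[OF 1 2] N_cmul[OF d\<zeta>, of c]] by (simp only:)
      qed
      define F where "F = int (fact ?K)"
      have t0: "NX ?p (Suc k) (tau ?p (Suc k) ?T - scal F (tau ?p (Suc k) (Tt r (Suc k) y')))"
        unfolding NX_def Sym_diff Sym_tau_Sym Sym_cmul F_def by simp
      have t2: "NX ?p (Suc k) (Tt r k (tau r k y') - scal (c * c1) (Tt r k y))" using NX_Tt[OF ty] unfolding ops_diff ops_cmul .
      have "scal (m2 * F * c * c1) x - tau ?p (Suc k) ?x2 =
          tau ?p (Suc k) e - scal m2 (tau ?p (Suc k) ?T - scal F (tau ?p (Suc k) (Tt r (Suc k) y')))
          - scal (m2 * F) (tau ?p (Suc k) (Tt r (Suc k) y') - Tt r k (tau r k y'))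
          - scal (m2 * F) (Tt r k (tau r k y') - scal (c * c1) (Tt r k y)) + scal (m2 * F * c * c1) (x - Tt r k y)"
        unfolding ops_diff ops_cmul by (rule poly_mapping_eqI) (simp add: lookup_minus lookup_add algebra_simps)
      moreover have "NX ?p (Suc k) \<dots>" by (intro NX_add NX_diff NX_cmul e1 t0 t1 t2 xy)
      ultimately have "NX ?p (Suc k) (scal (m2 * F * c * c1) x - tau ?p (Suc k) ?x2)" by (simp only:)
      then show ?thesis
        by (intro tau_lift[OF x m2(3), of "m2 * F * c * c1"]) (use m2(1) u(1) c1 in \<open>simp_all add: F_def del: fact_Suc\<close>)
    qed
  qed
qed

theorem tau_onto:
  assumes phi: "cmap M M \<phi>" "inj_on \<phi> (tops M)" "\<phi> q = q" "q \<in> tops M"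
    and iso: "!!p k x. relcycle p (X k) {} x ==> hq p (X k) {} (chm p (conf_map \<phi> k) x) x"
    and rev: "!!p k y. cyc p k y ==> rnull (p + n) (X (Suc k)) (avoid (Suc k))
      (chm (p + n) (conf_map \<phi> (Suc k)) (Tt p k y) + Tt p k (chm p (conf_map \<phi> k) y))"
    and x: "relcycle p (X (Suc k)) {} x"
  shows "\<exists>x' C. C ~= 0 & relcycle p (X (Suc (Suc k))) {} x' &
    rnull p (X (Suc k)) {} (Sym p (Suc k) (scal C x - tau p (Suc k) x'))"
proof -
  from near_surj[OF relcycle_of_cycle[OF x]] obtain y where y: "cyc (p - n) k y" "p < n ==> y = 0"
    and xy: "NX p (Suc k) (x - chm p (P k) (cross (p - n) n y (thom n)))" by blast
  show ?thesis
  proof (cases "p < n")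
    case True
    then have "NX p (Suc k) x" using xy y(2) by simp
    then show ?thesis using tau_lift[OF x singular_relcycle_0, of 1] ops_cmul(3)[of p "Suc k" 0 0] by simp
  next
    case False
    then obtain r where p: "p = r + n" by (metis le_add_diff_inverse2 not_less)
    have y': "cyc r k y" and xy': "NX (r + n) (Suc k) (x - Tt r k y)" using y(1) xy unfolding p add_diff_cancel_right' Tt_def .
    show ?thesis
      unfolding p by (rule tau_onto_aux[where \<phi> = \<phi> and y = y]; (rule phi y' xy' x[unfolded p] | erule iso | erule rev))
  qed
qed

end

lemma chain_positive_bound:
  assumes c: "schain p Z c" and f: "cmap Z Rtop f" and pos: "!!z. z \<in> tops Z ==> 0 < f z"
  obtains \<delta> where "0 < \<delta>" "schain p (subtop Z {z. \<delta> < f z}) c"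
proof -
  define K where "K = (\<Union>h\<in>keys c. h ` stdsimp p)"
  have s: "ssimp p Z h" if "h \<in> keys c" for h using c that by (auto simp: schain_def)
  have cpt: "compactin Z (h ` stdsimp p)" if "h \<in> keys c" for h by (rule image_compactin[of "subtop (powertop_real UNIV) (stdsimp p)"])
      (use s[OF that] in \<open>simp_all add: ssimplex_def compactin_subtopology compactin_standard_simplex\<close>)
  have "compactin Z K" unfolding K_def by (rule compactin_Union) (use cpt in \<open>auto simp del: compactin_subtopology\<close>)
  then have K: "compact (f ` K)" and KZ: "K \<subseteq> tops Z" using image_compactin[OF _ f] compactin_subset_topspace by (simp, blast)
  obtain \<delta> where \<delta>: "0 < \<delta>" "!!z. z \<in> K ==> \<delta> < f z"
  proof (cases "K = {}")
    case False
    then obtain m where m: "m \<in> f ` K" "!!t. t \<in> f ` K ==> m \<le> t" using compact_attains_inf[OF K] by (metis image_is_empty)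
    then have "0 < m" using pos KZ by auto
    show thesis by (rule that[of "m / 2"]) (use m \<open>0 < m\<close> in force)+
  qed (use that[of 1] in auto)
  have "ssimp p (subtop Z {z. \<delta> < f z}) h" if "h \<in> keys c" for h
    unfolding singular_simplex_subtopology using s[OF that] \<delta>(2) that by (auto simp: K_def)
  then show thesis using that[OF \<delta>(1)] by (auto simp: schain_def)
qed

lemma Euclidean_small_ball:
  assumes U: "openin (Euc n) U" "zv \<in> U"
  obtains \<epsilon> where "0 < \<epsilon>" "!!u. u \<in> tops (Euc n) ==> enorm n u < \<epsilon> ==> u \<in> U"
proof -
  obtain V where V: "openin (powertop_real UNIV) V" "U = V Int tops (Euc n)"
    using U(1) unfolding Euclidean_space_def openin_subtopology by auto
  then obtain F where F: "finite {i. F i ~= (UNIV :: real set)}" "!!i. open (F i)" "zv \<in> Pi\<^sub>E UNIV F" "Pi\<^sub>E UNIV F \<subseteq> V"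
    using U(2) unfolding openin_product_topology_alt by fastforce
  have "\<exists>e>0. \<forall>x. \<bar>x\<bar> < e --> x \<in> F i" for i
  proof -
    have "\<forall>x\<in>F i. \<exists>e>0. \<forall>y. \<bar>y - x\<bar> < e --> y \<in> F i" using F(2)[of i] unfolding open_dist dist_real_def .
    moreover have "0 \<in> F i" using F(3) by (simp add: PiE_iff)
    ultimately show ?thesis by fastforce
  qed
  then obtain e where e: "!!i. 0 < e i" "!!i x. \<bar>x\<bar> < e i ==> x \<in> F i" by metis
  define \<epsilon> where "\<epsilon> = Min (insert 1 (e ` {..<n}))"
  have "0 < \<epsilon>" unfolding \<epsilon>_def using e(1) by (subst Min_gr_iff) auto
  moreover have "u \<in> U" if u: "u \<in> tops (Euc n)" "enorm n u < \<epsilon>" for u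
  proof -
    have "u i \<in> F i" for i
    proof (cases "i < n")
      case True
      have "\<bar>u i\<bar> \<le> enorm n u" unfolding enorm_def using True by (intro member_le_sum) auto
      also have "\<dots> < \<epsilon>" by (rule u(2))
      also have "\<epsilon> \<le> e i" unfolding \<epsilon>_def using True by (intro Min_le) auto
      finally show ?thesis by (rule e(2))
    next
      case False
      then have "u i = 0" using u(1) by (simp add: top_Euc)
      then show ?thesis using F(3) by (simp add: PiE_iff)
    qed
    then show ?thesis using F(4) u(1) V(2) by auto
  qed
  ultimately show thesis using that by blast
qed

context puncture
begin

lemma q_in: "q \<in> tops M" using g_in[of zv] g_zv by (simp add: top_Euc)

lemma openin_minus_q: "openin M (tops M Int {x. x ~= q})"
proof -
  have "openin M {x \<in> tops M. nu x \<in> {0<..}}" by (rule openin_preim[OF cont_nu]) simp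
  moreover have "{x \<in> tops M. nu x \<in> {0<..}} = tops M Int {x. x ~= q}" using nu_0 nu_nonneg by (auto simp: less_le)
  ultimately show ?thesis by simp
qed

lemma shrink_chart:
  assumes "0 < e"
  shows "hq n M {x. x ~= q} (chm n (%u. g (%i. e * sig n u i)) (thom n)) (chm n g (thom n))"
proof (rule hq_homotopy[OF relcycle_thom])
  let ?I = "ptop (I01) E" and ?h = "%z :: real \<times> rvec. lerp (fst z) (%i. e * sig n (snd z) i) (snd z)"
  have h: "cmap ?I E ?h" by (intro cont_lerp cont_01D[OF cont_fst] cont_snd cont_scale cont_sig) auto
  from cont_comp[OF this cont_g] show "cmap ?I M (%z. g (?h z))" by (simp add: o_def)
  fix s u assume s: "0 \<le> s" "s \<le> (1::real)" and u: "u \<in> tops E" "u \<in> nz"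
  define t where "t = e * (1 / (1 + enorm n u))"
  have "0 < t" using assms enorm_add1_pos(1)[of n u] unfolding t_def by (intro mult_pos_pos) auto
  then have "0 < (1 - s) * t + s" using lerp_less[OF s, of 0 t 0 1] by simp
  then have "(%i. ((1 - s) * t + s) * u i) ~= zv" using u(2) by (intro posmult) auto
  moreover have "?h (s, u) = (%i. ((1 - s) * t + s) * u i)" by (simp add: t_def sig_def algebra_simps)
  moreover have "?h (s, u) \<in> tops E" using funcset_mem[OF cont_fun[OF h], of "(s, u)"] s u by simp
  ultimately show "g (?h (s, u)) \<in> {x. x ~= q}" by (simp add: g_eq_q)
qed auto

lemma Tt_reverse:
  assumes phi: "cmap M M \<phi>" "inj_on \<phi> (tops M)" "\<phi> q = q"
    and rev: "rnull n M {x. x ~= q} (chm n \<phi> (chm n g (thom n)) + chm n g (thom n))"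
    and y: "cyc p k y"
  shows "rnull (p + n) (X (Suc k)) (avoid (Suc k))
      (chm (p + n) (conf_map \<phi> (Suc k)) (Tt p k y) + Tt p k (chm p (conf_map \<phi> k) y))"
proof -
  let ?ph = "conf_map \<phi> k"
  have pav: "conf_map \<phi> k \<in> tops (X k) Int avoid k \<rightarrow> avoid k" for k
    using phi q_in by (auto simp: avoid_def conf_map_def conf_top inj_on_def)
  have phX: "cmap (X k) (X k) (conf_map \<phi> k)" for k by (rule cm_conf_map[OF phi(1,2)])
  have phY: "cmap (Y k) (Y k) ?ph" using pav phX by (intro cont_subI cont_from_sub) auto
  have cid: "cmap (Y k) (Y k) (%x. x)" by simp
  have "cmap (Y k) Rtop (%y. min (mu k y) (mu k (?ph y)))" by (intro continuous_map_real_min cm_mu cm_Y_D[OF cid] cm_Y_D[OF phY])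
  moreover have "0 < min (mu k z) (mu k (?ph z))" if "z \<in> tops (Y k)" for z
    using mu_pos[OF that] mu_pos[OF funcset_mem[OF cont_fun[OF phY] that]] by simp
  ultimately obtain \<delta> where \<delta>: "0 < \<delta>" "schain p (subtop (Y k) {z. \<delta> < min (mu k z) (mu k (?ph z))}) y"
    by (rule chain_positive_bound[OF cyc_chain[OF y]])
  define Y' where "Y' = subtop (Y k) {z. \<delta> < min (mu k z) (mu k (?ph z))}"
  have y': "relcycle p Y' {} y" using \<delta>(2) bdry_cycle[OF y] by (simp add: scycle Y'_def)
  have Y': "z \<in> tops (Y k)" "\<delta> < mu k z" "\<delta> < mu k (?ph z)" "\<delta> < 1" if "z \<in> tops Y'" for z
    using that mu_le(1)[of k z] by (auto simp: Y'_def)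
  have iY: "cmap Y' (Y k) (%x. x)" "cmap Y' (Y k) ?ph" unfolding Y'_def using phY by (simp_all add: cont_from_sub)
  let ?B = "subtop M {x. 2 * nu x < \<delta>}"
  have pg: "cmap E M (%u. \<phi> (g u))" using cont_comp[OF cont_g phi(1)] by (simp add: o_def)
  have "cmap E Rtop (%u. nu (\<phi> (g u)))" using cont_comp[OF pg cont_nu] by (simp add: o_def)
  from openin_preim[OF this, of "{..<\<delta> / 2}"]
  have "openin E {u \<in> tops E. nu (\<phi> (g u)) < \<delta> / 2}" by simp
  moreover have "zv \<in> {u \<in> tops E. nu (\<phi> (g u)) < \<delta> / 2}"
    using \<delta>(1) nu_0[OF q_in] by (simp add: top_Euc g_zv phi(3))
  ultimately obtain \<epsilon> where \<epsilon>: "0 < \<epsilon>" "!!u. u \<in> tops E ==> enorm n u < \<epsilon> ==> nu (\<phi> (g u)) < \<delta> / 2"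
    by (rule Euclidean_small_ball) blast
  define e where "e = min \<delta> \<epsilon> / 2"
  have e: "0 < e" "2 * e \<le> \<delta>" "e < \<epsilon>" using \<delta>(1) \<epsilon>(1) by (auto simp: e_def min_def)
  define v where "v u = (%i. e * sig n u i)" for u
  have cv: "cmap E E v" unfolding v_def by (intro cont_scale cont_sig) auto
  have vn: "enorm n (v u) < e" for u using e(1) enorm_sig_less[of n u] unfolding v_def enorm_scale by simp
  have vE: "v u \<in> tops E" if "u \<in> tops E" for u using cont_fun[OF cv] that by blast
  have v0: "v u = zv \<longleftrightarrow> u = zv" for u using posmult[OF e(1), of "sig n u"] by (auto simp: v_def)
  let ?\<gamma> = "%u. g (v u)"
  let ?t = "cross p n y (thom n)"
  let ?Z = "ptop Y' E" and ?r = "p + n" and ?XX = "X (Suc k)" and ?AA = "avoid (Suc k)"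
  have tc: "relcycle ?r ?Z (csub {} nz) ?t" by (rule relcycle_cross[OF y' relcycle_thom])
  have cs: "cmap ?Z E (%z. v (snd z))" using cont_comp[OF cont_snd cv] by (simp add: o_def)
  have straight: "hq ?r ?XX ?AA (chm ?r (%z. ins k (f (fst z), pt k (f (fst z), snd z))) ?t) (chm ?r (%z. ins k (f (fst z), v (snd z))) ?t)"
    if f: "cmap Y' (Y k) f" and mu: "!!z. z \<in> tops Y' ==> \<delta> < mu k (f z)" for f
  proof -
    have cf: "cmap ?Z (Y k) (%z. f (fst z))" using cont_comp[OF cont_fst f] by (simp add: o_def)
    have fY: "f z \<in> tops (Y k)" if "z \<in> tops Y'" for z using cont_fun[OF f] that by blast
    show ?thesis
    proof (rule hq_ins[OF cf cm_pt[OF cf cont_snd] _ cs _ tc])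
      show "2 * enorm n (pt k (f (fst z), snd z)) < mu k (f (fst z))" if "z \<in> tops ?Z" for z using that by (intro enorm_pt fY) auto
      show "2 * enorm n (v (snd z)) < mu k (f (fst z))" if "z \<in> tops ?Z" for z using that mu[of "fst z"] vn[of "snd z"] e(2) by auto
      fix s z assume s: "0 \<le> s" "s \<le> (1::real)" "z \<in> tops ?Z" "z \<in> csub {} nz"
      define t where "t = (1 - s) * (mu k (f (fst z)) / 2) + s * e"
      have "fst z \<in> tops Y'" using s(3) by auto
      then have "0 < mu k (f (fst z)) / 2" using mu_pos[OF fY] by simp
      from lerp_less[OF s(1,2) this e(1)] have "0 < t" by (simp add: t_def)
      then have "(%i. t * sig n (snd z) i) ~= zv" using s(4) by (intro posmult) (auto simp: csub_def)
      moreover have "lerp s (pt k (f (fst z), snd z)) (v (snd z)) = (%i. t * sig n (snd z) i)"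
        by (simp add: pt_pair v_def t_def algebra_simps)
      ultimately show "lerp s (pt k (f (fst z), snd z)) (v (snd z)) ~= zv" by simp
    qed
  qed
  have c1: "hq ?r ?XX ?AA (Tt p k y) (chm ?r (%z. ins k (fst z, v (snd z))) ?t)"
    using straight[OF iY(1) Y'(2)] unfolding Tt_def P_def[abs_def] by simp
  have c2: "hq ?r ?XX ?AA (Tt p k (chm p ?ph y)) (chm ?r (%z. ins k (?ph (fst z), v (snd z))) ?t)"
  proof -
    have "cross p n (chm p ?ph y) (thom n) = chm ?r (%z. (?ph (fst z), snd z)) ?t"
      using cross_natural[of p n ?ph y id "thom n"] unfolding chm_ident[OF schain_thom] map_prod_def case_prod_unfold by simp
    then show ?thesis using straight[OF iY(2) Y'(3)] unfolding Tt_def by (simp add: chm_comp P_def)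
  qed
  let ?Q = "%z. (?ph (fst z))(k := snd z)"
  have cQ: "cmap (ptop Y' ?B) ?XX ?Q"
  proof -
    let ?W = "ptop Y' ?B"
    have cp: "cmap ?W (Y k) (%z. ?ph (fst z))" using cont_comp[OF cont_fst iY(2)] by (simp add: o_def)
    have cB: "cmap ?W M snd" by (rule cont_full[OF cont_snd])
    have T: "?Q z \<in> tops ?XX" if "z \<in> tops ?W" for z
    proof -
      have z: "?ph (fst z) \<in> tops (Y k)" "\<delta> < mu k (?ph (fst z))" "snd z \<in> tops M" "2 * nu (snd z) < \<delta>"
        using that funcset_mem[OF cont_fun[OF cp] that] Y'(3) by auto
      have "snd z \<notin> ?ph (fst z) ` {..<k}"
      proof
        assume "snd z \<in> ?ph (fst z) ` {..<k}"
        then obtain j where "j < k" "snd z = ?ph (fst z) j" by auto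
        then show False using mu_le(2)[of j k "?ph (fst z)"] z nu_nonneg[OF z(3)] by simp
      qed
      then have "inj_on (?Q z) {..<Suc k}" using z(1) by (intro inj_on_upd) (auto simp: conf_top)
      then show ?thesis using z by (auto simp: conf_top extensional_def less_Suc_eq)
    qed
    show ?thesis
    proof (rule cont_confI)
      show "cmap ?W M (%z. ?Q z j)" if "j < Suc k" for j using cm_Y_D[OF cp, of j] cB that by (cases "j = k") auto
    qed (use T conf_top in blast)+
  qed
  have Qav: "?Q \<in> tops (ptop Y' ?B) Int csub {} {x. x ~= q} \<rightarrow> ?AA"
  proof
    fix z assume z: "z \<in> tops (ptop Y' ?B) Int csub {} {x. x ~= q}"
    then have "?ph (fst z) \<in> avoid k" using cont_fun[OF iY(2)] by fastforce
    then show "?Q z \<in> ?AA" using z by (auto simp: avoid_def csub_def less_Suc_eq)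
  qed
  have \<gamma>B: "cmap E ?B ?\<gamma>" "cmap E ?B (%u. \<phi> (?\<gamma> u))"
  proof -
    have "cmap E M ?\<gamma>" using cont_comp[OF cv cont_g] by (simp add: o_def)
    moreover have "2 * nu (?\<gamma> u) < \<delta>" if "u \<in> tops E" for u using nu_g[OF vE[OF that]] vn[of u] e(2) by linarith
    ultimately show "cmap E ?B ?\<gamma>" by (intro cont_subI) auto
    have "cmap E M (%u. \<phi> (?\<gamma> u))" using cont_comp[OF cv pg] by (simp add: o_def)
    moreover have "2 * nu (\<phi> (?\<gamma> u)) < \<delta>" if "u \<in> tops E" for u
      using \<epsilon>(2)[OF vE[OF that]] vn[of u] e(3) by linarith
    ultimately show "cmap E ?B (%u. \<phi> (?\<gamma> u))" by (intro cont_subI) auto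
  qed
  have \<gamma>q: "?\<gamma> \<in> nz Int tops E \<rightarrow> {x. x ~= q}" "(%u. \<phi> (?\<gamma> u)) \<in> nz Int tops E \<rightarrow> {x. x ~= q}"
  proof -
    show 1: "?\<gamma> \<in> nz Int tops E \<rightarrow> {x. x ~= q}" using g_eq_q[OF vE] v0 by auto
    have "\<phi> x ~= q" if "x ~= q" "x \<in> tops M" for x using that phi(2,3) q_in by (auto simp: inj_on_def)
    then show "(%u. \<phi> (?\<gamma> u)) \<in> nz Int tops E \<rightarrow> {x. x ~= q}" using 1 g_in[OF vE] by (auto simp: Pi_iff)
  qed
  let ?s1 = "chm n ?\<gamma> (thom n)" and ?s2 = "chm n (%u. \<phi> (?\<gamma> u)) (thom n)"
  have th: "relcycle n E (nz Int tops E) (thom n)" using relcycle_thom[of n] by (simp only: Int_commute[of nz] relcycle_restrict)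
  have s12: "relcycle n ?B {x. x ~= q} (?s2 + ?s1)" by (intro singular_relcycle_add relcycle_chm[OF th] \<gamma>B \<gamma>q)
  have "rnull n M {x. x ~= q} (?s2 + ?s1)"
  proof -
    have h: "hq n M {x. x ~= q} ?s1 (chm n g (thom n))" using shrink_chart[OF e(1)] by (simp add: v_def)
    have "\<phi> \<in> tops M Int {x. x ~= q} \<rightarrow> {x. x ~= q}" using phi(2,3) q_in by (auto simp: inj_on_def)
    from rnull_chm[OF h phi(1) this]
    have "hq n M {x. x ~= q} ?s2 (chm n \<phi> (chm n g (thom n)))" by (simp add: chm_diff chm_comp)
    from rnull_add[OF rnull_add[OF this h] rev] show ?thesis by (simp add: algebra_simps)
  qed
  moreover have "openin M (tops M Int {x. 2 * nu x < \<delta>})"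
    using openin_preim[OF cont_nu, of "{..<\<delta> / 2}"] by (simp add: Int_def mult.commute)
  moreover have "tops M \<subseteq> {x. 2 * nu x < \<delta>} Un {x. x ~= q}" using nu_0[OF q_in] \<delta>(1) by auto
  ultimately have "rnull n ?B {x. x ~= q} (?s2 + ?s1)" using s12 openin_minus_q by (intro rnull_excision)
  from rnull_chm[OF rnull_cross_right[OF y' this] cQ Qav]
  have "rnull ?r ?XX ?AA (chm ?r ?Q (cross p n y ?s2) + chm ?r ?Q (cross p n y ?s1))" by (simp only: cross_add_right chm_add)
  moreover have cr: "cross p n y (chm n f (thom n)) = chm ?r (%z. (fst z, f (snd z))) ?t" for f :: "rvec => 'a"
  proof -
    have "schain p Y' y" using y' by (simp add: scycle)
    then show ?thesis using cross_natural[of p n id y f "thom n"] by (simp add: chm_ident map_prod_def case_prod_unfold)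
  qed
  moreover have "chm ?r ?Q (chm ?r (%z. (fst z, ?\<gamma> (snd z))) ?t) = chm ?r (%z. ins k (?ph (fst z), v (snd z))) ?t"
    by (simp add: chm_comp ins_def)
  moreover have "chm ?r ?Q (chm ?r (%z. (fst z, \<phi> (?\<gamma> (snd z)))) ?t) =
      chm ?r (conf_map \<phi> (Suc k)) (chm ?r (%z. ins k (fst z, v (snd z))) ?t)"
  proof -
    have "(?ph y)(k := \<phi> x) = conf_map \<phi> (Suc k) (y(k := x))" for y x by (auto simp: conf_map_def fun_eq_iff)
    then show ?thesis by (simp add: chm_comp ins_def)
  qed
  ultimately have 1: "rnull ?r ?XX ?AA (chm ?r (conf_map \<phi> (Suc k)) (chm ?r (%z. ins k (fst z, v (snd z))) ?t) +
     chm ?r (%z. ins k (?ph (fst z), v (snd z))) ?t)" by simp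
  from rnull_chm[OF c1 phX pav]
  have 2: "hq ?r ?XX ?AA (chm ?r (conf_map \<phi> (Suc k)) (Tt p k y)) (chm ?r (conf_map \<phi> (Suc k)) (chm ?r (%z. ins k (fst z, v (snd z))) ?t))"
    by (simp only: chm_diff)
  from rnull_add[OF rnull_add[OF 2 c2] 1] show ?thesis by (simp add: algebra_simps)
qed

end

section \<open>Charts and isotopies\<close>

definition isig :: "nat => rvec => rvec" where
  "isig n w = (%i. 1 / (1 - enorm n w) * w i)"

lemma isig_sig: "isig n (sig n u) = u"
proof -
  have "1 / (1 - enorm n (sig n u)) = 1 + enorm n u" unfolding enorm_sig using enorm_add1_pos[of n u] by (simp add: field_simps)
  then show ?thesis using enorm_add1_pos(2)[of n u] by (simp add: isig_def sig_def)
qed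

lemma sig_isig: "enorm n w < 1 ==> sig n (isig n w) = w"
proof -
  assume w: "enorm n w < 1"
  have "1 + enorm n (isig n w) = 1 / (1 - enorm n w)" using w unfolding isig_def enorm_scale by (simp add: field_simps)
  then show ?thesis using w by (simp add: sig_def isig_def)
qed

lemma cm_isig:
  assumes f: "cmap Z (Euc n) f" and "!!z. z \<in> tops Z ==> enorm n (f z) < 1"
  shows "cmap Z (Euc n) (%z. isig n (f z))" unfolding isig_def
  by (intro cont_scale f cont_real_divide cont_diff cont_enorm[OF f] cont_cconst)
    (use assms(2) in force)

definition ball_chart :: "nat => 'a topology => (rvec => 'a) => ('a => nat => real) => bool" where
  "ball_chart n M g gi \<longleftrightarrow> cmap (Euc n) M g & openin M (g ` tops (Euc n)) &
    cmap (subtop M (g ` tops (Euc n))) (Euc n) gi &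
    (\<forall>u\<in>tops (Euc n). gi (g u) = u)"

lemma ball_chart_exists:
  assumes "has_chart_at (Euc n) M x"
  obtains g gi where "ball_chart n M g gi" "g zv = x"
proof -
  let ?E = "Euc n"
  obtain U V where U: "openin M U" "x \<in> U" and V: "openin ?E V" and "subtop M U homeomorphic_space subtop ?E V"
    using assms by (auto simp: has_chart_at_def)
  then obtain f f' where f: "cmap (subtop M U) (subtop ?E V) f" "cmap (subtop ?E V) (subtop M U) f'"
    and ff': "!!y. y \<in> tops (subtop M U) ==> f' (f y) = y" "!!v. v \<in> tops (subtop ?E V) ==> f (f' v) = v"
    unfolding homeomorphic_space_def homeomorphic_maps_def by metis
  have UM: "U \<subseteq> tops M" and VE: "V \<subseteq> tops ?E" using U(1) V openin_subset by auto
  then have tU: "tops (subtop M U) = U" and tV: "tops (subtop ?E V) = V" by auto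
  define c where "c = f x"
  have fV: "f y \<in> V" if "y \<in> U" for y using funcset_mem[OF cont_fun[OF f(1)], of y] that unfolding tU tV .
  have fU: "f' v \<in> U" if "v \<in> V" for v using funcset_mem[OF cont_fun[OF f(2)], of v] that unfolding tU tV .
  have c: "c \<in> V" "c \<in> tops ?E" using fV[OF U(2)] VE by (auto simp: c_def)
  have cc: "cmap Z ?E (%_. c)" for Z :: "'z topology" using c by (simp add: cont_const)
  have "cmap ?E ?E (%u i. c i + u i)" by (intro cont_Euc_add cc) simp
  from openin_preim[OF this V] have "openin ?E {u \<in> tops ?E. (%i. c i + u i) \<in> V}" .
  moreover have "zv \<in> {u \<in> tops ?E. (%i. c i + u i) \<in> V}" using c by (simp add: top_Euc)
  ultimately obtain \<epsilon> where \<epsilon>: "0 < \<epsilon>" "!!u. u \<in> tops ?E ==> enorm n u < \<epsilon> ==> (%i. c i + u i) \<in> V"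
    by (rule Euclidean_small_ball) blast
  define h where "h u = (%i. c i + \<epsilon> * sig n u i)" for u
  define h' where "h' v = (%i. 1 / \<epsilon> * (v i + - c i))" for v
  define g where "g u = f' (h u)" for u
  define gi where "gi y = isig n (h' (f y))" for y
  have hE: "cmap ?E ?E h" unfolding h_def by (intro cont_Euc_add cc cont_scale cont_sig) auto
  have hV: "h u \<in> V" if u: "u \<in> tops ?E" for u
  proof -
    have "(%i. \<epsilon> * sig n u i) \<in> tops ?E" using u by (simp add: sig_def top_Euc)
    moreover have "enorm n (%i. \<epsilon> * sig n u i) < \<epsilon>" using \<epsilon>(1) enorm_sig_less[of n u] unfolding enorm_scale by simp
    ultimately show ?thesis unfolding h_def by (rule \<epsilon>(2))
  qed
  have h'h: "h' (h u) = sig n u" for u using \<epsilon>(1) by (simp add: h_def h'_def)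
  have hh': "h (isig n (h' v)) = v" if "enorm n (h' v) < 1" for v
    using \<epsilon>(1) unfolding h_def sig_isig[OF that] by (simp add: h'_def)
  have "cmap ?E (subtop ?E V) h" by (rule cont_subI[OF hE hV])
  from cont_comp[OF this f(2)] have cg: "cmap ?E (subtop M U) g" by (simp add: o_def g_def[abs_def])
  have gg: "gi (g u) = u" if "u \<in> tops ?E" for u
    using ff'(2)[of "h u"] hV[OF that] unfolding tV by (simp add: g_def gi_def h'h isig_sig)
  have "cmap (subtop M U) ?E f" using f(1) cont_full by blast
  moreover have "cmap Z ?E (%z. h' (w z))" if "cmap Z ?E w" for Z :: "'a topology" and w
    unfolding h'_def by (intro cont_scale cont_Euc_add that cont_uminus_Euclidean cc) simp
  ultimately have ch': "cmap (subtop M U) ?E (%y. h' (f y))" by blast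
  have img: "g ` tops ?E = {y \<in> tops (subtop M U). enorm n (h' (f y)) \<in> {..<1}}"
  proof
    show "g ` tops ?E \<subseteq> {y \<in> tops (subtop M U). enorm n (h' (f y)) \<in> {..<1}}"
      using hV fU ff'(2) enorm_sig_less unfolding tU tV by (auto simp: g_def h'h)
    show "{y \<in> tops (subtop M U). enorm n (h' (f y)) \<in> {..<1}} \<subseteq> g ` tops ?E"
    proof
      fix y assume y: "y \<in> {y \<in> tops (subtop M U). enorm n (h' (f y)) \<in> {..<1}}"
      have "h' (f y) \<in> tops ?E" using funcset_mem[OF cont_fun[OF ch'], of y] y by simp
      then have "isig n (h' (f y)) \<in> tops ?E" by (simp add: isig_def top_Euc)
      moreover have "g (isig n (h' (f y))) = y" using y ff'(1) unfolding g_def by (simp add: hh')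
      ultimately show "y \<in> g ` tops ?E" by (metis imageI)
    qed
  qed
  have "openin (subtop M U) (g ` tops ?E)" unfolding img by (rule openin_preim[OF cont_enorm[OF ch']]) simp
  then have og: "openin M (g ` tops ?E)" using U(1) openin_trans_full by blast
  have sub: "subtop M (g ` tops ?E) = subtop (subtop M U) (g ` tops ?E)"
    unfolding subtop_subtop img by (metis (no_types, lifting) Int_absorb1 mem_Collect_eq subsetI tU)
  have "cmap (subtop M (g ` tops ?E)) ?E gi" unfolding gi_def[abs_def] sub by (rule cm_isig[OF cont_from_sub[OF ch']]) (use img in auto)
  moreover have "g zv = x" unfolding g_def h_def using ff'(1)[of x, unfolded tU, OF U(2)] by (simp add: c_def)
  moreover have "cmap ?E M g" using cg cont_full by blast
  ultimately show thesis using that[of g gi] gg og by (simp add: ball_chart_def)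
qed

lemma ball_chart_interior:
  assumes "ball_chart n M g gi" "u \<in> tops (Euc n)"
  shows "has_chart_at (Euc n) M (g u)"
proof -
  let ?E = "Euc n" and ?U = "g ` tops (Euc n)"
  have g: "cmap ?E M g" "openin M ?U" "cmap (subtop M ?U) ?E gi" "!!u. u \<in> tops ?E ==> gi (g u) = u"
    using assms(1) by (auto simp: ball_chart_def)
  have "homeomorphic_maps (subtop M ?U) (subtop ?E (tops ?E)) gi g" unfolding homeomorphic_maps_def using g by (auto simp: cont_in_subtop)
  then show ?thesis unfolding has_chart_at_def homeomorphic_space_def using g(2) assms(2) openin_topspace by blast
qed

lemma compactin_unit_ball: "compactin (Euc n) {u \<in> tops (Euc n). enorm n u \<le> 1}"
proof -
  let ?E = "Euc n" and ?B = "Pi\<^sub>E UNIV (%i. if i < n then {-1..1} else {0::real})"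
  have "compactin (powertop_real UNIV) ?B" by (subst compactin_PiE) auto
  moreover have sub: "?B \<subseteq> tops ?E" by (auto simp: top_Euc PiE_iff split: if_splits)
  ultimately have B: "compactin ?E ?B" unfolding Euclidean_space_def compactin_subtopology by (auto simp: PiE_iff split: if_splits)
  have "closedin ?E {u \<in> tops ?E. enorm n u \<in> {..1}}"
    by (rule closedin_continuous_map_preimage[OF cont_enorm[OF cont_id[unfolded id_def]]]) simp
  from closed_Int_compactin[OF this B] have "compactin ?E ({u \<in> tops ?E. enorm n u \<in> {..1}} Int ?B)" .
  moreover have "{u \<in> tops ?E. enorm n u \<in> {..1}} Int ?B = {u \<in> tops ?E. enorm n u \<le> 1}"
  proof -
    have "u \<in> ?B" if u: "u \<in> tops ?E" "enorm n u \<le> 1" for u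
    proof (rule PiE_I)
      fix i
      have "\<bar>u i\<bar> \<le> enorm n u" if "i < n" unfolding enorm_def using that by (intro member_le_sum) auto
      then show "u i \<in> (if i < n then {-1..1} else {0})" using u by (cases "i < n") (auto simp: top_Euc abs_le_iff)
    qed simp
    then show ?thesis by blast
  qed
  ultimately show ?thesis by simp
qed

text \<open>Translation by \<open>t * v\<close>, conjugated to the open unit ball; outside of the ball the
  formula gives the identity.\<close>

definition shift :: "nat => rvec => real => rvec => rvec" where
  "shift n v t u = (%i. 1 / (max 0 (1 - enorm n u) + enorm n (%i. u i + t * max 0 (1 - enorm n u) * v i) - max 0 (enorm n u - 1)) *
    (u i + t * max 0 (1 - enorm n u) * v i))"

lemma shift_out: "1 \<le> enorm n u ==> shift n v t u = u" by (simp add: shift_def)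

lemma shift_in: "enorm n u < 1 ==> shift n v t u = sig n (%i. isig n u i + t * v i)"
proof -
  assume u: "enorm n u < 1"
  define r where "r = 1 - enorm n u"
  have r: "0 < r" using u by (simp add: r_def)
  define w where "w = (%i. u i + t * r * v i)"
  have eq: "(%i. isig n u i + t * v i) = (%i. 1 / r * w i)" using r by (simp add: isig_def r_def[symmetric] w_def field_simps)
  have "enorm n (%i. 1 / r * w i) = enorm n w / r" using r unfolding enorm_scale by simp
  moreover have "1 / (1 + enorm n w / r) * (1 / r * a) = 1 / (r + enorm n w) * a" for a
    using r enorm_nonneg[of n w] by (simp add: divide_simps)
  ultimately have "sig n (%i. 1 / r * w i) = (%i. 1 / (r + enorm n w) * w i)" by (simp only: sig_def)
  moreover have "max 0 (1 - enorm n u) = r" "max 0 (enorm n u - 1) = 0" using u by (simp_all add: r_def)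
  ultimately show ?thesis unfolding eq shift_def by (simp only: w_def diff_0_right)
qed

lemma shift_shift:
  shows "shift n (%i. - v i) t (shift n v t u) = u" and "shift n v t (shift n (%i. - v i) t u) = u"
proof -
  have "shift n (%i. - v i) t (shift n v t u) = u" for v
    by (cases "enorm n u < 1") (simp_all add: shift_out shift_in isig_sig sig_isig enorm_sig_less)
  from this[of v] this[of "%i. - v i"] show "shift n (%i. - v i) t (shift n v t u) = u" "shift n v t (shift n (%i. - v i) t u) = u"
    by simp_all
qed

lemma shift_0: "shift n v 0 u = u" by (cases "enorm n u < 1") (simp_all add: shift_out shift_in sig_isig)

lemma cm_shift:
  assumes t: "cmap Z Rtop t" and u: "cmap Z (Euc n) u" and v: "v \<in> tops (Euc n)"
  shows "cmap Z (Euc n) (%z. shift n v (t z) (u z))"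
proof -
  let ?r = "%z. max 0 (1 - enorm n (u z))"
  note r = continuous_map_real_max cont_diff continuous_map_add continuous_map_real_mult cont_cconst t
    cont_enorm[OF u]
  have w: "cmap Z (Euc n) (%z i. u z i + t z * ?r z * v i)" using v by (intro cont_Euc_add cont_scale u r) (simp add: cont_const)
  have D: "?r z + enorm n (%i. u z i + t z * ?r z * v i) - max 0 (enorm n (u z) - 1) ~= 0" for z
  proof (cases "enorm n (u z) < 1")
    case True
    then show ?thesis using enorm_nonneg[of n "%i. u z i + t z * ?r z * v i"] by linarith
  next
    case False
    then have "max 0 (1 - enorm n (u z)) = 0" "max 0 (enorm n (u z) - 1) = enorm n (u z) - 1" by simp_all
    then show ?thesis by simp
  qed
  have "cmap Z Rtop (%z. 1 / (?r z + enorm n (%i. u z i + t z * ?r z * v i) - max 0 (enorm n (u z) - 1)))"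
    by (intro cont_real_divide r cont_enorm[OF w] D)
  then show ?thesis unfolding shift_def by (intro cont_scale w)
qed

definition isotopy :: "'a topology => (real => 'a => 'a) => (real => 'a => 'a) => bool" where
  "isotopy M H K \<longleftrightarrow>
     cmap (ptop (I01) M) M (%z. H (fst z) (snd z)) &
     cmap (ptop (I01) M) M (%z. K (fst z) (snd z)) &
     (\<forall>t\<in>{0..1}. \<forall>x\<in>tops M. K t (H t x) = x & H t (K t x) = x) & (\<forall>x\<in>tops M. H 0 x = x)"

lemma isotopy_at:
  assumes "isotopy M H K" "0 \<le> t" "t \<le> 1"
  shows "cmap M M (H t)" "cmap M M (K t)"
proof -
  have "cmap M (ptop (I01) M) (%x. (t, x))" using assms(2,3) by (intro cont_pairedI) (auto simp: cont_const)
  from cont_comp[OF this, of M "%z. H (fst z) (snd z)"] cont_comp[OF this, of M "%z. K (fst z) (snd z)"]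
  show "cmap M M (H t)" "cmap M M (K t)" using assms(1) by (simp_all add: isotopy_def o_def)
qed

lemma isotopy_inverse:
  assumes "isotopy M H K" shows "isotopy M K H"
proof -
  have "K 0 x = x" if "x \<in> tops M" for x using assms that unfolding isotopy_def by (metis atLeastAtMost_iff order_refl zero_le_one)
  then show ?thesis using assms by (auto simp: isotopy_def)
qed

lemma isotopy_comp:
  assumes 1: "isotopy M H K" and 2: "isotopy M H' K'"
  shows "isotopy M (%t x. H' t (H t x)) (%t x. K t (K' t x))"
proof -
  have c: "cmap (ptop (I01) M) M (%z. G' (fst z) (G (fst z) (snd z)))"
    if "cmap (ptop (I01) M) M (%z. G (fst z) (snd z))"
      "cmap (ptop (I01) M) M (%z. G' (fst z) (snd z))" for G G'
    using cont_comp[OF cont_pairedI[OF cont_fst that(1)] that(2)] by (simp add: o_def)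
  have in_M: "H t x \<in> tops M" if "t \<in> {0..1}" "x \<in> tops M" for t x
    using funcset_mem[OF cont_fun[OF isotopy_at(1)[OF 1]]] that by simp
  have in_M': "K' t x \<in> tops M" if "t \<in> {0..1}" "x \<in> tops M" for t x
    using funcset_mem[OF cont_fun[OF isotopy_at(2)[OF 2]]] that by simp
  note d = 1[unfolded isotopy_def] 2[unfolded isotopy_def]
  show ?thesis unfolding isotopy_def
  proof (intro conjI ballI)
    show "cmap (ptop (I01) M) M (%z. H' (fst z) (H (fst z) (snd z)))"
      "cmap (ptop (I01) M) M (%z. K (fst z) (K' (fst z) (snd z)))" using d by (auto intro: c[of H H'] c[of K' K])
    fix x assume x: "x \<in> tops M"
    show "H' 0 (H 0 x) = x" using d x by simp
    fix t :: real assume t: "t \<in> {0..1}"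
    show "K t (K' t (H' t (H t x))) = x" "H' t (H t (K t (K' t x))) = x" using d x t in_M[OF t x] in_M'[OF t x] by simp_all
  qed
qed

lemma isotopy_push:
  assumes H: "Hausdorff_space M" and ch: "ball_chart n M g gi" and v: "v \<in> tops (Euc n)"
  defines "P == %v t x. if x \<in> g ` tops (Euc n) then g (shift n v t (gi x)) else x"
  shows "isotopy M (P v) (P (%i. - v i))"
proof -
  let ?E = "Euc n" and ?U = "g ` tops (Euc n)" and ?I = "I01"
  let ?C = "g ` {u \<in> tops ?E. enorm n u \<le> 1}"
  have g: "cmap ?E M g" "openin M ?U" "cmap (subtop M ?U) ?E gi" "!!u. u \<in> tops ?E ==> gi (g u) = u"
    using ch by (auto simp: ball_chart_def)
  have cl: "closedin M ?C" by (rule compactin_imp_closedin[OF H image_compactin[OF compactin_unit_ball g(1)]])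
  have out: "g (shift n v t (gi x)) = x" if x: "x \<in> ?U" "x \<notin> ?C" for v t x
  proof -
    obtain u where u: "u \<in> tops ?E" "x = g u" using x(1) by blast
    then have "1 \<le> enorm n u" using x(2) by force
    then show ?thesis using u g(4) by (simp add: shift_out)
  qed
  have cont: "cmap (ptop ?I M) M (%z. P v (fst z) (snd z))" if v: "v \<in> tops ?E" for v
  proof (rule pasting_lemma[where I = "{True, False}" and T = "%c. {0..1} \<times> (if c then ?U else tops M - ?C)"
        and f = "%c z. if c then g (shift n v (fst z) (gi (snd z))) else snd z"])
    fix c :: bool
    show "openin (ptop ?I M) ({0..1} \<times> (if c then ?U else tops M - ?C))" using g(2) cl by (auto simp: openin_prod_Times_iff)
    let ?Z = "subtop (ptop ?I M) ({0..1} \<times> (if c then ?U else tops M - ?C))"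
    show "cmap ?Z M (%z. if c then g (shift n v (fst z) (gi (snd z))) else snd z)"
    proof (cases c)
      case True
      have s: "cmap ?Z (subtop M ?U) snd" by (intro cont_subI cont_from_sub cont_snd) (auto simp: True)
      have t: "cmap ?Z Rtop fst" by (intro cont_from_sub cont_01D[OF cont_fst])
      have "cmap ?Z ?E (%z. gi (snd z))" using cont_comp[OF s g(3)] by (simp add: o_def)
      from cont_comp[OF cm_shift[OF t this v] g(1)] show ?thesis using True by (simp add: o_def)
    next
      case False
      then show ?thesis by (simp add: cont_from_sub cont_snd)
    qed
  next
    fix c d :: bool and z
    assume "z \<in> tops (ptop ?I M) Int ({0..1} \<times> (if c then ?U else tops M - ?C)) Int ({0..1} \<times> (if d then ?U else tops M - ?C))"
    then show "(if c then g (shift n v (fst z) (gi (snd z))) else snd z) = (if d then g (shift n v (fst z) (gi (snd z))) else snd z)"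
      using out by (cases c; cases d) (auto simp: mem_Times_iff)
  next
    fix z assume "z \<in> tops (ptop ?I M)"
    then show "\<exists>c. c \<in> {True, False} & z \<in> {0..1} \<times> (if c then ?U else tops M - ?C) &
        P v (fst z) (snd z) = (if c then g (shift n v (fst z) (gi (snd z))) else snd z)"
      by (intro exI[of _ "snd z \<in> ?U"]) (auto simp: P_def mem_Times_iff image_iff)
  qed
  have mv: "(%i. - v i) \<in> tops ?E" using v by (simp add: top_Euc)
  have sE: "shift n v t u \<in> tops ?E" if "u \<in> tops ?E" "v \<in> tops ?E" for v t u using that by (simp add: shift_def top_Euc)
  have inv: "P (%i. - v i) t (P v t x) = x & P v t (P (%i. - v i) t x) = x" for t x
  proof (cases "x \<in> ?U")
    case True
    then obtain u where u: "u \<in> tops ?E" "x = g u" by auto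
    then show ?thesis using sE[OF u(1)] v mv g(4) by (auto simp: P_def shift_shift)
  qed (simp add: P_def)
  have "P v 0 x = x" for x using g(4) by (auto simp: P_def shift_0)
  then show ?thesis unfolding isotopy_def using cont[OF v] cont[OF mv] inv by auto
qed

section \<open>Transport of local orientations\<close>

lemma homol_chm:
  assumes "homrel p X S a b" "cmap X X' f" "f \<in> tops X Int S \<rightarrow> T"
  shows "homrel p X' T (chm p f a) (chm p f b)"
proof -
  have "relbdry p X (tops X Int S) (a - b)" using assms(1) by (simp add: homrel_def)
  from relbdry_chm[OF this assms(2,3)] show ?thesis by (simp add: homrel_def chm_diff)
qed

lemma homol_cmul: "homrel p X S a b ==> homrel p X S (scal k a) (scal k b)"
  using singular_relboundary_cmul[of p X S "a - b" k] by (simp only: homrel_def scal_diff)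

lemma homol_sym: "homrel p X S a b ==> homrel p X S b a" by (simp add: homologous_rel_sym)

lemma homol_trans [trans]: "homrel p X S a b ==> homrel p X S b c ==> homrel p X S a c" using homologous_rel_trans by blast

lemma relcycle_chm_Int:
  assumes "relcycle p X S c" "cmap X X' f" "f \<in> tops X Int S \<rightarrow> T"
  shows "relcycle p X' T (chm p f c)" using relcycle_chm[of p X "tops X Int S" c] assms by simp

lemma relcycle_chain: "relcycle p X S c ==> schain p X c" by (simp add: relcycle)

lemma generate_homology_class:
  assumes c: "relcycle p X S c"
    and gen: "!!c'. relcycle p X S c' ==> \<exists>m. homrel p X S c' (scal m c)"
  shows "generate (rhgroup (int p) X S) {homset p X S c} = carrier (rhgroup (int p) X S)"
    (is "generate ?G {?a} = _")
proof -
  interpret G: group ?G by simp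
  have a: "?a \<in> carrier ?G" using c by (auto simp: carrier_relative_homology_group)
  have mult: "homset p X S x \<otimes>\<^bsub>?G\<^esub> homset p X S y = homset p X S (x + y)" for x y
  proof -
    have "z \<in> (\<Union>r\<in>homset p X S x. \<Union>s\<in>homset p X S y. {r + s})" if z: "homrel p X S (x + y) z" for z
    proof -
      have "homrel p X S y (z - x)" using z by (simp add: homrel_def algebra_simps)
      then show ?thesis by (intro UN_I[of x] UN_I[of "z - x"]) auto
    qed
    then show ?thesis unfolding mult_relative_homology_group by (auto intro: homologous_rel_add)
  qed
  have nat: "homset p X S (scal (int m) c) \<in> generate ?G {?a}" for m
  proof (induction m)
    case 0
    have "homset p X S 0 = \<one>\<^bsub>?G\<^esub>" by (simp add: homologous_rel_set_eq_relboundary)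
    then show ?case using generate.one[of ?G "{?a}"] by simp
  next
    case (Suc m)
    have "scal (int (Suc m)) c = scal (int m) c + c" by (simp add: frag_cmul_distrib)
    then show ?case using generate.eng[OF Suc generate.incl[of ?a "{?a}" ?G]] by (simp only: mult) simp
  qed
  have neg: "homset p X S (- b) \<in> generate ?G {?a}" if b: "homset p X S b \<in> generate ?G {?a}" "relcycle p X S b" for b
  proof -
    have "homset p X S b \<otimes>\<^bsub>?G\<^esub> homset p X S (- b) = \<one>\<^bsub>?G\<^esub>"
      unfolding mult by (simp add: homologous_rel_set_eq_relboundary)
    moreover have "homset p X S b \<in> carrier ?G" "homset p X S (- b) \<in> carrier ?G"
      using b(2) by (auto simp: carrier_relative_homology_group singular_relcycle_minus)
    ultimately have "homset p X S (- b) = inv\<^bsub>?G\<^esub> homset p X S b" by (metis G.inv_equality G.inv_inv)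
    then show ?thesis using G.generate_m_inv_closed[OF _ b(1)] a by simp
  qed
  show ?thesis
  proof
    show "generate ?G {?a} \<subseteq> carrier ?G" using G.generate_incl a by simp
    show "carrier ?G \<subseteq> generate ?G {?a}"
    proof
      fix A assume "A \<in> carrier ?G"
      then obtain c' where c': "relcycle p X S c'" "A = homset p X S c'" by (auto simp: carrier_relative_homology_group)
      obtain m where "homrel p X S c' (scal m c)" using gen[OF c'(1)] by blast
      then have A: "A = homset p X S (scal m c)" unfolding c'(2) homologous_rel_set_eq .
      show "A \<in> generate ?G {?a}"
      proof (cases "0 \<le> m")
        case True
        then show ?thesis using nat[of "nat m"] by (simp add: A)
      next
        case False
        then show ?thesis using neg[OF nat[of "nat (- m)"] relcycle_cmul[OF c]] by (simp add: A)
      qed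
    qed
  qed
qed

locale transport =
  fixes n :: nat and M N0 :: "'a topology"
  assumes haus: "Hausdorff_space M" and N0: "N0 = subtop M (manifold_interior n M)"
begin

abbreviation (input) "E == Euc n"
abbreviation (input) "off x == tops N0 - {x}"
abbreviation (input) "bc g gi == ball_chart n M g gi & ball_chart n N0 g gi"
abbreviation (input) "isot H K == isotopy M H K & isotopy N0 H K"
abbreviation (input) "theta g == chm n g (thom n)"
abbreviation (input) "push f == chm n f"

lemma top_N0: "tops N0 = manifold_interior n M" by (auto simp: N0 manifold_interior_def)

lemma chart_at:
  assumes x: "x \<in> tops N0" obtains g gi where "bc g gi" "g zv = x"
proof -
  obtain g gi where g: "ball_chart n M g gi" "g zv = x"
    by (rule ball_chart_exists[of n M x]) (use x in \<open>simp add: top_N0 manifold_interior_def\<close>)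
  have gM: "g ` tops E \<subseteq> tops M" using g(1) openin_subset by (auto simp: ball_chart_def)
  have sub: "g ` tops E \<subseteq> manifold_interior n M" using ball_chart_interior[OF g(1)] gM by (auto simp: manifold_interior_def)
  have eq: "subtop N0 (g ` tops E) = subtop M (g ` tops E)" unfolding N0 subtop_subtop using sub by (simp add: Int_absorb1)
  have "openin N0 (g ` tops E)" unfolding N0 openin_subtopology using g(1) sub by (intro exI[of _ "g ` tops E"]) (auto simp: ball_chart_def)
  moreover have "cmap E N0 g" unfolding N0 using g(1) sub by (intro cont_subI) (auto simp: ball_chart_def)
  ultimately have "ball_chart n N0 g gi" using g(1) unfolding ball_chart_def eq by simp
  then show thesis using g that by blast
qed

lemma haus_N0: "Hausdorff_space N0" unfolding N0 using haus Hausdorff_space_subtopology by blast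

context
  fixes g gi assumes g: "bc g gi"
begin

lemma chart_facts:
  shows "cmap E N0 g" "openin N0 (g ` tops E)" "cmap (subtop N0 (g ` tops E)) E gi"
    "u \<in> tops E ==> gi (g u) = u" "g zv \<in> tops N0"
proof -
  show *: "cmap E N0 g" "openin N0 (g ` tops E)" "cmap (subtop N0 (g ` tops E)) E gi"
    "u \<in> tops E ==> gi (g u) = u" for u using g by (auto simp: ball_chart_def)
  show "g zv \<in> tops N0" using funcset_mem[OF cont_fun[OF *(1)], of zv] by (simp add: top_Euc)
qed

lemma off_zv: "g \<in> tops E Int nz \<rightarrow> off (g zv)"
proof
  fix u assume u: "u \<in> tops E Int nz"
  have "g u ~= g zv" using u chart_facts(4)[of u] chart_facts(4)[of zv] by (auto simp: top_Euc)
  moreover have "g u \<in> tops N0" using funcset_mem[OF cont_fun[OF chart_facts(1)], of u] u by simp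
  ultimately show "g u \<in> off (g zv)" by simp
qed

lemma off_gi: "gi \<in> tops (subtop N0 (g ` tops E)) Int off (g zv) \<rightarrow> nz" using chart_facts(4) by fastforce

lemma relcycle_theta: "relcycle n N0 (off (g zv)) (theta g)" by (rule relcycle_chm_Int[OF relcycle_thom chart_facts(1) off_zv])

lemma open_off: "openin N0 (off x)"
proof (cases "x \<in> tops N0")
  case True
  then have "closedin N0 {x}" using closedin_Hausdorff_sing_eq[OF haus_N0, of x] by simp
  then show ?thesis by (rule openin_diff[OF openin_topspace])
next
  case False
  then have "off x = tops N0" by blast
  then show ?thesis using openin_topspace[of N0] by metis
qed

lemma theta_generates:
  assumes c: "relcycle n N0 (off (g zv)) c"
  obtains m where "homrel n N0 (off (g zv)) c (scal m (theta g))"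
proof -
  let ?U = "g ` tops E"
  have "tops N0 \<subseteq> ?U Un off (g zv)" by (auto simp: top_Euc)
  from excision_surj[OF chart_facts(2) open_off this c] obtain c' where
    c': "relcycle n (subtop N0 ?U) (off (g zv)) c'" "homrel n N0 (off (g zv)) c c'" .
  obtain m where "homrel n E nz (push gi c') (scal m (thom n))"
    by (rule thom_generates[OF relcycle_chm_Int[OF c'(1) chart_facts(3) off_gi]])
  from homol_chm[OF this chart_facts(1) off_zv]
  have "homrel n N0 (off (g zv)) (push (%x. g (gi x)) c') (scal m (theta g))" by (simp add: chm_comp chm_cmul)
  moreover have "push (%x. g (gi x)) c' = c'" by (rule chm_id_gen[OF relcycle_chain[OF c'(1)]]) (use chart_facts(4) in auto)
  ultimately have "homrel n N0 (off (g zv)) c' (scal m (theta g))" by simp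
  from homol_trans[OF c'(2) this] show thesis by (rule that)
qed

lemma theta_nontorsion:
  assumes "rnull n N0 (off (g zv)) (scal m (theta g))"
  shows "m = 0"
proof -
  let ?U = "g ` tops E"
  have "tops N0 \<subseteq> ?U Un off (g zv)" by (auto simp: top_Euc)
  moreover have "relcycle n (subtop N0 ?U) (off (g zv)) (theta g)"
    by (rule relcycle_chm_Int[OF relcycle_thom _ off_zv]) (auto intro: cont_subI chart_facts(1))
  from relcycle_cmul[OF this]
  have "relcycle n (subtop N0 ?U) (off (g zv)) (scal m (theta g))" .
  moreover have "openin N0 (tops N0 Int ?U)" "openin N0 (tops N0 Int off (g zv))"
    using openin_Int[OF openin_topspace chart_facts(2)] openin_Int[OF openin_topspace open_off] by blast+
  ultimately have "rnull n (subtop N0 ?U) (off (g zv)) (scal m (theta g))" using assms rnull_excision by blast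
  from rnull_chm[OF this chart_facts(3) off_gi]
  have "rnull n E nz (scal m (push (%u. gi (g u)) (thom n)))" by (simp only: chm_cmul chm_comp)
  moreover have "push (%u. gi (g u)) (thom n) = thom n" by (rule chm_id_gen[OF relcycle_chain[OF relcycle_thom] chart_facts(4)])
  ultimately show ?thesis using thom_nontorsion by simp
qed

end

lemma move:
  assumes g: "bc g gi" and u: "u \<in> tops E" "enorm n u < 1"
  obtains H K where "isot H K" "H 1 (g zv) = g u" "!!t x. x \<notin> g ` {u \<in> tops E. enorm n u < 1} ==> H t x = x"
proof -
  let ?v = "isig n u"
  have v: "?v \<in> tops E" using u(1) by (simp add: isig_def top_Euc)
  have z: "zv \<in> tops E" by (simp add: top_Euc)
  let ?P = "%v t x. if x \<in> g ` tops E then g (shift n v t (gi x)) else x"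
  have "isot (?P ?v) (?P (%i. - ?v i))" using g isotopy_push[OF haus _ v] isotopy_push[OF haus_N0 _ v] by blast
  moreover have "shift n ?v 1 zv = u" using sig_isig[OF u(2)] by (simp add: shift_in isig_def)
  then have "?P ?v 1 (g zv) = g u" using chart_facts(4)[OF g z] z by auto
  moreover have "?P ?v t x = x" if "x \<notin> g ` {u \<in> tops E. enorm n u < 1}" for t x
  proof (cases "x \<in> g ` tops E")
    case True
    then obtain w where w: "w \<in> tops E" "x = g w" by blast
    then have "1 \<le> enorm n w" using that by force
    then show ?thesis using w chart_facts(4)[OF g w(1)] by (simp add: shift_out)
  qed simp
  ultimately show thesis by (rule that)
qed

lemma isot_facts:
  assumes H: "isot H K" and x: "x \<in> tops N0"
  shows "cmap N0 N0 (H 1)" "cmap N0 N0 (K 1)" "K 1 (H 1 x) = x" "H 1 (K 1 x) = x"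
    "H 1 x \<in> tops N0" "H 1 \<in> tops N0 Int off x \<rightarrow> off (H 1 x)"
proof -
  show c: "cmap N0 N0 (H 1)" "cmap N0 N0 (K 1)" using H isotopy_at[of N0 H K 1] by simp_all
  have KH: "K 1 (H 1 x) = x & H 1 (K 1 x) = x" if "x \<in> tops N0" for x using H that unfolding isotopy_def by simp
  show "K 1 (H 1 x) = x" "H 1 (K 1 x) = x" using KH[OF x] by simp_all
  have top: "H 1 x \<in> tops N0" if "x \<in> tops N0" for x using funcset_mem[OF cont_fun[OF c(1)] that] .
  show "H 1 x \<in> tops N0" using top[OF x] .
  show "H 1 \<in> tops N0 Int off x \<rightarrow> off (H 1 x)"
  proof
    fix y assume y: "y \<in> tops N0 Int off x"
    then have "H 1 y ~= H 1 x" using KH[of y] KH[OF x] by auto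
    then show "H 1 y \<in> off (H 1 x)" using y top by simp
  qed
qed

lemma isot_id: "isot (%t x. x) (%t x. x)" by (simp add: isotopy_def cont_snd)

lemma theta_fixed:
  assumes g: "bc g gi" and H: "isot H K" "H 1 (g zv) = g zv"
    and nr: "~ homrel n N0 (off (g zv)) (push (H 1) (theta g)) (- theta g)"
  shows "homrel n N0 (off (g zv)) (push (H 1) (theta g)) (theta g)"
proof -
  let ?r = "g zv"
  note r = chart_facts(5)[OF g]
  have K: "isot K H" using H(1) isotopy_inverse by blast
  have Kr: "K 1 ?r = ?r" using isot_facts(3)[OF H(1) r] H(2) by simp
  note h = isot_facts[OF H(1) r, unfolded H(2)] and k = isot_facts[OF K r, unfolded Kr]
  obtain m where m: "homrel n N0 (off ?r) (push (H 1) (theta g)) (scal m (theta g))"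
    by (rule theta_generates[OF g relcycle_chm_Int[OF relcycle_theta[OF g] h(1,6)]])
  obtain l where l: "homrel n N0 (off ?r) (push (K 1) (theta g)) (scal l (theta g))"
    by (rule theta_generates[OF g relcycle_chm_Int[OF relcycle_theta[OF g] k(1,6)]])
  have "push (%x. K 1 (H 1 x)) (theta g) = theta g"
    by (rule chm_id_gen[OF relcycle_chain[OF relcycle_theta[OF g]]]) (rule isot_facts(3)[OF H(1)])
  then have "homrel n N0 (off ?r) (theta g) (scal m (push (K 1) (theta g)))" using homol_chm[OF m k(1,6)] by (simp only: chm_comp chm_cmul)
  from homol_trans[OF this homol_cmul[OF l, of m]]
  have "rnull n N0 (off ?r) (theta g - scal (m * l) (theta g))" using hq_homol by simp
  moreover have "theta g - scal (m * l) (theta g) = scal (1 - m * l) (theta g)"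
    by (intro poly_mapping_eqI) (simp add: lookup_minus algebra_simps)
  ultimately have "m * l = 1" using theta_nontorsion[OF g, of "1 - m * l"] by simp
  then have "m = 1 | m = -1" by (auto simp: zmult_eq_1_iff)
  then show ?thesis using m nr by auto
qed

lemma orientable:
  assumes nr: "!!g gi H K. bc g gi ==> isot H K ==> H 1 (g zv) = g zv ==>
      ~ homrel n N0 (off (g zv)) (push (H 1) (theta g)) (- theta g)"
  shows "orientable_manifold n M"
proof -
  define R where "R x y \<longleftrightarrow> (\<exists>H K. isot H K & H 1 x = y)" for x y
  define rep where "rep x = (SOME r. r \<in> tops N0 & R r x)" for x
  define chart where "chart r = (SOME g. \<exists>gi. bc g gi & g zv = r)" for r
  define mv where "mv x = (SOME H. \<exists>K. isot H K & H 1 (rep x) = x)" for x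
  define om where "om x = push (mv x 1) (theta (chart (rep x)))" for x
  have comp: "isot (%t x. H' t (H t x)) (%t x. K t (K' t x))" if "isot H K" "isot H' K'" for H H' K K' using that isotopy_comp by blast
  have R_trans: "R x z" if R: "R x y" "R y z" for x y z
  proof -
    obtain H K H' K' where "isot H K" "H 1 x = y" "isot H' K'" "H' 1 y = z" using R unfolding R_def by blast
    then show ?thesis using comp[of H K H' K'] unfolding R_def by (intro exI[of _ "%t x. H' t (H t x)"] exI[of _ "%t x. K t (K' t x)"]) simp
  qed
  have R_sym: "R y x" if R: "R x y" "x \<in> tops N0" for x y
  proof -
    obtain H K where H: "isot H K" "H 1 x = y" using R(1) unfolding R_def by blast
    then have "K 1 y = x" "isot K H" using isot_facts(3)[OF H(1) R(2)] isotopy_inverse by blast+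
    then show ?thesis unfolding R_def by blast
  qed
  have rep: "rep x \<in> tops N0 & R (rep x) x" if "x \<in> tops N0" for x
    unfolding rep_def by (rule someI[of _ x]) (use that isot_id in \<open>auto simp: R_def\<close>)
  have rep_eq: "rep x = rep y" if "R x y" "x \<in> tops N0" for x y
  proof -
    have "(r \<in> tops N0 & R r x) = (r \<in> tops N0 & R r y)" for r using R_trans[OF _ that(1)] R_trans[OF _ R_sym[OF that]] by blast
    then show ?thesis unfolding rep_def by simp
  qed
  have chart: "\<exists>gi. bc (chart r) gi & chart r zv = r" if "r \<in> tops N0" for r
  proof -
    obtain g gi where "bc g gi" "g zv = r" using chart_at[OF \<open>r \<in> tops N0\<close>] .
    then have "\<exists>g gi. bc g gi & g zv = r" by (intro exI[of _ g] exI[of _ gi] conjI) simp_all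
    from someI_ex[OF this] show ?thesis unfolding chart_def .
  qed
  have mv: "\<exists>K. isot (mv x) K & mv x 1 (rep x) = x" if "x \<in> tops N0" for x
  proof -
    have "\<exists>H K. isot H K & H 1 (rep x) = x" using rep[OF that] unfolding R_def by (rule conjunct2)
    from someI_ex[OF this] show ?thesis unfolding mv_def .
  qed
  have rel: "relcycle n N0 (off x) (om x)" if x: "x \<in> tops N0" for x
  proof -
    obtain gi where g: "bc (chart (rep x)) gi" "chart (rep x) zv = rep x" using chart rep[OF x] by blast
    obtain K where A: "isot (mv x) K" "mv x 1 (rep x) = x" using mv[OF x] by blast
    have "rep x \<in> tops N0" using rep[OF x] by simp
    note f = isot_facts[OF A(1) this]
    show ?thesis unfolding om_def using relcycle_chm_Int[OF relcycle_theta[OF g(1)] f(1), of "off x"] f(6) unfolding g(2) A(2) by blast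
  qed
  have inv: "homrel n N0 (off (H 1 x)) (push (H 1) (om x)) (om (H 1 x))" if x: "x \<in> tops N0" and H: "isot H K" for x H K
  proof -
    let ?y = "H 1 x" and ?r = "rep x"
    have y: "?y \<in> tops N0" using isot_facts(5)[OF H x] .
    have r: "?r \<in> tops N0" using rep[OF x] by simp
    have "R x ?y" unfolding R_def using H by (intro exI[of _ H] exI[of _ K] conjI) simp_all
    then have ry: "rep ?y = ?r" using rep_eq x by simp
    obtain gi where g: "bc (chart ?r) gi" "chart ?r zv = ?r" using chart[OF r] by blast
    obtain A' where A: "isot (mv x) A'" "mv x 1 ?r = x" using mv[OF x] by blast
    obtain B' where B: "isot (mv ?y) B'" "mv ?y 1 ?r = ?y" using mv[OF y] unfolding ry by blast
    have B'i: "isot B' (mv ?y)" using B(1) isotopy_inverse by blast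
    have B'y: "B' 1 ?y = ?r" using isot_facts(3)[OF B(1) r] B(2) by simp
    let ?th = "theta (chart ?r)"
    note L = comp[OF comp[OF A(1) H] B'i]
    have "homrel n N0 (off ?r) (push (%z. B' 1 (H 1 (mv x 1 z))) ?th) ?th"
      using theta_fixed[OF g(1) L _ nr[OF g(1) L]] by (simp add: g(2) A(2) B'y)
    from homol_chm[OF this isot_facts(1)[OF B(1) r] isot_facts(6)[OF B(1) r]]
    have "homrel n N0 (off ?y) (push (%z. mv ?y 1 (B' 1 (H 1 (mv x 1 z)))) ?th) (om ?y)" unfolding B(2) by (simp only: om_def ry chm_comp)
    moreover have "push (%z. mv ?y 1 (B' 1 (H 1 (mv x 1 z)))) ?th = push (%z. H 1 (mv x 1 z)) ?th"
    proof (rule chm_eq[OF relcycle_chain[OF relcycle_theta[OF g(1)]]])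
      fix z assume "z \<in> tops N0"
      then show "mv ?y 1 (B' 1 (H 1 (mv x 1 z))) = H 1 (mv x 1 z)"
        using isot_facts(4)[OF B(1)] isot_facts(5)[OF H] isot_facts(5)[OF A(1)] by simp
    qed
    ultimately show ?thesis by (simp only: om_def chm_comp)
  qed
  have gen: "\<exists>m. homrel n N0 (off x) (theta g) (scal m (om x))" if g: "bc g gi" "g zv = x" for g gi x
  proof -
    have x: "x \<in> tops N0" using chart_facts(5)[OF g(1)] g(2) by simp
    let ?r = "rep x"
    have r: "?r \<in> tops N0" using rep[OF x] by simp
    obtain ci where c: "bc (chart ?r) ci" "chart ?r zv = ?r" using chart[OF r] by blast
    obtain K where A: "isot (mv x) K" "mv x 1 ?r = x" using mv[OF x] by blast
    have K: "isot K (mv x)" using A(1) isotopy_inverse by blast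
    have Kx: "K 1 x = ?r" using isot_facts(3)[OF A(1) r] A(2) by simp
    have "relcycle n N0 (off (chart ?r zv)) (push (K 1) (theta g))"
      using relcycle_chm_Int[OF relcycle_theta[OF g(1)] isot_facts(1)[OF K x], of "off ?r"] isot_facts(6)[OF K x]
      unfolding g(2) Kx c(2) by blast
    then obtain m where "homrel n N0 (off ?r) (push (K 1) (theta g)) (scal m (theta (chart ?r)))"
      by (rule theta_generates[OF c(1)]) (simp add: c(2))
    from homol_chm[OF this isot_facts(1)[OF A(1) r] isot_facts(6)[OF A(1) r]]
    have "homrel n N0 (off x) (push (%z. mv x 1 (K 1 z)) (theta g)) (scal m (om x))" unfolding A(2) by (simp only: om_def chm_comp chm_cmul)
    moreover have "push (%z. mv x 1 (K 1 z)) (theta g) = theta g"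
      by (rule chm_id_gen[OF relcycle_chain[OF relcycle_theta[OF g(1)]]]) (rule isot_facts(4)[OF A(1)])
    ultimately show ?thesis by auto
  qed
  define mu where "mu x = homset n N0 (off x) (om x)" for x
  have "is_orientation n N0 mu" unfolding is_orientation_def
  proof (intro conjI ballI)
    fix x assume x: "x \<in> tops N0"
    obtain g gi where g: "bc g gi" "g zv = x" using chart_at[OF x] by blast
    show "mu x \<in> carrier (local_homology_group n N0 {x})" unfolding mu_def carrier_relative_homology_group using rel[OF x] by blast
    show "generate (local_homology_group n N0 {x}) {mu x} = carrier (local_homology_group n N0 {x})" unfolding mu_def
    proof (rule generate_homology_class[OF rel[OF x]])
      fix c' assume c': "relcycle n N0 (off x) c'"
      obtain m where m: "homrel n N0 (off x) c' (scal m (theta g))" using theta_generates[OF g(1), unfolded g(2), OF c'] .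
      obtain l where "homrel n N0 (off x) (theta g) (scal l (om x))" using gen[OF g] by blast
      from homol_trans[OF m homol_cmul[OF this, of m]]
      show "\<exists>m. homrel n N0 (off x) c' (scal m (om x))" by auto
    qed
    let ?B = "{u \<in> tops E. enorm n u < 1}"
    define U where U_def: "U = g ` ?B"
    note cf = chart_facts[OF g(1)]
    have "openin N0 U"
    proof -
      have "g ` ?B = {y \<in> tops (subtop N0 (g ` tops E)). enorm n (gi y) \<in> {..<1}}"
        using cf(4) openin_subset[OF cf(2)] by (auto simp: image_iff)
      moreover have "openin (subtop N0 (g ` tops E)) \<dots>" by (rule openin_preim[OF cont_enorm[OF cf(3)]]) simp
      ultimately show ?thesis using openin_trans_full[OF _ cf(2)] unfolding U_def by metis
    qed
    moreover have "x \<in> U" unfolding U_def g(2)[symmetric] by (intro imageI) (simp add: top_Euc)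
    moreover have "\<exists>\<alpha>\<in>carrier (local_homology_group n N0 U). \<forall>y\<in>U.
           hom_induced (int n) N0 (tops N0 - U) N0 (off y) id \<alpha> = mu y"
    proof -
      let ?V = "tops N0 - U"
      have th: "schain n E (thom n)" "schain (n - 1) (subtop E nz) (bdry n (thom n))" using relcycle_thom[of n] by (simp_all add: relcycle)
      obtain \<delta> where \<delta>: "0 < \<delta>" "schain (n - 1) (subtop (subtop E nz) {u. \<delta> < enorm n u}) (bdry n (thom n))"
        by (rule chain_positive_bound[OF th(2) cont_enorm[OF cont_from_sub[OF cont_id[unfolded id_def]]]])
          (auto simp: enorm_pos_iff)
      have "schain (n - 1) (subtop E {u. \<delta> < enorm n u}) (bdry n (thom n))"
        using \<delta>(2) unfolding subtop_subtop by (rule singular_chain_mono) auto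
      then have rd: "relcycle n E {u. \<delta> < enorm n u} (thom n)" using th(1) by (simp add: relcycle)
      define a where "a = push (%u. g (%i. 1 / \<delta> * u i)) (thom n)"
      have cw: "cmap E E (%u i. 1 / \<delta> * u i)" by (intro cont_scale) auto
      have a: "relcycle n N0 ?V a" unfolding a_def
      proof (rule relcycle_chm_Int[OF rd])
        show "cmap E N0 (%u. g (%i. 1 / \<delta> * u i))" using cont_comp[OF cw cf(1)] by (simp add: o_def)
        show "(%u. g (%i. 1 / \<delta> * u i)) \<in> tops E Int {u. \<delta> < enorm n u} \<rightarrow> ?V"
        proof
          fix u assume u: "u \<in> tops E Int {u. \<delta> < enorm n u}"
          let ?w = "%i. 1 / \<delta> * u i"
          have w: "?w \<in> tops E" using funcset_mem[OF cont_fun[OF cw], of u] u by blast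
          have "1 < \<bar>1 / \<delta>\<bar> * enorm n u" using u \<delta>(1) by (simp add: field_simps)
          then have w1: "1 < enorm n ?w" by (simp only: enorm_scale)
          have "g ?w \<notin> U"
          proof
            assume "g ?w \<in> U"
            then obtain v where "g ?w = g v" "v \<in> ?B" unfolding U_def by (rule imageE)
            then have v: "v \<in> tops E" "enorm n v < 1" "g ?w = g v" by simp_all
            from arg_cong[OF v(3), of gi] have "?w = v" unfolding cf(4)[OF w] cf(4)[OF v(1)] .
            then show False using v(2) w1 by (simp only:)
          qed
          then show "g ?w \<in> ?V" using funcset_mem[OF cont_fun[OF cf(1)] w] by (rule DiffI[rotated])
        qed
      qed
      have ca: "schain n N0 a" using relcycle_chain[OF a] .
      have a_th: "homrel n N0 (off x) a (theta g)"
      proof -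
        let ?I = "ptop (I01) E"
        have "cmap ?I E (%z i. ((1 - fst z) * (1 / \<delta>) + fst z) * snd z i)"
          by (intro cont_scale cont_snd continuous_map_add continuous_map_real_mult cont_diff
              cont_cconst cont_01D[OF cont_fst])
        from cont_comp[OF this cf(1)]
        have c: "cmap ?I N0 (%z. g (%i. ((1 - fst z) * (1 / \<delta>) + fst z) * snd z i))" by (simp add: o_def)
        have "homrel n N0 (off x) (push (%u. g (%i. ((1 - fst (0::real, u)) * (1 / \<delta>) + fst (0, u)) * snd (0::real, u) i)) (thom n))
            (push (%u. g (%i. ((1 - fst (1::real, u)) * (1 / \<delta>) + fst (1, u)) * snd (1::real, u) i)) (thom n))"
        proof (rule homol_homotopy[OF relcycle_thom c])
          fix t u assume t: "0 \<le> t" "t \<le> (1::real)" and u: "u \<in> tops E" "u \<in> nz"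
          have "0 < (1 - t) * (1 / \<delta>) + t" using lerp_less[OF t, of 0 "1 / \<delta>" 0 1] \<delta>(1) by simp
          then have "(%i. ((1 - t) * (1 / \<delta>) + t) * u i) ~= zv" using u(2) by (intro posmult) auto
          moreover have "(%i. ((1 - t) * (1 / \<delta>) + t) * u i) \<in> tops E" using u(1) by (simp add: top_Euc)
          ultimately show "g (%i. ((1 - fst (t, u)) * (1 / \<delta>) + fst (t, u)) * snd (t, u) i) \<in> off x"
            using off_zv[OF g(1)] unfolding g(2) fst_conv snd_conv by blast
        qed
        then show ?thesis unfolding a_def by simp
      qed
      obtain s where "homrel n N0 (off x) (om x) (scal s (theta g))" using theta_generates[OF g(1), unfolded g(2), OF rel[OF x]] .
      from homol_trans[OF this homol_cmul[OF homol_sym[OF a_th]]]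
      have sa: "homrel n N0 (off x) (scal s a) (om x)" by (rule homol_sym)
      have sV: "relcycle n N0 ?V (scal s a)" by (rule relcycle_cmul[OF a])
      show ?thesis
      proof (intro bexI ballI)
        show "homset n N0 ?V (scal s a) \<in> carrier (local_homology_group n N0 U)"
          unfolding carrier_relative_homology_group using sV by (intro imageI CollectI)
        fix y assume y: "y \<in> U"
        obtain u where "y = g u" "u \<in> ?B" using y unfolding U_def by (rule imageE)
        then have u: "u \<in> tops E" "enorm n u < 1" "y = g u" by simp_all
        obtain H K where H: "isot H K" "H 1 x = y" and out: "!!t x. x \<notin> U ==> H t x = x"
          by (rule move[OF g(1) u(1,2), unfolded g(2) u(3)[symmetric], folded U_def]) (rule that)
        have Vy: "tops N0 Int ?V \<subseteq> off y" using y by blast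
        have cH: "cmap (ptop (I01) N0) N0 (%z. H (fst z) (snd z))" using H(1) by (simp add: isotopy_def)
        have "homrel n N0 (off y) (push (%x. H (fst (0::real, x)) (snd (0::real, x))) a) (push (%x. H (fst (1::real, x)) (snd (1::real, x))) a)"
          by (rule homol_homotopy[OF a cH]) (use out y in auto)
        moreover have "push (%x. H (fst (0::real, x)) (snd (0::real, x))) a = a"
          by (rule chm_id_gen[OF ca]) (use H(1) in \<open>simp add: isotopy_def\<close>)
        ultimately have "homrel n N0 (off y) a (push (H 1) a)" by simp
        from homol_cmul[OF this, of s]
        have "homrel n N0 (off y) (scal s a) (push (H 1) (scal s a))" by (simp only: chm_cmul)
        also have "homrel n N0 (off y) \<dots> (push (H 1) (om x))"
          using homol_chm[OF sa isot_facts(1)[OF H(1) x] isot_facts(6)[OF H(1) x]] unfolding H(2) .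
        also have "homrel n N0 (off y) \<dots> (om y)" using inv[OF x H(1)] unfolding H(2) .
        finally have fin: "homrel n N0 (off y) (scal s a) (om y)" .
        have "hom_induced (int n) N0 ?V N0 (off y) id (homset n N0 ?V (scal s a)) =
            homset n N0 (off y) (push id (scal s a))" by (rule hom_induced_chain_map_gen[OF cont_id _ sV]) (use Vy in auto)
        also have "push id (scal s a) = scal s a" by (rule chm_id_gen[OF relcycle_chain[OF sV]]) simp
        also have "homset n N0 (off y) (scal s a) = mu y" unfolding mu_def homologous_rel_set_eq by (rule fin)
        finally show "hom_induced (int n) N0 ?V N0 (off y) id (homset n N0 ?V (scal s a)) = mu y" .
      qed
    qed
    ultimately show "\<exists>U. openin N0 U & x \<in> U & (\<exists>\<alpha>\<in>carrier (local_homology_group n N0 U). \<forall>y\<in>U.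
           hom_induced (int n) N0 (tops N0 - U) N0 (off y) id \<alpha> = mu y)" by blast
  qed
  then show ?thesis unfolding orientable_manifold_def N0 by blast
qed

end

section \<open>Surjectivity of the transfer\<close>

lemma puncture_exists:
  assumes H: "Hausdorff_space M" and ch: "ball_chart (Suc b) M g gi" and q: "g zv = q"
  defines "nu == %x. if x \<in> g ` tops (Euc (Suc b)) then min 1 (enorm (Suc b) (gi x)) else 1"
  shows "puncture b M q g gi nu"
proof -
  let ?n = "Suc b"
  let ?E = "Euc ?n"
  let ?U = "g ` tops ?E" and ?C = "g ` {u \<in> tops ?E. enorm ?n u \<le> 1}"
  have g: "cmap ?E M g" "openin M ?U" "cmap (subtop M ?U) ?E gi" "!!u. u \<in> tops ?E ==> gi (g u) = u"
    using ch by (auto simp: ball_chart_def)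
  have cl: "closedin M ?C" by (rule compactin_imp_closedin[OF H image_compactin[OF compactin_unit_ball g(1)]])
  have out: "min 1 (enorm ?n (gi x)) = 1" if x: "x \<in> ?U" "x \<notin> ?C" for x
  proof -
    obtain u where u: "u \<in> tops ?E" "x = g u" using x(1) by blast
    then have "1 \<le> enorm ?n u" using x(2) by force
    then show ?thesis using u g(4) by simp
  qed
  have cont: "cmap M Rtop nu"
  proof (rule pasting_lemma[where I = "{True, False}" and T = "%c. if c then ?U else tops M - ?C"
        and f = "%c x. if c then min 1 (enorm ?n (gi x)) else 1"])
    fix c :: bool
    show "openin M (if c then ?U else tops M - ?C)" using g(2) cl by auto
    show "cmap (subtop M (if c then ?U else tops M - ?C)) Rtop (%x. if c then min 1 (enorm ?n (gi x)) else 1)"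
      using continuous_map_real_min[OF cont_cconst[of _ 1] cont_enorm[OF g(3)]] by (cases c) simp_all
  next
    fix c d :: bool and x
    assume "x \<in> tops M Int (if c then ?U else tops M - ?C) Int (if d then ?U else tops M - ?C)"
    then show "(if c then min 1 (enorm ?n (gi x)) else 1) = (if d then min 1 (enorm ?n (gi x)) else 1)" using out by (cases c; cases d) auto
  next
    fix x assume "x \<in> tops M"
    then show "\<exists>c. c \<in> {True, False} & x \<in> (if c then ?U else tops M - ?C) & nu x = (if c then min 1 (enorm ?n (gi x)) else 1)"
      by (intro exI[of _ "x \<in> ?U"]) (auto simp: nu_def image_iff)
  qed
  have z: "zv \<in> tops ?E" by (simp add: top_Euc)
  show ?thesis
  proof
    show "nu (g u) = min 1 (enorm ?n u)" if "u \<in> tops ?E" for u using that g(4) by (simp add: nu_def)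
    show "nu x = 0 \<longleftrightarrow> x = q" for x
    proof (cases "x \<in> ?U")
      case True
      then obtain u where u: "u \<in> tops ?E" "x = g u" by blast
      have "g u = g zv \<longleftrightarrow> u = zv" using g(4)[OF u(1)] g(4)[OF z] by metis
      moreover have "min 1 (enorm ?n u) = 0 \<longleftrightarrow> u = zv"
        using enorm_pos_iff[OF u(1)] enorm_nonneg[of ?n u] by (auto simp: min_def)
      ultimately show ?thesis using u q g(4) by (simp add: nu_def)
    next
      case False
      then show ?thesis using q z by (auto simp: nu_def)
    qed
    show "0 \<le> nu x" for x using enorm_nonneg by (simp add: nu_def)
    show "x \<in> ?U" if "nu x < 1" for x using that by (auto simp: nu_def split: if_splits)
  qed (use g q cont in auto)
qed

lemma conf_isotopy:
  assumes H: "isotopy M H K" and x: "relcycle p (conf k M) {} x"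
  shows "hq p (conf k M) {} (chm p (conf_map (H 1) k) x) x"
proof -
  let ?I = "ptop (I01) (conf k M)"
  have inv: "K t (H t y) = y" if "t \<in> {0..1}" "y \<in> tops M" for t y using H that by (simp add: isotopy_def)
  have cH: "cmap (ptop (I01) M) M (%z. H (fst z) (snd z))" and H0: "!!x. x \<in> tops M ==> H 0 x = x"
    using H by (simp_all add: isotopy_def)
  have "hq p (conf k M) {} (chm p (%x. x) x) (chm p (conf_map (H 1) k) x)"
  proof (rule hq_homotopy[OF x, of _ "%z. conf_map (H (fst z)) k (snd z)"])
    show "cmap ?I (conf k M) (%z. conf_map (H (fst z)) k (snd z))"
    proof (rule cont_confI)
      fix j assume j: "j < k"
      have "cmap ?I (ptop (I01) M) (%z. (fst z, snd z j))" by (intro cont_pairedI cont_fst cont_confD[OF cont_snd j])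
      from cont_comp[OF this cH]
      show "cmap ?I M (%z. conf_map (H (fst z)) k (snd z) j)" using j by (simp add: o_def conf_map_def)
    next
      fix z assume z: "z \<in> tops ?I"
      show "inj_on (conf_map (H (fst z)) k (snd z)) {..<k}"
      proof (rule inj_onI)
        fix i j assume "i \<in> {..<k}" "j \<in> {..<k}" "conf_map (H (fst z)) k (snd z) i = conf_map (H (fst z)) k (snd z) j"
        then have "H (fst z) (snd z i) = H (fst z) (snd z j)" by (simp add: conf_map_def)
        moreover have "fst z \<in> {0..1}" "snd z i \<in> tops M" "snd z j \<in> tops M"
          using z \<open>i \<in> _\<close> \<open>j \<in> _\<close> by (auto simp: conf_top)
        ultimately have "snd z i = snd z j" using inv by metis
        then show "i = j" using z \<open>i \<in> _\<close> \<open>j \<in> _\<close> by (auto simp: conf_top inj_on_def)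
      qed
    qed (simp add: conf_map_def)
    fix y assume y: "y \<in> tops (conf k M)"
    show "conf_map (H (fst (0, y))) k (snd (0, y)) = y"
    proof (rule extensionalityI[of _ "{..<k}"])
      show "conf_map (H (fst (0, y))) k (snd (0, y)) j = y j" if "j \<in> {..<k}" for j using H0 y that by (simp add: conf_map_def conf_top)
    qed (use y in \<open>simp_all add: conf_map_def conf_top\<close>)
  qed simp_all
  moreover have "chm p (%x. x) x = x" by (rule chm_id_gen[OF relcycle_chain[OF x]]) simp
  ultimately show ?thesis using hq_sym by simp
qed

theorem transfer_onto:
  assumes H: "Hausdorff_space M" and no: "~ orientable_manifold n M"
    and x: "relcycle p (conf (Suc k) M) {} x"
  shows "\<exists>x' C. C ~= 0 & relcycle p (conf (Suc (Suc k)) M) {} x' &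
    rnull p (conf (Suc k) M) {} (Sym p (Suc k) (scal C x - tau p (Suc k) x'))"
proof -
  define N0 where "N0 = subtop M (manifold_interior n M)"
  interpret T: transport n M N0 by unfold_locales (use H in \<open>simp_all add: N0_def\<close>)
  obtain g gi F K where g: "ball_chart n M g gi" "ball_chart n N0 g gi" and F: "isotopy M F K" "isotopy N0 F K" "F 1 (g zv) = g zv"
    and rev: "homrel n N0 (tops N0 - {g zv}) (chm n (F 1) (chm n g (thom n))) (- chm n g (thom n))" using T.orientable no by blast
  let ?q = "g zv" and ?th = "chm n g (thom n)"
  have phi: "cmap M M (F 1)" "inj_on (F 1) (tops M)"
    using isotopy_at(1)[OF F(1), of 1] F(1) by (auto simp: isotopy_def intro: inj_on_inverseI[where g = "K 1"])
  have rn: "rnull n N0 (tops N0 - {?q}) (chm n (F 1) ?th + ?th)" using hq_homol[OF rev] by simp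
  have "rnull n M {x. x ~= ?q} (chm n (%x. x) (chm n (F 1) ?th + ?th))" by (rule rnull_chm[OF rn]) (auto simp: N0_def cont_from_sub)
  moreover have "chm n (%x. x) (chm n (F 1) ?th + ?th) = chm n (F 1) ?th + ?th" by (rule chm_id_gen[OF rnull_imp_chain[OF rn]]) simp
  ultimately have rM: "rnull n M {x. x ~= ?q} (chm n (F 1) ?th + ?th)" by simp
  have q: "?q \<in> tops M" using T.chart_facts(5)[of g gi] g by (simp add: N0_def)
  have "n ~= 0"
  proof
    assume n: "n = 0"
    have z: "tops (Euc n) = {zv}" using n by (auto simp: top_Euc)
    have "chm n (F 1) ?th = ?th" unfolding chm_comp by (rule chm_eq[OF relcycle_chain[OF relcycle_thom]]) (simp add: z F(3))
    moreover have "?th + ?th = scal 2 ?th" by (intro poly_mapping_eqI) (simp add: lookup_add)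
    ultimately show False using T.theta_nontorsion[of g gi 2] g rn by simp
  qed
  then obtain b where b: "n = Suc b" using not0_implies_Suc by blast
  interpret P: puncture b M ?q g gi "%x. if x \<in> g ` tops (Euc (Suc b)) then min 1 (enorm (Suc b) (gi x)) else 1"
    by (rule puncture_exists[OF H]) (use g b in simp_all)
  show ?thesis by (rule P.tau_onto[OF phi F(3) q conf_isotopy[OF F(1)] P.Tt_reverse[OF phi F(3) rM[unfolded b]] x])
qed

section \<open>Lifting chains to ordered configurations\<close>

abbreviation "uconf == unordered_configuration_space"
abbreviation "orb == configuration_orbit"

lemma orb_perm: "\<sigma> permutes {..<k} ==> orb k (x \<circ> \<sigma>) = orb k x"
proof -
  assume s: "\<sigma> permutes {..<k}"
  have "x \<circ> \<sigma> \<circ> \<tau> = x \<circ> (\<sigma> \<circ> \<tau>)" "x \<circ> \<tau> = x \<circ> \<sigma> \<circ> (inv_into UNIV \<sigma> \<circ> \<tau>)" for \<tau>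
    using permutes_inv_o[OF s] by (simp_all add: o_assoc fun.map_comp) (metis comp_assoc comp_id)
  then show ?thesis unfolding configuration_orbit_def using permutes_compose[OF _ s] permutes_compose[OF _ permutes_inv[OF s]] by blast
qed

lemma orb_eq: "orb k x = orb k y \<longleftrightarrow> (\<exists>\<sigma>\<in>perms k. y = x \<circ> \<sigma>)"
proof
  assume eq: "orb k x = orb k y"
  have "y \<in> orb k y" unfolding configuration_orbit_def using permutes_id[of "{..<k}"] by (metis (mono_tags, lifting) comp_id mem_Collect_eq)
  then show "\<exists>\<sigma>\<in>perms k. y = x \<circ> \<sigma>" unfolding eq[symmetric] by (auto simp: configuration_orbit_def)
qed (auto simp: orb_perm)

lemma cm_orb: "cmap (conf k M) (uconf k M) (orb k)"
  unfolding unordered_configuration_space_def by (rule quotient_imp_continuous_map[OF quotient_map_quotient_topology])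

lemma perm_top: "\<sigma> permutes {..<k} ==> x \<in> tops (conf k M) ==> x \<circ> \<sigma> \<in> tops (conf k M)"
  using funcset_mem[OF cont_fun[OF cm_perm]] .

lemma orb_open:
  assumes W: "openin (conf k M) W" shows "openin (uconf k M) (orb k ` W)"
proof -
  have "{x \<in> tops (conf k M). orb k x \<in> orb k ` W} = (\<Union>\<sigma>\<in>perms k. {x \<in> tops (conf k M). x \<circ> \<sigma> \<in> W})"
    by (auto simp: image_iff orb_eq)
  moreover have "openin (conf k M) \<dots>" using openin_preim[OF cm_perm W] by auto
  moreover have "W \<subseteq> tops (conf k M)" using openin_subset[OF W] .
  ultimately show ?thesis unfolding unordered_configuration_space_def openin_quotient_topology by auto
qed

lemma perm_free:
  assumes x: "x \<in> tops (conf k M)" and s: "\<sigma> permutes {..<k}" and eq: "x \<circ> \<sigma> = x"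
  shows "\<sigma> = id"
proof
  fix i
  show "\<sigma> i = id i"
  proof (cases "i < k")
    case True
    then have "x (\<sigma> i) = x i" "\<sigma> i < k" using fun_cong[OF eq, of i] permutes_in_image[OF s, of i] by simp_all
    then show ?thesis using x True by (auto simp: conf_top inj_on_def)
  qed (use permutes_not_in[OF s, of i] in simp)
qed

lemma Hausdorff_conf: "Hausdorff_space M ==> Hausdorff_space (conf k M)"
  unfolding ordered_configuration_space_def by (simp add: Hausdorff_space_subtopology Hausdorff_space_product_topology)

lemma local_section:
  assumes H: "Hausdorff_space M" and z: "z \<in> tops (uconf k M)"
  obtains U s where "openin (uconf k M) U" "z \<in> U" "cmap (subtop (uconf k M) U) (conf k M) s" "!!c. c \<in> U ==> orb k (s c) = c"
proof -
  let ?X = "conf k M"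
  obtain x where x: "x \<in> tops ?X" "z = orb k x" using z by (auto simp: unordered_configuration_space_def)
  have "\<exists>V. openin ?X V & x \<in> V & (\<forall>y\<in>V. y \<circ> \<sigma> \<notin> V)" if s: "\<sigma> \<in> perms k - {id}" for \<sigma>
  proof -
    have "x \<circ> \<sigma> ~= x" using perm_free[OF x(1)] s by blast
    moreover have "x \<circ> \<sigma> \<in> tops ?X" using perm_top x(1) s by blast
    ultimately obtain A B where AB: "openin ?X A" "openin ?X B" "x \<in> A" "x \<circ> \<sigma> \<in> B" "disjnt A B"
      using Hausdorff_conf[OF H] x(1) unfolding Hausdorff_space_def by metis
    have "openin ?X {y \<in> tops ?X. y \<circ> \<sigma> \<in> B}" using openin_preim[OF cm_perm AB(2)] s by blast
    from openin_Int[OF AB(1) this] show ?thesis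
      by (intro exI[of _ "A Int {y \<in> tops ?X. y \<circ> \<sigma> \<in> B}"]) (use AB x(1) in \<open>auto simp: disjnt_iff\<close>)
  qed
  then obtain V where V: "!!\<sigma>. \<sigma> \<in> perms k - {id} ==> openin ?X (V \<sigma>) & x \<in> V \<sigma> & (\<forall>y\<in>V \<sigma>. y \<circ> \<sigma> \<notin> V \<sigma>)" by metis
  define W where "W = (\<Inter>\<sigma>\<in>perms k - {id}. V \<sigma>) Int tops ?X"
  have W: "openin ?X W" unfolding W_def by (rule openin_INT) (use V in auto)
  have xW: "x \<in> W" using x(1) V by (auto simp: W_def)
  have inj: "y = y'" if yy: "y \<in> W" "y' \<in> W" "orb k y = orb k y'" for y y'
  proof -
    obtain \<sigma> where s: "\<sigma> \<in> perms k" "y' = y \<circ> \<sigma>" using yy(3) by (auto simp: orb_eq)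
    show ?thesis
    proof (cases "\<sigma> = id")
      case False
      then have "y \<in> V \<sigma>" "y \<circ> \<sigma> \<in> V \<sigma>" using yy s by (auto simp: W_def)
      then show ?thesis using V[of \<sigma>] s(1) False by blast
    qed (simp add: s(2))
  qed
  define s where "s c = (THE y. y \<in> W & orb k y = c)" for c
  have s_orb: "s (orb k y) = y" if "y \<in> W" for y unfolding s_def by (rule the_equality) (use that inj in auto)
  have oW: "openin (uconf k M) (orb k ` W)" by (rule orb_open[OF W])
  show thesis
  proof (rule that[of "orb k ` W" s])
    show "openin (uconf k M) (orb k ` W)" "z \<in> orb k ` W" using oW xW x(2) by auto
    show "orb k (s c) = c" if "c \<in> orb k ` W" for c using that s_orb by auto
    have top: "tops (subtop (uconf k M) (orb k ` W)) = orb k ` W" using openin_subset[OF oW] by auto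
    show "cmap (subtop (uconf k M) (orb k ` W)) ?X s" unfolding cmap top
    proof (intro conjI allI impI)
      show "s ` orb k ` W \<subseteq> tops ?X" using s_orb openin_subset[OF W] by auto
      fix O' assume O: "openin ?X O'"
      have "{c \<in> orb k ` W. s c \<in> O'} = orb k ` W Int orb k ` (W Int O')" using s_orb by auto
      then show "openin (subtop (uconf k M) (orb k ` W)) {c \<in> orb k ` W. s c \<in> O'}"
        using orb_open[OF openin_Int[OF W O]] by (auto simp: openin_subtopology_Int2)
    qed
  qed
qed

lemma lift_unique:
  assumes H: "Hausdorff_space M" and f: "ssimp p (conf k M) f" and g: "ssimp p (conf k M) g"
    and eq: "smap p (orb k) f = smap p (orb k) g"
  obtains \<sigma> where "\<sigma> permutes {..<k}" "g = smap p (%x. x \<circ> \<sigma>) f"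
proof -
  let ?T = "subtop (powertop_real UNIV) (stdsimp p)" and ?X = "conf k M"
  have top: "tops ?T = stdsimp p" by simp
  have fc: "cmap ?T ?X f" and gc: "cmap ?T ?X g" using f g by (simp_all add: ssimplex_def)
  define D where "D \<sigma> = {x \<in> tops ?T. f x \<circ> \<sigma> = g x}" for \<sigma>
  have cl: "closedin ?T (D \<sigma>)" if "\<sigma> \<in> perms k" for \<sigma> unfolding D_def
    by (rule closedin_continuous_maps_eq[OF Hausdorff_conf[OF H] _ gc])
      (use cont_comp[OF fc cm_perm[of \<sigma> k M]] that in \<open>simp add: o_def[of "%x. x \<circ> \<sigma>"]\<close>)
  have cover: "\<exists>\<sigma>\<in>perms k. x \<in> D \<sigma>" if x: "x \<in> stdsimp p" for x
  proof -
    have "orb k (f x) = orb k (g x)" using fun_cong[OF eq, of x] x by (simp add: simplex_map_def)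
    then show ?thesis using x by (auto simp: orb_eq D_def)
  qed
  have disj: "\<sigma> = \<tau>" if "x \<in> D \<sigma>" "x \<in> D \<tau>" "\<sigma> \<in> perms k" "\<tau> \<in> perms k" for x \<sigma> \<tau>
  proof -
    have fx: "f x \<in> tops ?X" using funcset_mem[OF cont_fun[OF fc]] that(1) by (auto simp: D_def)
    have "f x \<circ> \<sigma> = f x \<circ> \<tau>" using that by (simp add: D_def)
    then have "f x \<circ> (\<sigma> \<circ> inv_into UNIV \<tau>) = f x" using permutes_inv_o(1)[of \<tau> "{..<k}"] that(4) by (simp add: o_assoc) (metis comp_assoc comp_id)
    then have "\<sigma> \<circ> inv_into UNIV \<tau> = id" using perm_free[OF fx] permutes_compose[OF permutes_inv] that(3,4) by blast
    then show ?thesis using permutes_inv_o(2)[of \<tau> "{..<k}"] that(4) by (metis comp_assoc comp_id id_comp mem_Collect_eq)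
  qed
  obtain x0 where x0: "x0 \<in> stdsimp p" using nonempty_standard_simplex by blast
  obtain \<sigma> where s: "\<sigma> \<in> perms k" "x0 \<in> D \<sigma>" using cover[OF x0] by blast
  have "tops ?T - D \<sigma> = (\<Union>\<tau>\<in>perms k - {\<sigma>}. D \<tau>)"
  proof
    show "tops ?T - D \<sigma> \<subseteq> (\<Union>\<tau>\<in>perms k - {\<sigma>}. D \<tau>)" using cover by fastforce
    show "(\<Union>\<tau>\<in>perms k - {\<sigma>}. D \<tau>) \<subseteq> tops ?T - D \<sigma>" using disj s(1) by (auto simp: D_def)
  qed
  moreover have "closedin ?T (\<Union>\<tau>\<in>perms k - {\<sigma>}. D \<tau>)" by (rule closedin_Union) (use cl in auto)
  ultimately have "openin ?T (D \<sigma>)" using openin_closedin_eq[of ?T "D \<sigma>"] by (auto simp: D_def)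
  moreover have "connected_space ?T"
    using path_connectedin_imp_connectedin[OF path_connectedin_standard_simplex, of p] by (simp add: connectedin_def)
  ultimately have D: "D \<sigma> = stdsimp p" using cl[OF s(1)] s(2) top unfolding connected_space_clopen_in by blast
  have "g = smap p (%x. x \<circ> \<sigma>) f"
  proof (rule extensionalityI[of _ "stdsimp p"])
    show "g \<in> extensional (stdsimp p)" using g by (simp add: ssimplex_def)
    show "g x = smap p (%x. x \<circ> \<sigma>) f x" if x: "x \<in> stdsimp p" for x
    proof -
      have "x \<in> D \<sigma>" using x D by simp
      then show ?thesis using x by (simp add: D_def simplex_map_def)
    qed
  qed (simp add: simplex_map_def)
  then show thesis using that[of \<sigma>] s(1) by simp
qed

text \<open>A chain of the orbit space determines the symmetrisation of its lifts.\<close>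

lemma Sym_lift_unique:
  assumes H: "Hausdorff_space M" and x: "schain p (conf k M) x" and y: "schain p (conf k M) y"
    and eq: "chm p (orb k) x = chm p (orb k) y"
  shows "Sym p k x = Sym p k y"
proof -
  define h where "h f = (SOME h. ssimp p (conf k M) h & smap p (orb k) h = f)" for f
  have "frag_extend (%f. Sym p k (frag_of (h f))) (chm p (orb k) x) = Sym p k x" if "schain p (conf k M) x" for x
    using that unfolding schain_def
  proof (induction rule: frag_induction)
    case (one f)
    then have f: "ssimp p (conf k M) f" by simp
    have "ssimp p (conf k M) (h (smap p (orb k) f)) & smap p (orb k) (h (smap p (orb k) f)) = smap p (orb k) f"
      unfolding h_def by (rule someI[of _ f]) (simp add: f)
    then obtain \<sigma> where s: "\<sigma> permutes {..<k}" "h (smap p (orb k) f) = smap p (%x. x \<circ> \<sigma>) f"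
      using lift_unique[OF H f, of "h (smap p (orb k) f)"] by metis
    have "Sym p k (frag_of (smap p (%x. x \<circ> \<sigma>) f)) = Sym p k (frag_of f)"
      using Sym_perm[OF s(1), of p "frag_of f"] by (simp add: chain_map_of)
    then show ?case by (simp add: chain_map_of s(2))
  qed (simp_all add: chm_diff frag_extend_diff Sym_diff)
  from this[OF x] this[OF y] show ?thesis using eq by simp
qed

lemma subdivision_power:
  assumes "schain p X c"
  shows "schain p X ((sd p ^^ N) c)"
    "bdry p ((sd p ^^ N) c) = (sd (p - Suc 0) ^^ N) (bdry p c)"
    "(sd p ^^ N) (chm p f c) = chm p f ((sd p ^^ N) c)"
proof -
  have "schain p X ((sd p ^^ N) c) &
    bdry p ((sd p ^^ N) c) = (sd (p - Suc 0) ^^ N) (bdry p c) &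
    (sd p ^^ N) (chm p f c) = chm p f ((sd p ^^ N) c)" using assms
    by (induction N) (simp_all add: singular_chain_singular_subdivision chain_boundary_singular_subdivision[of p X] naturality_singular_subdivision[of p X])
  then show "schain p X ((sd p ^^ N) c)"
    "bdry p ((sd p ^^ N) c) = (sd (p - Suc 0) ^^ N) (bdry p c)"
    "(sd p ^^ N) (chm p f c) = chm p f ((sd p ^^ N) c)" by blast+
qed

lemma subdivision_power_homol:
  "relcycle p X S c ==> homrel p X S ((sd p ^^ N) c) c"
proof (induction N)
  case (Suc N)
  then have "homrel p X S ((sd p ^^ N) c) c" by simp
  moreover have "relcycle p X S ((sd p ^^ N) c)" using homologous_rel_singular_relcycle[OF calculation] Suc.prems by simp
  ultimately show ?case using homol_trans[OF homologous_rel_singular_subdivision] by simp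
qed simp

lemma lift_subdivision:
  assumes H: "Hausdorff_space M" and c: "schain p (uconf k M) c"
  obtains N x where "schain p (conf k M) x" "(sd p ^^ N) c = chm p (orb k) x"
proof -
  let ?C = "uconf k M" and ?X = "conf k M"
  define V where "V = {U. openin ?C U & (\<exists>s. cmap (subtop ?C U) ?X s & (\<forall>c\<in>U. orb k (s c) = c))}"
  have cov: "tops ?C \<subseteq> \<Union>V"
  proof
    fix z assume z: "z \<in> tops ?C"
    show "z \<in> \<Union>V" unfolding V_def by (rule local_section[OF H z]) blast
  qed
  have op: "U \<in> V ==> openin ?C U" for U by (simp add: V_def)
  have "\<exists>N. \<forall>m f. N \<le> m --> f \<in> keys ((sd p ^^ m) c) --> (\<exists>U\<in>V. f \<in> stdsimp p \<rightarrow> U)"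
    by (rule sufficient_iterated_singular_subdivision_exists[of V ?C p c, OF _ cov c]) (use op in blast)+
  then obtain N where N0: "\<forall>m f. N \<le> m --> f \<in> keys ((sd p ^^ m) c) --> (\<exists>U\<in>V. f \<in> stdsimp p \<rightarrow> U)"
    by (rule exE)
  note N = N0[THEN spec, THEN spec, THEN mp, OF order_refl, THEN mp]
  let ?c = "(sd p ^^ N) c"
  have "\<exists>h. ssimp p ?X h & smap p (orb k) h = f" if f: "f \<in> keys ?c" for f
  proof -
    obtain U where U0: "U \<in> V" and U1: "f \<in> stdsimp p \<rightarrow> U" using N[OF f] by (rule bexE)
    obtain s where "cmap (subtop ?C U) ?X s" "\<forall>c\<in>U. orb k (s c) = c" using U0 unfolding V_def by blast
    then have U: "f \<in> stdsimp p \<rightarrow> U" "cmap (subtop ?C U) ?X s" "!!c. c \<in> U ==> orb k (s c) = c" using U1 by simp_all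
    have "ssimp p ?C f" using subdivision_power(1)[OF c, of N] f unfolding schain_def by blast
    moreover have "f ` stdsimp p \<subseteq> U" using U(1) by blast
    ultimately have fU: "ssimp p (subtop ?C U) f" by (simp add: singular_simplex_subtopology)
    have "smap p (orb k) (smap p s f) = f"
    proof (rule extensionalityI[of _ "stdsimp p"])
      show "smap p (orb k) (smap p s f) x = f x" if "x \<in> stdsimp p" for x using that U(1,3) by (auto simp: simplex_map_def)
    qed (use fU in \<open>simp_all add: simplex_map_def ssimplex_def\<close>)
    then show ?thesis using singular_simplex_simplex_map[OF fU U(2)] by blast
  qed
  then obtain h where h: "!!f. f \<in> keys ?c ==> ssimp p ?X (h f) & smap p (orb k) (h f) = f" by metis
  show thesis
  proof (rule that)
    show "schain p ?X (frag_extend (frag_of \<circ> h) ?c)" by (rule singular_chain_extend) (simp add: h singular_chain_of)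
    have "chm p (orb k) (frag_extend (frag_of \<circ> h) ?c) = frag_extend ((frag_of \<circ> smap p (orb k)) \<circ> h) ?c"
      unfolding chain_map_def by (rule frag_extend_compose)
    also have "\<dots> = frag_extend frag_of ?c" by (rule frag_extend_eq) (simp add: h)
    also have "\<dots> = ?c" by (rule frag_expansion[symmetric])
    finally show "?c = chm p (orb k) (frag_extend (frag_of \<circ> h) ?c)" by (rule sym)
  qed
qed

lemma Sym_orb: "chm p (orb k) (Sym p k x) = scal (fact k) (chm p (orb k) x)"
proof -
  have "chm p (orb k) (Sym p k x) = (\<Sum>\<sigma>\<in>perms k. chm p (orb k) x)"
    unfolding Sym_def chm_sum' chm_comp by (intro sum.cong) (simp_all add: orb_perm)
  then show ?thesis by (simp add: scal_card)
qed

lemma lift_cycle: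
  assumes H: "Hausdorff_space M" and c: "relcycle p (uconf k M) {} c"
  obtains x where "relcycle p (conf k M) {} x" "hq p (uconf k M) {} (scal (fact k) c) (chm p (orb k) x)"
proof -
  obtain N x where x: "schain p (conf k M) x" "(sd p ^^ N) c = chm p (orb k) x" using lift_subdivision[OF H relcycle_chain[OF c]] by blast
  have hom: "homrel p (uconf k M) {} (chm p (orb k) x) c" using subdivision_power_homol[OF c, of N] unfolding x(2) .
  then have "bdry p (chm p (orb k) x) = 0" using homologous_rel_singular_relcycle[OF hom] c by (simp add: scycle)
  then have "chm (p - 1) (orb k) (bdry p x) = chm (p - 1) (orb k) 0" using bdry_chm[OF x(1), of "orb k"] by simp
  then have "Sym (p - 1) k (bdry p x) = 0" using Sym_lift_unique[OF H sbdry[OF x(1)] singular_chain_0] by simp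
  then have "bdry p (Sym p k x) = 0" using bdry_Sym[OF x(1)] by simp
  moreover have "schain p (conf k M) (Sym p k x)" unfolding Sym_def by (rule singular_chain_sum) (use schain_chm[OF x(1) cm_perm] in auto)
  ultimately have "relcycle p (conf k M) {} (Sym p k x)" by (simp add: scycle)
  moreover have "hq p (uconf k M) {} (scal (fact k) c) (chm p (orb k) (Sym p k x))"
    unfolding Sym_orb by (rule hq_cmul[OF hq_homol[OF homol_sym[OF hom]]])
  ultimately show thesis by (rule that)
qed

lemma Sym_null_of_orb:
  assumes H: "Hausdorff_space M" and x: "relcycle p (conf k M) {} x"
    and null: "rnull p (uconf k M) {} (chm p (orb k) x)"
  shows "rnull p (conf k M) {} (Sym p k x)"
proof -
  obtain m d where m: "m ~= 0" and d: "schain (Suc p) (uconf k M) d" "scal m (chm p (orb k) x) = bdry (Suc p) d"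
    using null unfolding rnull_empty_iff by blast
  have mx: "relcycle p (conf k M) {} (scal m x)" by (rule relcycle_cmul[OF x])
  obtain N y where y: "schain (Suc p) (conf k M) y" "(sd (Suc p) ^^ N) d = chm (Suc p) (orb k) y" using lift_subdivision[OF H d(1)] by blast
  let ?x = "(sd p ^^ N) (scal m x)"
  have cx: "schain p (conf k M) ?x" by (rule subdivision_power(1)[OF relcycle_chain[OF mx]])
  have "chm p (orb k) ?x = (sd p ^^ N) (chm p (orb k) (scal m x))" by (rule subdivision_power(3)[OF relcycle_chain[OF mx], symmetric])
  also have "\<dots> = (sd p ^^ N) (bdry (Suc p) d)" by (simp only: chm_cmul d(2))
  also have "\<dots> = bdry (Suc p) (chm (Suc p) (orb k) y)" unfolding y(2)[symmetric] using subdivision_power(2)[OF d(1), of N] by simp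
  also have "\<dots> = chm p (orb k) (bdry (Suc p) y)" using bdry_chm[OF y(1), of "orb k"] by simp
  finally have "Sym p k ?x = Sym p k (bdry (Suc p) y)" using Sym_lift_unique[OF H cx] sbdry[OF y(1)] by simp
  then have "rnull p (conf k M) {} (Sym p k ?x)" using rnull_Sym[OF rnull_boundary[OF y(1), of "{}"] cm_perm] by simp
  moreover have "hq p (conf k M) {} (Sym p k ?x) (Sym p k (scal m x))" unfolding Sym_diff[symmetric]
    by (rule rnull_Sym[OF hq_homol[OF subdivision_power_homol[OF mx]]]) (use cm_perm in auto)
  ultimately have "rnull p (conf k M) {} (scal m (Sym p k x))" using hq_rnull[OF hq_sym] by (simp only: Sym_cmul)
  then show ?thesis using m rnull_cancel by blast
qed

section \<open>Comparing Betti numbers by integral chains\<close>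

abbreviation "rchain == Poly_Mapping.map rat_of_int"
abbreviation "rscale r == Poly_Mapping.map ((*) (r :: rat))"

lemma rbdries_closed:
  shows "0 \<in> rbdries p X"
    and "w \<in> rbdries p X ==> w' \<in> rbdries p X ==> w + w' \<in> rbdries p X"
    and "w \<in> rbdries p X ==> rscale r w \<in> rbdries p X"
proof -
  interpret C: vectorspace class_ring "rchains (Suc p) X" by (rule vectorspace_rational_chains)
  have add: "c + d \<in> carrier (rchains (Suc p) X)" if "c \<in> carrier (rchains (Suc p) X)" "d \<in> carrier (rchains (Suc p) X)" for c d
    using C.module.M.a_closed[OF that] by (simp add: rational_chains_def)
  have sc: "rscale r c \<in> carrier (rchains (Suc p) X)" if "c \<in> carrier (rchains (Suc p) X)" for c r
    using C.module.smult_closed[OF _ that, of r] by (simp add: rational_chains_def)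
  show "0 \<in> rbdries p X" unfolding rational_boundaries_def by (intro image_eqI[of _ _ 0]) (simp_all add: rational_chains_def)
  show "w + w' \<in> rbdries p X" if "w \<in> rbdries p X" "w' \<in> rbdries p X"
    using that add unfolding rational_boundaries_def by (auto simp flip: rational_boundary_add)
  show "rscale r w \<in> rbdries p X" if "w \<in> rbdries p X"
    using that sc unfolding rational_boundaries_def by (auto simp flip: rational_boundary_smult)
qed

definition hcls :: "nat => 'a topology => 'a rational_chain => 'a rational_chain set" where
  "hcls p X z = (%w. w + z) ` rbdries p X"

lemma hcls_coset: "hcls p X z = rbdries p X +>\<^bsub>rcycles p X\<^esub> z"
  by (auto simp: hcls_def a_r_coset_def r_coset_def rational_cycles_def rational_chains_def)

lemma carrier_homology: "carrier (rhom p X) = hcls p X ` carrier (rcycles p X)"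
  by (auto simp: rational_homology_def quotient_module_def A_RCOSETS_def RCOSETS_def hcls_coset a_r_coset_def)

lemma hcls_add: "hcls p X u \<oplus>\<^bsub>rhom p X\<^esub> hcls p X v = hcls p X (u + v)"
proof -
  have "hcls p X u \<oplus>\<^bsub>rhom p X\<^esub> hcls p X v = (\<Union>a\<in>hcls p X u. \<Union>b\<in>hcls p X v. {a + b})"
    by (simp add: rational_homology_def quotient_module_def set_add_def set_mult_def rational_cycles_def rational_chains_def)
  also have "\<dots> = hcls p X (u + v)"
  proof
    show "(\<Union>a\<in>hcls p X u. \<Union>b\<in>hcls p X v. {a + b}) \<subseteq> hcls p X (u + v)"
    proof clarsimp
      fix a b assume "a \<in> hcls p X u" "b \<in> hcls p X v"
      then obtain w w' where w: "w \<in> rbdries p X" "w' \<in> rbdries p X" "a = w + u" "b = w' + v" by (auto simp: hcls_def)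
      have "a + b = (w + w') + (u + v)" by (simp add: w algebra_simps)
      then show "a + b \<in> hcls p X (u + v)" using rbdries_closed(2)[OF w(1,2)] unfolding hcls_def by blast
    qed
    show "hcls p X (u + v) \<subseteq> (\<Union>a\<in>hcls p X u. \<Union>b\<in>hcls p X v. {a + b})"
    proof
      fix c assume "c \<in> hcls p X (u + v)"
      then obtain w where w: "w \<in> rbdries p X" "c = w + (u + v)" by (auto simp: hcls_def)
      have wv: "w + u \<in> hcls p X u" "v \<in> hcls p X v"
        using w(1) rbdries_closed(1)[of p X] by (auto simp: hcls_def image_iff intro: bexI[of _ 0])
      then show "c \<in> (\<Union>a\<in>hcls p X u. \<Union>b\<in>hcls p X v. {a + b})" by (intro UN_I[OF wv(1)] UN_I[OF wv(2)]) (simp add: w(2) add.assoc)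
    qed
  qed
  finally show ?thesis .
qed

lemma hcls_scale: "r \<odot>\<^bsub>rhom p X\<^esub> hcls p X z = hcls p X (rscale r z)"
proof -
  have "r \<odot>\<^bsub>rhom p X\<^esub> hcls p X z = (\<Union>a\<in>hcls p X z. hcls p X (rscale r a))"
    by (simp add: rational_homology_def quotient_module_def hcls_coset) (simp add: rational_cycles_def rational_chains_def)
  also have "\<dots> = hcls p X (rscale r z)"
  proof
    show "hcls p X (rscale r z) \<subseteq> (\<Union>a\<in>hcls p X z. hcls p X (rscale r a))"
      using rbdries_closed(1)[of p X] by (intro UN_upper) (auto simp: hcls_def image_iff intro: bexI[of _ 0])
    show "(\<Union>a\<in>hcls p X z. hcls p X (rscale r a)) \<subseteq> hcls p X (rscale r z)"
    proof clarsimp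
      fix a c assume "a \<in> hcls p X z" "c \<in> hcls p X (rscale r a)"
      then obtain w w' where w: "w \<in> rbdries p X" "w' \<in> rbdries p X" "a = w + z" "c = w' + rscale r a" by (auto simp: hcls_def)
      have "c = (w' + rscale r w) + rscale r z" by (simp add: w map_mult_add)
      then show "c \<in> hcls p X (rscale r z)" using rbdries_closed(2)[OF w(2) rbdries_closed(3)[OF w(1)]] unfolding hcls_def by blast
    qed
  qed
  finally show ?thesis .
qed

lemma hcls_zero: "\<zero>\<^bsub>rhom p X\<^esub> = hcls p X 0" by (simp add: rational_homology_def quotient_module_def hcls_def)

lemma hcls_eq_zero: "hcls p X z = \<zero>\<^bsub>rhom p X\<^esub> \<longleftrightarrow> z \<in> rbdries p X"
proof
  assume "hcls p X z = \<zero>\<^bsub>rhom p X\<^esub>"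
  then have "hcls p X z = rbdries p X" by (simp add: rational_homology_def quotient_module_def)
  moreover have "0 + z \<in> hcls p X z" unfolding hcls_def using rbdries_closed(1) by (rule imageI)
  ultimately show "z \<in> rbdries p X" by simp
next
  assume z: "z \<in> rbdries p X"
  have "w + z \<in> rbdries p X" if "w \<in> rbdries p X" for w using rbdries_closed(2)[OF that z] .
  moreover have "w \<in> hcls p X z" if w: "w \<in> rbdries p X" for w
  proof -
    have "w = (w + rscale (-1) z) + z" by (rule poly_mapping_eqI) (simp add: lookup_add)
    then show ?thesis using rbdries_closed(2)[OF w rbdries_closed(3)[OF z]] unfolding hcls_def by blast
  qed
  ultimately show "hcls p X z = \<zero>\<^bsub>rhom p X\<^esub>" by (auto simp: rational_homology_def quotient_module_def hcls_def)
qed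

lemma clear_denominators:
  fixes z :: "'b \<Rightarrow>\<^sub>0 rat"
  obtains D c where "D ~= 0" "rscale (of_int D) z = rchain c" "keys c \<subseteq> keys z"
proof -
  define D where "D = (\<Prod>x\<in>keys z. snd (quotient_of (lookup z x)))"
  have pos: "0 < snd (quotient_of r)" for r by (rule quotient_of_denom_pos')
  have int: "\<exists>m. of_int D * lookup z x = of_int m" if x: "x \<in> keys z" for x
  proof -
    obtain a b where ab: "quotient_of (lookup z x) = (a, b)" by fastforce
    have "snd (quotient_of (lookup z x)) dvd D" unfolding D_def by (rule dvd_prodI) (use x in auto)
    then obtain e where "D = b * e" unfolding ab snd_conv by (rule dvdE)
    then have "of_int D * lookup z x = of_int (e * a)" using quotient_of_denom_pos[OF ab] by (simp add: quotient_of_div[OF ab])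
    then show ?thesis by blast
  qed
  define c where "c = (\<Sum>x\<in>keys z. scal \<lfloor>of_int D * lookup z x\<rfloor> (frag_of x))"
  have c: "lookup c x = \<lfloor>of_int D * lookup z x\<rfloor>" for x
    unfolding c_def lookup_sum by (simp add: lookup_single when_def if_distrib[of "(*) _"] in_keys_iff cong: if_cong)
  show thesis
  proof (rule that)
    show "D ~= 0" using pos unfolding D_def by (simp add: less_imp_neq[symmetric])
    show "rscale (of_int D) z = rchain c"
    proof (rule poly_mapping_eqI)
      fix x
      show "lookup (rscale (of_int D) z) x = lookup (rchain c) x" using int[of x] by (cases "x \<in> keys z") (auto simp: c in_keys_iff)
    qed
    show "keys c \<subseteq> keys z" by (auto simp: in_keys_iff c)
  qed
qed

lemma rchain_inject: "rchain c = rchain d \<longleftrightarrow> c = d"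
proof
  assume "rchain c = rchain d"
  then have "rat_of_int (lookup c x) = rat_of_int (lookup d x)" for x by (metis lookup_map_of_int)
  then show "c = d" by (intro poly_mapping_eqI) simp
qed simp

lemma rchain_cmul: "rchain (scal m c) = rscale (of_int m) (rchain c)" by (rule poly_mapping_eqI) simp

lemma rscale_scale: "rscale r (rscale s c) = rscale (r * s) c" and rscale_1: "rscale 1 c = c" by (rule poly_mapping_eqI, simp)+

lemma rchain_carrier: "schain p X c \<longleftrightarrow> rchain c \<in> carrier (rchains p X)"
proof -
  have "keys (rchain c) = keys c" by (auto simp: in_keys_iff)
  then show ?thesis by (simp add: schain_def rational_chains_def)
qed

lemma rchain_cycle: "relcycle p X {} c ==> rchain c \<in> carrier (rcycles p X)"
  by (simp add: scycle rational_cycles_def rchain_carrier[symmetric] rational_boundary_of_int poly_mapping_eqI)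

lemma rat_bdry: "rchain c \<in> rbdries p X \<longleftrightarrow> rnull p X {} c"
proof
  assume "rchain c \<in> rbdries p X"
  then obtain z where z: "z \<in> carrier (rchains (Suc p) X)" "rchain c = rational_boundary (Suc p) z"
    by (auto simp: rational_boundaries_def)
  obtain D d where D: "D ~= 0" "rscale (of_int D) z = rchain d" "keys d \<subseteq> keys z" by (rule clear_denominators)
  have "rchain (scal D c) = rscale (of_int D) (rational_boundary (Suc p) z)" by (simp only: rchain_cmul z(2))
  also have "\<dots> = rational_boundary (Suc p) (rscale (of_int D) z)" by (rule rational_boundary_smult[symmetric])
  also have "\<dots> = rchain (bdry (Suc p) d)" by (simp only: D(2) rational_boundary_of_int)
  finally have "scal D c = bdry (Suc p) d" by (simp only: rchain_inject)
  moreover have "schain (Suc p) X d" using z(1) D(3) by (simp add: schain_def rational_chains_def)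
  ultimately show "rnull p X {} c" using D(1) unfolding rnull_empty_iff by blast
next
  assume "rnull p X {} c"
  then obtain m d where m: "m ~= 0" "schain (Suc p) X d" "scal m c = bdry (Suc p) d" unfolding rnull_empty_iff by blast
  have "rscale (of_int m) (rchain c) = rational_boundary (Suc p) (rchain d)"
    by (simp only: rational_boundary_of_int m(3)[symmetric] rchain_cmul)
  then have "rscale (of_int m) (rchain c) \<in> rbdries p X" using m(2) unfolding rational_boundaries_def rchain_carrier by blast
  from rbdries_closed(3)[OF this, of "1 / of_int m"] show "rchain c \<in> rbdries p X" using m(1) by (simp add: rscale_scale rscale_1)
qed

lemma lincomb_hcls:
  assumes J: "finite J" and inj: "inj_on (%j. hcls p X (z j)) J" and z: "!!j. j \<in> J ==> z j \<in> carrier (rcycles p X)"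
  shows "module.lincomb (rhom p X) a ((%j. hcls p X (z j)) ` J) = hcls p X (\<Sum>j\<in>J. rscale (a (hcls p X (z j))) (z j))"
proof -
  interpret V: vectorspace class_ring "rhom p X" by (rule vectorspace_rational_homology)
  let ?H = "rhom p X" and ?v = "%j. hcls p X (z j)"
  have v: "?v j \<in> carrier ?H" if "j \<in> J" for j using z[OF that] by (simp add: carrier_homology)
  have av: "a (?v j) \<odot>\<^bsub>?H\<^esub> ?v j \<in> carrier ?H" if "j \<in> J" for j by (rule V.module.smult_closed[OF _ v[OF that]]) simp
  have "finsum ?H (%j. a (?v j) \<odot>\<^bsub>?H\<^esub> ?v j) K = hcls p X (\<Sum>j\<in>K. rscale (a (?v j)) (z j))" if "K \<subseteq> J" for K
    using finite_subset[OF that J] that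
  proof (induction K rule: finite_induct)
    case empty
    then show ?case by (simp add: hcls_zero)
  next
    case (insert x F)
    then have "finsum ?H (%j. a (?v j) \<odot>\<^bsub>?H\<^esub> ?v j) (insert x F) = a (?v x) \<odot>\<^bsub>?H\<^esub> ?v x \<oplus>\<^bsub>?H\<^esub> finsum ?H (%j. a (?v j) \<odot>\<^bsub>?H\<^esub> ?v j) F"
      by (intro V.module.M.finsum_insert) (use av in auto)
    then show ?case using insert by (simp add: hcls_scale hcls_add)
  qed
  from this[OF order_refl] show ?thesis
    unfolding V.lincomb_def using V.module.M.finsum_reindex[OF _ inj, of "%v. a v \<odot>\<^bsub>?H\<^esub> v"] av by force
qed

definition cycle_indep :: "nat => 'a topology => nat => (nat => 'a chain) => bool" where
  "cycle_indep p X N c \<longleftrightarrow> (\<forall>j<N. relcycle p X {} (c j)) &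
     (\<forall>a. rnull p X {} (\<Sum>j<N. scal (a j) (c j)) --> (\<forall>j<N. a j = 0))"

lemma rchain_lincomb: "rchain (\<Sum>j<N. scal (a j) (c j)) = (\<Sum>j<N. rscale (of_int (a j)) (rchain (c j)))"
  by (simp only: map_of_int_sum rchain_cmul)

lemma cycle_indep_rational:
  assumes c: "cycle_indep p X N c" and r: "(\<Sum>j<N. rscale (r j) (rchain (c j))) \<in> rbdries p X" and j: "j < N"
  shows "r j = 0"
proof -
  define z where "z = (\<Sum>j<N. Poly_Mapping.single j (r j))"
  have z: "lookup z j = r j" if "j < N" for j using that unfolding z_def lookup_sum by (simp add: lookup_single when_def)
  obtain D b where D: "D ~= 0" "rscale (of_int D) z = rchain b" by (rule clear_denominators)
  have b: "of_int D * r j = of_int (lookup b j)" if "j < N" for j using arg_cong[OF D(2), of "%w. lookup w j"] z[OF that] by simp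
  have "rscale (of_int D) (\<Sum>j<N. rscale (r j) (rchain (c j))) = (\<Sum>j<N. rscale (of_int D * r j) (rchain (c j)))"
    by (simp only: map_mult_sum rscale_scale)
  also have "\<dots> = rchain (\<Sum>j<N. scal (lookup b j) (c j))" unfolding rchain_lincomb by (intro sum.cong) (simp_all add: b)
  finally have "rnull p X {} (\<Sum>j<N. scal (lookup b j) (c j))" using rbdries_closed(3)[OF r, of "of_int D"] by (simp only: rat_bdry)
  then have "lookup b j = 0" using c j unfolding cycle_indep_def by blast
  then show ?thesis using b[OF j] D(1) by simp
qed

lemma cycle_indep_le_betti:
  assumes c: "cycle_indep p X N c" and d: "rational_betti p X = enat d"
  shows "N \<le> d"
proof -
  interpret V: vectorspace class_ring "rhom p X" by (rule vectorspace_rational_homology)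
  let ?z = "%j. rchain (c j)" and ?v = "%j. hcls p X (rchain (c j))"
  have fd: "V.fin_dim" "V.dim = d" using d by (simp_all add: rational_betti_def vector_space_dim_def split: if_splits)
  have z: "?z j \<in> carrier (rcycles p X)" if "j \<in> {..<N}" for j using rchain_cycle[of p X "c j"] c that by (simp add: cycle_indep_def)
  have inj: "inj_on ?v {..<N}"
  proof (rule inj_onI, rule ccontr)
    fix i j assume ij: "i \<in> {..<N}" "j \<in> {..<N}" "?v i = ?v j" "i ~= j"
    have "0 + ?z i \<in> ?v i" unfolding hcls_def by (rule imageI[OF rbdries_closed(1)])
    then obtain w where w: "w \<in> rbdries p X" "?z i = w + ?z j" unfolding ij(3) by (auto simp: hcls_def)
    define r where "r l = (if l = i then 1 else 0) - (if l = j then 1 else 0 :: rat)" for l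
    have "(\<Sum>l<N. rscale (r l) (?z l)) = w"
    proof (rule poly_mapping_eqI)
      fix x
      have "lookup (\<Sum>l<N. rscale (r l) (?z l)) x =
          (\<Sum>l<N. (if l = i then lookup (?z l) x else 0)) - (\<Sum>l<N. (if l = j then lookup (?z l) x else 0))"
        unfolding lookup_sum sum_subtractf[symmetric] by (intro sum.cong) (auto simp: r_def)
      also have "\<dots> = lookup (?z i) x - lookup (?z j) x" using ij(1,2) by simp
      also have "\<dots> = lookup w x" unfolding w(2) by (simp add: lookup_add)
      finally show "lookup (\<Sum>l<N. rscale (r l) (?z l)) x = lookup w x" .
    qed
    then have "r i = 0" using cycle_indep_rational[OF c, of r i] w(1) ij(1) by simp
    then show False using ij(4) by (simp add: r_def)
  qed
  have carr: "?v ` {..<N} \<subseteq> carrier (rhom p X)" using z by (auto simp: carrier_homology)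
  have "V.lin_indpt (?v ` {..<N})"
  proof (rule V.finite_lin_indpt2[OF _ carr])
    fix a assume a: "V.lincomb a (?v ` {..<N}) = \<zero>\<^bsub>rhom p X\<^esub>"
    have "V.lincomb a (?v ` {..<N}) = hcls p X (\<Sum>j<N. rscale (a (?v j)) (?z j))" by (rule lincomb_hcls[OF finite_lessThan inj z])
    then have "(\<Sum>j<N. rscale (a (?v j)) (?z j)) \<in> rbdries p X"
      unfolding a using hcls_eq_zero[of p X "\<Sum>j<N. rscale (a (?v j)) (?z j)"] by simp
    from cycle_indep_rational[OF c this] show "\<forall>v\<in>?v ` {..<N}. a v = \<zero>\<^bsub>class_ring\<^esub>" by simp
  qed simp
  from V.li_le_dim(2)[OF fd(1) carr this] show ?thesis using fd(2) card_image[OF inj] by simp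
qed

lemma betti_le_cycle_indep:
  assumes bound: "!!N c. cycle_indep p X N c ==> N \<le> d"
  shows "rational_betti p X \<le> enat d"
proof -
  interpret V: vectorspace class_ring "rhom p X" by (rule vectorspace_rational_homology)
  let ?H = "rhom p X"
  have fin_bound: "card S \<le> d" if S: "finite S" "S \<subseteq> carrier ?H" "V.lin_indpt S" for S
  proof -
    obtain e where e: "bij_betw e {..<card S} S" using ex_bij_betw_nat_finite[OF S(1)] by (auto simp: atLeast0LessThan)
    have "\<exists>y\<in>carrier (rcycles p X). e j = hcls p X y" if "j < card S" for j
      using bij_betw_apply[OF e, of j] that S(2) by (auto simp: carrier_homology)
    then obtain y where y: "!!j. j < card S ==> y j \<in> carrier (rcycles p X) & e j = hcls p X (y j)" by metis
    have "\<exists>D c. D ~= 0 & rscale (of_int D) (y j) = rchain c & keys c \<subseteq> keys (y j)" for j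
      by (rule clear_denominators[of "y j"]) blast
    then obtain D c where D: "!!j. D j ~= 0 & rscale (of_int (D j)) (y j) = rchain (c j) & keys (c j) \<subseteq> keys (y j)" by metis
    have "cycle_indep p X (card S) c" unfolding cycle_indep_def
    proof (intro conjI allI impI)
      fix j assume j: "j < card S"
      have yj: "keys (y j) \<subseteq> singular_simplex_set p X" "rational_boundary p (y j) = 0"
        using y[OF j] by (simp_all add: rational_cycles_def rational_chains_def)
      have "rchain (bdry p (c j)) = rscale (of_int (D j)) (rational_boundary p (y j))"
        using D[of j] by (simp only: rational_boundary_of_int[symmetric] rational_boundary_smult[symmetric])
      also have "\<dots> = rchain 0" by (rule poly_mapping_eqI) (simp add: yj(2))
      finally have "bdry p (c j) = 0" by (simp only: rchain_inject)
      then show "relcycle p X {} (c j)" using D[of j] yj(1) by (auto simp: scycle schain_def)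
    next
      fix a j assume null: "rnull p X {} (\<Sum>j<card S. scal (a j) (c j))" and j: "j < card S"
      show "a j = 0"
      proof (rule ccontr)
        assume aj: "a j ~= 0"
        define r where "r v = rat_of_int (a (the_inv_into {..<card S} e v) * D (the_inv_into {..<card S} e v))" for v
        have re: "r (e i) = of_int (a i * D i)" if "i < card S" for i
          using the_inv_into_f_f[OF bij_betw_imp_inj_on[OF e], of i] that by (simp add: r_def)
        have inj: "inj_on (%j. hcls p X (y j)) {..<card S}" using bij_betw_imp_inj_on[OF e] y by (simp add: inj_on_def)
        have img: "(%j. hcls p X (y j)) ` {..<card S} = S" using bij_betw_imp_surj_on[OF e] y by force
        have "V.lincomb r S = hcls p X (\<Sum>j<card S. rscale (r (hcls p X (y j))) (y j))"
          using lincomb_hcls[OF finite_lessThan inj, of r] y unfolding img by simp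
        also have "(\<Sum>j<card S. rscale (r (hcls p X (y j))) (y j)) = (\<Sum>j<card S. rscale (of_int (a j)) (rchain (c j)))"
        proof (rule sum.cong)
          fix i assume "i \<in> {..<card S}"
          then have "r (hcls p X (y i)) = of_int (a i) * of_int (D i)" using re[of i] y[of i] by simp
          then show "rscale (r (hcls p X (y i))) (y i) = rscale (of_int (a i)) (rchain (c i))" using D[of i] by (simp flip: rscale_scale)
        qed simp
        also have "hcls p X \<dots> = \<zero>\<^bsub>?H\<^esub>" unfolding hcls_eq_zero rchain_lincomb[symmetric] rat_bdry by (rule null)
        finally have "V.lincomb r S = \<zero>\<^bsub>?H\<^esub>" .
        moreover have "e j \<in> S" using bij_betw_apply[OF e, of j] j by simp
        moreover have "r (e j) ~= \<zero>\<^bsub>class_ring\<^esub>" using re[OF j] aj D[of j] by simp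
        ultimately show False using V.lin_dep_crit[OF S(1) order_refl, of r "e j"] S(3) by simp
      qed
    qed
    then show ?thesis by (rule bound)
  qed
  have all_bound: "finite S & card S \<le> d" if S: "S \<subseteq> carrier ?H & V.lin_indpt S" for S
  proof -
    have "finite S"
    proof (rule ccontr)
      assume "infinite S"
      then obtain T where T: "T \<subseteq> S" "finite T" "card T = Suc d" using infinite_arbitrarily_large by metis
      have "V.lin_indpt T" using S V.subset_li_is_li T(1) by blast
      then show False using fin_bound[OF T(2)] T(1,3) S by auto
    qed
    then show ?thesis using fin_bound S by blast
  qed
  have "V.lin_indpt {}" by (rule V.finite_lin_indpt2) simp_all
  then obtain A where A: "finite A" "maximal A (%S. S \<subseteq> carrier ?H & V.lin_indpt S)"
    using maximal_exists[of "%S. S \<subseteq> carrier ?H & V.lin_indpt S" d "{}"] all_bound by auto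
  have basis: "V.basis A" by (rule V.max_li_is_basis[OF A(2)])
  have gen: "V.gen_set A" and li: "A \<subseteq> carrier ?H & V.lin_indpt A" using basis unfolding V.basis_def by simp_all
  have "V.dim \<le> d" using V.dim_basis[OF A(1) basis] all_bound[OF li] by simp
  moreover have "V.fin_dim" unfolding V.fin_dim_def by (rule exI[of _ A], intro conjI, rule A(1), rule conjunct1[OF li], rule gen)
  ultimately show ?thesis unfolding rational_betti_def vector_space_dim_def by (simp only: if_True enat_ord_simps)
qed

lemma betti_le_relation:
  fixes A :: "'a topology" and B :: "'b topology"
  assumes add: "!!c c' d d'. R c c' ==> R d d' ==> R (c + d) (c' + d')"
    and cmul: "!!m c c'. R c c' ==> R (scal m c) (scal m c')"
    and ex: "!!c. relcycle p A {} c ==> \<exists>m c'. m ~= 0 & relcycle p B {} c' & R (scal m c) c'"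
    and inj: "!!c c'. R c c' ==> rnull p B {} c' ==> rnull p A {} c"
  shows "rational_betti p A \<le> rational_betti p B"
proof (cases "rational_betti p B")
  case (enat d)
  have "rational_betti p A \<le> enat d"
  proof (rule betti_le_cycle_indep)
    fix N c assume c: "cycle_indep p A N c"
    have "\<exists>m c'. m ~= 0 & relcycle p B {} c' & R (scal m (c j)) c'" if "j < N" for j
      by (rule ex) (use c that in \<open>simp add: cycle_indep_def\<close>)
    then obtain m c' where m: "!!j. j < N ==> m j ~= 0 & relcycle p B {} (c' j) & R (scal (m j) (c j)) (c' j)" by metis
    have "cycle_indep p B N c'" unfolding cycle_indep_def
    proof (intro conjI allI impI)
      fix a j assume null: "rnull p B {} (\<Sum>j<N. scal (a j) (c' j))" and j: "j < N"
      have 0: "R 0 0" using cmul[OF conjunct2[OF conjunct2[OF m[OF j]]], of 0] by simp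
      have "R (\<Sum>j<n. scal (a j) (scal (m j) (c j))) (\<Sum>j<n. scal (a j) (c' j))" if "n \<le> N" for n using that
      proof (induction n)
        case (Suc n)
        then have "R (scal (m n) (c n)) (c' n)" using m[of n] by simp
        from add[OF Suc.IH cmul[OF this, of "a n"]] Suc.prems show ?case by simp
      qed (simp add: 0)
      from inj[OF this[OF order_refl] null] have "rnull p A {} (\<Sum>j<N. scal (a j * m j) (c j))" by simp
      then have "a j * m j = 0" using conjunct2[OF c[unfolded cycle_indep_def], THEN spec, of "%j. a j * m j"] j by simp
      then show "a j = 0" using m[OF j] by simp
    qed (use m in simp)
    then show "N \<le> d" by (rule cycle_indep_le_betti[OF _ enat])
  qed
  then show ?thesis by (simp add: enat)
qed simp

lemma betti_configuration_mono:
  assumes H: "Hausdorff_space M" and no: "~ orientable_manifold n M"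
  shows "rational_betti p (uconf (Suc k) M) \<le> rational_betti p (uconf (Suc (Suc k)) M)"
proof -
  let ?K = "Suc k"
  let ?X = "conf ?K M" and ?C = "uconf ?K M" and ?X' = "conf (Suc ?K) M"
  define R where "R c c' \<longleftrightarrow> (\<exists>x x'. relcycle p ?X {} x & relcycle p ?X' {} x' & c' = chm p (orb (Suc ?K)) x' &
      hq p ?C {} c (chm p (orb ?K) x) & rnull p ?X {} (Sym p ?K (x - tau p ?K x')))" for c c'
  note pushC = rnull_chm[OF _ cm_orb, where S = "{}" and T = "{}", simplified]
  show ?thesis
  proof (rule betti_le_relation[of R])
    fix c c' d d' assume "R c c'" "R d d'"
    then obtain x x' y y' where x: "relcycle p ?X {} x" "relcycle p ?X' {} x'" "c' = chm p (orb (Suc ?K)) x'"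
        "hq p ?C {} c (chm p (orb ?K) x)" "rnull p ?X {} (Sym p ?K (x - tau p ?K x'))"
      and y: "relcycle p ?X {} y" "relcycle p ?X' {} y'" "d' = chm p (orb (Suc ?K)) y'"
        "hq p ?C {} d (chm p (orb ?K) y)" "rnull p ?X {} (Sym p ?K (y - tau p ?K y'))" unfolding R_def by blast
    have "x + y - tau p ?K (x' + y') = (x - tau p ?K x') + (y - tau p ?K y')" by (simp add: tau_add)
    then have "rnull p ?X {} (Sym p ?K (x + y - tau p ?K (x' + y')))" using rnull_add[OF x(5) y(5)] by (simp only: Sym_add)
    then show "R (c + d) (c' + d')" unfolding R_def using x y hq_add[OF x(4) y(4)]
      by (intro exI[of _ "x + y"] exI[of _ "x' + y'"]) (simp add: singular_relcycle_add chm_add)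
  next
    fix m c c' assume "R c c'"
    then obtain x x' where x: "relcycle p ?X {} x" "relcycle p ?X' {} x'" "c' = chm p (orb (Suc ?K)) x'"
        "hq p ?C {} c (chm p (orb ?K) x)" "rnull p ?X {} (Sym p ?K (x - tau p ?K x'))" unfolding R_def by blast
    have "rnull p ?X {} (Sym p ?K (scal m x - tau p ?K (scal m x')))"
      using rnull_cmul[OF x(5), of m] by (simp only: Sym_cmul tau_cmul scal_diff Sym_diff)
    then show "R (scal m c) (scal m c')" unfolding R_def using x hq_cmul[OF x(4), of m]
      by (intro exI[of _ "scal m x"] exI[of _ "scal m x'"]) (simp only: relcycle_cmul chm_cmul simp_thms)
  next
    fix c assume "relcycle p ?C {} c"
    then obtain x where x: "relcycle p ?X {} x" "hq p ?C {} (scal (fact ?K) c) (chm p (orb ?K) x)" by (rule lift_cycle[OF H])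
    obtain x' C where x': "C ~= 0" "relcycle p ?X' {} x'" "rnull p ?X {} (Sym p ?K (scal C x - tau p ?K x'))"
      using transfer_onto[OF H no x(1)] by blast
    have "hq p ?C {} (scal (C * fact ?K) c) (chm p (orb ?K) (scal C x))"
      using hq_cmul[OF x(2), of C] by (simp only: chm_cmul frag_cmul_cmul)
    then have "R (scal (C * fact ?K) c) (chm p (orb (Suc ?K)) x')" unfolding R_def using x'(2,3) relcycle_cmul[OF x(1), of C] by blast
    moreover have "C * fact ?K ~= 0" using x'(1) by simp
    moreover have "relcycle p (uconf (Suc ?K) M) {} (chm p (orb (Suc ?K)) x')" using relcycle_chm[OF x'(2) cm_orb, of "{}"] by simp
    ultimately show "\<exists>m c'. m ~= 0 & relcycle p (uconf (Suc ?K) M) {} c' & R (scal m c) c'" by blast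
  next
    fix c c' assume "R c c'" and null: "rnull p (uconf (Suc ?K) M) {} c'"
    then obtain x x' where x: "relcycle p ?X {} x" "relcycle p ?X' {} x'" "c' = chm p (orb (Suc ?K)) x'"
        "hq p ?C {} c (chm p (orb ?K) x)" "rnull p ?X {} (Sym p ?K (x - tau p ?K x'))" unfolding R_def by blast
    have "rnull p ?X' {} (Sym p (Suc ?K) x')" by (rule Sym_null_of_orb[OF H x(2)]) (use null x(3) in simp)
    then have "rnull p ?X {} (tau p ?K (Sym p (Suc ?K) x'))" unfolding tau_def by (intro rnull_sum rnull_chm[OF _ cm_del]) auto
    then have "rnull p ?X {} (Sym p ?K (tau p ?K (Sym p (Suc ?K) x')))" using rnull_Sym[OF _ cm_perm, of p ?K M "{}"] by simp
    then have "rnull p ?X {} (Sym p ?K (tau p ?K x'))" unfolding Sym_tau_Sym by (rule rnull_cancel) (simp del: fact_Suc)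
    from rnull_add[OF x(5) this] have "rnull p ?X {} (Sym p ?K x)" by (simp add: Sym_diff)
    then have "rnull p ?C {} (chm p (orb ?K) (Sym p ?K x))" by (rule rnull_chm[OF _ cm_orb]) simp
    then have "rnull p ?C {} (chm p (orb ?K) x)" unfolding Sym_orb by (rule rnull_cancel) (simp del: fact_Suc)
    then show "rnull p ?C {} c" by (rule hq_rnull[OF x(4)])
  qed
qed

theorem theorem2:
  fixes M :: "'a topology" and n i :: nat
  assumes "manifold_with_boundary n M"
    and "\<not> orientable_manifold n M"
    and "finite_type M"
  shows "mono_on {1..} (\<lambda>k. rational_betti i (unordered_configuration_space k M))"
proof (rule mono_onI)
  fix k l :: nat assume kl: "k \<in> {1..}" "k \<le> l"
  show "rational_betti i (unordered_configuration_space k M) \<le> rational_betti i (unordered_configuration_space l M)"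
    using kl(2)
  proof (induction rule: dec_induct)
    case (step m)
    then obtain j where "m = Suc j" using kl(1) by (cases m) auto
    then have "rational_betti i (unordered_configuration_space m M) \<le> rational_betti i (unordered_configuration_space (Suc m) M)"
      using betti_configuration_mono[of M n i j] assms(1,2) by (simp add: manifold_with_boundary_def)
    with step.IH show ?case by (rule order_trans)
  qed simp
qed

end
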